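(* Let $\Omega\subset\mathbb{R}^2$ be a bounded open set and let $f=(f_1,f_2)\colon\Omega\to\mathbb{R}^2$ be a bounded sense preserving $BV$-homeomorphism. Let $U\subset\Omega$ be a Borel set. Then (a) $Df^{-1}(f(U))=\operatorname{adj} Df(U)$, an equality of $2\times 2$ matrices, i.e. $D_1(f^{-1})_1(f(U))=D_2f_2(U)$, $D_2(f^{-1})_1(f(U))=-D_2f_1(U)$, $D_1(f^{-1})_2(f(U))=-D_1f_2(U)$, $D_2(f^{-1})_2(f(U))=D_1f_1(U)$; (b) $\operatorname{Det} Df(U)=|f(U)|$, where the distribution $\operatorname{Det} Df$ is understood as a measure on $\Omega$ (it is represented by the measure $E\mapsto |f(E)|$ on Borel sets $E\subset\Omega$).
   Context: $|E|$ denotes Lebesgue measure. $BV(\Omega)$ is the space of $u\in L^1(\Omega)$ whose distributional partial derivatives $D_iu$ are signed Radon measures with finite total variation on $\Omega$; $f\in BV(\Omega;\mathbb{R}^2)$ means each component is in $BV(\Omega)$. For a matrix of measures, $Df=(D_jf_i)_{i,j}$ (row $i$, column $j$), and $$\operatorname{adj} Df=\begin{pmatrix} D_2f_2 & -D_2f_1\\ -D_1f_2 & D_1f_1\end{pmatrix},$$ which is a matrix-valued measure. A $BV$-homeomorphism $f\colon\Omega\to\mathbb{R}^2$ is a mapping in $BV(\Omega;\mathbb{R}^2)$ which is a homeomorphism of $\Omega$ onto the open set $f(\Omega)$. It is known that then $f^{-1}\in BV_{\mathrm{loc}}(f(\Omega);\mathbb{R}^2)$, so that $Df^{-1}=(D_j(f^{-1})_i)_{i,j}$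 is a matrix of signed Radon measures on $f(\Omega)$. A continuous $f\colon\Omega\to\mathbb{R}^2$ is sense preserving if the topological (Brouwer) degree satisfies $\deg(f,V,y_0)>0$ for all domains $V\subset\subset\Omega$ and all $y_0\in f(V)\setminus f(\partial V)$. For a continuous $BV$ mapping $f\colon\Omega\to\mathbb{R}^2$, the distributional Jacobian $\operatorname{Det} Df$ is the distribution $$\langle \operatorname{Det} Df,\varphi\rangle=\lim_{j\to\infty}\int_\Omega \varphi(x)\,J_{f_j}(x)\,dx,\qquad \varphi\in C_c^\infty(\Omega),$$ where $f_j$ are standard convolution approximations of $f$ and $J_{f_j}=\det Df_j$; equivalently, $$\langle \operatorname{Det} Df,\varphi\rangle=-\int_\Omega f_1\,D_1\varphi\,d(D_2f_2)+\int_\Omega f_1\,D_2\varphi\,d(D_1f_2).$$ *)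

theory Defs
  imports "HOL-Analysis.Analysis"
begin

section \<open>Test functions\<close>

definition part_deriv :: "2 \<Rightarrow> (real^2 \<Rightarrow> real) \<Rightarrow> real^2 \<Rightarrow> real" where
  "part_deriv i \<phi> x = frechet_derivative \<phi> (at x) (axis i 1)"

primrec C_k :: "nat \<Rightarrow> (real^2 \<Rightarrow> real) \<Rightarrow> bool" where
  "C_k 0 \<phi> \<longleftrightarrow> continuous_on UNIV \<phi>"
| "C_k (Suc k) \<phi> \<longleftrightarrow> (\<forall>x. \<phi> differentiable (at x)) \<and> (\<forall>i. C_k k (part_deriv i \<phi>))"

definition test_functions :: "(real^2) set \<Rightarrow> (real^2 \<Rightarrow> real) set" where
  "test_functions \<Omega> = {\<phi>. (\<forall>k. C_k k \<phi>) \<and>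
     compact (closure {x. \<phi> x \<noteq> 0}) \<and> closure {x. \<phi> x \<noteq> 0} \<subseteq> \<Omega>}"


section \<open>Signed Radon measures\<close>

text \<open>A (locally finite) signed Radon measure on an open set is encoded by its Jordan
  decomposition, the pair of its positive and negative parts. Mutual singularity makes the pair
  unique; local finiteness alone suffices for the parts to be Radon, since every locally finite
  Borel measure on an open subset of the plane is regular.\<close>

type_synonym signed_measure = "(real^2) measure \<times> (real^2) measure"

definition radon_measure_on :: "(real^2) set \<Rightarrow> (real^2) measure \<Rightarrow> bool" where
  "radon_measure_on \<Omega> M \<longleftrightarrow> sets M = sets (restrict_space borel \<Omega>) \<and>
     (\<forall>K. compact K \<and> K \<subseteq> \<Omega> \<longrightarrow> emeasure M K < \<infinity>)"

definition signed_radon_on :: "(real^2) set \<Rightarrow> signed_measure \<Rightarrow> bool" where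
  "signed_radon_on \<Omega> m \<longleftrightarrow> radon_measure_on \<Omega> (fst m) \<and> radon_measure_on \<Omega> (snd m) \<and>
     (\<exists>A \<in> sets (restrict_space borel \<Omega>). emeasure (fst m) (\<Omega> - A) = 0 \<and> emeasure (snd m) A = 0)"

text \<open>The real value \<open>sm_val m E\<close> is meaningful only if \<open>sm_finite m E\<close> holds, i.e. if the total
  variation of \<open>m\<close> on \<open>E\<close> is finite.\<close>

definition sm_finite :: "signed_measure \<Rightarrow> (real^2) set \<Rightarrow> bool" where
  "sm_finite m E \<longleftrightarrow> emeasure (fst m) E < \<infinity> \<and> emeasure (snd m) E < \<infinity>"

definition sm_val :: "signed_measure \<Rightarrow> (real^2) set \<Rightarrow> real" where
  "sm_val m E = measure (fst m) E - measure (snd m) E"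

definition sm_integral :: "signed_measure \<Rightarrow> (real^2 \<Rightarrow> real) \<Rightarrow> real" where
  "sm_integral m \<phi> = integral\<^sup>L (fst m) \<phi> - integral\<^sup>L (snd m) \<phi>"

definition represents_distr ::
    "(real^2) set \<Rightarrow> signed_measure \<Rightarrow> ((real^2 \<Rightarrow> real) \<Rightarrow> real) \<Rightarrow> bool" where
  "represents_distr \<Omega> m T \<longleftrightarrow> signed_radon_on \<Omega> m \<and>
     (\<forall>\<phi> \<in> test_functions \<Omega>. T \<phi> = sm_integral m \<phi>)"

definition is_measure_distr :: "(real^2) set \<Rightarrow> ((real^2 \<Rightarrow> real) \<Rightarrow> real) \<Rightarrow> bool" where
  "is_measure_distr \<Omega> T \<longleftrightarrow> (\<exists>m. represents_distr \<Omega> m T)"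

definition distr_measure :: "(real^2) set \<Rightarrow> ((real^2 \<Rightarrow> real) \<Rightarrow> real) \<Rightarrow> signed_measure" where
  "distr_measure \<Omega> T = (THE m. represents_distr \<Omega> m T)"


section \<open>Functions of bounded variation\<close>

definition distr_deriv ::
    "(real^2) set \<Rightarrow> 2 \<Rightarrow> (real^2 \<Rightarrow> real) \<Rightarrow> (real^2 \<Rightarrow> real) \<Rightarrow> real" where
  "distr_deriv \<Omega> j u \<phi> = - (LINT x:\<Omega>|lebesgue. u x * part_deriv j \<phi> x)"

definition D_measure :: "(real^2) set \<Rightarrow> 2 \<Rightarrow> (real^2 \<Rightarrow> real) \<Rightarrow> signed_measure" where
  "D_measure \<Omega> j u = distr_measure \<Omega> (distr_deriv \<Omega> j u)"

definition BV_on :: "(real^2) set \<Rightarrow> (real^2 \<Rightarrow> real) \<Rightarrow> bool" where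
  "BV_on \<Omega> u \<longleftrightarrow> set_integrable lebesgue \<Omega> u \<and>
     (\<forall>j. is_measure_distr \<Omega> (distr_deriv \<Omega> j u) \<and> sm_finite (D_measure \<Omega> j u) \<Omega>)"

definition BV_loc_on :: "(real^2) set \<Rightarrow> (real^2 \<Rightarrow> real) \<Rightarrow> bool" where
  "BV_loc_on \<Omega> u \<longleftrightarrow> (\<forall>K. compact K \<and> K \<subseteq> \<Omega> \<longrightarrow> set_integrable lebesgue K u) \<and>
     (\<forall>j. is_measure_distr \<Omega> (distr_deriv \<Omega> j u))"

definition D_val :: "(real^2) set \<Rightarrow> 2 \<Rightarrow> (real^2 \<Rightarrow> real^2) \<Rightarrow> 2 \<Rightarrow> (real^2) set \<Rightarrow> real" where
  "D_val \<Omega> j f i E = sm_val (D_measure \<Omega> j (\<lambda>x. f x $ i)) E"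

definition D_matrix :: "(real^2) set \<Rightarrow> (real^2 \<Rightarrow> real^2) \<Rightarrow> (real^2) set \<Rightarrow> real^2^2" where
  "D_matrix \<Omega> f E = (\<chi> i j. D_val \<Omega> j f i E)"

definition adj_D :: "(real^2) set \<Rightarrow> (real^2 \<Rightarrow> real^2) \<Rightarrow> (real^2) set \<Rightarrow> real^2^2" where
  "adj_D \<Omega> f E = vector
     [vector [D_val \<Omega> 2 f 2 E, - D_val \<Omega> 2 f 1 E],
      vector [- D_val \<Omega> 1 f 2 E, D_val \<Omega> 1 f 1 E]]"

definition BV_homeomorphism :: "(real^2) set \<Rightarrow> (real^2 \<Rightarrow> real^2) \<Rightarrow> bool" where
  "BV_homeomorphism \<Omega> f \<longleftrightarrow> (\<forall>i. BV_on \<Omega> (\<lambda>x. f x $ i)) \<and>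
     open (f ` \<Omega>) \<and> (\<exists>g. homeomorphism \<Omega> (f ` \<Omega>) f g)"


section \<open>Brouwer degree\<close>

text \<open>A \<open>C\<^sup>1\<close> map \<open>g\<close> that is closer to \<open>f\<close> on the closure of \<open>V\<close> than \<open>y\<close> is to
  \<open>f(\<partial>V)\<close>, and for which \<open>y\<close> is a regular value.\<close>

definition regular_approx ::
    "(real^2 \<Rightarrow> real^2) \<Rightarrow> (real^2) set \<Rightarrow> real^2 \<Rightarrow> (real^2 \<Rightarrow> real^2) \<Rightarrow> bool" where
  "regular_approx f V y g \<longleftrightarrow> (\<forall>i. C_k 1 (\<lambda>x. g x $ i)) \<and>
     (\<forall>x \<in> closure V. dist (g x) (f x) < infdist y (f ` frontier V)) \<and>
     (\<forall>x \<in> V. g x = y \<longrightarrow> det (jacobian g (at x)) \<noteq> 0)"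

text \<open>For bounded open \<open>V\<close>, \<open>f\<close> continuous on the closure of \<open>V\<close> and \<open>y\<close> outside \<open>f(\<partial>V)\<close>, the
  signed number of preimages below is a finite sum and does not depend on \<open>g\<close>.\<close>

definition brouwer_degree :: "(real^2 \<Rightarrow> real^2) \<Rightarrow> (real^2) set \<Rightarrow> real^2 \<Rightarrow> int" where
  "brouwer_degree f V y = (THE d. \<exists>g. regular_approx f V y g \<and>
     real_of_int d = (\<Sum>x\<in>{x \<in> V. g x = y}. sgn (det (jacobian g (at x)))))"

definition sense_preserving :: "(real^2) set \<Rightarrow> (real^2 \<Rightarrow> real^2) \<Rightarrow> bool" where
  "sense_preserving \<Omega> f \<longleftrightarrow> continuous_on \<Omega> f \<and>
     (\<forall>V y. open V \<and> connected V \<and> V \<noteq> {} \<and> compact (closure V) \<and> closure V \<subseteq> \<Omega> \<and>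
        y \<in> f ` V - f ` frontier V \<longrightarrow> brouwer_degree f V y > 0)"


section \<open>Distributional Jacobian\<close>

definition bump :: "real^2 \<Rightarrow> real" where
  "bump x = (if norm x < 1 then exp (- 1 / (1 - (norm x)\<^sup>2)) else 0)"

definition mollifier :: "real \<Rightarrow> real^2 \<Rightarrow> real" where
  "mollifier \<epsilon> x = bump (x /\<^sub>R \<epsilon>) / (\<epsilon>\<^sup>2 * integral\<^sup>L lebesgue bump)"

text \<open>The convolution of \<open>f\<close>, extended by zero outside \<open>\<Omega>\<close>, with the mollifier of radius
  \<open>1/(n+1)\<close>. The extension affects only points within that radius of the complement of \<open>\<Omega>\<close>, and
  these are eventually disjoint from the support of any given test function.\<close>

definition conv_approx :: "(real^2) set \<Rightarrow> (real^2 \<Rightarrow> real^2) \<Rightarrow> nat \<Rightarrow> real^2 \<Rightarrow> real^2" where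
  "conv_approx \<Omega> f n x = (LINT y:\<Omega>|lebesgue. mollifier (1 / real (Suc n)) (x - y) *\<^sub>R f y)"

definition approx_Jacobian ::
    "(real^2) set \<Rightarrow> (real^2 \<Rightarrow> real^2) \<Rightarrow> (real^2 \<Rightarrow> real) \<Rightarrow> nat \<Rightarrow> real" where
  "approx_Jacobian \<Omega> f \<phi> n =
     (LINT x:\<Omega>|lebesgue. \<phi> x * det (jacobian (conv_approx \<Omega> f n) (at x)))"

definition Det_D :: "(real^2) set \<Rightarrow> (real^2 \<Rightarrow> real^2) \<Rightarrow> (real^2 \<Rightarrow> real) \<Rightarrow> real" where
  "Det_D \<Omega> f \<phi> = lim (approx_Jacobian \<Omega> f \<phi>)"

end

theory Submission
  imports Defs
begin

text \<open>Let \<open>h\<close> be the inverse of \<open>f\<close>, let \<open>f\<^sub>n\<close> be the mollifications of \<open>f\<close> and \<open>J\<^sub>n\<close> their Jacobians. For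
  a cutoff \<open>\<theta>\<close> and large \<open>n\<close>, \<open>\<integral> \<theta> \<zeta>(f\<^sub>n) J\<^sub>n\<close> equals a degree times \<open>\<integral> \<zeta>\<close> for
  \<open>\<zeta>\<close> supported near a point; multiplicativity of the degree for \<open>h \<circ> f\<close> together with
  sense preservation makes this degree 1. The main step is \<open>\<integral> \<theta> x\<^sub>i \<zeta>(f\<^sub>n) J\<^sub>n \<longlongrightarrow> \<integral> \<zeta> h\<^sub>i\<close>. Here \<open>x\<^sub>i\<close> is a
  combination of two linear functions none of whose level lines has an image of positive area (only countably
  many directions fail this). Such a function is cut into thin layers; on each layer the degree
  computes the integral except near the two bounding level sets, where it is controlled by the isoperimetric
  inequality \<open>\<bar>\<integral> \<phi> \<zeta>(g) J\<^sub>g\<bar> \<le> C \<parallel>\<zeta>\<parallel>\<^sub>2 (\<integral> \<bar>\<nabla>\<phi>\<bar> \<bar>\<nabla>g\<bar>)\<close>, the total variation being additive over the layers.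
  With \<open>\<zeta> = \<partial>\<^sub>j \<psi>\<close>, integration by parts and the weak convergence of \<open>Df\<^sub>n\<close> turn this limit into the
  formula for \<open>Dh\<close>. For \<open>Det Df\<close> one applies that formula to mollifications of \<open>h\<close> in the chain rule for
  \<open>\<phi> \<circ> h\<close>, tested against \<open>y\<^sub>1\<close>.\<close>

section \<open>Continuously differentiable functions on the plane\<close>

text \<open>The obstacle is that the derivative of \<open>f\<close> is only a measure and that
  \<open>f\<close> may send null sets to sets of positive area, so no area formula applies to
  \<open>f\<close> or \<open>h\<close>. Everything is therefore expressed by
  \<open>jac_pair \<theta> g \<zeta>\<close>, an integral that involves only C^1 maps
  \<open>g\<close>, and by its stability under uniform perturbation of \<open>g\<close>. Product
  kernels serve as \<open>\<zeta>\<close> because a primitive in one coordinate is explicit: its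
  constancy off the kernel gives homotopy invariance, its values between 0 and 1 give the
  isoperimetric inequality. Cutting into layers pays because the error of one layer is the variation
  over that layer times the square root of an area in the image: the variations add up to a bound
  that does not depend on the number of layers, while the areas become uniformly small once the
  level lines have images of measure 0. Integrality of the degree is essential, since
  multiplicativity alone only says that the degrees of \<open>f\<close> and \<open>h\<close> are
  reciprocal.\<close>

lemma vec2_eq_axis: "(h::real^2) = h$1 *\<^sub>R axis 1 1 + h$2 *\<^sub>R axis 2 1"
  by (simp add: vec_eq_iff forall_2 axis_def)

lemma part_derivI:
  assumes "(u has_derivative u') (at x)"
  shows "part_deriv i u x = u' (axis i 1)"
  using frechet_derivative_at[OF assms] by (simp add: part_deriv_def)

lemma has_derivative_part_deriv:
  assumes "u differentiable (at x)"
  shows "(u has_derivative (\<lambda>h. part_deriv 1 u x * h$1 + part_deriv 2 u x * h$2)) (at x)"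
proof -
  have D: "(u has_derivative frechet_derivative u (at x)) (at x)"
    using assms frechet_derivative_works by blast
  interpret L: linear "frechet_derivative u (at x)"
    using D has_derivative_linear by blast
  have "frechet_derivative u (at x) h = part_deriv 1 u x * h$1 + part_deriv 2 u x * h$2" for h
  proof -
    have "frechet_derivative u (at x) h
      = frechet_derivative u (at x) (h$1 *\<^sub>R axis 1 1 + h$2 *\<^sub>R axis 2 1)"
      using vec2_eq_axis[of h] by simp
    also have "\<dots> = h$1 *\<^sub>R part_deriv 1 u x + h$2 *\<^sub>R part_deriv 2 u x"
      unfolding part_deriv_def L.add L.scaleR by simp
    finally show ?thesis by (simp add: mult.commute)
  qed
  then have "frechet_derivative u (at x) = (\<lambda>h. part_deriv 1 u x * h$1 + part_deriv 2 u x * h$2)"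
    by (rule ext)
  then show ?thesis using D by metis
qed

lemma C_k_Suc_imp: "C_k (Suc k) u \<Longrightarrow> C_k k u"
proof (induction k arbitrary: u)
  case 0
  then show ?case
    by (auto simp: continuous_on_eq_continuous_at differentiable_imp_continuous_within)
qed auto

lemma C_k_continuous: "C_k k u \<Longrightarrow> continuous_on UNIV u"
  by (cases k) (auto simp: continuous_on_eq_continuous_at differentiable_imp_continuous_within)

lemma C1_iff: "C_k 1 u \<longleftrightarrow> (\<forall>x. u differentiable (at x)) \<and> (\<forall>i. continuous_on UNIV (part_deriv i u))"
  by simp

lemma C1_differentiable: "C_k 1 u \<Longrightarrow> u differentiable (at x)"
  by simp

lemma C1_pd_continuous: "C_k 1 u \<Longrightarrow> continuous_on UNIV (part_deriv i u)"
  by simp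

lemma C1_has_derivative:
  "C_k 1 u \<Longrightarrow> (u has_derivative (\<lambda>h. part_deriv 1 u x * h$1 + part_deriv 2 u x * h$2)) (at x)"
  by (rule has_derivative_part_deriv) simp

lemma C1I:
  assumes "\<And>x. (u has_derivative (\<lambda>h. a 1 x * h$1 + a 2 x * h$2)) (at x)"
    and "\<And>i::2. continuous_on UNIV (a i)"
  shows "C_k 1 u" "part_deriv i u = a i"
proof -
  have *: "part_deriv i u = a i" for i
    using part_derivI[OF assms(1), of i] exhaust_2[of i] by (auto simp: axis_def fun_eq_iff)
  then show "part_deriv i u = a i" .
  show "C_k 1 u"
    unfolding C1_iff using assms * by (auto simp: differentiable_def)
qed

lemma part_deriv_add:
  assumes "u differentiable (at x)" "v differentiable (at x)"
  shows "part_deriv i (\<lambda>x. u x + v x) x = part_deriv i u x + part_deriv i v x"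
  by (subst part_derivI[OF has_derivative_add[OF assms[unfolded frechet_derivative_works]]])
     (simp add: part_deriv_def)

lemma part_deriv_mult:
  assumes "u differentiable (at x)" "v differentiable (at x)"
  shows "part_deriv i (\<lambda>x. u x * v x) x = u x * part_deriv i v x + part_deriv i u x * v x"
  by (subst part_derivI[OF has_derivative_mult[OF assms[unfolded frechet_derivative_works]]])
     (simp add: part_deriv_def)

lemma part_deriv_const: "part_deriv i (\<lambda>x. c) x = 0"
  by (simp add: part_deriv_def)

lemma C_k_const: "C_k k (\<lambda>x. c)"
proof (induction k arbitrary: c)
  case (Suc k)
  have "part_deriv i (\<lambda>x. c) = (\<lambda>x. 0)" for i
    by (simp add: part_deriv_const fun_eq_iff)
  then show ?case using Suc by simp
qed simp

lemma C_k_add: "C_k k u \<Longrightarrow> C_k k v \<Longrightarrow> C_k k (\<lambda>x. u x + v x)"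
proof (induction k arbitrary: u v)
  case 0
  then show ?case by (simp add: continuous_on_add)
next
  case (Suc k)
  have "part_deriv i (\<lambda>x. u x + v x) = (\<lambda>x. part_deriv i u x + part_deriv i v x)" for i
    using Suc by (simp add: fun_eq_iff part_deriv_add)
  then show ?case using Suc by simp
qed

lemma C_k_mult: "C_k k u \<Longrightarrow> C_k k v \<Longrightarrow> C_k k (\<lambda>x. u x * v x)"
proof (induction k arbitrary: u v)
  case 0
  then show ?case by (simp add: continuous_on_mult)
next
  case (Suc k)
  have *: "part_deriv i (\<lambda>x. u x * v x) = (\<lambda>x. u x * part_deriv i v x + part_deriv i u x * v x)" for i
    using Suc by (simp add: fun_eq_iff part_deriv_mult)
  have "C_k k u" "C_k k v" using Suc.prems C_k_Suc_imp by blast+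
  then show ?case using Suc by (simp add: * C_k_add)
qed

lemma C_k_cmult: "C_k k u \<Longrightarrow> C_k k (\<lambda>x. c * u x)"
  by (intro C_k_mult C_k_const)

lemma C_k_uminus: "C_k k u \<Longrightarrow> C_k k (\<lambda>x. - u x)"
  using C_k_cmult[of k u "-1"] by simp

lemma C_k_diff: "C_k k u \<Longrightarrow> C_k k v \<Longrightarrow> C_k k (\<lambda>x. u x - v x)"
  using C_k_add[OF _ C_k_uminus] by fastforce

lemma part_deriv_nth: "part_deriv i (\<lambda>x. x $ j) x = (if i = j then 1 else 0)"
  by (subst part_derivI[OF bounded_linear_imp_has_derivative[OF bounded_linear_vec_nth]])
     (simp add: axis_def)

lemma C_k_nth: "C_k k (\<lambda>x. x $ j)"
proof (cases k)
  case 0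
  then show ?thesis by (simp add: continuous_on_component)
next
  case (Suc m)
  have "part_deriv i (\<lambda>x. x $ j) = (\<lambda>x. if i = j then 1 else 0)" for i
    by (simp add: part_deriv_nth fun_eq_iff)
  then show ?thesis using Suc
    by (auto intro!: C_k_const bounded_linear_imp_differentiable bounded_linear_vec_nth)
qed

lemma part_deriv_affine:
  assumes "u differentiable (at (c *\<^sub>R x + b))"
  shows "part_deriv i (\<lambda>x. u (c *\<^sub>R x + b)) x = c * part_deriv i u (c *\<^sub>R x + b)"
proof -
  have "((\<lambda>x. u (c *\<^sub>R x + b)) has_derivative
     (\<lambda>h. part_deriv 1 u (c *\<^sub>R x + b) * (c *\<^sub>R h)$1 + part_deriv 2 u (c *\<^sub>R x + b) * (c *\<^sub>R h)$2)) (at x)"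
    by (rule has_derivative_compose[where f="\<lambda>x. c *\<^sub>R x + b" and g=u, OF _ has_derivative_part_deriv[OF assms]])
       (auto intro!: derivative_eq_intros)
  from part_derivI[OF this, of i] show ?thesis using exhaust_2[of i]
    by (auto simp: axis_def)
qed

lemma C_k_affine: "C_k k u \<Longrightarrow> C_k k (\<lambda>x. u (c *\<^sub>R x + b))"
proof (induction k arbitrary: u)
  case 0
  have "continuous_on UNIV (u \<circ> (\<lambda>x. c *\<^sub>R x + b))"
    using 0 by (intro continuous_on_compose continuous_intros) (auto intro: continuous_on_subset)
  then show ?case by (simp add: o_def)
next
  case (Suc k)
  have "(\<lambda>x. u (c *\<^sub>R x + b)) differentiable (at x)" for x
  proof -
    have "(u \<circ> (\<lambda>x. c *\<^sub>R x + b)) differentiable (at x)"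
      using Suc.prems by (intro differentiable_chain_at) auto
    then show ?thesis by (simp add: o_def)
  qed
  moreover have "part_deriv i (\<lambda>x. u (c *\<^sub>R x + b)) = (\<lambda>x. c * part_deriv i u (c *\<^sub>R x + b))" for i
    using Suc.prems by (simp add: fun_eq_iff part_deriv_affine)
  ultimately show ?case using Suc by (simp add: C_k_cmult)
qed

lemma has_derivative_vec2:
  fixes g :: "real^2 \<Rightarrow> real^2"
  assumes "\<And>i. C_k 1 (\<lambda>x. g x $ i)"
  shows "(g has_derivative (\<lambda>h. \<chi> i. part_deriv 1 (\<lambda>x. g x $ i) x * h$1 + part_deriv 2 (\<lambda>x. g x $ i) x * h$2)) (at x)"
  by (subst has_derivative_componentwise_within)
     (auto simp: Basis_vec_def inner_axis intro!: C1_has_derivative assms)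

lemma C1_compose:
  fixes g :: "real^2 \<Rightarrow> real^2"
  assumes u: "C_k 1 u" and g: "\<And>i. C_k 1 (\<lambda>x. g x $ i)"
  shows "C_k 1 (\<lambda>x. u (g x))"
    and "part_deriv j (\<lambda>x. u (g x)) x
      = part_deriv 1 u (g x) * part_deriv j (\<lambda>x. g x $ 1) x + part_deriv 2 u (g x) * part_deriv j (\<lambda>x. g x $ 2) x"
proof -
  let ?a = "\<lambda>j x. part_deriv 1 u (g x) * part_deriv j (\<lambda>x. g x $ 1) x + part_deriv 2 u (g x) * part_deriv j (\<lambda>x. g x $ 2) x"
  have gc: "continuous_on UNIV g"
    by (intro continuous_at_imp_continuous_on ballI has_derivative_continuous[OF has_derivative_vec2[OF g]])
  have "((\<lambda>x. u (g x)) has_derivative (\<lambda>h. ?a 1 x * h$1 + ?a 2 x * h$2)) (at x)" for x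
    by (rule has_derivative_eq_rhs[OF has_derivative_compose[OF has_derivative_vec2[OF g] C1_has_derivative[OF u]]])
       (simp add: fun_eq_iff algebra_simps)
  moreover have "continuous_on UNIV (?a i)" for i
    by (intro continuous_intros continuous_on_compose2[OF C1_pd_continuous[OF u] gc]
        C1_pd_continuous g) auto
  ultimately show "C_k 1 (\<lambda>x. u (g x))" "part_deriv j (\<lambda>x. u (g x)) x = ?a j x"
    using C1I[of "\<lambda>x. u (g x)" ?a] by auto
qed

lemma C1_compose_real:
  assumes u: "C_k 1 u" and "\<And>t. (r has_real_derivative r' t) (at t)" "continuous_on UNIV r'"
  shows "C_k 1 (\<lambda>x. r (u x))" and "part_deriv j (\<lambda>x. r (u x)) x = r' (u x) * part_deriv j u x"
proof -
  let ?a = "\<lambda>j x. r' (u x) * part_deriv j u x"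
  have "((\<lambda>x. r (u x)) has_derivative (\<lambda>h. ?a 1 x * h$1 + ?a 2 x * h$2)) (at x)" for x
    by (rule has_derivative_eq_rhs[OF has_derivative_compose[OF C1_has_derivative[OF u]
          assms(2)[unfolded has_field_derivative_def]]])
       (simp add: fun_eq_iff algebra_simps)
  moreover have "continuous_on UNIV (?a i)" for i
    by (intro continuous_intros continuous_on_compose2[OF assms(3) C_k_continuous[OF u]]
        C1_pd_continuous u) auto
  ultimately show "C_k 1 (\<lambda>x. r (u x))" "part_deriv j (\<lambda>x. r (u x)) x = ?a j x"
    using C1I[of "\<lambda>x. r (u x)" ?a] by auto
qed

text \<open>The coefficient of the 2-form du \<and> dv. Keeping the two functions in separate slots
  lets cutoffs and compositions be moved between them, which a bare Jacobian determinant would not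
  allow.\<close>

definition wedge :: "(real^2 \<Rightarrow> real) \<Rightarrow> (real^2 \<Rightarrow> real) \<Rightarrow> real^2 \<Rightarrow> real" where
  "wedge u v x = part_deriv 1 u x * part_deriv 2 v x - part_deriv 2 u x * part_deriv 1 v x"

lemma wedge_swap: "wedge u v x = - wedge v u x"
  by (simp add: wedge_def)

lemma wedge_mult_left:
  assumes "u differentiable (at x)" "v differentiable (at x)"
  shows "wedge (\<lambda>x. u x * v x) w x = u x * wedge v w x + v x * wedge u w x"
  using assms by (simp add: wedge_def part_deriv_mult algebra_simps)

lemma wedge_continuous: "C_k 1 u \<Longrightarrow> C_k 1 v \<Longrightarrow> continuous_on UNIV (wedge u v)"
  unfolding wedge_def by (intro continuous_intros C1_pd_continuous)

lemma wedge_nth: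
  "wedge (\<lambda>x. x $ 1) v x = part_deriv 2 v x" "wedge (\<lambda>x. x $ 2) v x = - part_deriv 1 v x"
  by (simp_all add: wedge_def part_deriv_nth)

text \<open>In d(u \<circ> g) \<and> dg_2 the part along dg_2 is annihilated. A partial derivative
  of \<open>u\<close> at \<open>g x\<close> times the Jacobian of \<open>g\<close> is thus a single
  wedge, the divergence form behind all later integrations by parts.\<close>

lemma wedge_compose:
  fixes g :: "real^2 \<Rightarrow> real^2"
  assumes u: "C_k 1 u" and g: "\<And>i. C_k 1 (\<lambda>x. g x $ i)"
  shows "wedge (\<lambda>x. u (g x)) (\<lambda>x. g x $ 2) x = part_deriv 1 u (g x) * wedge (\<lambda>x. g x $ 1) (\<lambda>x. g x $ 2) x"
    and "wedge (\<lambda>x. g x $ 1) (\<lambda>x. u (g x)) x = part_deriv 2 u (g x) * wedge (\<lambda>x. g x $ 1) (\<lambda>x. g x $ 2) x"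
  unfolding wedge_def C1_compose(2)[OF u g] by (simp_all add: algebra_simps)

lemma det_jacobian:
  fixes g :: "real^2 \<Rightarrow> real^2"
  assumes "\<And>i. C_k 1 (\<lambda>x. g x $ i)"
  shows "det (jacobian g (at x)) = wedge (\<lambda>x. g x $ 1) (\<lambda>x. g x $ 2) x"
proof -
  have "frechet_derivative g (at x) =
    (\<lambda>h. \<chi> i. part_deriv 1 (\<lambda>x. g x $ i) x * h$1 + part_deriv 2 (\<lambda>x. g x $ i) x * h$2)"
    using frechet_derivative_at[OF has_derivative_vec2[OF assms]] by metis
  then show ?thesis
    by (simp add: jacobian_def matrix_def det_2 axis_def wedge_def)
qed

section \<open>Integration of functions with bounded support\<close>

lemma integrable_continuous_bounded_support:
  fixes u :: "'a::euclidean_space \<Rightarrow> real"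
  assumes "continuous_on UNIV u" "bounded {x. u x \<noteq> 0}"
  shows "integrable lborel u"
proof -
  obtain R where R: "{x. u x \<noteq> 0} \<subseteq> cball 0 R"
    using bounded_subset_ballD[OF assms(2), of 0] ball_subset_cball by (metis order_trans)
  have "integrable lborel (\<lambda>x. indicator (cball 0 R) x *\<^sub>R u x)"
    by (rule borel_integrable_compact) (auto intro: continuous_on_subset assms)
  moreover have "(\<lambda>x. indicator (cball 0 R) x *\<^sub>R u x) = u"
    using R by (auto simp: fun_eq_iff indicator_def)
  ultimately show ?thesis by simp
qed

lemma bounded_support_mult1: "bounded {x. u x \<noteq> 0} \<Longrightarrow> bounded {x. u x * (v x :: real) \<noteq> 0}"
  by (rule bounded_subset) auto

lemma bounded_support_mult2: "bounded {x. v x \<noteq> 0} \<Longrightarrow> bounded {x. u x * (v x :: real) \<noteq> 0}"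
  by (rule bounded_subset) auto

lemma part_deriv_eq_0:
  assumes "open U" "x \<in> U" "\<And>y. y \<in> U \<Longrightarrow> u y = c"
  shows "part_deriv i u x = 0"
proof -
  have "((\<lambda>y. c) has_derivative (\<lambda>h. 0)) (at x)" by simp
  then have "(u has_derivative (\<lambda>h. 0)) (at x)"
    by (rule has_derivative_transform_within_open[OF _ assms(1,2)]) (use assms in auto)
  then show ?thesis by (rule part_derivI)
qed

lemma part_deriv_support: "{x. part_deriv i u x \<noteq> 0} \<subseteq> closure {x. u x \<noteq> 0}"
proof
  fix x assume "x \<in> {x. part_deriv i u x \<noteq> 0}"
  moreover have "part_deriv i u x = 0" if "x \<notin> closure {x. u x \<noteq> 0}"
    by (rule part_deriv_eq_0[of "- closure {x. u x \<noteq> 0}" x u 0])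
       (use that closure_subset[of "{x. u x \<noteq> 0}"] in \<open>auto\<close>)
  ultimately show "x \<in> closure {x. u x \<noteq> 0}" by auto
qed

lemma bounded_support_part_deriv:
  "bounded {x. u x \<noteq> 0} \<Longrightarrow> bounded {x. part_deriv i u x \<noteq> 0}"
  using part_deriv_support bounded_closure bounded_subset by metis

lemma bounded_support_wedge:
  "bounded {x. u x \<noteq> 0} \<Longrightarrow> bounded {x. wedge u v x \<noteq> 0}"
proof -
  assume "bounded {x. u x \<noteq> 0}"
  moreover have "{x. wedge u v x \<noteq> 0} \<subseteq> closure {x. u x \<noteq> 0}"
  proof
    fix x assume "x \<in> {x. wedge u v x \<noteq> 0}"
    then have "part_deriv 1 u x \<noteq> 0 \<or> part_deriv 2 u x \<noteq> 0" by (auto simp: wedge_def)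
    then show "x \<in> closure {x. u x \<noteq> 0}" using part_deriv_support[of _ u] by blast
  qed
  ultimately show ?thesis using bounded_closure bounded_subset by blast
qed

section \<open>Integration by parts from translation invariance\<close>

lemma integral_translate:
  fixes u :: "'a::euclidean_space \<Rightarrow> real"
  assumes "u \<in> borel_measurable borel"
  shows "(\<integral>x. u (x + a) \<partial>lborel) = integral\<^sup>L lborel u"
proof -
  have "integral\<^sup>L lborel u = integral\<^sup>L (distr lborel borel ((+) a)) u"
    by (simp add: lborel_distr_plus)
  also have "\<dots> = (\<integral>x. u (a + x) \<partial>lborel)"
    by (rule integral_distr) (use assms in auto)
  finally show ?thesis by (simp add: add.commute)
qed

lemma axis_line_derivative:
  assumes "u differentiable (at (x + t *\<^sub>R axis i 1))"
  shows "((\<lambda>t. u (x + t *\<^sub>R axis i 1)) has_real_derivative part_deriv i u (x + t *\<^sub>R axis i 1)) (at t)"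
proof -
  let ?p = "x + t *\<^sub>R axis i (1::real)"
  have "((\<lambda>t. x + t *\<^sub>R axis i (1::real)) has_derivative (\<lambda>h. h *\<^sub>R axis i 1)) (at t)"
    by (auto intro!: derivative_eq_intros)
  from has_derivative_compose[OF this has_derivative_part_deriv[OF assms]]
  have "((\<lambda>t. u (x + t *\<^sub>R axis i 1)) has_derivative
     (\<lambda>h. part_deriv 1 u ?p * (h *\<^sub>R axis i 1)$1 + part_deriv 2 u ?p * (h *\<^sub>R axis i (1::real))$2)) (at t)" .
  moreover have "(\<lambda>h. part_deriv 1 u ?p * (h *\<^sub>R axis i 1)$1 + part_deriv 2 u ?p * (h *\<^sub>R axis i (1::real))$2)
      = (*) (part_deriv i u ?p)"
    using exhaust_2[of i] by (auto simp: axis_def fun_eq_iff)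
  ultimately show ?thesis
    unfolding has_field_derivative_def by metis
qed

lemma C1_diff_quot_bounded:
  assumes "C_k 1 u" "bounded B"
  obtains M where "0 \<le> M" "\<And>x t. x \<in> B \<Longrightarrow> \<bar>t\<bar> \<le> 1 \<Longrightarrow> \<bar>u (x + t *\<^sub>R axis i 1) - u x\<bar> \<le> M * \<bar>t\<bar>"
proof -
  obtain R where R: "B \<subseteq> cball 0 R" using bounded_subset_ballD[OF assms(2), of 0] ball_subset_cball by (metis order_trans)
  have "compact (part_deriv i u ` cball 0 (R+1))"
    by (intro compact_continuous_image continuous_on_subset[OF C1_pd_continuous[OF assms(1)]]) auto
  then have "bounded (part_deriv i u ` cball 0 (R+1))" by (rule compact_imp_bounded)
  then obtain M where "\<forall>y\<in>part_deriv i u ` cball 0 (R+1). norm y \<le> M"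
    unfolding bounded_iff by blast
  then have M: "\<bar>part_deriv i u x\<bar> \<le> M" if "x \<in> cball 0 (R+1)" for x
    using that by auto
  have *: "\<bar>u (x + t *\<^sub>R axis i 1) - u x\<bar> \<le> max M 0 * \<bar>t\<bar>" if x: "x \<in> B" and t: "\<bar>t\<bar> \<le> 1" for x t
  proof -
    have "norm (u (x + t *\<^sub>R axis i 1) - u (x + 0 *\<^sub>R axis i 1)) \<le> max M 0 * norm (t - 0)"
    proof (rule field_differentiable_bound[where S="cball 0 1" and f'="\<lambda>t. part_deriv i u (x + t *\<^sub>R axis i 1)" and f="\<lambda>t. u (x + t *\<^sub>R axis i 1)"])
      show "((\<lambda>t. u (x + t *\<^sub>R axis i 1)) has_field_derivative part_deriv i u (x + z *\<^sub>R axis i 1)) (at z within cball 0 1)"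
        for z using axis_line_derivative[OF C1_differentiable[OF assms(1)]] has_field_derivative_at_within by blast
      show "norm (part_deriv i u (x + z *\<^sub>R axis i 1)) \<le> max M 0" if "z \<in> cball 0 1" for z
      proof -
        have "norm (x + z *\<^sub>R axis i (1::real)) \<le> norm x + norm z"
          using norm_triangle_ineq[of x "z *\<^sub>R axis i 1"] by simp
        moreover have "norm x \<le> R" using R x by auto
        moreover have "norm z \<le> 1" using that by simp
        ultimately have "x + z *\<^sub>R axis i 1 \<in> cball 0 (R+1)" by simp
        then show ?thesis using M by fastforce
      qed
    qed (use t in auto)
    then show ?thesis by simp
  qed
  show thesis by (rule that[of "max M 0"]) (use * in auto)
qed

lemma diff_quot_tendsto:
  assumes "C_k 1 u" "s \<longlonglongrightarrow> 0" "\<And>n. s n \<noteq> 0"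
  shows "(\<lambda>n. (u (x + s n *\<^sub>R axis i 1) - u x) / s n) \<longlonglongrightarrow> part_deriv i u x"
proof -
  have "((\<lambda>t. u (x + t *\<^sub>R axis i 1)) has_real_derivative part_deriv i u (x + 0 *\<^sub>R axis i 1)) (at 0)"
    by (rule axis_line_derivative) (use assms in simp)
  then have "((\<lambda>t. (u (x + t *\<^sub>R axis i 1) - u x) / t) \<longlongrightarrow> part_deriv i u x) (at 0)"
    by (simp add: has_field_derivative_iff)
  moreover have "filterlim s (at 0) sequentially"
    using assms by (simp add: filterlim_at)
  ultimately show ?thesis by (rule filterlim_compose)
qed

lemma integral_diff_quot_tendsto:
  assumes w: "continuous_on UNIV w" "bounded {x. w x \<noteq> 0}" and u: "C_k 1 u"
    and s: "s \<longlonglongrightarrow> 0" "\<And>n. s n \<noteq> 0" "\<And>n. \<bar>s n\<bar> \<le> 1"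
  shows "(\<lambda>n. \<integral>x. w x * ((u (x + s n *\<^sub>R axis i 1) - u x) / s n) \<partial>lborel) \<longlonglongrightarrow> (\<integral>x. w x * part_deriv i u x \<partial>lborel)"
proof -
  obtain M where M: "0 \<le> M" "\<And>x t. x \<in> {x. w x \<noteq> 0} \<Longrightarrow> \<bar>t\<bar> \<le> 1 \<Longrightarrow> \<bar>u (x + t *\<^sub>R axis i 1) - u x\<bar> \<le> M * \<bar>t\<bar>"
    using C1_diff_quot_bounded[OF u w(2)] by blast
  have cu: "continuous_on UNIV u" by (rule C_k_continuous[OF u])
  have [measurable]: "u \<in> borel_measurable borel" "w \<in> borel_measurable borel" "part_deriv i u \<in> borel_measurable borel"
    using cu w(1) C1_pd_continuous[OF u] by (auto intro: borel_measurable_continuous_onI)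
  show ?thesis
  proof (rule integral_dominated_convergence[where w="\<lambda>x. \<bar>w x\<bar> * M"])
    show "integrable lborel (\<lambda>x. \<bar>w x\<bar> * M)"
      by (intro integrable_mult_left integrable_abs integrable_continuous_bounded_support w)
    show "AE x in lborel. (\<lambda>n. w x * ((u (x + s n *\<^sub>R axis i 1) - u x) / s n)) \<longlonglongrightarrow> w x * part_deriv i u x"
      by (intro AE_I2 tendsto_intros diff_quot_tendsto u s)
    fix n
    show "AE x in lborel. norm (w x * ((u (x + s n *\<^sub>R axis i 1) - u x) / s n)) \<le> \<bar>w x\<bar> * M"
    proof (intro AE_I2)
      fix x
      have "\<bar>u (x + s n *\<^sub>R axis i 1) - u x\<bar> / \<bar>s n\<bar> \<le> M" if "w x \<noteq> 0"
        using M(2)[of x "s n"] that s(2)[of n] s(3)[of n] by (simp add: divide_le_eq)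
      then show "norm (w x * ((u (x + s n *\<^sub>R axis i 1) - u x) / s n)) \<le> \<bar>w x\<bar> * M"
        using M(1) mult_left_mono[of "\<bar>u (x + s n *\<^sub>R axis i 1) - u x\<bar> / \<bar>s n\<bar>" M "\<bar>w x\<bar>"]
        by (cases "w x = 0") (auto simp: abs_mult)
    qed
  qed measurable
qed

text \<open>With the bounded support on \<open>u\<close>, the weight \<open>w\<close> may be
  multiplied by a cutoff equal to 1 wherever a difference quotient of step at most 1 can be nonzero;
  this reduces the claim to a weight of bounded support.\<close>

lemma integral_diff_quot_tendsto':
  assumes w: "continuous_on UNIV w" and u: "C_k 1 u" "bounded {x. u x \<noteq> 0}"
    and s: "s \<longlonglongrightarrow> 0" "\<And>n. s n \<noteq> 0" "\<And>n. \<bar>s n\<bar> \<le> 1"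
  shows "(\<lambda>n. \<integral>x. w x * ((u (x + s n *\<^sub>R axis i 1) - u x) / s n) \<partial>lborel) \<longlonglongrightarrow> (\<integral>x. w x * part_deriv i u x \<partial>lborel)"
proof -
  obtain R where R: "{x. u x \<noteq> 0} \<subseteq> cball 0 R"
    using bounded_subset_ballD[OF u(2), of 0] ball_subset_cball by (metis order_trans)
  define c :: "real^2 \<Rightarrow> real" where "c x = max 0 (min 1 (R + 3 - norm x))" for x
  have c1: "c x = 1" if "norm x \<le> R + 2" for x using that by (simp add: c_def)
  have "(\<lambda>n. \<integral>x. (c x * w x) * ((u (x + s n *\<^sub>R axis i 1) - u x) / s n) \<partial>lborel) \<longlonglongrightarrow> (\<integral>x. (c x * w x) * part_deriv i u x \<partial>lborel)"
  proof (rule integral_diff_quot_tendsto[OF _ _ u(1) s])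
    show "continuous_on UNIV (\<lambda>x. c x * w x)"
      unfolding c_def by (intro continuous_intros w)
    show "bounded {x. c x * w x \<noteq> 0}"
      by (rule bounded_subset[of "cball 0 (R+3)"]) (auto simp: c_def max_def min_def split: if_splits)
  qed
  moreover have "(c x * w x) * ((u (x + s n *\<^sub>R axis i 1) - u x) / s n) = w x * ((u (x + s n *\<^sub>R axis i 1) - u x) / s n)" for x n
  proof (cases "norm x \<le> R + 2")
    case True then show ?thesis by (simp add: c1)
  next
    case False
    have "norm (x + s n *\<^sub>R axis i (1::real)) \<ge> norm x - norm (s n *\<^sub>R axis i (1::real) :: real^2)"
      using norm_diff_ineq[of x "s n *\<^sub>R axis i 1"] by simp
    then have "norm (x + s n *\<^sub>R axis i (1::real)) > R"
      using s(3)[of n] False by simp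
    then have "u (x + s n *\<^sub>R axis i 1) = 0" "u x = 0" using R False by force+
    then show ?thesis by simp
  qed
  moreover have "(c x * w x) * part_deriv i u x = w x * part_deriv i u x" for x
  proof (cases "norm x \<le> R + 2")
    case True then show ?thesis by (simp add: c1)
  next
    case False
    then have "x \<notin> closure {x. u x \<noteq> 0}"
      using closure_minimal[OF R(1)] by auto
    then show ?thesis using part_deriv_support[of i u] by auto
  qed
  ultimately show ?thesis by (simp only:)
qed

lemma bounded_support_translate:
  fixes u :: "'a::real_normed_vector \<Rightarrow> real"
  assumes "bounded {x. u x \<noteq> 0}"
  shows "bounded {x. u (x + a) \<noteq> 0}"
proof -
  have "{x. u (x + a) \<noteq> 0} = (\<lambda>x. - a + x) ` {x. u x \<noteq> 0}"
    by (force simp: image_iff algebra_simps)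
  then show ?thesis using bounded_translation[OF assms, of "- a"] by (simp only:)
qed

lemma continuous_translate:
  fixes u :: "'a::real_normed_vector \<Rightarrow> real"
  assumes "continuous_on UNIV u"
  shows "continuous_on UNIV (\<lambda>x. u (x + a))"
  by (intro continuous_on_compose2[OF assms] continuous_intros) auto

text \<open>The mollification radius of \<open>conv_approx\<close>. It doubles as the generic null
  sequence for difference quotients and kernel widths.\<close>

definition step_seq :: "nat \<Rightarrow> real" where "step_seq n = 1 / Suc n"

lemma step_seq:
  "step_seq \<longlonglongrightarrow> 0" "step_seq n \<noteq> 0" "\<bar>step_seq n\<bar> \<le> 1" "step_seq n > 0"
  unfolding step_seq_def using LIMSEQ_Suc[OF lim_1_over_n] by auto

text \<open>Every difference quotient has integral 0 by translation invariance, and the limit passes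
  under the integral. Neither Fubini nor the one-dimensional fundamental theorem enters.\<close>

lemma integral_part_deriv_eq_0:
  assumes u: "C_k 1 u" and b: "bounded {x. u x \<noteq> 0}"
  shows "(\<integral>x. part_deriv i u x \<partial>lborel) = 0"
proof -
  have cu: "continuous_on UNIV u" by (rule C_k_continuous[OF u])
  have mu: "u \<in> borel_measurable borel" using cu by (rule borel_measurable_continuous_onI)
  have "(\<integral>x. (u (x + step_seq n *\<^sub>R axis i 1) - u x) / step_seq n \<partial>lborel) = 0" for n
  proof -
    have "(\<integral>x. (u (x + step_seq n *\<^sub>R axis i 1) - u x) / step_seq n \<partial>lborel)
      = ((\<integral>x. u (x + step_seq n *\<^sub>R axis i 1) \<partial>lborel) - (\<integral>x. u x \<partial>lborel)) / step_seq n"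
      by (simp add: integrable_continuous_bounded_support cu b continuous_translate bounded_support_translate)
    then show ?thesis using integral_translate[OF mu] by simp
  qed
  then show ?thesis
    using integral_diff_quot_tendsto'[OF continuous_on_const[of _ 1] u b step_seq(1-3), of i]
    by (simp only: mult_1 LIMSEQ_const_iff)
qed

lemma integration_by_parts:
  assumes u: "C_k 1 u" and v: "C_k 1 v" and b: "bounded {x. u x \<noteq> 0}"
  shows "(\<integral>x. u x * part_deriv i v x \<partial>lborel) = - (\<integral>x. part_deriv i u x * v x \<partial>lborel)"
proof -
  have "(\<integral>x. part_deriv i (\<lambda>x. u x * v x) x \<partial>lborel) = 0"
    by (intro integral_part_deriv_eq_0 C_k_mult u v bounded_support_mult1 b)
  moreover have "part_deriv i (\<lambda>x. u x * v x) x = u x * part_deriv i v x + part_deriv i u x * v x" for x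
    using u v by (simp add: part_deriv_mult)
  moreover have "integrable lborel (\<lambda>x. u x * part_deriv i v x)"
    by (intro integrable_continuous_bounded_support continuous_intros C_k_continuous[OF u] C1_pd_continuous[OF v] bounded_support_mult1 b)
  moreover have "integrable lborel (\<lambda>x. part_deriv i u x * v x)"
    by (intro integrable_continuous_bounded_support continuous_intros C_k_continuous[OF v] C1_pd_continuous[OF u] bounded_support_mult1 bounded_support_part_deriv b)
  ultimately show ?thesis by simp
qed

text \<open>For C^2 functions this is Stokes' theorem for d(a db). Here \<open>b\<close> is only
  C^1, so its second derivatives are avoided by replacing the derivative in the second direction by
  a difference quotient.\<close>

lemma integral_wedge_eq_0:
  assumes a: "C_k 1 a" and b: "C_k 1 b" and s: "bounded {x. a x \<noteq> 0}"
  shows "(\<integral>x. wedge a b x \<partial>lborel) = 0"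
proof -
  let ?e = "axis 2 1 :: real^2"
  have ca: "continuous_on UNIV a" and cb: "continuous_on UNIV b"
    using a b C_k_continuous by blast+
  have pa: "continuous_on UNIV (part_deriv i a)" and pb: "continuous_on UNIV (part_deriv i b)" for i
    using a b C1_pd_continuous by blast+
  \<comment> \<open>Discrete version of the identity: integrate by parts in the first direction,
    where the difference quotient of \<open>b\<close> is still C^1, then translate so that the
    quotient falls on \<open>a\<close>, with step \<open>- t\<close>.\<close>
  have eq: "(\<integral>x. part_deriv 1 a x * ((b (x + t *\<^sub>R ?e) - b x) / t) \<partial>lborel)
    = (\<integral>x. part_deriv 1 b x * ((a (x + (- t) *\<^sub>R ?e) - a x) / (- t)) \<partial>lborel)" if "t \<noteq> 0" for t
  proof -
    define q where "q x = (1/t) * (b (1 *\<^sub>R x + t *\<^sub>R ?e) - b x)" for x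
    have q: "C_k 1 q" unfolding q_def by (intro C_k_cmult C_k_diff C_k_affine b)
    have dq: "part_deriv 1 q x = (part_deriv 1 b (x + t *\<^sub>R ?e) - part_deriv 1 b x) / t" for x
    proof -
      have "((\<lambda>x. (1/t) * (b (1 *\<^sub>R x + t *\<^sub>R ?e) - b x)) has_derivative
        (\<lambda>h. (1/t) * ((part_deriv 1 b (x + t *\<^sub>R ?e) * (1 *\<^sub>R h + 0)$1 + part_deriv 2 b (x + t *\<^sub>R ?e) * (1 *\<^sub>R h + 0)$2)
          - (part_deriv 1 b x * h$1 + part_deriv 2 b x * h$2)))) (at x)"
        by (intro has_derivative_mult_right has_derivative_diff C1_has_derivative b
            has_derivative_compose[where f="\<lambda>x. 1 *\<^sub>R x + t *\<^sub>R ?e" and g=b and g'="\<lambda>h. part_deriv 1 b (x + t *\<^sub>R ?e) * h$1 + part_deriv 2 b (x + t *\<^sub>R ?e) * h$2"])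
          (use C1_has_derivative[OF b] in \<open>auto intro!: derivative_eq_intros\<close>)
      from part_derivI[OF this, of 1] show ?thesis
        unfolding q_def by (simp add: axis_def)
    qed
    have i1: "integrable lborel (\<lambda>x. a x * part_deriv 1 b (x + t *\<^sub>R ?e))"
      by (intro integrable_continuous_bounded_support continuous_intros ca continuous_translate pb bounded_support_mult1 s)
    have i2: "integrable lborel (\<lambda>x. a x * part_deriv 1 b x)"
      by (intro integrable_continuous_bounded_support continuous_intros ca pb bounded_support_mult1 s)
    have i3: "integrable lborel (\<lambda>x. a (x + (-t) *\<^sub>R ?e) * part_deriv 1 b x)"
      by (intro integrable_continuous_bounded_support continuous_intros continuous_translate ca pb bounded_support_mult1 bounded_support_translate s)
    have "(\<integral>x. part_deriv 1 a x * ((b (x + t *\<^sub>R ?e) - b x) / t) \<partial>lborel) = (\<integral>x. part_deriv 1 a x * q x \<partial>lborel)"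
      by (simp add: q_def)
    also have "\<dots> = - (\<integral>x. a x * part_deriv 1 q x \<partial>lborel)"
      using integration_by_parts[OF a q s, of 1] by simp
    also have "(\<integral>x. a x * part_deriv 1 q x \<partial>lborel)
      = (\<integral>x. (a x * part_deriv 1 b (x + t *\<^sub>R ?e) - a x * part_deriv 1 b x) / t \<partial>lborel)"
      by (simp add: dq algebra_simps)
    also have "\<dots> = ((\<integral>x. a x * part_deriv 1 b (x + t *\<^sub>R ?e) \<partial>lborel) - (\<integral>x. a x * part_deriv 1 b x \<partial>lborel)) / t"
      using i1 i2 by simp
    also have "(\<integral>x. a x * part_deriv 1 b (x + t *\<^sub>R ?e) \<partial>lborel) = (\<integral>x. a (x + (-t) *\<^sub>R ?e) * part_deriv 1 b x \<partial>lborel)"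
    proof -
      have "(\<lambda>x. a (x + (-t) *\<^sub>R ?e) * part_deriv 1 b x) \<in> borel_measurable borel"
        by (intro borel_measurable_continuous_onI continuous_intros continuous_translate ca pb)
      from integral_translate[OF this, of "t *\<^sub>R ?e"] show ?thesis by simp
    qed
    also have "\<dots> - (\<integral>x. a x * part_deriv 1 b x \<partial>lborel) = (\<integral>x. a (x + (-t) *\<^sub>R ?e) * part_deriv 1 b x - a x * part_deriv 1 b x \<partial>lborel)"
      using i2 i3 by simp
    also have "- (\<dots> / t) = (\<integral>x. (a (x + (-t) *\<^sub>R ?e) * part_deriv 1 b x - a x * part_deriv 1 b x) / (-t) \<partial>lborel)"
      by simp
    also have "\<dots> = (\<integral>x. part_deriv 1 b x * ((a (x + (- t) *\<^sub>R ?e) - a x) / (- t)) \<partial>lborel)"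
      by (intro Bochner_Integration.integral_cong refl) (use that in \<open>simp add: field_simps\<close>)
    finally show ?thesis .
  qed
  have "(\<lambda>n. \<integral>x. part_deriv 1 a x * ((b (x + step_seq n *\<^sub>R ?e) - b x) / step_seq n) \<partial>lborel) \<longlonglongrightarrow> (\<integral>x. part_deriv 1 a x * part_deriv 2 b x \<partial>lborel)"
    by (intro integral_diff_quot_tendsto step_seq pa b bounded_support_part_deriv s)
  moreover have "(\<lambda>n. \<integral>x. part_deriv 1 b x * ((a (x + (- step_seq n) *\<^sub>R ?e) - a x) / (- step_seq n)) \<partial>lborel) \<longlonglongrightarrow> (\<integral>x. part_deriv 1 b x * part_deriv 2 a x \<partial>lborel)"
    by (intro integral_diff_quot_tendsto' pb a s) (use step_seq tendsto_minus[OF step_seq(1)] in auto)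
  ultimately have *: "(\<integral>x. part_deriv 1 a x * part_deriv 2 b x \<partial>lborel) = (\<integral>x. part_deriv 1 b x * part_deriv 2 a x \<partial>lborel)"
    using eq[OF step_seq(2)] LIMSEQ_unique by auto
  have "integrable lborel (\<lambda>x. part_deriv 1 a x * part_deriv 2 b x)" "integrable lborel (\<lambda>x. part_deriv 1 b x * part_deriv 2 a x)"
    by (intro integrable_continuous_bounded_support continuous_intros pa pb bounded_support_mult1 bounded_support_mult2 bounded_support_part_deriv s)+
  with * show ?thesis unfolding wedge_def by (simp add: mult.commute)
qed

lemma wedge_by_parts:
  assumes t: "C_k 1 \<theta>" and u: "C_k 1 u" and v: "C_k 1 v" and s: "bounded {x. \<theta> x \<noteq> 0}"
  shows "(\<integral>x. \<theta> x * wedge u v x \<partial>lborel) = - (\<integral>x. u x * wedge \<theta> v x \<partial>lborel)"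
proof -
  have "(\<integral>x. wedge (\<lambda>x. \<theta> x * u x) v x \<partial>lborel) = 0"
    by (intro integral_wedge_eq_0 C_k_mult t u v bounded_support_mult1 s)
  moreover have "wedge (\<lambda>x. \<theta> x * u x) v x = \<theta> x * wedge u v x + u x * wedge \<theta> v x" for x
    using t u by (intro wedge_mult_left) auto
  moreover have "integrable lborel (\<lambda>x. \<theta> x * wedge u v x)" "integrable lborel (\<lambda>x. u x * wedge \<theta> v x)"
    by (intro integrable_continuous_bounded_support continuous_intros C_k_continuous[OF t] C_k_continuous[OF u]
      wedge_continuous t u v bounded_support_mult1 bounded_support_mult2 bounded_support_wedge s)+
  ultimately show ?thesis by simp
qed

section \<open>Mollification\<close>

text \<open>The functions exp(-1/t) / t^n, extended by 0, are closed under differentiation up to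
  linear combinations. Smoothness of \<open>bump\<close> then follows by an induction that treats
  all \<open>n\<close> at once.\<close>

definition exp_recip :: "nat \<Rightarrow> real \<Rightarrow> real" where
  "exp_recip n t = (if t > 0 then exp (- 1 / t) / t ^ n else 0)"

lemma exp_ge_power_over_fact: "(t::real) \<ge> 0 \<Longrightarrow> t ^ n / fact n \<le> exp t"
proof -
  assume t: "t \<ge> 0"
  have s: "(\<lambda>n. t ^ n /\<^sub>R fact n) sums exp t" by (rule exp_converges)
  have "(\<Sum>k\<in>{n}. t ^ k /\<^sub>R fact k) \<le> (\<Sum>k. t ^ k /\<^sub>R fact k)"
    using t s by (intro sum_le_suminf) (auto simp: sums_iff)
  then show ?thesis using s by (simp add: sums_iff divide_inverse mult.commute)
qed

text \<open>A single term of the exponential series at 1/t, the one of order n + 2, bounds the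
  exponential from below. The surplus factor t^2 makes the derivative at 0 vanish.\<close>

lemma exp_recip_bound: "\<bar>exp_recip n t\<bar> \<le> fact (n+2) * t\<^sup>2"
proof (cases "t > 0")
  case True
  define F :: real where "F = fact (n+2)"
  have "(1/t) ^ (n+2) / F \<le> exp (1/t)"
    unfolding F_def using True by (intro exp_ge_power_over_fact) auto
  moreover have "F > 0" "t ^ (n+2) > 0" using True by (simp_all add: F_def del: fact_Suc)
  ultimately have "1 \<le> exp (1/t) * (F * t ^ (n+2))"
    unfolding power_one_over by (simp add: field_simps del: power_Suc)
  then have "exp (- (1/t)) \<le> F * t ^ (n+2)"
    by (simp add: exp_minus field_simps)
  then have "\<bar>exp_recip n t\<bar> \<le> F * t\<^sup>2" using True
    by (simp add: exp_recip_def divide_le_eq power2_eq_square field_simps)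
  then show ?thesis by (simp add: F_def del: fact_Suc)
qed (auto simp: exp_recip_def)

lemma exp_recip_deriv:
  "(exp_recip n has_real_derivative exp_recip (n+2) t - real n * exp_recip (n+1) t) (at t)"
proof -
  consider "t > 0" | "t < 0" | "t = 0" by linarith
  then show ?thesis
  proof cases
    case 1
    have "((\<lambda>t. exp (- 1 / t) / t ^ n) has_real_derivative exp_recip (n+2) t - real n * exp_recip (n+1) t) (at t)"
    proof (cases n)
      case 0
      with 1 show ?thesis
        by (auto intro!: derivative_eq_intros simp: exp_recip_def power2_eq_square)
    next
      case (Suc m)
      have [simp]: "t ^ m = t * t ^ (m - Suc 0)" if "m > 0"
        using that by (cases m) auto
      show ?thesis using 1 Suc
        by (cases "m = 0") (auto intro!: derivative_eq_intros simp: exp_recip_def field_simps power2_eq_square)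
    qed
    then show ?thesis
      by (rule has_field_derivative_transform_within_open[where S="{0<..}"]) (use 1 in \<open>auto simp: exp_recip_def\<close>)
  next
    case 2
    have "((\<lambda>t. 0) has_real_derivative exp_recip (n+2) t - real n * exp_recip (n+1) t) (at t)"
      using 2 by (simp add: exp_recip_def)
    then show ?thesis
      by (rule has_field_derivative_transform_within_open[where S="{..<0}"]) (use 2 in \<open>auto simp: exp_recip_def\<close>)
  next
    case 3
    have "((\<lambda>h. exp_recip n h / h) \<longlongrightarrow> 0) (at 0)"
    proof (rule Lim_null_comparison)
      show "\<forall>\<^sub>F h in at 0. norm (exp_recip n h / h) \<le> fact (n+2) * \<bar>h\<bar>"
        unfolding eventually_at_filter
      proof (rule always_eventually, intro allI impI)
        fix h :: real assume "h \<noteq> 0"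
        then have "\<bar>exp_recip n h\<bar> / \<bar>h\<bar> \<le> fact (n+2) * h\<^sup>2 / \<bar>h\<bar>"
          by (intro divide_right_mono exp_recip_bound) auto
        also have "\<dots> = fact (n+2) * \<bar>h\<bar>" using \<open>h \<noteq> 0\<close>
          by (metis abs_mult_self_eq divide_eq_eq mult.assoc power2_abs power2_eq_square abs_eq_0)
        finally show "norm (exp_recip n h / h) \<le> fact (n+2) * \<bar>h\<bar>" by simp
      qed
      show "((\<lambda>h. fact (n+2) * \<bar>h\<bar>) \<longlongrightarrow> (0::real)) (at 0)"
        by (auto intro!: tendsto_eq_intros)
    qed
    then show ?thesis using 3 by (simp add: has_field_derivative_iff exp_recip_def)
  qed
qed

lemma exp_recip_continuous: "continuous_on UNIV (exp_recip n)"
  using exp_recip_deriv DERIV_isCont continuous_at_imp_continuous_on by blast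

definition smooth :: "(real^2 \<Rightarrow> real) \<Rightarrow> bool" where "smooth u \<longleftrightarrow> (\<forall>k. C_k k u)"

lemma smooth_C1: "smooth u \<Longrightarrow> C_k 1 u"
  unfolding smooth_def by blast

lemma norm_sq_vec2: "(norm (x::real^2))\<^sup>2 = x$1 * x$1 + x$2 * x$2"
  by (simp add: norm_vec_def L2_set_def sum_2 power2_eq_square)

lemma C_k_exp_recip: "C_k k (\<lambda>x. exp_recip n (1 - (norm x)\<^sup>2))"
proof (induction k arbitrary: n)
  case 0
  have "continuous_on UNIV (\<lambda>x::real^2. exp_recip n (1 - (norm x)\<^sup>2))"
    by (intro continuous_on_compose2[OF exp_recip_continuous] continuous_intros) auto
  then show ?case by simp
next
  case (Suc k)
  let ?u = "\<lambda>x::real^2. 1 - (x$1 * x$1 + x$2 * x$2)"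
  have u: "C_k m ?u" for m by (intro C_k_diff C_k_add C_k_const C_k_mult C_k_nth)
  have du: "part_deriv i ?u x = - 2 * x $ i" for i x
  proof -
    have "(?u has_derivative (\<lambda>h. 0 - ((x$1 * h$1 + h$1 * x$1) + (x$2 * h$2 + h$2 * x$2)))) (at x)"
      by (intro has_derivative_diff has_derivative_add has_derivative_mult has_derivative_const
          bounded_linear_imp_has_derivative bounded_linear_vec_nth)
    from part_derivI[OF this, of i] show ?thesis
      using exhaust_2[of i] by (auto simp: axis_def)
  qed
  let ?r = "\<lambda>t. exp_recip (n+2) t - real n * exp_recip (n+1) t"
  have r': "continuous_on UNIV ?r" by (intro continuous_intros exp_recip_continuous)
  have 1: "C_k 1 (\<lambda>x. exp_recip n (?u x))"
    by (rule C1_compose_real[OF u exp_recip_deriv r'])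
  have 2: "part_deriv i (\<lambda>x. exp_recip n (?u x)) = (\<lambda>x. ?r (?u x) * (- 2 * x $ i))" for i
    using C1_compose_real(2)[OF u exp_recip_deriv r'] du by auto
  have "C_k k (\<lambda>x. ?r (?u x) * (- 2 * x $ i))" for i
    using Suc by (intro C_k_mult C_k_diff C_k_const C_k_nth) (simp_all add: norm_sq_vec2)
  then show ?case using 1 by (simp add: norm_sq_vec2 2)
qed

lemma bump_eq: "bump x = exp_recip 0 (1 - (norm x)\<^sup>2)"
proof -
  have "norm x < 1 \<longleftrightarrow> 0 < 1 - (norm x)\<^sup>2"
    using abs_square_less_1[of "norm x"] by simp
  then show ?thesis by (simp add: bump_def exp_recip_def)
qed

lemma smooth_bump: "smooth bump"
  unfolding smooth_def using C_k_exp_recip[of _ 0] by (simp add: bump_eq[abs_def])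

lemma bump_nonneg: "bump x \<ge> 0" and bump_pos_iff: "bump x > 0 \<longleftrightarrow> norm x < 1"
  and bump_eq_0: "norm x \<ge> 1 \<Longrightarrow> bump x = 0"
  by (simp_all add: bump_def)

lemma bump_continuous: "continuous_on UNIV bump"
  using smooth_bump C_k_continuous smooth_def by blast

lemma bump_integrable: "integrable lborel bump"
  by (rule integrable_continuous_bounded_support[OF bump_continuous])
     (rule bounded_subset[of "ball 0 1"], auto simp: bump_def split: if_splits)

lemma integral_bump: "integral\<^sup>L lebesgue bump = integral\<^sup>L lborel bump"
  by (rule integral_completion) (use bump_continuous borel_measurable_continuous_onI in auto)

lemma nonneg_continuous_integral_pos:
  fixes u :: "'a::euclidean_space \<Rightarrow> real"
  assumes "continuous_on UNIV u" "integrable lborel u" "\<And>x. u x \<ge> 0" "u a > 0"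
  shows "integral\<^sup>L lborel u > 0"
proof (rule ccontr)
  assume "\<not> integral\<^sup>L lborel u > 0"
  moreover have "integral\<^sup>L lborel u \<ge> 0" using assms(3) by (intro integral_nonneg_AE) auto
  ultimately have "integral\<^sup>L lborel u = 0" by simp
  then have "AE x in lborel. u x = 0"
    using integral_nonneg_eq_0_iff_AE[OF assms(2)] assms(3) by auto
  then have "AE x in lebesgue. u x = 0" by (rule AE_completion)
  then have "negligible {x. u x \<noteq> 0}"
    by (simp add: completion.AE_iff_null_sets negligible_iff_null_sets)
  moreover have "open {x. u x \<noteq> 0}"
    using assms(1) by (intro open_Collect_neq) auto
  moreover have "a \<in> {x. u x \<noteq> 0}" using assms(4) by auto
  ultimately show False using open_not_negligible by blast
qed

lemma bump_integral_pos: "integral\<^sup>L lborel bump > 0"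
  by (rule nonneg_continuous_integral_pos[where a=0])
     (auto simp: bump_continuous bump_integrable bump_nonneg bump_pos_iff)

lemma smooth_mollifier: "smooth (mollifier \<epsilon>)"
proof -
  have "C_k k (\<lambda>x. inverse (\<epsilon>\<^sup>2 * integral\<^sup>L lebesgue bump) * bump (inverse \<epsilon> *\<^sub>R x + 0))" for k
    using smooth_bump unfolding smooth_def by (intro C_k_cmult C_k_affine) auto
  then show ?thesis
    unfolding smooth_def mollifier_def[abs_def] by (simp add: divide_inverse mult.commute)
qed

lemma mollifier_continuous: "continuous_on UNIV (mollifier \<epsilon>)"
  using smooth_mollifier C_k_continuous smooth_def by blast

lemma mollifier_nonneg: "mollifier \<epsilon> x \<ge> 0"
  unfolding mollifier_def integral_bump using bump_nonneg bump_integral_pos by simp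

lemma mollifier_eq_0: "\<epsilon> > 0 \<Longrightarrow> norm x \<ge> \<epsilon> \<Longrightarrow> mollifier \<epsilon> x = 0"
  unfolding mollifier_def by (simp add: bump_eq_0 field_simps)

lemma mollifier_minus: "mollifier \<epsilon> (- x) = mollifier \<epsilon> x"
  by (simp add: mollifier_def bump_def)

lemma mollifier_bounded_support: "\<epsilon> > 0 \<Longrightarrow> bounded {x. mollifier \<epsilon> x \<noteq> 0}"
  by (rule bounded_subset[of "ball 0 \<epsilon>"]) (use mollifier_eq_0 in \<open>force+\<close>)

lemma mollifier_integral: "\<epsilon> > 0 \<Longrightarrow> integral\<^sup>L lborel (mollifier \<epsilon>) = 1"
proof -
  assume e: "\<epsilon> > 0"
  have [measurable]: "bump \<in> borel_measurable borel" using bump_continuous borel_measurable_continuous_onI by auto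
  have "integral\<^sup>L lborel (\<lambda>x. bump (x /\<^sub>R \<epsilon>)) = integral\<^sup>L (density (distr lborel borel (\<lambda>x. 0 + \<epsilon> *\<^sub>R x)) (\<lambda>_. \<bar>\<epsilon>\<bar>^DIM(real^2))) (\<lambda>x. bump (x /\<^sub>R \<epsilon>))"
    using lborel_affine[of \<epsilon> "0::real^2"] e by simp
  also have "\<dots> = integral\<^sup>L (distr lborel borel (\<lambda>x. 0 + \<epsilon> *\<^sub>R x)) (\<lambda>x. \<bar>\<epsilon>\<bar>^DIM(real^2) *\<^sub>R bump (x /\<^sub>R \<epsilon>))"
    using e by (subst integral_density) (auto simp: ennreal_power)
  also have "\<dots> = \<epsilon>\<^sup>2 * integral\<^sup>L lborel bump"
    using e by (subst integral_distr) auto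
  finally have "integral\<^sup>L lborel (\<lambda>x. bump (x /\<^sub>R \<epsilon>)) = \<epsilon>\<^sup>2 * integral\<^sup>L lborel bump" .
  then show ?thesis
    using e bump_integral_pos unfolding mollifier_def[abs_def] integral_bump by simp
qed

lemma bounded_support_reflect:
  fixes u :: "'a::real_normed_vector \<Rightarrow> real"
  assumes "bounded {x. u x \<noteq> 0}"
  shows "bounded {y. u (x - y) \<noteq> 0}"
proof -
  have "{y. u (x - y) \<noteq> 0} = (\<lambda>z. x - z) ` {z. u z \<noteq> 0}"
    by (force simp: image_iff algebra_simps)
  moreover have "bounded ((\<lambda>z. x - z) ` {z. u z \<noteq> 0})"
    using bounded_minus_comp[of "\<lambda>_. x" _ "\<lambda>z. z"] assms by (simp add: image_constant_conv)
  ultimately show ?thesis by simp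
qed

lemma continuous_reflect:
  fixes u :: "'a::real_normed_vector \<Rightarrow> real"
  assumes "continuous_on UNIV u"
  shows "continuous_on UNIV (\<lambda>y. u (x - y))"
  by (intro continuous_on_compose2[OF assms] continuous_intros) auto

lemma mollifier_reflect_integral:
  assumes "\<epsilon> > 0"
  shows "(\<integral>y. mollifier \<epsilon> (x - y) \<partial>lborel) = 1" "integrable lborel (\<lambda>y. mollifier \<epsilon> (x - y))"
proof -
  have *: "mollifier \<epsilon> (x - y) = mollifier \<epsilon> (y + (- x))" for y
    using mollifier_minus[of \<epsilon> "x - y"] by (simp add: algebra_simps)
  have "(\<integral>y. mollifier \<epsilon> (y + (- x)) \<partial>lborel) = integral\<^sup>L lborel (mollifier \<epsilon>)"
    by (rule integral_translate) (intro borel_measurable_continuous_onI mollifier_continuous)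
  then show "(\<integral>y. mollifier \<epsilon> (x - y) \<partial>lborel) = 1" using * mollifier_integral[OF assms] by simp
  show "integrable lborel (\<lambda>y. mollifier \<epsilon> (x - y))"
    by (intro integrable_continuous_bounded_support continuous_reflect mollifier_continuous
        bounded_support_reflect mollifier_bounded_support assms)
qed

section \<open>Uniform estimates and convolution with a measure\<close>

lemma uniformly_continuous_bounded_support:
  fixes u :: "'a::euclidean_space \<Rightarrow> real"
  assumes "continuous_on UNIV u" "bounded {x. u x \<noteq> 0}"
  shows "uniformly_continuous_on UNIV u"
  unfolding uniformly_continuous_on_def
proof (intro allI impI)
  fix e :: real assume e: "e > 0"
  obtain R where R: "{x. u x \<noteq> 0} \<subseteq> ball 0 R"
    using bounded_subset_ballD[OF assms(2), of 0] by blast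
  have "uniformly_continuous_on (cball 0 (R+1)) u"
    by (intro compact_uniformly_continuous continuous_on_subset[OF assms(1)]) auto
  then obtain d where d: "d > 0" "\<And>x y. x \<in> cball 0 (R+1) \<Longrightarrow> y \<in> cball 0 (R+1) \<Longrightarrow> dist y x < d \<Longrightarrow> dist (u y) (u x) < e"
    unfolding uniformly_continuous_on_def using e by metis
  show "\<exists>d>0. \<forall>x\<in>UNIV. \<forall>x'\<in>UNIV. dist x' x < d \<longrightarrow> dist (u x') (u x) < e"
  proof (intro exI[of _ "min d 1"] conjI ballI impI)
    fix x y :: 'a assume xy: "dist y x < min d 1"
    show "dist (u y) (u x) < e"
    proof (cases "norm x \<le> R + 1 \<and> norm y \<le> R + 1")
      case True then show ?thesis using d xy by auto
    next
      case False
      have "norm x \<le> norm y + dist y x" "norm y \<le> norm x + dist y x"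
        using norm_triangle_ineq2[of x y] norm_triangle_ineq2[of y x] by (auto simp: dist_norm norm_minus_commute)
      then have "norm x \<ge> R" "norm y \<ge> R" using False xy by auto
      then have "u x = 0" "u y = 0" using R by force+
      then show ?thesis using e by simp
    qed
  qed (use d in auto)
qed

lemma uniformly_continuous_bounded_supportE:
  fixes u :: "'a::euclidean_space \<Rightarrow> real"
  assumes "continuous_on UNIV u" "bounded {x. u x \<noteq> 0}" "e > 0"
  obtains d where "d > 0" "\<And>x y. norm (y - x) < d \<Longrightarrow> \<bar>u y - u x\<bar> < e"
  using uniformly_continuous_bounded_support[OF assms(1,2)] assms(3)
  unfolding uniformly_continuous_on_def dist_norm real_norm_def by (metis UNIV_I)

lemma bounded_supportE:
  fixes u :: "'a::euclidean_space \<Rightarrow> real"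
  assumes "continuous_on UNIV u" "bounded {x. u x \<noteq> 0}"
  obtains M where "M > 0" "\<And>x. \<bar>u x\<bar> \<le> M"
proof -
  have "compact (u ` closure {x. u x \<noteq> 0})"
    by (intro compact_continuous_image continuous_on_subset[OF assms(1)]) (use assms(2) in auto)
  then have "bounded (u ` closure {x. u x \<noteq> 0})" by (rule compact_imp_bounded)
  then obtain M where M: "M > 0" "\<forall>y\<in>u ` closure {x. u x \<noteq> 0}. norm y \<le> M"
    unfolding bounded_pos by blast
  have "\<bar>u x\<bar> \<le> M" for x
    using M closure_subset[of "{x. u x \<noteq> 0}"] by (cases "u x = 0") auto
  then show thesis using that M by blast
qed

text \<open>The mean value inequality applied to \<open>u\<close> minus its linearization at
  \<open>x\<close>. The point is that \<open>d\<close> does not depend on \<open>x\<close>: this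
  permits differentiation under an integral with respect to an arbitrary measure.\<close>

lemma C1_uniform_derivative:
  assumes u: "C_k 1 u" and s: "bounded {x. u x \<noteq> 0}" and e: "e > 0"
  obtains d where "d > 0" "\<And>x h. norm h < d \<Longrightarrow>
    \<bar>u (x + h) - u x - (part_deriv 1 u x * h$1 + part_deriv 2 u x * h$2)\<bar> \<le> e * norm h"
proof -
  have "\<exists>d>0. \<forall>x y. norm (y - x) < d \<longrightarrow> \<bar>part_deriv i u y - part_deriv i u x\<bar> < e / 2" for i
  proof -
    have "e / 2 > 0" using e by simp
    from uniformly_continuous_bounded_supportE[OF C1_pd_continuous[OF u, of i] bounded_support_part_deriv[OF s, of i] this]
    show ?thesis by metis
  qed
  then obtain d where d: "\<And>i. d i > 0" "\<And>i x y. norm (y - x) < d i \<Longrightarrow> \<bar>part_deriv i u y - part_deriv i u x\<bar> < e / 2"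
    by metis
  define \<delta> where "\<delta> = min (d 1) (d 2)"
  have "\<bar>u (x + h) - u x - (part_deriv 1 u x * h$1 + part_deriv 2 u x * h$2)\<bar> \<le> e * norm h" if h: "norm h < \<delta>" for x h
  proof -
    define w where "w y = u y - (part_deriv 1 u x * y$1 + part_deriv 2 u x * y$2)" for y
    have "norm (w (x + h) - w x) \<le> e * norm ((x + h) - x)"
    proof (rule differentiable_bound[where S="ball x \<delta>" and f'="\<lambda>y k. (part_deriv 1 u y * k$1 + part_deriv 2 u y * k$2) - (part_deriv 1 u x * k$1 + part_deriv 2 u x * k$2)"])
      show "(w has_derivative (\<lambda>k. (part_deriv 1 u y * k$1 + part_deriv 2 u y * k$2) - (part_deriv 1 u x * k$1 + part_deriv 2 u x * k$2))) (at y within ball x \<delta>)" for y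
        unfolding w_def
        by (rule has_derivative_at_withinI, intro has_derivative_diff C1_has_derivative u has_derivative_add
            has_derivative_mult_right bounded_linear_imp_has_derivative bounded_linear_vec_nth)
      show "onorm (\<lambda>k::real^2. (part_deriv 1 u y * k$1 + part_deriv 2 u y * k$2) - (part_deriv 1 u x * k$1 + part_deriv 2 u x * k$2)) \<le> e"
        if "y \<in> ball x \<delta>" for y
      proof (rule onorm_le)
        fix k :: "real^2"
        have y: "norm (y - x) < d 1" "norm (y - x) < d 2" using that by (auto simp: \<delta>_def dist_norm norm_minus_commute)
        have "norm ((part_deriv 1 u y * k$1 + part_deriv 2 u y * k$2) - (part_deriv 1 u x * k$1 + part_deriv 2 u x * k$2))
          = \<bar>(part_deriv 1 u y - part_deriv 1 u x) * k$1 + (part_deriv 2 u y - part_deriv 2 u x) * k$2\<bar>"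
          by (simp add: algebra_simps)
        also have "\<dots> \<le> \<bar>part_deriv 1 u y - part_deriv 1 u x\<bar> * \<bar>k$1\<bar> + \<bar>part_deriv 2 u y - part_deriv 2 u x\<bar> * \<bar>k$2\<bar>"
          by (metis abs_mult abs_triangle_ineq)
        also have "\<dots> \<le> e/2 * norm k + e/2 * norm k"
          using d(2)[OF y(1)] d(2)[OF y(2)] component_le_norm_cart[of k 1] component_le_norm_cart[of k 2] e
          by (intro add_mono mult_mono) auto
        finally show "norm ((part_deriv 1 u y * k$1 + part_deriv 2 u y * k$2) - (part_deriv 1 u x * k$1 + part_deriv 2 u x * k$2)) \<le> e * norm k"
          by simp
      qed
    qed (use h d(1) in \<open>auto simp: \<delta>_def dist_norm\<close>)
    then show ?thesis by (simp add: w_def algebra_simps)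
  qed
  moreover have "\<delta> > 0" using d(1) by (simp add: \<delta>_def)
  ultimately show thesis using that by blast
qed

text \<open>Convolution of \<open>\<rho>\<close> with the signed measure of density \<open>w\<close>
  with respect to \<open>M\<close>. With \<open>M = lborel\<close> it mollifies a function, with
  \<open>w = 1\<close> it mollifies a measure; both uses meet in
  \<open>moll_part_deriv\<close>.\<close>

definition conv :: "(real^2) measure \<Rightarrow> (real^2 \<Rightarrow> real) \<Rightarrow> (real^2 \<Rightarrow> real) \<Rightarrow> real^2 \<Rightarrow> real" where
  "conv M \<rho> w x = (\<integral>y. \<rho> (x - y) * w y \<partial>M)"

lemma conv_integrable:
  fixes \<rho> w :: "real^2 \<Rightarrow> real"
  assumes "sets M = sets borel" "integrable M w" "continuous_on UNIV \<rho>" "bounded {x. \<rho> x \<noteq> 0}"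
  shows "integrable M (\<lambda>y. \<rho> (x - y) * w y)"
proof -
  obtain C where C: "\<And>x. \<bar>\<rho> x\<bar> \<le> C" using bounded_supportE[OF assms(3,4)] by blast
  have [measurable]: "(\<lambda>y. \<rho> (x - y)) \<in> borel_measurable M"
    using borel_measurable_continuous_onI[OF continuous_reflect[OF assms(3)]] assms(1) measurable_cong_sets by blast
  have [measurable]: "w \<in> borel_measurable M" using assms(2) by auto
  show ?thesis
    by (rule Bochner_Integration.integrable_bound[where f="\<lambda>y. C * \<bar>w y\<bar>"])
       (use assms(2) C in \<open>auto simp: abs_mult intro!: mult_right_mono AE_I2 order_trans[OF C abs_ge_self]\<close>)
qed

lemma conv_continuous:
  assumes "sets M = sets borel" "integrable M w" "continuous_on UNIV \<rho>" "bounded {x. \<rho> x \<noteq> 0}"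
  shows "continuous_on UNIV (conv M \<rho> w)"
  unfolding continuous_on_iff
proof (intro ballI allI impI)
  fix x :: "real^2" and e :: real assume e: "e > 0"
  \<comment> \<open>Thresholds are divided by \<open>W + 1\<close> rather than \<open>W\<close>,
    which covers a function \<open>w\<close> that vanishes almost everywhere.\<close>
  define W where "W = (\<integral>y. \<bar>w y\<bar> \<partial>M)"
  have W: "W \<ge> 0" unfolding W_def by simp
  obtain d where d: "d > 0" "\<And>x y. norm (y - x) < d \<Longrightarrow> \<bar>\<rho> y - \<rho> x\<bar> < e / (W + 1)"
    using uniformly_continuous_bounded_supportE[OF assms(3,4), of "e/(W+1)"] e W by auto
  show "\<exists>d>0. \<forall>x'\<in>UNIV. dist x' x < d \<longrightarrow> dist (conv M \<rho> w x') (conv M \<rho> w x) < e"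
  proof (intro exI[of _ d] conjI ballI impI d(1))
    fix x' assume x': "dist x' x < d"
    have "conv M \<rho> w x' - conv M \<rho> w x = (\<integral>y. \<rho> (x' - y) * w y - \<rho> (x - y) * w y \<partial>M)"
      unfolding conv_def by (intro Bochner_Integration.integral_diff[symmetric] conv_integrable assms)
    also have "\<bar>\<dots>\<bar> \<le> (\<integral>y. \<bar>\<rho> (x' - y) * w y - \<rho> (x - y) * w y\<bar> \<partial>M)"
      by (rule integral_abs_bound)
    also have "\<dots> \<le> (\<integral>y. e / (W + 1) * \<bar>w y\<bar> \<partial>M)"
    proof (rule integral_mono)
      show "integrable M (\<lambda>y. \<bar>\<rho> (x' - y) * w y - \<rho> (x - y) * w y\<bar>)"
        by (intro integrable_abs Bochner_Integration.integrable_diff conv_integrable assms)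
      show "integrable M (\<lambda>y. e / (W + 1) * \<bar>w y\<bar>)" using assms(2) by auto
      show "\<bar>\<rho> (x' - y) * w y - \<rho> (x - y) * w y\<bar> \<le> e / (W + 1) * \<bar>w y\<bar>" for y
      proof -
        have "\<bar>\<rho> (x' - y) - \<rho> (x - y)\<bar> \<le> e / (W + 1)"
          using d(2)[of "x' - y" "x - y"] x' by (simp add: dist_norm)
        from mult_right_mono[OF this abs_ge_zero[of "w y"]] show ?thesis
          by (simp add: left_diff_distrib[symmetric] abs_mult)
      qed
    qed
    also have "\<dots> = e / (W + 1) * W" by (simp add: W_def)
    also have "\<dots> < e" using e W by (simp add: field_simps)
    finally show "dist (conv M \<rho> w x') (conv M \<rho> w x) < e" by (simp add: dist_real_def)
  qed
qed

lemma conv_C1: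
  assumes M: "sets M = sets borel" "integrable M w" and r: "C_k 1 \<rho>" "bounded {x. \<rho> x \<noteq> 0}"
  shows "C_k 1 (conv M \<rho> w)" "part_deriv i (conv M \<rho> w) = conv M (part_deriv i \<rho>) w"
proof -
  define W where "W = (\<integral>y. \<bar>w y\<bar> \<partial>M)"
  have W: "W \<ge> 0" unfolding W_def by simp
  have c\<rho>: "continuous_on UNIV \<rho>" by (rule C_k_continuous[OF r(1)])
  have cd: "continuous_on UNIV (part_deriv i \<rho>)" "bounded {x. part_deriv i \<rho> x \<noteq> 0}" for i
    using C1_pd_continuous[OF r(1)] bounded_support_part_deriv[OF r(2)] by auto
  have i1: "integrable M (\<lambda>z. \<rho> (a - z) * w z)" for a by (rule conv_integrable[OF M c\<rho> r(2)])
  have i2: "integrable M (\<lambda>z. part_deriv i \<rho> (a - z) * w z)" for a i by (rule conv_integrable[OF M cd])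
  have der: "(conv M \<rho> w has_derivative (\<lambda>h. conv M (part_deriv 1 \<rho>) w x * h$1 + conv M (part_deriv 2 \<rho>) w x * h$2)) (at x)" for x
    unfolding has_derivative_at_alt
  proof (intro conjI allI impI)
    show "bounded_linear (\<lambda>h. conv M (part_deriv 1 \<rho>) w x * h$1 + conv M (part_deriv 2 \<rho>) w x * h$2)"
      by (intro bounded_linear_add bounded_linear_mult_right[THEN bounded_linear_compose] bounded_linear_vec_nth)
    fix e :: real assume e: "e > 0"
    obtain d where d: "d > 0" "\<And>x h. norm h < d \<Longrightarrow>
      \<bar>\<rho> (x + h) - \<rho> x - (part_deriv 1 \<rho> x * h$1 + part_deriv 2 \<rho> x * h$2)\<bar> \<le> e / (W+1) * norm h"
      using C1_uniform_derivative[OF r, of "e/(W+1)"] e W by auto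
    show "\<exists>d>0. \<forall>y. norm (y - x) < d \<longrightarrow> norm (conv M \<rho> w y - conv M \<rho> w x - (conv M (part_deriv 1 \<rho>) w x * (y - x)$1 + conv M (part_deriv 2 \<rho>) w x * (y - x)$2)) \<le> e * norm (y - x)"
    proof (intro exI[of _ d] conjI allI impI d(1))
      fix y assume y: "norm (y - x) < d"
      define h where "h = y - x"
      let ?I = "\<lambda>z. (\<rho> (y - z) - \<rho> (x - z) - (part_deriv 1 \<rho> (x - z) * h$1 + part_deriv 2 \<rho> (x - z) * h$2)) * w z"
      have I: "?I z = \<rho> (y - z) * w z - \<rho> (x - z) * w z - ((part_deriv 1 \<rho> (x - z) * w z) * h$1 + (part_deriv 2 \<rho> (x - z) * w z) * h$2)" for z
        by (simp add: algebra_simps)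
      have iI: "integrable M ?I" unfolding I
        by (intro Bochner_Integration.integrable_diff Bochner_Integration.integrable_add integrable_mult_left i1 i2)
      have eq: "conv M \<rho> w y - conv M \<rho> w x - (conv M (part_deriv 1 \<rho>) w x * h$1 + conv M (part_deriv 2 \<rho>) w x * h$2) = (\<integral>z. ?I z \<partial>M)"
        unfolding I conv_def by (simp add: i1 i2)
      have "\<bar>\<integral>z. ?I z \<partial>M\<bar> \<le> (\<integral>z. \<bar>?I z\<bar> \<partial>M)" by (rule integral_abs_bound)
      also have "\<dots> \<le> (\<integral>z. e / (W + 1) * norm h * \<bar>w z\<bar> \<partial>M)"
      proof (rule integral_mono)
        show "integrable M (\<lambda>z. \<bar>?I z\<bar>)" using iI by (rule integrable_abs)
        show "integrable M (\<lambda>z. e / (W + 1) * norm h * \<bar>w z\<bar>)" using M(2) by auto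
        show "\<bar>?I z\<bar> \<le> e / (W + 1) * norm h * \<bar>w z\<bar>" for z
          unfolding abs_mult using d(2)[of h "x - z"] y
          by (intro mult_right_mono) (auto simp: h_def algebra_simps)
      qed
      also have "\<dots> = e * norm h * (W / (W + 1))" by (simp add: W_def)
      also have "\<dots> \<le> e * norm h" using e W by (intro mult_left_le) (auto simp: field_simps)
      finally have fin: "\<bar>\<integral>z. ?I z \<partial>M\<bar> \<le> e * norm h" .
      show "norm (conv M \<rho> w y - conv M \<rho> w x - (conv M (part_deriv 1 \<rho>) w x * (y - x)$1 + conv M (part_deriv 2 \<rho>) w x * (y - x)$2)) \<le> e * norm (y - x)"
        unfolding real_norm_def h_def[symmetric] eq by (rule fin)
    qed
  qed
  have "continuous_on UNIV (conv M (part_deriv i \<rho>) w)" for i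
    by (rule conv_continuous[OF M cd])
  from C1I[of "conv M \<rho> w" "\<lambda>i. conv M (part_deriv i \<rho>) w", OF der this]
  show "C_k 1 (conv M \<rho> w)" "part_deriv i (conv M \<rho> w) = conv M (part_deriv i \<rho>) w" by auto
qed

lemma conv_C_k:
  assumes M: "sets M = sets borel" "integrable M w"
  shows "C_k k \<rho> \<Longrightarrow> bounded {x. \<rho> x \<noteq> 0} \<Longrightarrow> C_k k (conv M \<rho> w)"
proof (induction k arbitrary: \<rho>)
  case 0
  then show ?case using conv_continuous[OF M] by simp
next
  case (Suc k)
  have 1: "C_k 1 \<rho>" using Suc.prems(1) by (auto dest: C_k_continuous)
  have "C_k k (part_deriv i (conv M \<rho> w))" for i
    unfolding conv_C1(2)[OF M 1 Suc.prems(2)]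
    using Suc by (intro Suc.IH bounded_support_part_deriv) auto
  then show ?case using conv_C1(1)[OF M 1 Suc.prems(2)] by simp
qed

section \<open>Cutoff functions\<close>

lemma compact_neighborhood:
  fixes K :: "'a::euclidean_space set"
  assumes "compact K" "open \<Omega>" "K \<subseteq> \<Omega>" "K \<noteq> {}"
  obtains \<delta> where "\<delta> > 0" "compact {x. infdist x K \<le> \<delta>}" "{x. infdist x K \<le> \<delta>} \<subseteq> \<Omega>"
  using compact_in_open_separated[OF assms(4,1,2,3)] compact_infdist_le[OF assms(4,1)] by metis

lemma test_functionD:
  assumes "\<phi> \<in> test_functions \<Omega>"
  shows "smooth \<phi>" "compact (closure {x. \<phi> x \<noteq> 0})" "closure {x. \<phi> x \<noteq> 0} \<subseteq> \<Omega>"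
    "bounded {x. \<phi> x \<noteq> 0}" "C_k 1 \<phi>" "continuous_on UNIV \<phi>"
proof -
  show s: "smooth \<phi>" "compact (closure {x. \<phi> x \<noteq> 0})" "closure {x. \<phi> x \<noteq> 0} \<subseteq> \<Omega>"
    using assms by (auto simp: test_functions_def smooth_def)
  show "bounded {x. \<phi> x \<noteq> 0}"
    using s(2) compact_imp_bounded bounded_subset closure_subset by metis
  show "C_k 1 \<phi>" using s(1) by (rule smooth_C1)
  then show "continuous_on UNIV \<phi>" by (rule C_k_continuous)
qed

lemma cutoff_exists:
  assumes "compact K" "open \<Omega>" "K \<subseteq> \<Omega>"
  obtains \<theta> W where "\<theta> \<in> test_functions \<Omega>" "\<And>x. 0 \<le> \<theta> x" "\<And>x. \<theta> x \<le> 1" "open W" "K \<subseteq> W" "W \<subseteq> \<Omega>" "\<And>x. x \<in> W \<Longrightarrow> \<theta> x = 1"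
proof (cases "K = {}")
  case True
  have "(\<lambda>x. 0) \<in> test_functions \<Omega>" by (simp add: test_functions_def C_k_const)
  with True show thesis by (intro that[of "\<lambda>x. 0" "{}"]) auto
next
  case False
  obtain \<delta> where d: "\<delta> > 0" and c\<delta>: "compact {x. infdist x K \<le> \<delta>}" and sub: "{x. infdist x K \<le> \<delta>} \<subseteq> \<Omega>"
    using compact_neighborhood[OF assms False] by blast
  \<comment> \<open>The indicator of the neighbourhood of radius \<open>2 * e\<close> is mollified
    at scale \<open>e\<close>. The result is 1 within distance \<open>e\<close> of \<open>K\<close>
    and vanishes beyond \<open>3 * e\<close>, hence inside the compact neighbourhood of radius
    \<open>4 * e\<close>.\<close>
  define e where "e = \<delta> / 4"
  have e: "e > 0" using d by (simp add: e_def)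
  define K2 where "K2 = {x. infdist x K \<le> 2 * e}"
  have cK2: "compact K2" unfolding K2_def by (rule compact_infdist_le[OF False assms(1)]) (use e in simp)
  have iK2: "integrable lborel (indicator K2 :: real^2 \<Rightarrow> real)"
    using cK2 emeasure_bounded_finite[OF compact_imp_bounded[OF cK2]]
    by (intro integrable_real_indicator) (auto simp: compact_imp_closed)
  define \<theta> where "\<theta> = conv lborel (mollifier e) (indicator K2)"
  have W: "\<theta> x = 1" if "infdist x K < e" for x
  proof -
    have "mollifier e (x - y) * indicator K2 y = mollifier e (x - y)" for y
    proof (cases "norm (x - y) < e")
      case True
      then have "infdist y K \<le> 2 * e"
        using infdist_triangle[of y K x] that by (simp add: dist_norm norm_minus_commute)
      then show ?thesis by (simp add: K2_def)
    qed (simp add: mollifier_eq_0 e)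
    then show ?thesis unfolding \<theta>_def conv_def by (simp only: mollifier_reflect_integral(1)[OF e])
  qed
  have supp: "infdist x K \<le> 3 * e" if "\<theta> x \<noteq> 0" for x
  proof (rule ccontr)
    assume n: "\<not> infdist x K \<le> 3 * e"
    have "mollifier e (x - y) * indicator K2 y = 0" for y
    proof (cases "y \<in> K2")
      case True
      then have "norm (x - y) \<ge> e"
        using infdist_triangle[of x K y] n by (simp add: K2_def dist_norm)
      then show ?thesis by (simp add: mollifier_eq_0 e)
    qed simp
    then have "\<theta> x = 0" unfolding \<theta>_def conv_def by (simp only: Bochner_Integration.integral_zero)
    then show False using that by simp
  qed
  have b01: "0 \<le> \<theta> x \<and> \<theta> x \<le> 1" for x
  proof -
    have "(\<integral>y. mollifier e (x - y) * indicator K2 y \<partial>lborel) \<le> (\<integral>y. mollifier e (x - y) \<partial>lborel)"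
      by (intro integral_mono conv_integrable iK2 mollifier_continuous mollifier_bounded_support
          mollifier_reflect_integral e) (auto simp: indicator_def mollifier_nonneg)
    moreover have "0 \<le> (\<integral>y. mollifier e (x - y) * indicator K2 y \<partial>lborel)"
      by (intro integral_nonneg_AE AE_I2) (simp add: mollifier_nonneg)
    ultimately show ?thesis
      using mollifier_reflect_integral(1)[OF e, of x] by (simp add: \<theta>_def conv_def)
  qed
  have cl: "closure {x. \<theta> x \<noteq> 0} \<subseteq> {x. infdist x K \<le> \<delta>}"
    using supp d by (intro closure_minimal compact_imp_closed[OF c\<delta>]) (force simp: e_def)
  have "\<theta> \<in> test_functions \<Omega>"
    unfolding test_functions_def
  proof (intro CollectI conjI allI)
    show "C_k k \<theta>" for k unfolding \<theta>_def
      by (intro conv_C_k iK2 mollifier_bounded_support e) (use smooth_mollifier in \<open>auto simp: smooth_def\<close>)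
    show "compact (closure {x. \<theta> x \<noteq> 0})"
      using compact_Int_closed[OF c\<delta> closed_closure, of "{x. \<theta> x \<noteq> 0}"] cl by (simp add: Int_absorb1)
    show "closure {x. \<theta> x \<noteq> 0} \<subseteq> \<Omega>" using cl sub by blast
  qed
  moreover have "open {x. infdist x K < e}"
    by (intro open_Collect_less continuous_intros)
  moreover have "K \<subseteq> {x. infdist x K < e}" using e by auto
  moreover have "{x. infdist x K < e} \<subseteq> \<Omega>" using sub e by (force simp: e_def)
  ultimately show thesis using that[of \<theta> "{x. infdist x K < e}"] b01 W by blast
qed

section \<open>Uniqueness of the representing measure\<close>

lemma radon_space: "radon_measure_on \<Omega> M \<Longrightarrow> space M = \<Omega>"
  unfolding radon_measure_on_def using sets_eq_imp_space_eq[of M "restrict_space borel \<Omega>"] by (simp add: space_restrict_space)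

lemma radon_measurable:
  fixes \<phi> :: "real^2 \<Rightarrow> real"
  assumes "radon_measure_on \<Omega> M" "\<phi> \<in> borel_measurable borel"
  shows "\<phi> \<in> borel_measurable M"
  using measurable_restrict_space1[OF assms(2), of \<Omega>] assms(1)
  unfolding radon_measure_on_def by (metis measurable_cong_sets)

lemma radon_compact_sets:
  assumes "radon_measure_on \<Omega> M" "compact K" "K \<subseteq> \<Omega>"
  shows "K \<in> sets M" "emeasure M K < \<infinity>"
proof -
  have "K \<in> sets (restrict_space borel \<Omega>)"
    unfolding sets_restrict_space using assms by (intro image_eqI[of _ _ K]) (auto simp: compact_imp_closed)
  then show "K \<in> sets M" "emeasure M K < \<infinity>" using assms by (auto simp: radon_measure_on_def)
qed

text \<open>One sequence of cutoffs, supported in shrinking neighbourhoods of \<open>K\<close>,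
  serves all Radon measures at once. It can therefore be applied simultaneously to the four parts of
  two signed measures.\<close>

lemma compact_measure_limit:
  fixes K :: "(real^2) set"
  assumes K: "compact K" "K \<subseteq> \<Omega>" and \<Omega>: "open \<Omega>"
  obtains \<theta> where "\<And>n. \<theta> n \<in> test_functions \<Omega>" "\<And>n x. 0 \<le> \<theta> n x \<and> \<theta> n x \<le> 1" "\<And>n x. x \<in> K \<Longrightarrow> \<theta> n x = 1"
    "\<And>M. radon_measure_on \<Omega> M \<Longrightarrow> (\<lambda>n. integral\<^sup>L M (\<theta> n)) \<longlonglongrightarrow> measure M K"
proof (cases "K = {}")
  case True
  have "(\<lambda>x. 0) \<in> test_functions \<Omega>" by (simp add: test_functions_def C_k_const)
  with True show thesis by (intro that[of "\<lambda>n x. 0"]) auto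
next
  case False
  obtain \<delta> where d: "\<delta> > 0" and c\<delta>: "compact {x. infdist x K \<le> \<delta>}" and sub: "{x. infdist x K \<le> \<delta>} \<subseteq> \<Omega>"
    using compact_neighborhood[OF K(1) \<Omega> K(2) False] by blast
  \<comment> \<open>The minimum with \<open>\<delta>\<close> keeps all supports in one compact
    neighbourhood, whose indicator is the dominating function.\<close>
  let ?V = "\<lambda>n. {x. infdist x K < min \<delta> (step_seq n)}"
  have "\<exists>\<theta>. \<theta> \<in> test_functions (?V n) \<and> (\<forall>x. 0 \<le> \<theta> x \<and> \<theta> x \<le> 1) \<and> (\<forall>x\<in>K. \<theta> x = 1)" for n
  proof -
    have "open (?V n)" by (intro open_Collect_less continuous_intros)
    moreover have "K \<subseteq> ?V n" using d step_seq(4)[of n] by auto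
    ultimately show ?thesis using cutoff_exists[OF K(1), of "?V n"] by (metis subsetD)
  qed
  then obtain \<theta> where \<theta>: "\<And>n. \<theta> n \<in> test_functions (?V n)" "\<And>n x. 0 \<le> \<theta> n x" "\<And>n x. \<theta> n x \<le> 1" "\<And>n x. x \<in> K \<Longrightarrow> \<theta> n x = 1"
    by metis
  have V: "?V n \<subseteq> \<Omega>" for n using sub by force
  have tf: "\<theta> n \<in> test_functions \<Omega>" for n
    using \<theta>(1)[of n] V[of n] unfolding test_functions_def by blast
  have out: "\<theta> n x = 0" if "x \<notin> ?V n" for n x
    using subsetD[OF test_functionD(3)[OF \<theta>(1)[of n]], of x] that closure_subset[of "{x. \<theta> n x \<noteq> 0}"] by auto
  show thesis
  proof (rule that[of \<theta>])
    show "\<theta> n \<in> test_functions \<Omega>" "0 \<le> \<theta> n x \<and> \<theta> n x \<le> 1" "x \<in> K \<Longrightarrow> \<theta> n x = 1" for n x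
      using tf \<theta>(2-4) by auto
    fix M assume M: "radon_measure_on \<Omega> M"
    have "(\<lambda>n. integral\<^sup>L M (\<theta> n)) \<longlonglongrightarrow> integral\<^sup>L M (indicator K)"
    proof (rule integral_dominated_convergence[where w="indicator {x. infdist x K \<le> \<delta>}"])
      show "indicator K \<in> borel_measurable M"
        using radon_compact_sets(1)[OF M K] by (rule borel_measurable_indicator)
      show "\<theta> n \<in> borel_measurable M" for n
        by (rule radon_measurable[OF M borel_measurable_continuous_onI[OF test_functionD(6)[OF tf]]])
      show "integrable M (indicator {x. infdist x K \<le> \<delta>} :: real^2 \<Rightarrow> real)"
        using radon_compact_sets[OF M c\<delta> sub] by (intro integrable_real_indicator) auto
      show "AE x in M. (\<lambda>n. \<theta> n x) \<longlonglongrightarrow> indicator K x"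
      proof (intro AE_I2)
        fix x show "(\<lambda>n. \<theta> n x) \<longlonglongrightarrow> indicator K x"
        proof (cases "x \<in> K")
          case True then show ?thesis by (simp add: \<theta>(4))
        next
          case False
          have "infdist x K > 0"
            using False \<open>K \<noteq> {}\<close> K(1) by (metis compact_imp_closed in_closed_iff_infdist_zero infdist_nonneg less_eq_real_def)
          then have "eventually (\<lambda>n. step_seq n < infdist x K) sequentially"
            by (rule order_tendstoD(2)[OF step_seq(1)])
          then have "eventually (\<lambda>n. \<theta> n x = indicator K x) sequentially"
          proof eventually_elim
            case (elim n)
            then have "x \<notin> ?V n" by auto
            then show ?case using out False by simp
          qed
          then show ?thesis by (rule tendsto_eventually)
        qed
      qed
      show "AE x in M. norm (\<theta> n x) \<le> indicator {x. infdist x K \<le> \<delta>} x" for n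
      proof (intro AE_I2)
        fix x show "norm (\<theta> n x) \<le> indicator {x. infdist x K \<le> \<delta>} x"
          using out[of x n] \<theta>(2,3)[of n x] by (cases "infdist x K \<le> \<delta>") (auto simp: abs_if)
      qed
    qed
    moreover have "integral\<^sup>L M (indicator K) = measure M K"
      using radon_compact_sets[OF M K] by simp
    ultimately show "(\<lambda>n. integral\<^sup>L M (\<theta> n)) \<longlonglongrightarrow> measure M K" by simp
  qed
qed

text \<open>An open set is a countable union of compact sets, so its relatively closed subsets are
  countable unions of compact ones. The compact subsets are thus a generator stable under
  intersection.\<close>

lemma sets_restrict_borel_compact:
  assumes "open (\<Omega> :: (real^2) set)"
  shows "sets (restrict_space borel \<Omega>) = sigma_sets \<Omega> {K. compact K \<and> K \<subseteq> \<Omega>}" (is "_ = sigma_sets \<Omega> ?E")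
proof
  show "sets (restrict_space borel \<Omega>) \<subseteq> sigma_sets \<Omega> ?E"
  proof -
    obtain C :: "nat \<Rightarrow> (real^2) set" where C: "\<And>n. compact (C n)" "\<And>n. C n \<subseteq> \<Omega>" "\<Union> (range C) = \<Omega>"
      using open_Union_compact_subsets[OF assms] by metis
    have "sets (borel :: (real^2) measure) = sigma_sets UNIV (Collect closed)"
      unfolding borel_eq_closed by (rule sets_measure_of) simp
    then have "sets (restrict_space borel \<Omega>) = sigma_sets \<Omega> ((\<inter>) \<Omega> ` Collect closed)"
      unfolding sets_restrict_space using sigma_sets_Int[of \<Omega> UNIV "Collect closed"] assms by (metis borel_open subset_UNIV)
    also have "\<dots> \<subseteq> sigma_sets \<Omega> ?E"
    proof (rule sigma_sets_mono, safe)
      fix F :: "(real^2) set" assume F: "closed F"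
      have "\<Omega> \<inter> F = (\<Union>n. C n \<inter> F)" using C(3) by blast
      also have "\<dots> \<in> sigma_sets \<Omega> ?E"
        by (rule sigma_sets.Union, rule sigma_sets.Basic) (use C F in \<open>auto intro: compact_Int_closed\<close>)
      finally show "\<Omega> \<inter> F \<in> sigma_sets \<Omega> ?E" .
    qed
    finally show ?thesis .
  qed
  have "?E \<subseteq> sets (restrict_space borel \<Omega>)"
    unfolding sets_restrict_space by (auto intro!: image_eqI[where f="(\<inter>) \<Omega>"] simp: compact_imp_closed)
  then show "sigma_sets \<Omega> ?E \<subseteq> sets (restrict_space borel \<Omega>)"
    using sets.sigma_sets_subset[of ?E "restrict_space borel \<Omega>"] by (simp add: space_restrict_space)
qed

lemma Int_stable_compact: "Int_stable {K. compact K \<and> K \<subseteq> (\<Omega>::'a::t2_space set)}"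
  by (auto simp: Int_stable_def compact_Int)

lemma radon_measure_eqI:
  assumes \<Omega>: "open \<Omega>" and M: "radon_measure_on \<Omega> M" and N: "radon_measure_on \<Omega> N"
    and eq: "\<And>K. compact K \<Longrightarrow> K \<subseteq> \<Omega> \<Longrightarrow> measure M K = measure N K"
  shows "M = N"
proof -
  obtain C :: "nat \<Rightarrow> (real^2) set" where C: "\<And>n. compact (C n)" "\<And>n. C n \<subseteq> \<Omega>" "\<Union> (range C) = \<Omega>"
    using open_Union_compact_subsets[OF \<Omega>] by metis
  show ?thesis
  proof (rule measure_eqI_generator_eq[where E="{K. compact K \<and> K \<subseteq> \<Omega>}" and \<Omega>=\<Omega> and A=C])
    show "Int_stable {K. compact K \<and> K \<subseteq> \<Omega>}" by (rule Int_stable_compact)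
    show "emeasure M X = emeasure N X" if "X \<in> {K. compact K \<and> K \<subseteq> \<Omega>}" for X
      using that eq[of X] radon_compact_sets(2)[OF M, of X] radon_compact_sets(2)[OF N, of X]
      by (simp add: emeasure_eq_ennreal_measure)
  qed (use C M N sets_restrict_borel_compact[OF \<Omega>] radon_compact_sets(2)[OF M] in \<open>auto simp: radon_measure_on_def less_top\<close>)
qed

text \<open>The total variation may be infinite, so values are first compared on sets
  \<open>E \<inter> K\<close> with \<open>K\<close> compact, by Dynkin's argument in
  \<open>E\<close>. Evaluating on a Hahn set then recovers the positive parts, which is the
  uniqueness of the Jordan decomposition.\<close>

lemma signed_radon_eqI:
  assumes \<Omega>: "open \<Omega>" and m: "signed_radon_on \<Omega> m" and n: "signed_radon_on \<Omega> n"
    and eq: "\<And>K. compact K \<Longrightarrow> K \<subseteq> \<Omega> \<Longrightarrow> sm_val m K = sm_val n K"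
  shows "m = n"
proof -
  note [simp] = sm_val_def
  have R: "radon_measure_on \<Omega> (fst m)" "radon_measure_on \<Omega> (snd m)" "radon_measure_on \<Omega> (fst n)" "radon_measure_on \<Omega> (snd n)"
    using m n by (auto simp: signed_radon_on_def)
  have S: "sets (fst m) = sets (restrict_space borel \<Omega>)" "sets (snd m) = sets (restrict_space borel \<Omega>)"
      "sets (fst n) = sets (restrict_space borel \<Omega>)" "sets (snd n) = sets (restrict_space borel \<Omega>)"
    using R by (auto simp: radon_measure_on_def)
  have val: "sm_val m (E \<inter> K) = sm_val n (E \<inter> K)"
    if K: "compact K" "K \<subseteq> \<Omega>" and E: "E \<in> sets (restrict_space borel \<Omega>)" for E K
  proof -
    have KS: "K \<in> sets (restrict_space borel \<Omega>)" using radon_compact_sets(1)[OF R(1) K] S by simp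
    have fin: "emeasure M (A \<inter> K) \<noteq> \<infinity>" if "M \<in> {fst m, snd m, fst n, snd n}" for M A
    proof -
      have "emeasure M (A \<inter> K) \<le> emeasure M K"
        using that KS S by (intro emeasure_mono) auto
      moreover have "emeasure M K < \<infinity>" using that radon_compact_sets(2)[OF _ K] R by auto
      ultimately show ?thesis by (metis infinity_ennreal_def less_top order_le_less_trans)
    qed
    have Pow: "{K. compact K \<and> K \<subseteq> \<Omega>} \<subseteq> Pow \<Omega>" by auto
    show ?thesis using Int_stable_compact Pow E[unfolded sets_restrict_borel_compact[OF \<Omega>]]
    proof (induction E rule: sigma_sets_induct_disjoint)
      case (basic A)
      then show ?case using eq[of "A \<inter> K"] K by (auto intro: compact_Int)
    next
      case empty then show ?case by simp
    next
      case (compl A)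
      have A: "A \<in> sets (restrict_space borel \<Omega>)" using compl(1) sets_restrict_borel_compact[OF \<Omega>] by simp
      have "measure M ((\<Omega> - A) \<inter> K) = measure M K - measure M (A \<inter> K)" if "M \<in> {fst m, snd m, fst n, snd n}" for M
      proof -
        have "(\<Omega> - A) \<inter> K = K - A \<inter> K" using K by auto
        then show ?thesis
          using measure_Diff[of M K "A \<inter> K"] fin[OF that, of UNIV] A KS S that by auto
      qed
      moreover have "sm_val m K = sm_val n K" by (rule eq[OF K])
      ultimately show ?case using compl(2) by simp
    next
      case (union A)
      have A: "A i \<in> sets (restrict_space borel \<Omega>)" for i
        using union(2) sets_restrict_borel_compact[OF \<Omega>] by auto
      have "(\<lambda>i. measure M (A i \<inter> K)) sums measure M ((\<Union>i. A i) \<inter> K)" if "M \<in> {fst m, snd m, fst n, snd n}" for M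
      proof -
        have "A i \<inter> K \<in> sets (restrict_space borel \<Omega>)" for i using A KS by (rule sets.Int)
        then have "range (\<lambda>i. A i \<inter> K) \<subseteq> sets M" using S that by auto
        moreover have "(\<Union>i. A i \<inter> K) = (\<Union>i. A i) \<inter> K" by auto
        moreover have "disjoint_family (\<lambda>i. A i \<inter> K)" using union(1) by (auto simp: disjoint_family_on_def)
        ultimately show ?thesis
          using measure_UNION[of "\<lambda>i. A i \<inter> K" M] fin[OF that, of "\<Union>i. A i"] by simp
      qed
      then have "(\<lambda>i. sm_val m (A i \<inter> K)) sums sm_val m ((\<Union>i. A i) \<inter> K)"
        "(\<lambda>i. sm_val n (A i \<inter> K)) sums sm_val n ((\<Union>i. A i) \<inter> K)"
        unfolding sm_val_def by (auto intro!: sums_diff)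
      then show ?case using union(3) sums_unique2 by fastforce
    qed
  qed
  obtain P where P: "P \<in> sets (restrict_space borel \<Omega>)" "emeasure (fst m) (\<Omega> - P) = 0" "emeasure (snd m) P = 0"
    using m by (auto simp: signed_radon_on_def)
  obtain Q where Q: "Q \<in> sets (restrict_space borel \<Omega>)" "emeasure (fst n) (\<Omega> - Q) = 0" "emeasure (snd n) Q = 0"
    using n by (auto simp: signed_radon_on_def)
  \<comment> \<open>On a compact set the positive part is the value of the signed measure on the positive set.\<close>
  have le: "measure (fst m) K \<le> measure (fst n) K"
    if R: "radon_measure_on \<Omega> (fst m)" "radon_measure_on \<Omega> (snd m)" "radon_measure_on \<Omega> (fst n)" "radon_measure_on \<Omega> (snd n)"
     and P: "P \<in> sets (restrict_space borel \<Omega>)" "emeasure (fst m) (\<Omega> - P) = 0" "emeasure (snd m) P = 0"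
     and val: "\<And>E. E \<in> sets (restrict_space borel \<Omega>) \<Longrightarrow> sm_val m (E \<inter> K) = sm_val n (E \<inter> K)"
     and K: "compact K" "K \<subseteq> \<Omega>" for m n :: signed_measure and P K
  proof -
    have S: "sets (fst m) = sets (restrict_space borel \<Omega>)" "sets (snd m) = sets (restrict_space borel \<Omega>)"
      "sets (fst n) = sets (restrict_space borel \<Omega>)" "sets (snd n) = sets (restrict_space borel \<Omega>)"
      using R by (auto simp: radon_measure_on_def)
    have KS: "K \<in> sets (restrict_space borel \<Omega>)" using radon_compact_sets(1)[OF R(1) K] S by simp
    have \<Omega>S: "\<Omega> \<in> sets (restrict_space borel \<Omega>)" using \<Omega> by (auto simp: sets_restrict_space)
    have s1: "P \<inter> K \<in> sets (fst m)" "\<Omega> - P \<in> sets (fst m)"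
      unfolding S using P(1) KS \<Omega>S by (simp_all only: sets.Int sets.Diff)
    have "emeasure (fst m) K \<le> emeasure (fst m) (P \<inter> K \<union> (\<Omega> - P))"
      using K s1 by (intro emeasure_mono sets.Un) auto
    also have "\<dots> \<le> emeasure (fst m) (P \<inter> K) + emeasure (fst m) (\<Omega> - P)"
      by (rule emeasure_subadditive[OF s1])
    finally have "emeasure (fst m) K \<le> emeasure (fst m) (P \<inter> K) + emeasure (fst m) (\<Omega> - P)" .
    then have "emeasure (fst m) K = emeasure (fst m) (P \<inter> K)"
      using P emeasure_mono[of "P \<inter> K" K "fst m"] KS S by (intro antisym) auto
    then have "measure (fst m) K = measure (fst m) (P \<inter> K)" by (simp add: measure_def)
    also have "\<dots> = sm_val m (P \<inter> K)"
    proof -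
      have "emeasure (snd m) (P \<inter> K) = 0"
        using emeasure_mono[of "P \<inter> K" P "snd m"] P S by auto
      then show ?thesis by (simp add: measure_def)
    qed
    also have "\<dots> = sm_val n (P \<inter> K)" by (rule val[OF P(1)])
    also have "\<dots> \<le> measure (fst n) (P \<inter> K)" by simp
    also have "\<dots> \<le> measure (fst n) K"
      using radon_compact_sets(2)[OF R(3) K] KS P S by (intro measure_mono_fmeasurable) (auto simp: fmeasurable_def)
    finally show ?thesis .
  qed
  have fst_eq: "measure (fst m) K = measure (fst n) K" if K: "compact K" "K \<subseteq> \<Omega>" for K
    using le[OF R P val[OF K] K] le[OF R(3,4,1,2) Q val[OF K, symmetric] K] by simp
  have "fst m = fst n" by (rule radon_measure_eqI[OF \<Omega> R(1,3) fst_eq])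
  moreover have "snd m = snd n"
    by (rule radon_measure_eqI[OF \<Omega> R(2,4)]) (use fst_eq eq in force)
  ultimately show ?thesis by (simp add: prod_eq_iff)
qed

lemma represents_distr_unique:
  assumes \<Omega>: "open \<Omega>" and m: "represents_distr \<Omega> m T" and n: "represents_distr \<Omega> n T"
  shows "m = n"
proof (rule signed_radon_eqI[OF \<Omega>])
  show "signed_radon_on \<Omega> m" "signed_radon_on \<Omega> n" using m n by (auto simp: represents_distr_def)
  then have R: "radon_measure_on \<Omega> (fst m)" "radon_measure_on \<Omega> (snd m)" "radon_measure_on \<Omega> (fst n)" "radon_measure_on \<Omega> (snd n)"
    by (auto simp: signed_radon_on_def)
  fix K :: "(real^2) set" assume K: "compact K" "K \<subseteq> \<Omega>"
  obtain \<theta> where \<theta>: "\<And>n. \<theta> n \<in> test_functions \<Omega>"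
    "\<And>M. radon_measure_on \<Omega> M \<Longrightarrow> (\<lambda>n. integral\<^sup>L M (\<theta> n)) \<longlonglongrightarrow> measure M K"
    by (rule compact_measure_limit[OF K \<Omega>]) blast
  have "(\<lambda>k. sm_integral m (\<theta> k)) \<longlonglongrightarrow> sm_val m K" "(\<lambda>k. sm_integral n (\<theta> k)) \<longlonglongrightarrow> sm_val n K"
    unfolding sm_integral_def sm_val_def by (intro tendsto_diff \<theta> R)+
  moreover have "sm_integral m (\<theta> k) = sm_integral n (\<theta> k)" for k
    using m n \<theta>(1)[of k] unfolding represents_distr_def by metis
  ultimately show "sm_val m K = sm_val n K" using LIMSEQ_unique by auto
qed

lemma distr_measure_eq:
  "open \<Omega> \<Longrightarrow> represents_distr \<Omega> m T \<Longrightarrow> distr_measure \<Omega> T = m"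
  unfolding distr_measure_def using represents_distr_unique by blast

section \<open>Mollified sequences\<close>

definition moll :: "(real^2) set \<Rightarrow> (real^2 \<Rightarrow> real) \<Rightarrow> nat \<Rightarrow> real^2 \<Rightarrow> real" where
  "moll \<Omega> u n = conv lborel (mollifier (step_seq n)) (\<lambda>y. indicator \<Omega> y * u y)"

definition bdd_cont :: "(real^2) set \<Rightarrow> (real^2 \<Rightarrow> real) \<Rightarrow> bool" where
  "bdd_cont \<Omega> u \<longleftrightarrow> open \<Omega> \<and> bounded \<Omega> \<and> continuous_on \<Omega> u \<and> bounded (u ` \<Omega>)"

lemma indicator_mult_measurable:
  fixes u :: "real^2 \<Rightarrow> real"
  assumes "open \<Omega>" "continuous_on \<Omega> u"
  shows "(\<lambda>y. indicator \<Omega> y * u y) \<in> borel_measurable borel"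
  using borel_measurable_continuous_on_indicator[of \<Omega> u] assms by simp

lemma bdd_cont_integrable:
  assumes "bdd_cont \<Omega> u"
  shows "integrable lborel (\<lambda>y. indicator \<Omega> y * u y)"
proof -
  obtain C where C: "\<And>y. y \<in> \<Omega> \<Longrightarrow> \<bar>u y\<bar> \<le> C"
    using assms unfolding bdd_cont_def bounded_iff by auto
  show ?thesis
  proof (rule Bochner_Integration.integrable_bound[where f="\<lambda>y. C * indicator \<Omega> y"])
    show "integrable lborel (\<lambda>y. C * indicator \<Omega> y)"
      using assms emeasure_bounded_finite[of \<Omega>] unfolding bdd_cont_def
      by (intro integrable_mult_right integrable_real_indicator) auto
    show "(\<lambda>y. indicator \<Omega> y * u y) \<in> borel_measurable lborel"
      using indicator_mult_measurable[of \<Omega> u] assms unfolding bdd_cont_def by simp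
  qed (use C in \<open>force simp: indicator_def\<close>)
qed

lemma moll_C_k: "bdd_cont \<Omega> u \<Longrightarrow> C_k k (moll \<Omega> u n)"
  unfolding moll_def using smooth_mollifier
  by (intro conv_C_k bdd_cont_integrable mollifier_bounded_support step_seq) (auto simp: smooth_def)

text \<open>Once the radius is below \<open>\<delta>\<close>, the average at a point of
  \<open>K\<close> sees only a compact neighbourhood of \<open>K\<close> inside
  \<open>\<Omega>\<close>. There \<open>u\<close> is uniformly continuous and the extension by 0 is
  invisible.\<close>

lemma moll_uniform:
  assumes u: "bdd_cont \<Omega> u" and K: "compact K" "K \<subseteq> \<Omega>" and e: "e > 0"
  shows "\<forall>\<^sub>F n in sequentially. \<forall>x\<in>K. \<bar>moll \<Omega> u n x - u x\<bar> < e"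
proof (cases "K = {}")
  case False
  have \<Omega>: "open \<Omega>" and cu: "continuous_on \<Omega> u" using u by (auto simp: bdd_cont_def)
  obtain \<delta> where d: "\<delta> > 0" and c\<delta>: "compact {x. infdist x K \<le> \<delta>}" and sub: "{x. infdist x K \<le> \<delta>} \<subseteq> \<Omega>"
    using compact_neighborhood[OF K(1) \<Omega> K(2) False] by blast
  have "uniformly_continuous_on {x. infdist x K \<le> \<delta>} u"
    by (intro compact_uniformly_continuous continuous_on_subset[OF cu] sub c\<delta>)
  then obtain r where r: "r > 0" "\<And>x y. infdist x K \<le> \<delta> \<Longrightarrow> infdist y K \<le> \<delta> \<Longrightarrow> dist y x < r \<Longrightarrow> dist (u y) (u x) < e/2"
    unfolding uniformly_continuous_on_def using e by (metis half_gt_zero mem_Collect_eq)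
  have "\<forall>\<^sub>F n in sequentially. step_seq n < min r \<delta>"
    by (rule order_tendstoD(2)[OF step_seq(1)]) (use r d in auto)
  then show ?thesis
  proof eventually_elim
    case (elim n)
    let ?r = "mollifier (step_seq n)" and ?u = "\<lambda>y. indicator \<Omega> y * u y"
    show ?case
    proof
      fix x assume x: "x \<in> K"
      have i1: "integrable lborel (\<lambda>y. ?r (x - y) * ?u y)"
        by (intro conv_integrable bdd_cont_integrable u mollifier_continuous mollifier_bounded_support step_seq) simp
      have i2: "integrable lborel (\<lambda>y. ?r (x - y) * u x)"
        by (intro integrable_mult_left mollifier_reflect_integral step_seq)
      have i3: "integrable lborel (\<lambda>y. ?r (x - y) * (e/2))"
        by (intro integrable_mult_left mollifier_reflect_integral step_seq)
      have "moll \<Omega> u n x - u x = (\<integral>y. ?r (x - y) * ?u y \<partial>lborel) - (\<integral>y. ?r (x - y) * u x \<partial>lborel)"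
        by (simp add: moll_def conv_def mollifier_reflect_integral(1) step_seq)
      also have "\<dots> = (\<integral>y. ?r (x - y) * ?u y - ?r (x - y) * u x \<partial>lborel)"
        by (rule Bochner_Integration.integral_diff[symmetric]) (rule i1 i2)+
      finally have "\<bar>moll \<Omega> u n x - u x\<bar> = \<bar>\<integral>y. ?r (x - y) * ?u y - ?r (x - y) * u x \<partial>lborel\<bar>" by (simp only:)
      also have "\<dots> \<le> (\<integral>y. \<bar>?r (x - y) * ?u y - ?r (x - y) * u x\<bar> \<partial>lborel)"
        by (rule integral_abs_bound)
      also have "\<dots> \<le> (\<integral>y. ?r (x - y) * (e/2) \<partial>lborel)"
      proof (rule integral_mono[OF _ i3])
        show "integrable lborel (\<lambda>y. \<bar>?r (x - y) * ?u y - ?r (x - y) * u x\<bar>)"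
          by (intro integrable_abs Bochner_Integration.integrable_diff i1 i2)
        fix y
        show "\<bar>?r (x - y) * ?u y - ?r (x - y) * u x\<bar> \<le> ?r (x - y) * (e/2)"
        proof (cases "norm (x - y) < step_seq n")
          case True
          then have "infdist y K \<le> \<delta>" "dist y x < r"
            using infdist_le[OF x, of y] elim by (auto simp: dist_norm norm_minus_commute)
          moreover have "infdist x K \<le> \<delta>" using x d by simp
          ultimately have "\<bar>u y - u x\<bar> \<le> e/2" "y \<in> \<Omega>"
            using r(2)[of x y] sub by (auto simp: dist_real_def)
          from mult_left_mono[OF this(1) mollifier_nonneg[of "step_seq n" "x - y"]] this(2)
          show ?thesis using mollifier_nonneg[of "step_seq n" "x - y"]
            by (simp add: right_diff_distrib[symmetric] abs_mult)
        qed (simp add: mollifier_eq_0 step_seq)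
      qed
      also have "\<dots> = e/2" by (simp add: mollifier_reflect_integral(1) step_seq)
      also have "\<dots> < e" using e by simp
      finally show "\<bar>moll \<Omega> u n x - u x\<bar> < e" .
    qed
  qed
qed simp

lemma conv_mollifier_uniform:
  assumes w: "continuous_on UNIV w" "bounded {x. w x \<noteq> 0}" and e: "e > 0"
  shows "\<forall>\<^sub>F n in sequentially. \<forall>x. \<bar>conv lborel (mollifier (step_seq n)) w x - w x\<bar> \<le> e"
proof -
  obtain r where r: "r > 0" "\<And>x y. norm (y - x) < r \<Longrightarrow> \<bar>w y - w x\<bar> < e"
    using uniformly_continuous_bounded_supportE[OF w e] by blast
  have iw: "integrable lborel w" by (rule integrable_continuous_bounded_support[OF w])
  have "\<forall>\<^sub>F n in sequentially. step_seq n < r"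
    by (rule order_tendstoD(2)[OF step_seq(1) r(1)])
  then show ?thesis
  proof eventually_elim
    case (elim n)
    let ?r = "mollifier (step_seq n)"
    show ?case
    proof
      fix x
      have i1: "integrable lborel (\<lambda>y. ?r (x - y) * w y)"
        by (intro conv_integrable iw mollifier_continuous mollifier_bounded_support step_seq) simp
      have i2: "integrable lborel (\<lambda>y. ?r (x - y) * c)" for c
        by (intro integrable_mult_left mollifier_reflect_integral step_seq)
      have "conv lborel ?r w x - w x = (\<integral>y. ?r (x - y) * w y \<partial>lborel) - (\<integral>y. ?r (x - y) * w x \<partial>lborel)"
        by (simp add: conv_def mollifier_reflect_integral(1) step_seq)
      also have "\<dots> = (\<integral>y. ?r (x - y) * w y - ?r (x - y) * w x \<partial>lborel)"
        by (rule Bochner_Integration.integral_diff[symmetric]) (rule i1 i2)+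
      finally have "\<bar>conv lborel ?r w x - w x\<bar> = \<bar>\<integral>y. ?r (x - y) * w y - ?r (x - y) * w x \<partial>lborel\<bar>" by (simp only:)
      also have "\<dots> \<le> (\<integral>y. \<bar>?r (x - y) * w y - ?r (x - y) * w x\<bar> \<partial>lborel)"
        by (rule integral_abs_bound)
      also have "\<dots> \<le> (\<integral>y. ?r (x - y) * e \<partial>lborel)"
      proof (rule integral_mono[OF _ i2])
        show "integrable lborel (\<lambda>y. \<bar>?r (x - y) * w y - ?r (x - y) * w x\<bar>)"
          by (intro integrable_abs Bochner_Integration.integrable_diff i1 i2)
        fix y
        show "\<bar>?r (x - y) * w y - ?r (x - y) * w x\<bar> \<le> ?r (x - y) * e"
        proof (cases "norm (x - y) < step_seq n")
          case True
          then have "\<bar>w y - w x\<bar> \<le> e" using r(2)[of y x] elim by (simp add: norm_minus_commute)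
          then show ?thesis
            using mollifier_nonneg[of "step_seq n" "x - y"]
            by (simp add: right_diff_distrib[symmetric] abs_mult mult_left_mono)
        qed (simp add: mollifier_eq_0 step_seq)
      qed
      also have "\<dots> = e" by (simp add: mollifier_reflect_integral(1) step_seq)
      finally show "\<bar>conv lborel ?r w x - w x\<bar> \<le> e" .
    qed
  qed
qed

lemma conv_mollifier_contraction:
  assumes w: "integrable lborel w" and w': "integrable lborel w'" and e: "\<And>y. \<bar>w y - w' y\<bar> \<le> e"
  shows "\<bar>conv lborel (mollifier (step_seq n)) w x - conv lborel (mollifier (step_seq n)) w' x\<bar> \<le> e"
proof -
  let ?r = "mollifier (step_seq n)"
  have i1: "integrable lborel (\<lambda>y. ?r (x - y) * w y)" "integrable lborel (\<lambda>y. ?r (x - y) * w' y)"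
    by (intro conv_integrable w w' mollifier_continuous mollifier_bounded_support step_seq sets_lborel)+
  have i2: "integrable lborel (\<lambda>y. ?r (x - y) * e)"
    by (intro integrable_mult_left mollifier_reflect_integral step_seq)
  have "conv lborel ?r w x - conv lborel ?r w' x = (\<integral>y. ?r (x - y) * w y - ?r (x - y) * w' y \<partial>lborel)"
    unfolding conv_def by (rule Bochner_Integration.integral_diff[symmetric]) (rule i1)+
  then have "\<bar>conv lborel ?r w x - conv lborel ?r w' x\<bar> = \<bar>\<integral>y. ?r (x - y) * w y - ?r (x - y) * w' y \<partial>lborel\<bar>" by (simp only:)
  also have "\<dots> \<le> (\<integral>y. \<bar>?r (x - y) * w y - ?r (x - y) * w' y\<bar> \<partial>lborel)"
    by (rule integral_abs_bound)
  also have "\<dots> \<le> (\<integral>y. ?r (x - y) * e \<partial>lborel)"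
    by (intro integral_mono i1 i2 integrable_abs Bochner_Integration.integrable_diff)
       (use e mollifier_nonneg in \<open>auto simp: right_diff_distrib[symmetric] abs_mult intro!: mult_left_mono\<close>)
  also have "\<dots> = e" by (simp add: mollifier_reflect_integral(1) step_seq)
  finally show ?thesis .
qed

text \<open>Passes from the vector-valued Lebesgue integral in the definition of
  \<open>conv_approx\<close> to a scalar convolution over Borel sets, to which the results on
  \<open>conv\<close> apply.\<close>

lemma conv_approx_nth:
  fixes f :: "real^2 \<Rightarrow> real^2"
  assumes "open \<Omega>" "bounded \<Omega>" "continuous_on \<Omega> f" "bounded (f ` \<Omega>)"
  shows "bdd_cont \<Omega> (\<lambda>x. f x $ i)" "conv_approx \<Omega> f n x $ i = moll \<Omega> (\<lambda>x. f x $ i) n x"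
proof -
  have "bounded ((\<lambda>v. v $ i) ` f ` \<Omega>)"
    by (rule bounded_linear_image[OF assms(4) bounded_linear_vec_nth])
  then show b: "bdd_cont \<Omega> (\<lambda>x. f x $ i)"
    unfolding bdd_cont_def using assms by (auto simp: image_image intro: continuous_on_component)
  let ?r = "mollifier (step_seq n)"
  define F where "F y = indicator \<Omega> y *\<^sub>R (?r (x - y) *\<^sub>R f y)" for y
  obtain C where C: "\<And>z. \<bar>?r z\<bar> \<le> C"
    using bounded_supportE[OF mollifier_continuous mollifier_bounded_support[OF step_seq(4)]] by metis
  obtain B where B: "B > 0" "\<And>y. y \<in> \<Omega> \<Longrightarrow> norm (f y) \<le> B"
    using assms(4) unfolding bounded_pos by auto
  have mF: "F \<in> borel_measurable borel"
    unfolding F_def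
    by (intro borel_measurable_continuous_on_indicator continuous_intros assms continuous_on_subset[OF continuous_reflect[OF mollifier_continuous]])
       (use assms in auto)
  have iF: "integrable lborel F"
  proof (rule Bochner_Integration.integrable_bound[where f="\<lambda>y. (C * B) * indicator \<Omega> y"])
    show "integrable lborel (\<lambda>y. (C * B) * indicator \<Omega> y)"
      using assms emeasure_bounded_finite[of \<Omega>] by (intro integrable_mult_right integrable_real_indicator) auto
    show "F \<in> borel_measurable lborel" using mF by simp
    have "\<bar>?r (x - y)\<bar> * norm (f y) \<le> C * B" if "y \<in> \<Omega>" for y
      using C[of "x - y"] B(2)[OF that] B(1) by (intro mult_mono) auto
    moreover have "C * B \<ge> 0" using C[of 0] B(1) by (intro mult_nonneg_nonneg) auto
    ultimately show "AE y in lborel. norm (F y) \<le> norm ((C * B) * indicator \<Omega> y)"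
      by (intro AE_I2) (auto simp: F_def indicator_def)
  qed
  have "conv_approx \<Omega> f n x = integral\<^sup>L lebesgue F"
    unfolding conv_approx_def set_lebesgue_integral_def F_def step_seq_def by simp
  also have "\<dots> = integral\<^sup>L lborel F" using mF by (intro integral_completion) simp
  finally have "conv_approx \<Omega> f n x $ i = (\<integral>y. F y $ i \<partial>lborel)"
    using integral_bounded_linear[OF bounded_linear_vec_nth iF, of i] by simp
  also have "\<dots> = moll \<Omega> (\<lambda>x. f x $ i) n x"
    unfolding moll_def conv_def F_def by (intro Bochner_Integration.integral_cong) auto
  finally show "conv_approx \<Omega> f n x $ i = moll \<Omega> (\<lambda>x. f x $ i) n x" .
qed

section \<open>Weak derivatives that are finite measures\<close>

text \<open>The pair lives on the Borel sets of the whole plane and represents the derivative only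
  as a difference. Convolution and push-forward then act on each measure separately, without
  tracking a restricted space or a Hahn set.\<close>

definition weak_deriv :: "(real^2) set \<Rightarrow> 2 \<Rightarrow> (real^2 \<Rightarrow> real) \<Rightarrow> (real^2) measure \<Rightarrow> (real^2) measure \<Rightarrow> bool" where
  "weak_deriv \<Omega> j u \<mu> \<nu> \<longleftrightarrow> finite_measure \<mu> \<and> finite_measure \<nu> \<and> sets \<mu> = sets borel \<and> sets \<nu> = sets borel \<and>
    (\<forall>\<phi>\<in>test_functions \<Omega>. - (\<integral>x. (indicator \<Omega> x * u x) * part_deriv j \<phi> x \<partial>lborel) = integral\<^sup>L \<mu> \<phi> - integral\<^sup>L \<nu> \<phi>)"

text \<open>The reflected mollifier centred at \<open>x\<close> is itself an admissible test
  function as soon as the closed ball lies in \<open>\<Omega>\<close>. Testing with it shows that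
  the derivative of the mollification is the mollification of the derivative measure.\<close>

lemma moll_part_deriv:
  assumes u: "bdd_cont \<Omega> u" and D: "weak_deriv \<Omega> j u \<mu> \<nu>" and x: "cball x (step_seq n) \<subseteq> \<Omega>"
  shows "part_deriv j (moll \<Omega> u n) x = conv \<mu> (mollifier (step_seq n)) (\<lambda>_. 1) x - conv \<nu> (mollifier (step_seq n)) (\<lambda>_. 1) x"
proof -
  let ?r = "mollifier (step_seq n)"
  define \<phi> where "\<phi> y = ?r ((-1) *\<^sub>R y + x)" for y
  have \<phi>_eq: "\<phi> y = ?r (x - y)" for y by (simp add: \<phi>_def)
  have r1: "C_k 1 ?r" by (rule smooth_C1[OF smooth_mollifier])
  have d\<phi>: "part_deriv j \<phi> y = - part_deriv j ?r (x - y)" for y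
  proof -
    have "part_deriv j \<phi> y = (-1) * part_deriv j ?r ((-1) *\<^sub>R y + x)"
      unfolding \<phi>_def[abs_def] by (rule part_deriv_affine) (use r1 in simp)
    then show ?thesis by simp
  qed
  have supp: "closure {y. \<phi> y \<noteq> 0} \<subseteq> cball x (step_seq n)"
  proof (rule closure_minimal)
    show "{y. \<phi> y \<noteq> 0} \<subseteq> cball x (step_seq n)"
      using mollifier_eq_0[OF step_seq(4)] by (force simp: \<phi>_eq dist_norm)
  qed simp
  have "\<phi> \<in> test_functions \<Omega>"
    unfolding test_functions_def
  proof (intro CollectI conjI allI)
    show "C_k k \<phi>" for k
      unfolding \<phi>_def[abs_def] using smooth_mollifier by (intro C_k_affine) (auto simp: smooth_def)
    show "compact (closure {y. \<phi> y \<noteq> 0})"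
      using compact_Int_closed[OF compact_cball closed_closure, of x "step_seq n" "{y. \<phi> y \<noteq> 0}"] supp by (simp add: Int_absorb1)
    show "closure {y. \<phi> y \<noteq> 0} \<subseteq> \<Omega>" using supp x by blast
  qed
  then have "- (\<integral>y. (indicator \<Omega> y * u y) * part_deriv j \<phi> y \<partial>lborel) = integral\<^sup>L \<mu> \<phi> - integral\<^sup>L \<nu> \<phi>"
    using D by (auto simp: weak_deriv_def)
  moreover have "- (\<integral>y. (indicator \<Omega> y * u y) * part_deriv j \<phi> y \<partial>lborel) = conv lborel (part_deriv j ?r) (\<lambda>y. indicator \<Omega> y * u y) x"
    unfolding conv_def d\<phi> by (simp add: mult.commute)
  moreover have "part_deriv j (moll \<Omega> u n) = conv lborel (part_deriv j ?r) (\<lambda>y. indicator \<Omega> y * u y)"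
    unfolding moll_def by (intro conv_C1 bdd_cont_integrable u r1 mollifier_bounded_support step_seq) simp
  ultimately show ?thesis
    by (simp add: conv_def \<phi>_eq[abs_def])
qed

text \<open>Mollification is self-adjoint because the mollifier is even: it can be moved from the
  measure to the weight \<open>w\<close>.\<close>

lemma conv_mollifier_fubini:
  assumes \<mu>: "finite_measure \<mu>" "sets \<mu> = sets borel" and w: "integrable lborel w"
  shows "integrable lborel (\<lambda>x. w x * conv \<mu> (mollifier (step_seq n)) (\<lambda>_. 1) x)"
    and "(\<integral>x. w x * conv \<mu> (mollifier (step_seq n)) (\<lambda>_. 1) x \<partial>lborel) = (\<integral>y. conv lborel (mollifier (step_seq n)) w y \<partial>\<mu>)"
proof -
  let ?r = "mollifier (step_seq n)"
  interpret \<mu>: finite_measure \<mu> by fact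
  interpret P: pair_sigma_finite lborel \<mu> by (intro pair_sigma_finite.intro sigma_finite_lborel \<mu>.sigma_finite_measure_axioms)
  obtain C where C: "\<And>z. \<bar>?r z\<bar> \<le> C"
    using bounded_supportE[OF mollifier_continuous mollifier_bounded_support[OF step_seq(4)]] by metis
  have i1: "integrable \<mu> (\<lambda>_. 1::real)" by simp
  have cc: "continuous_on UNIV (conv \<mu> ?r (\<lambda>_. 1))"
    by (intro conv_continuous i1 mollifier_continuous mollifier_bounded_support step_seq \<mu>)
  have ii: "integrable \<mu> (\<lambda>y. ?r (x - y))" for x
    using conv_integrable[OF \<mu>(2) i1 mollifier_continuous mollifier_bounded_support[OF step_seq(4)], of n x] by simp
  have bd: "\<bar>conv \<mu> ?r (\<lambda>_. 1) x\<bar> \<le> C * measure \<mu> (space \<mu>)" for x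
  proof -
    have "\<bar>\<integral>y. ?r (x - y) \<partial>\<mu>\<bar> \<le> (\<integral>y. \<bar>?r (x - y)\<bar> \<partial>\<mu>)" by (rule integral_abs_bound)
    also have "\<dots> \<le> (\<integral>y. C \<partial>\<mu>)" by (intro integral_mono integrable_abs ii C) simp
    finally show ?thesis by (simp add: conv_def mult.commute)
  qed
  have wm[measurable]: "w \<in> borel_measurable borel" using w by auto
  have rm[measurable]: "?r \<in> borel_measurable borel" by (intro borel_measurable_continuous_onI mollifier_continuous)
  have cm[measurable]: "conv \<mu> ?r (\<lambda>_. 1) \<in> borel_measurable borel" by (intro borel_measurable_continuous_onI cc)
  show int1: "integrable lborel (\<lambda>x. w x * conv \<mu> ?r (\<lambda>_. 1) x)"
    by (rule Bochner_Integration.integrable_bound[where f="\<lambda>x. w x * (C * measure \<mu> (space \<mu>))"])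
       (use w bd order_trans[OF abs_ge_zero C] in \<open>auto simp: abs_mult intro!: mult_left_mono AE_I2\<close>)
  have [measurable_cong]: "sets \<mu> = sets borel" by fact
  have meas: "(\<lambda>(x, y). w x * ?r (x - y)) \<in> borel_measurable (lborel \<Otimes>\<^sub>M \<mu>)"
    by measurable
  have "integrable (lborel \<Otimes>\<^sub>M \<mu>) (\<lambda>(x, y). w x * ?r (x - y))"
  proof (rule P.Fubini_integrable[OF meas])
    have "(\<lambda>x. \<integral>y. norm (case (x, y) of (x, y) \<Rightarrow> w x * ?r (x - y)) \<partial>\<mu>) = (\<lambda>x. \<bar>w x * conv \<mu> ?r (\<lambda>_. 1) x\<bar>)"
      by (auto simp: fun_eq_iff abs_mult conv_def mollifier_nonneg abs_of_nonneg integral_nonneg_AE)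
    then show "integrable lborel (\<lambda>x. \<integral>y. norm (case (x, y) of (x, y) \<Rightarrow> w x * ?r (x - y)) \<partial>\<mu>)"
      using integrable_abs[OF int1] by (simp only:)
    show "AE x in lborel. integrable \<mu> (\<lambda>y. case (x, y) of (x, y) \<Rightarrow> w x * ?r (x - y))"
      using ii by simp
  qed
  from P.Fubini_integral[OF this]
  have "(\<integral>y. (\<integral>x. w x * ?r (x - y) \<partial>lborel) \<partial>\<mu>) = (\<integral>x. (\<integral>y. w x * ?r (x - y) \<partial>\<mu>) \<partial>lborel)" .
  moreover have "(\<integral>y. w x * ?r (x - y) \<partial>\<mu>) = w x * conv \<mu> ?r (\<lambda>_. 1) x" for x
    by (simp add: conv_def)
  moreover have "(\<integral>x. w x * ?r (x - y) \<partial>lborel) = conv lborel ?r w y" for y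
  proof -
    have "w x * ?r (x - y) = ?r (y - x) * w x" for x
      using mollifier_minus[of "step_seq n" "x - y"] by simp
    then show ?thesis unfolding conv_def by (simp only:)
  qed
  ultimately show "(\<integral>x. w x * conv \<mu> ?r (\<lambda>_. 1) x \<partial>lborel) = (\<integral>y. conv lborel ?r w y \<partial>\<mu>)"
    by (simp only:)
qed

lemma eventually_cball_subset:
  assumes K: "compact K" "K \<subseteq> \<Omega>" "open \<Omega>"
  shows "\<forall>\<^sub>F n in sequentially. \<forall>x\<in>K. cball x (step_seq n) \<subseteq> (\<Omega> :: (real^2) set)"
proof (cases "K = {}")
  case False
  obtain \<delta> where d: "\<delta> > 0" and sub: "{x. infdist x K \<le> \<delta>} \<subseteq> \<Omega>"
    using compact_neighborhood[OF K(1,3,2) False] by blast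
  have "\<forall>\<^sub>F n in sequentially. step_seq n < \<delta>"
    by (rule order_tendstoD(2)[OF step_seq(1) d])
  then show ?thesis
  proof eventually_elim
    case (elim n)
    show ?case
    proof (intro ballI subsetI)
      fix x y assume "x \<in> K" "y \<in> cball x (step_seq n)"
      then have "infdist y K \<le> \<delta>" using infdist_le[of x K y] elim by (auto simp: dist_commute)
      then show "y \<in> \<Omega>" using sub by auto
    qed
  qed
qed simp

text \<open>After moving the mollifier onto the indicator of \<open>K\<close>, which stays at most 1
  in absolute value, only the masses of the two measures remain.\<close>

lemma moll_part_deriv_L1_bound:
  assumes u: "bdd_cont \<Omega> u" and D: "weak_deriv \<Omega> j u \<mu> \<nu>" and K: "compact K" "K \<subseteq> \<Omega>"
  shows "\<forall>\<^sub>F n in sequentially. (\<integral>x. indicator K x * \<bar>part_deriv j (moll \<Omega> u n) x\<bar> \<partial>lborel) \<le> measure \<mu> UNIV + measure \<nu> UNIV"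
proof -
  have \<Omega>: "open \<Omega>" using u by (simp add: bdd_cont_def)
  have \<mu>: "finite_measure \<mu>" "sets \<mu> = sets borel" and \<nu>: "finite_measure \<nu>" "sets \<nu> = sets borel" using D by (auto simp: weak_deriv_def)
  have iK: "integrable lborel (indicator K :: real^2 \<Rightarrow> real)"
    using K emeasure_bounded_finite[OF compact_imp_bounded[OF K(1)]]
    by (intro integrable_real_indicator) (auto simp: compact_imp_closed)
  have le1: "(\<integral>x. indicator K x * conv M (mollifier (step_seq n)) (\<lambda>_. 1) x \<partial>lborel) \<le> measure M UNIV"
    if M: "finite_measure M" "sets M = sets borel" for M n
  proof -
    interpret finite_measure M by fact
    have sp: "space M = UNIV" using sets_eq_imp_space_eq[OF M(2)] by simp
    have c1: "\<bar>conv lborel (mollifier (step_seq n)) (indicator K) y\<bar> \<le> 1" for y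
      using conv_mollifier_contraction[OF iK, of "\<lambda>_. 0" 1 n y] by (simp add: conv_def indicator_def)
    have cc: "continuous_on UNIV (conv lborel (mollifier (step_seq n)) (indicator K))"
      by (intro conv_continuous iK mollifier_continuous mollifier_bounded_support step_seq) simp
    have mm: "conv lborel (mollifier (step_seq n)) (indicator K) \<in> borel_measurable M"
      using borel_measurable_continuous_onI[OF cc] M(2) by (metis measurable_cong_sets)
    have "(\<integral>x. indicator K x * conv M (mollifier (step_seq n)) (\<lambda>_. 1) x \<partial>lborel) = (\<integral>y. conv lborel (mollifier (step_seq n)) (indicator K) y \<partial>M)"
      by (rule conv_mollifier_fubini(2)[OF M iK])
    also have "\<dots> \<le> (\<integral>y. 1 \<partial>M)"
    proof (rule integral_mono)
      show "integrable M (conv lborel (mollifier (step_seq n)) (indicator K))"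
        by (rule integrable_const_bound[where B=1]) (use c1 mm in auto)
      show "conv lborel (mollifier (step_seq n)) (indicator K) y \<le> 1" for y using c1[of y] by linarith
    qed simp
    finally show ?thesis by (simp add: sp)
  qed
  from eventually_cball_subset[OF K \<Omega>] show ?thesis
  proof eventually_elim
    case (elim n)
    let ?c = "\<lambda>M. conv M (mollifier (step_seq n)) (\<lambda>_. 1)"
    have nn: "?c M x \<ge> 0" for M x unfolding conv_def by (intro integral_nonneg_AE AE_I2) (simp add: mollifier_nonneg)
    have ib: "integrable lborel (\<lambda>x. indicator K x * ?c \<mu> x)" "integrable lborel (\<lambda>x. indicator K x * ?c \<nu> x)"
      by (rule conv_mollifier_fubini(1)[OF \<mu> iK], rule conv_mollifier_fubini(1)[OF \<nu> iK])
    have eq: "indicator K x * \<bar>part_deriv j (moll \<Omega> u n) x\<bar> = \<bar>indicator K x * ?c \<mu> x - indicator K x * ?c \<nu> x\<bar>" for x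
      using moll_part_deriv[OF u D] elim by (cases "x \<in> K") auto
    have "(\<integral>x. indicator K x * \<bar>part_deriv j (moll \<Omega> u n) x\<bar> \<partial>lborel) \<le> (\<integral>x. indicator K x * ?c \<mu> x + indicator K x * ?c \<nu> x \<partial>lborel)"
      unfolding eq
    proof (rule integral_mono)
      show "integrable lborel (\<lambda>x. \<bar>indicator K x * ?c \<mu> x - indicator K x * ?c \<nu> x\<bar>)"
        by (intro integrable_abs Bochner_Integration.integrable_diff ib)
      show "integrable lborel (\<lambda>x. indicator K x * ?c \<mu> x + indicator K x * ?c \<nu> x)"
        by (intro Bochner_Integration.integrable_add ib)
      show "\<bar>indicator K x * ?c \<mu> x - indicator K x * ?c \<nu> x\<bar> \<le> indicator K x * ?c \<mu> x + indicator K x * ?c \<nu> x" for x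
        using nn[of \<mu> x] nn[of \<nu> x] by (auto simp: indicator_def)
    qed
    also have "\<dots> = (\<integral>x. indicator K x * ?c \<mu> x \<partial>lborel) + (\<integral>x. indicator K x * ?c \<nu> x \<partial>lborel)"
      by (rule Bochner_Integration.integral_add[OF ib])
    also have "\<dots> \<le> measure \<mu> UNIV + measure \<nu> UNIV" using le1[OF \<mu>] le1[OF \<nu>] by (intro add_mono) auto
    finally show ?case .
  qed
qed

text \<open>The weights vary with \<open>n\<close> because in the applications they contain the
  mollified map itself. Self-adjointness puts the mollifier on \<open>w n\<close>, and uniform
  convergence there is enough against finite measures.\<close>

lemma moll_weak_convergence:
  assumes u: "bdd_cont \<Omega> u" and D: "weak_deriv \<Omega> j u \<mu> \<nu>" and K: "compact K" "K \<subseteq> \<Omega>"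
    and w: "\<And>n. continuous_on UNIV (w n)" "\<And>n x. x \<notin> K \<Longrightarrow> w n x = 0"
    and v: "continuous_on UNIV v" "\<And>x. x \<notin> K \<Longrightarrow> v x = 0"
    and conv: "\<And>e. e > 0 \<Longrightarrow> \<forall>\<^sub>F n in sequentially. \<forall>x. \<bar>w n x - v x\<bar> \<le> e"
  shows "(\<lambda>n. \<integral>x. w n x * part_deriv j (moll \<Omega> u n) x \<partial>lborel) \<longlonglongrightarrow> integral\<^sup>L \<mu> v - integral\<^sup>L \<nu> v"
proof -
  have \<Omega>: "open \<Omega>" using u by (simp add: bdd_cont_def)
  have \<mu>: "finite_measure \<mu>" "sets \<mu> = sets borel" and \<nu>: "finite_measure \<nu>" "sets \<nu> = sets borel" using D by (auto simp: weak_deriv_def)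
  have bw: "bounded {x. w n x \<noteq> 0}" for n
    by (rule bounded_subset[OF compact_imp_bounded[OF K(1)]]) (use w in auto)
  have bv: "bounded {x. v x \<noteq> 0}"
    by (rule bounded_subset[OF compact_imp_bounded[OF K(1)]]) (use v in auto)
  have iw: "integrable lborel (w n)" for n by (intro integrable_continuous_bounded_support w bw)
  have iv: "integrable lborel v" by (intro integrable_continuous_bounded_support v bv)
  let ?m = "\<lambda>n. mollifier (step_seq n)"
  have lim: "(\<lambda>n. \<integral>y. conv lborel (?m n) (w n) y \<partial>M) \<longlonglongrightarrow> integral\<^sup>L M v"
    if M: "finite_measure M" "sets M = sets borel" for M
  proof (rule LIMSEQ_I)
    interpret finite_measure M by fact
    fix e :: real assume e: "e > 0"
    \<comment> \<open>The two uniform errors, from \<open>w n\<close> to \<open>v\<close> and from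
      mollifying \<open>v\<close>, are each at most \<open>d\<close>. Integrated they contribute at
      most \<open>d * D\<close>, which is \<open>e / 2\<close>; the summand 1 covers the zero
      measure.\<close>
    define D where "D = 2 * measure M (space M) + 1"
    define d where "d = e / (2 * D)"
    have den: "D > 0" unfolding D_def by (simp add: add_nonneg_pos)
    have d: "d > 0" unfolding d_def using e den by simp
    have "\<forall>\<^sub>F n in sequentially. norm ((\<integral>y. conv lborel (?m n) (w n) y \<partial>M) - integral\<^sup>L M v) < e"
      using conv[OF d] conv_mollifier_uniform[OF v(1) bv d]
    proof eventually_elim
      case (elim n)
      have le: "\<bar>conv lborel (?m n) (w n) y - v y\<bar> \<le> 2 * d" for y
      proof -
        have "\<bar>conv lborel (?m n) (w n) y - conv lborel (?m n) v y\<bar> \<le> d"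
          by (rule conv_mollifier_contraction[OF iw iv]) (use elim in auto)
        moreover have "\<bar>conv lborel (?m n) v y - v y\<bar> \<le> d" using elim by auto
        ultimately show ?thesis by linarith
      qed
      have cc: "continuous_on UNIV (conv lborel (?m n) (w n))"
        by (intro conv_continuous iw mollifier_continuous mollifier_bounded_support step_seq) simp
      have mm: "conv lborel (?m n) (w n) \<in> borel_measurable M" "v \<in> borel_measurable M"
        using borel_measurable_continuous_onI[OF cc] borel_measurable_continuous_onI[OF v(1)] M(2) by (metis measurable_cong_sets)+
      obtain B where B: "\<And>x. \<bar>v x\<bar> \<le> B" using bounded_supportE[OF v(1) bv] by metis
      have i1: "integrable M v" by (rule integrable_const_bound[where B=B]) (use B mm in auto)
      have i2: "integrable M (conv lborel (?m n) (w n))"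
      proof (rule integrable_const_bound[where B="B + 2 * d"])
        show "AE y in M. norm (conv lborel (?m n) (w n) y) \<le> B + 2 * d"
        proof (intro AE_I2)
          fix y show "norm (conv lborel (?m n) (w n) y) \<le> B + 2 * d"
            using le[of y] B[of y] unfolding real_norm_def by linarith
        qed
      qed (rule mm)
      have "\<bar>(\<integral>y. conv lborel (?m n) (w n) y \<partial>M) - integral\<^sup>L M v\<bar> = \<bar>\<integral>y. conv lborel (?m n) (w n) y - v y \<partial>M\<bar>"
        by (simp only: Bochner_Integration.integral_diff[OF i2 i1])
      also have "\<dots> \<le> (\<integral>y. \<bar>conv lborel (?m n) (w n) y - v y\<bar> \<partial>M)" by (rule integral_abs_bound)
      also have "\<dots> \<le> (\<integral>y. 2 * d \<partial>M)"
        by (intro integral_mono integrable_abs Bochner_Integration.integrable_diff i1 i2 le) simp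
      also have "\<dots> = 2 * d * measure M (space M)" by simp
      also have "\<dots> \<le> d * D" using d by (simp add: algebra_simps D_def)
      also have "\<dots> = e / 2" unfolding d_def using den by simp
      also have "\<dots> < e" using e by simp
      finally show ?case by simp
    qed
    then show "\<exists>no. \<forall>n\<ge>no. norm ((\<integral>y. conv lborel (?m n) (w n) y \<partial>M) - integral\<^sup>L M v) < e"
      by (simp add: eventually_sequentially)
  qed
  have "(\<lambda>n. (\<integral>y. conv lborel (?m n) (w n) y \<partial>\<mu>) - (\<integral>y. conv lborel (?m n) (w n) y \<partial>\<nu>)) \<longlonglongrightarrow> integral\<^sup>L \<mu> v - integral\<^sup>L \<nu> v"
    by (intro tendsto_diff lim \<mu> \<nu>)
  moreover have "\<forall>\<^sub>F n in sequentially. (\<integral>y. conv lborel (?m n) (w n) y \<partial>\<mu>) - (\<integral>y. conv lborel (?m n) (w n) y \<partial>\<nu>)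
      = (\<integral>x. w n x * part_deriv j (moll \<Omega> u n) x \<partial>lborel)"
    using eventually_cball_subset[OF K \<Omega>]
  proof eventually_elim
    case (elim n)
    have eq: "w n x * part_deriv j (moll \<Omega> u n) x = w n x * conv \<mu> (?m n) (\<lambda>_. 1) x - w n x * conv \<nu> (?m n) (\<lambda>_. 1) x" for x
      using moll_part_deriv[OF u D] elim w(2)[of x n] by (cases "x \<in> K") (auto simp: right_diff_distrib)
    show ?case
      unfolding eq
      by (simp only: Bochner_Integration.integral_diff[OF conv_mollifier_fubini(1)[OF \<mu> iw] conv_mollifier_fubini(1)[OF \<nu> iw]]
          conv_mollifier_fubini(2)[OF \<mu> iw] conv_mollifier_fubini(2)[OF \<nu> iw])
  qed
  ultimately show ?thesis using Lim_transform_eventually by fast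
qed

section \<open>A product kernel\<close>

lemma DERIV_pos_part_sq: "((\<lambda>t::real. (max 0 t)\<^sup>2) has_real_derivative 2 * max 0 t) (at t)"
proof -
  consider "t > 0" | "t < 0" | "t = 0" by linarith
  then show ?thesis
  proof cases
    case 1
    have "((\<lambda>t::real. t\<^sup>2) has_real_derivative 2 * max 0 t) (at t)"
      using 1 by (auto intro!: derivative_eq_intros)
    then show ?thesis
      by (rule has_field_derivative_transform_within_open[where S="{0<..}"]) (use 1 in auto)
  next
    case 2
    have "((\<lambda>t::real. 0) has_real_derivative 2 * max 0 t) (at t)" using 2 by simp
    then show ?thesis
      by (rule has_field_derivative_transform_within_open[where S="{..<0}"]) (use 2 in auto)
  next
    case 3
    have "((\<lambda>h::real. (max 0 h)\<^sup>2 / h) \<longlongrightarrow> 0) (at 0)"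
    proof (rule Lim_null_comparison)
      show "\<forall>\<^sub>F h in at 0. norm ((max 0 h)\<^sup>2 / h) \<le> \<bar>h::real\<bar>"
        unfolding eventually_at_filter
        by (rule always_eventually) (auto simp: max_def power2_eq_square)
      show "((\<lambda>h::real. \<bar>h\<bar>) \<longlongrightarrow> 0) (at 0)" by (auto intro!: tendsto_eq_intros)
    qed
    then show ?thesis using 3 by (simp add: has_field_derivative_iff)
  qed
qed

text \<open>A polynomial bump of class C^1. One derivative is all that the integrations by parts ask
  of the kernel.\<close>

definition kern0 :: "real \<Rightarrow> real" where "kern0 s = (max 0 (1 - s\<^sup>2))\<^sup>2"

lemma kern0_deriv: "(kern0 has_real_derivative 2 * max 0 (1 - s\<^sup>2) * (- 2 * s)) (at s)"
proof -
  have "((\<lambda>s::real. 1 - s\<^sup>2) has_real_derivative (- 2 * s)) (at s)"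
    by (auto intro!: derivative_eq_intros)
  from DERIV_chain2[OF DERIV_pos_part_sq this] show ?thesis
    unfolding kern0_def[abs_def] .
qed

lemma kern0_continuous: "continuous_on UNIV kern0"
  unfolding kern0_def by (intro continuous_intros)

lemma kern0_eq_0: "\<bar>s\<bar> \<ge> 1 \<Longrightarrow> kern0 s = 0"
  using abs_le_square_iff[of 1 s] by (simp add: kern0_def)

lemma kern0_integrable: "integrable lborel kern0"
proof (rule integrable_continuous_bounded_support[OF kern0_continuous])
  show "bounded {x. kern0 x \<noteq> 0}"
    by (rule bounded_subset[of "{-1..1}"]) (use kern0_eq_0 in \<open>force+\<close>)
qed

lemma kern0_integral_pos: "integral\<^sup>L lborel kern0 > 0"
  by (rule nonneg_continuous_integral_pos[OF kern0_continuous kern0_integrable, of 0])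
     (auto simp: kern0_def)

definition kern :: "real \<Rightarrow> real \<Rightarrow> real" where
  "kern \<epsilon> s = kern0 (s / \<epsilon>) / (\<epsilon> * integral\<^sup>L lborel kern0)"

lemma kern_nonneg: "\<epsilon> > 0 \<Longrightarrow> kern \<epsilon> s \<ge> 0"
  unfolding kern_def using kern0_integral_pos by (simp add: kern0_def)

lemma kern_eq_0: "\<epsilon> > 0 \<Longrightarrow> \<bar>s\<bar> \<ge> \<epsilon> \<Longrightarrow> kern \<epsilon> s = 0"
  unfolding kern_def by (subst kern0_eq_0) (auto simp: le_divide_eq)

lemma kern_minus: "kern \<epsilon> (- s) = kern \<epsilon> s"
  by (simp add: kern_def kern0_def)

lemma kern_continuous: "continuous_on UNIV (kern \<epsilon>)"
proof -
  have "continuous_on UNIV (\<lambda>s. kern0 (s * inverse \<epsilon>) * inverse (\<epsilon> * integral\<^sup>L lborel kern0))"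
    by (intro continuous_intros continuous_on_compose2[OF kern0_continuous]) auto
  then show ?thesis by (simp add: kern_def[abs_def] divide_inverse)
qed

lemma kern_deriv:
  "\<exists>k'. (\<forall>s. (kern \<epsilon> has_real_derivative k' s) (at s)) \<and> continuous_on UNIV k'"
proof -
  define c where "c = inverse (\<epsilon> * integral\<^sup>L lborel kern0)"
  let ?k' = "\<lambda>s. (2 * max 0 (1 - (s * inverse \<epsilon>)\<^sup>2) * (- 2 * (s * inverse \<epsilon>)) * inverse \<epsilon>) * c"
  have "((\<lambda>s. kern0 (s * inverse \<epsilon>) * c) has_real_derivative ?k' s) (at s)" for s
  proof (rule DERIV_cmult_right, rule DERIV_chain2[OF kern0_deriv])
    show "((\<lambda>s. s * inverse \<epsilon>) has_real_derivative inverse \<epsilon>) (at s)"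
      by (auto intro!: derivative_eq_intros)
  qed
  moreover have "kern \<epsilon> = (\<lambda>s. kern0 (s * inverse \<epsilon>) * c)"
    by (simp add: kern_def[abs_def] c_def divide_inverse)
  moreover have "continuous_on UNIV ?k'" by (intro continuous_intros)
  ultimately show ?thesis
    by (intro exI[of _ ?k'] conjI allI) (simp_all only:)
qed

lemma kern_integrable: "\<epsilon> > 0 \<Longrightarrow> integrable lborel (kern \<epsilon>)"
proof (rule integrable_continuous_bounded_support[OF kern_continuous])
  assume e: "\<epsilon> > 0"
  have "{x. kern \<epsilon> x \<noteq> 0} \<subseteq> {-\<epsilon>..\<epsilon>}"
  proof
    fix x assume "x \<in> {x. kern \<epsilon> x \<noteq> 0}"
    then show "x \<in> {-\<epsilon>..\<epsilon>}" using kern_eq_0[OF e, of x] by (cases "\<bar>x\<bar> \<ge> \<epsilon>") auto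
  qed
  then show "bounded {x. kern \<epsilon> x \<noteq> 0}" using bounded_closed_interval bounded_subset by blast
qed

lemma kern_integral: "\<epsilon> > 0 \<Longrightarrow> integral\<^sup>L lborel (kern \<epsilon>) = 1"
proof -
  assume e: "\<epsilon> > 0"
  have "integral\<^sup>L lborel kern0 = \<bar>1/\<epsilon>\<bar> *\<^sub>R (\<integral>x. kern0 (0 + (1/\<epsilon>) * x) \<partial>lborel)"
    by (rule lborel_integral_real_affine) (use e in simp)
  then have "(\<integral>x. kern0 (x / \<epsilon>) \<partial>lborel) = \<epsilon> * integral\<^sup>L lborel kern0"
    using e by (simp add: field_simps)
  then show ?thesis using e kern0_integral_pos by (simp add: kern_def[abs_def])
qed

lemma kern_shift_integral:
  assumes "\<epsilon> > 0"
  shows "(\<integral>t. kern \<epsilon> (s - t) \<partial>lborel) = 1" "integrable lborel (\<lambda>t. kern \<epsilon> (s - t))"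
proof -
  show "(\<integral>t. kern \<epsilon> (s - t) \<partial>lborel) = 1"
    using lborel_integral_real_affine[of "-1" "kern \<epsilon>" s] kern_integral[OF assms] by simp
  show "integrable lborel (\<lambda>t. kern \<epsilon> (s - t))"
    using lborel_integrable_real_affine[OF kern_integrable[OF assms], of "-1" s] by simp
qed

text \<open>A smoothed Heaviside function. Its constancy off the support of the kernel is what
  homotopy invariance rests on, and its bounds 0 and 1 are what the isoperimetric inequality rests
  on.\<close>

lemma kern_primitive:
  assumes e: "\<epsilon> > 0"
  obtains A where "\<And>s. (A has_real_derivative kern \<epsilon> s) (at s)" "\<And>s. s \<le> - \<epsilon> \<Longrightarrow> A s = 0"
    "\<And>s. s \<ge> \<epsilon> \<Longrightarrow> A s = 1" "\<And>s. 0 \<le> A s" "\<And>s. A s \<le> 1"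
proof -
  have "\<exists>F. \<forall>x :: real. -\<infinity> < ereal x \<longrightarrow> ereal x < \<infinity> \<longrightarrow> (F has_vector_derivative kern \<epsilon> x) (at x)"
    by (rule einterval_antiderivative) (use kern_continuous in \<open>auto simp: continuous_on_eq_continuous_at\<close>)
  then obtain F where F: "\<And>x. (F has_real_derivative kern \<epsilon> x) (at x)"
    by (auto simp: has_real_derivative_iff_has_vector_derivative)
  have mono: "F x \<le> F y" if "x \<le> y" for x y
    by (rule DERIV_nonneg_imp_nondecreasing[OF that]) (use F kern_nonneg[OF e] in blast)
  have "\<exists>c. \<forall>s\<in>{..- \<epsilon>}. F s = c"
  proof (rule has_field_derivative_zero_constant)
    show "(F has_real_derivative 0) (at s within {..- \<epsilon>})" if "s \<in> {..- \<epsilon>}" for s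
      using has_field_derivative_at_within[OF F[of s]] kern_eq_0[OF e, of s] that by auto
  qed simp
  then have left: "F s = F (- \<epsilon>)" if "s \<le> - \<epsilon>" for s using that by force
  have "\<exists>c. \<forall>s\<in>{\<epsilon>..}. F s = c"
  proof (rule has_field_derivative_zero_constant)
    show "(F has_real_derivative 0) (at s within {\<epsilon>..})" if "s \<in> {\<epsilon>..}" for s
      using has_field_derivative_at_within[OF F[of s]] kern_eq_0[OF e, of s] that by auto
  qed simp
  then have right: "F s = F \<epsilon>" if "s \<ge> \<epsilon>" for s using that by force
  have "(\<integral>x. kern \<epsilon> x * indicator {-\<epsilon>..\<epsilon>} x \<partial>lborel) = F \<epsilon> - F (- \<epsilon>)"
    by (rule integral_FTC_Icc_real) (use e F kern_continuous in \<open>auto simp: continuous_on_eq_continuous_at\<close>)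
  moreover have "kern \<epsilon> x * indicator {-\<epsilon>..\<epsilon>} x = kern \<epsilon> x" for x
    using kern_eq_0[OF e, of x] by (cases "\<bar>x\<bar> \<ge> \<epsilon>") (auto simp: indicator_def)
  ultimately have tot: "F \<epsilon> - F (- \<epsilon>) = 1" using kern_integral[OF e] by (simp only:)
  define A where "A s = F s - F (- \<epsilon>)" for s
  show thesis
  proof (rule that[of A])
    show "(A has_real_derivative kern \<epsilon> s) (at s)" for s
      unfolding A_def using DERIV_diff[OF F[of s] DERIV_const] by simp
    show L: "A s = 0" if "s \<le> - \<epsilon>" for s using left[OF that] by (simp add: A_def)
    show R: "A s = 1" if "s \<ge> \<epsilon>" for s using right[OF that] tot by (simp add: A_def)
    show "0 \<le> A s" for s using mono[of "-\<epsilon>" s] L[of s] by (cases "s \<le> - \<epsilon>") (auto simp: A_def)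
    show "A s \<le> 1" for s using mono[of s \<epsilon>] R[of s] tot by (cases "s \<ge> \<epsilon>") (auto simp: A_def)
  qed
qed

text \<open>Unfolds Lebesgue measure on the plane as the image of the product measure over the two
  basis vectors; the function \<open>h\<close> in the proof assigns \<open>a\<close> to one of them
  and \<open>b\<close> to the other.\<close>

lemma integral_product_vec2:
  fixes a b :: "real \<Rightarrow> real"
  assumes a: "integrable lborel a" and b: "integrable lborel b"
  shows "(\<integral>y. a (y $ 1) * b (y $ 2) \<partial>(lborel :: (real^2) measure)) = integral\<^sup>L lborel a * integral\<^sup>L lborel b"
    and "integrable (lborel :: (real^2) measure) (\<lambda>y. a (y $ 1) * b (y $ 2))"
proof -
  interpret P: product_sigma_finite "\<lambda>_::real^2. lborel :: real measure"
    by unfold_locales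
  let ?B = "Basis :: (real^2) set"
  define h where "h c = (if c = axis 1 1 then a else b)" for c :: "real^2"
  have B: "?B = {axis 1 1, axis 2 1}"
    by (auto simp: Basis_vec_def UNIV_2)
  have ne: "axis 1 1 \<noteq> (axis 2 1 :: real^2)" by (simp add: axis_eq_axis)
  have ih: "integrable lborel (h c)" for c using a b by (simp add: h_def)
  have [measurable]: "a \<in> borel_measurable borel" "b \<in> borel_measurable borel" using a b by auto
  have lb: "(lborel :: (real^2) measure) = distr (\<Pi>\<^sub>M c\<in>?B. lborel) borel (\<lambda>f. \<Sum>c\<in>?B. f c *\<^sub>R c)"
    unfolding lborel_eq_real by (rule lborel_def)
  have meas: "(\<lambda>f. \<Sum>c\<in>?B. f c *\<^sub>R c) \<in> measurable (\<Pi>\<^sub>M c\<in>?B. lborel) borel" by measurable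
  have prod: "a ((\<Sum>c\<in>?B. f c *\<^sub>R c) $ 1) * b ((\<Sum>c\<in>?B. f c *\<^sub>R c) $ 2) = (\<Prod>c\<in>?B. h c (f c))" for f
    using ne by (simp add: B h_def) (simp add: axis_def)
  show "(\<integral>y. a (y $ 1) * b (y $ 2) \<partial>(lborel :: (real^2) measure)) = integral\<^sup>L lborel a * integral\<^sup>L lborel b"
    unfolding lb
    apply (subst integral_distr[OF meas])
    apply measurable
    unfolding prod
    apply (subst P.product_integral_prod)
    using ih ne by (auto simp: B h_def)
  show "integrable (lborel :: (real^2) measure) (\<lambda>y. a (y $ 1) * b (y $ 2))"
    unfolding lb
    apply (subst integrable_distr_eq[OF meas])
    apply measurable
    unfolding prod
    by (rule P.product_integrable_prod) (use ih in auto)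
qed

text \<open>A product rather than a radial mollifier, because a primitive in either coordinate is
  then explicit: \<open>A (y $ 1 - z $ 1) * kern \<epsilon> (y $ 2 - z $ 2)\<close> for the first
  one.\<close>

definition prod_kernel :: "real \<Rightarrow> real^2 \<Rightarrow> real^2 \<Rightarrow> real" where
  "prod_kernel \<epsilon> z y = kern \<epsilon> (y $ 1 - z $ 1) * kern \<epsilon> (y $ 2 - z $ 2)"

lemma prod_kernel_shift: "prod_kernel \<epsilon> z y = prod_kernel \<epsilon> (z - a) (y - a)"
  by (simp add: prod_kernel_def)

lemma prod_kernel_nonneg: "\<epsilon> > 0 \<Longrightarrow> prod_kernel \<epsilon> z y \<ge> 0"
  by (simp add: prod_kernel_def kern_nonneg)

lemma prod_kernel_swap: "prod_kernel \<epsilon> z y = prod_kernel \<epsilon> y z"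
  using kern_minus[of \<epsilon> "y $ 1 - z $ 1"] kern_minus[of \<epsilon> "y $ 2 - z $ 2"] by (simp add: prod_kernel_def)

lemma prod_kernel_eq_0:
  assumes "\<epsilon> > 0" "norm (y - z) \<ge> 2 * \<epsilon>"
  shows "prod_kernel \<epsilon> z y = 0"
proof -
  have "norm (y - z) \<le> \<bar>y $ 1 - z $ 1\<bar> + \<bar>y $ 2 - z $ 2\<bar>"
    using norm_le_l1_cart[of "y - z"] by (simp add: sum_2)
  then have "\<bar>y $ 1 - z $ 1\<bar> \<ge> \<epsilon> \<or> \<bar>y $ 2 - z $ 2\<bar> \<ge> \<epsilon>" using assms by linarith
  then show ?thesis using kern_eq_0[OF assms(1)] by (auto simp: prod_kernel_def)
qed

lemma prod_kernel_continuous_comp: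
  assumes "continuous_on S f" "continuous_on S g"
  shows "continuous_on S (\<lambda>x. prod_kernel \<epsilon> (f x) (g x))"
  unfolding prod_kernel_def
  by (intro continuous_on_mult continuous_on_compose2[OF kern_continuous] continuous_on_diff continuous_on_component assms) auto

lemma prod_kernel_integral:
  assumes "\<epsilon> > 0"
  shows "(\<integral>z. prod_kernel \<epsilon> z y \<partial>lborel) = 1" "integrable lborel (\<lambda>z. prod_kernel \<epsilon> z y)" "(\<integral>y. prod_kernel \<epsilon> z y \<partial>lborel) = 1"
    "integrable lborel (prod_kernel \<epsilon> z)"
proof -
  show 1: "(\<integral>z. prod_kernel \<epsilon> z y \<partial>lborel) = 1" for y
    unfolding prod_kernel_def
    using integral_product_vec2(1)[OF kern_shift_integral(2)[OF assms] kern_shift_integral(2)[OF assms], of "y$1" "y$2"]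
    by (simp add: kern_shift_integral(1)[OF assms])
  show 2: "integrable lborel (\<lambda>z. prod_kernel \<epsilon> z y)" for y
    unfolding prod_kernel_def by (rule integral_product_vec2(2)[OF kern_shift_integral(2)[OF assms] kern_shift_integral(2)[OF assms]])
  show "(\<integral>y. prod_kernel \<epsilon> z y \<partial>lborel) = 1" using 1[of z] prod_kernel_swap[of \<epsilon> z] by simp
  have "prod_kernel \<epsilon> z = (\<lambda>y. prod_kernel \<epsilon> y z)" by (rule ext) (rule prod_kernel_swap)
  then show "integrable lborel (prod_kernel \<epsilon> z)" using 2[of z] by (simp only:)
qed

section \<open>The Jacobian pairing\<close>

definition C1_map :: "(real^2 \<Rightarrow> real^2) \<Rightarrow> bool" where
  "C1_map g \<longleftrightarrow> (\<forall>i. C_k 1 (\<lambda>x. g x $ i))"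

text \<open>The analytic degree. If \<open>\<theta>\<close> is a cutoff that varies only where
  \<open>g\<close> stays away from the support of \<open>\<zeta>\<close>, and that support is small,
  the value is the degree of \<open>g\<close> times the integral of \<open>\<zeta>\<close>.\<close>

definition jac_pair :: "(real^2 \<Rightarrow> real) \<Rightarrow> (real^2 \<Rightarrow> real^2) \<Rightarrow> (real^2 \<Rightarrow> real) \<Rightarrow> real" where
  "jac_pair \<theta> g \<zeta> = (\<integral>x. \<theta> x * \<zeta> (g x) * wedge (\<lambda>x. g x $ 1) (\<lambda>x. g x $ 2) x \<partial>lborel)"

lemma C1_mapD: "C1_map g \<Longrightarrow> C_k 1 (\<lambda>x. g x $ i)"
  by (simp add: C1_map_def)

lemma C1_map_continuous: "C1_map g \<Longrightarrow> continuous_on UNIV g"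
  by (intro continuous_at_imp_continuous_on ballI has_derivative_continuous[OF has_derivative_vec2] C1_mapD)

lemma jac_pair_integrable:
  assumes "continuous_on UNIV \<theta>" "bounded {x. \<theta> x \<noteq> 0}" "C1_map g" "continuous_on UNIV \<zeta>"
  shows "integrable lborel (\<lambda>x. \<theta> x * \<zeta> (g x) * wedge (\<lambda>x. g x $ 1) (\<lambda>x. g x $ 2) x)"
  using assms C1_map_continuous[OF assms(3)]
  by (intro integrable_continuous_bounded_support continuous_on_mult wedge_continuous C1_mapD bounded_support_mult1)
     (auto intro: continuous_on_compose2)

lemma fubini_prod_kernel:
  assumes e: "\<epsilon> > 0" and w: "continuous_on UNIV w" "bounded {x. w x \<noteq> 0}" and g: "continuous_on UNIV g"
    and z: "continuous_on UNIV \<zeta>" "bounded {x. \<zeta> x \<noteq> 0}"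
  shows "(\<integral>z. \<zeta> z * (\<integral>x. w x * prod_kernel \<epsilon> z (g x) \<partial>lborel) \<partial>lborel)
       = (\<integral>x. w x * (\<integral>z. \<zeta> z * prod_kernel \<epsilon> z (g x) \<partial>lborel) \<partial>(lborel :: (real^2) measure))"
proof -
  let ?F = "\<lambda>(z :: real^2, x :: real^2). \<zeta> z * (w x * prod_kernel \<epsilon> z (g x))"
  have "continuous_on UNIV (\<lambda>p::(real^2)\<times>(real^2). \<zeta> (fst p) * (w (snd p) * prod_kernel \<epsilon> (fst p) (g (snd p))))"
    by (intro continuous_on_mult prod_kernel_continuous_comp continuous_on_compose2[OF z(1)] continuous_on_compose2[OF w(1)]
       continuous_on_compose2[OF g] continuous_on_fst continuous_on_snd continuous_on_id) auto
  then have c: "continuous_on UNIV ?F" by (simp add: case_prod_beta)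
  have "bounded {p. ?F p \<noteq> 0}"
    by (rule bounded_subset[OF bounded_Times[OF z(2) w(2)]]) auto
  then have "integrable (lborel \<Otimes>\<^sub>M lborel) ?F"
    unfolding lborel_prod by (rule integrable_continuous_bounded_support[OF c])
  from lborel_pair.Fubini_integral[OF this]
  have "(\<integral>x. (\<integral>z. \<zeta> z * (w x * prod_kernel \<epsilon> z (g x)) \<partial>lborel) \<partial>lborel) = (\<integral>z. (\<integral>x. \<zeta> z * (w x * prod_kernel \<epsilon> z (g x)) \<partial>lborel) \<partial>lborel)"
    by simp
  moreover have "(\<integral>z. \<zeta> z * (w x * prod_kernel \<epsilon> z (g x)) \<partial>lborel) = w x * (\<integral>z. \<zeta> z * prod_kernel \<epsilon> z (g x) \<partial>lborel)" for x
  proof -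
    have "\<zeta> z * (w x * prod_kernel \<epsilon> z (g x)) = w x * (\<zeta> z * prod_kernel \<epsilon> z (g x))" for z by simp
    then show ?thesis by (simp only: integral_mult_right_zero)
  qed
  ultimately show ?thesis by (simp only: integral_mult_right_zero)
qed

lemma prod_kernel_average_close:
  assumes e: "\<epsilon> > 0" and z: "continuous_on UNIV \<zeta>" "bounded {x. \<zeta> x \<noteq> 0}"
    and d: "\<And>z. norm (z - y) < 2 * \<epsilon> \<Longrightarrow> \<bar>\<zeta> z - \<zeta> y\<bar> \<le> d"
  shows "\<bar>(\<integral>z. \<zeta> z * prod_kernel \<epsilon> z y \<partial>lborel) - \<zeta> y\<bar> \<le> d"
proof -
  have ck: "continuous_on UNIV (\<lambda>z. prod_kernel \<epsilon> z y)"
    by (intro prod_kernel_continuous_comp continuous_on_id continuous_on_const)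
  have i1: "integrable lborel (\<lambda>z. \<zeta> z * prod_kernel \<epsilon> z y)"
    by (intro integrable_continuous_bounded_support continuous_on_mult z ck bounded_support_mult1)
  have i2: "integrable lborel (\<lambda>z. c * prod_kernel \<epsilon> z y)" for c
    by (intro integrable_mult_right prod_kernel_integral e)
  have c: "(\<integral>z. c * prod_kernel \<epsilon> z y \<partial>lborel) = c" for c
    using prod_kernel_integral(1)[OF e, of y] by simp
  have "(\<integral>z. \<zeta> z * prod_kernel \<epsilon> z y \<partial>lborel) - \<zeta> y = (\<integral>z. \<zeta> z * prod_kernel \<epsilon> z y \<partial>lborel) - (\<integral>z. \<zeta> y * prod_kernel \<epsilon> z y \<partial>lborel)"
    by (simp only: c)
  also have "\<dots> = (\<integral>z. \<zeta> z * prod_kernel \<epsilon> z y - \<zeta> y * prod_kernel \<epsilon> z y \<partial>lborel)"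
    by (rule Bochner_Integration.integral_diff[symmetric]) (rule i1 i2)+
  finally have "\<bar>(\<integral>z. \<zeta> z * prod_kernel \<epsilon> z y \<partial>lborel) - \<zeta> y\<bar> = \<bar>\<integral>z. \<zeta> z * prod_kernel \<epsilon> z y - \<zeta> y * prod_kernel \<epsilon> z y \<partial>lborel\<bar>"
    by (simp only:)
  also have "\<dots> \<le> (\<integral>z. \<bar>\<zeta> z * prod_kernel \<epsilon> z y - \<zeta> y * prod_kernel \<epsilon> z y\<bar> \<partial>lborel)"
    by (rule integral_abs_bound)
  also have "\<dots> \<le> (\<integral>z. d * prod_kernel \<epsilon> z y \<partial>lborel)"
  proof (rule integral_mono[OF _ i2])
    show "integrable lborel (\<lambda>z. \<bar>\<zeta> z * prod_kernel \<epsilon> z y - \<zeta> y * prod_kernel \<epsilon> z y\<bar>)"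
      by (intro integrable_abs Bochner_Integration.integrable_diff i1 i2)
    fix z
    show "\<bar>\<zeta> z * prod_kernel \<epsilon> z y - \<zeta> y * prod_kernel \<epsilon> z y\<bar> \<le> d * prod_kernel \<epsilon> z y"
    proof (cases "norm (z - y) < 2 * \<epsilon>")
      case True
      from mult_right_mono[OF d[OF True] prod_kernel_nonneg[OF e, of z y]] show ?thesis
        using prod_kernel_nonneg[OF e, of z y] by (simp add: left_diff_distrib[symmetric] abs_mult)
    next
      case False
      then have "prod_kernel \<epsilon> z y = 0" by (intro prod_kernel_eq_0 e) (simp add: norm_minus_commute)
      then show ?thesis by simp
    qed
  qed
  also have "\<dots> = d" by (rule c)
  finally show ?thesis .
qed

text \<open>By Fubini, superposing the pairings with translated kernels is the pairing with an
  average of \<open>\<zeta>\<close>, which tends to \<open>\<zeta>\<close>. Statements about kernels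
  thereby extend to all continuous \<open>\<zeta>\<close> of bounded support.\<close>

lemma jac_pair_prod_kernel_limit:
  assumes t: "continuous_on UNIV \<theta>" "bounded {x. \<theta> x \<noteq> 0}" and g: "C1_map g"
    and z: "continuous_on UNIV \<zeta>" "bounded {x. \<zeta> x \<noteq> 0}"
    and \<epsilon>: "\<epsilon> \<longlonglongrightarrow> 0" "\<And>n. \<epsilon> n > 0"
  shows "(\<lambda>n. \<integral>z. \<zeta> z * jac_pair \<theta> g (prod_kernel (\<epsilon> n) z) \<partial>lborel) \<longlonglongrightarrow> jac_pair \<theta> g \<zeta>"
proof -
  let ?J = "wedge (\<lambda>x. g x $ 1) (\<lambda>x. g x $ 2)"
  let ?w = "\<lambda>x. \<theta> x * ?J x"
  have cg: "continuous_on UNIV g" by (rule C1_map_continuous[OF g])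
  have w: "continuous_on UNIV ?w" "bounded {x. ?w x \<noteq> 0}"
    by (intro continuous_on_mult t wedge_continuous C1_mapD g bounded_support_mult1)+
  have eq: "(\<integral>z. \<zeta> z * jac_pair \<theta> g (prod_kernel (\<epsilon> n) z) \<partial>lborel) = (\<integral>x. ?w x * (\<integral>z. \<zeta> z * prod_kernel (\<epsilon> n) z (g x) \<partial>lborel) \<partial>lborel)" for n
    using fubini_prod_kernel[OF \<epsilon>(2) w cg z, of n] unfolding jac_pair_def
    by (simp add: mult_ac)
  obtain B where B: "B > 0" "\<And>x. \<bar>\<zeta> x\<bar> \<le> B" using bounded_supportE[OF z] by metis
  have mz[measurable]: "\<zeta> \<in> borel_measurable borel" "g \<in> borel_measurable borel" "\<theta> \<in> borel_measurable borel" "?J \<in> borel_measurable borel"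
    by (intro borel_measurable_continuous_onI z cg t wedge_continuous C1_mapD g)+
  have zz: "continuous_on UNIV (\<lambda>p::(real^2)\<times>(real^2). \<zeta> (snd p) * prod_kernel (\<epsilon> n) (snd p) (g (fst p)))" for n
    by (intro continuous_on_mult prod_kernel_continuous_comp continuous_on_compose2[OF z(1)] 
       continuous_on_compose2[OF cg] continuous_on_fst continuous_on_snd continuous_on_id) auto
  have "(\<lambda>(x, z). \<zeta> z * prod_kernel (\<epsilon> n) z (g x)) \<in> borel_measurable (lborel \<Otimes>\<^sub>M lborel)" for n
    using borel_measurable_continuous_onI[OF zz[of n]] by (simp add: case_prod_beta lborel_prod)
  then have mi[measurable]: "(\<lambda>x. \<integral>z. \<zeta> z * prod_kernel (\<epsilon> n) z (g x) \<partial>lborel) \<in> borel_measurable lborel" for n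
    by (rule lborel.borel_measurable_lebesgue_integral)
  have "(\<lambda>n. \<integral>x. ?w x * (\<integral>z. \<zeta> z * prod_kernel (\<epsilon> n) z (g x) \<partial>lborel) \<partial>lborel) \<longlonglongrightarrow> (\<integral>x. ?w x * \<zeta> (g x) \<partial>lborel)"
  \<comment> \<open>The average of \<open>\<zeta>\<close> differs from a value of
    \<open>\<zeta>\<close> by at most \<open>2 * B\<close>, and that value is at most
    \<open>B\<close>; hence the factor 3.\<close>
  proof (rule integral_dominated_convergence[where w="\<lambda>x. \<bar>?w x\<bar> * (3 * B)"])
    show "(\<lambda>x. ?w x * \<zeta> (g x)) \<in> borel_measurable lborel" by measurable
    show "(\<lambda>x. ?w x * (\<integral>z. \<zeta> z * prod_kernel (\<epsilon> n) z (g x) \<partial>lborel)) \<in> borel_measurable lborel" for n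
      by (intro borel_measurable_times mi) measurable
    show "integrable lborel (\<lambda>x. \<bar>?w x\<bar> * (3 * B))"
      by (intro integrable_mult_left integrable_abs integrable_continuous_bounded_support w)
    show "AE x in lborel. (\<lambda>n. ?w x * (\<integral>z. \<zeta> z * prod_kernel (\<epsilon> n) z (g x) \<partial>lborel)) \<longlonglongrightarrow> ?w x * \<zeta> (g x)"
    proof (intro AE_I2 tendsto_mult tendsto_const)
      fix x
      show "(\<lambda>n. \<integral>z. \<zeta> z * prod_kernel (\<epsilon> n) z (g x) \<partial>lborel) \<longlonglongrightarrow> \<zeta> (g x)"
      proof (rule LIMSEQ_I)
        fix r :: real assume r: "r > 0"
        obtain d where d: "d > 0" "\<And>x y. norm (y - x) < d \<Longrightarrow> \<bar>\<zeta> y - \<zeta> x\<bar> < r / 2"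
          using uniformly_continuous_bounded_supportE[OF z, of "r/2"] r by auto
        have "\<forall>\<^sub>F n in sequentially. \<epsilon> n < d / 2" by (rule order_tendstoD(2)[OF \<epsilon>(1)]) (use d in simp)
        then have "\<forall>\<^sub>F n in sequentially. norm ((\<integral>z. \<zeta> z * prod_kernel (\<epsilon> n) z (g x) \<partial>lborel) - \<zeta> (g x)) < r"
        proof eventually_elim
          case (elim n)
          have "\<bar>(\<integral>z. \<zeta> z * prod_kernel (\<epsilon> n) z (g x) \<partial>lborel) - \<zeta> (g x)\<bar> \<le> r / 2"
          proof (rule prod_kernel_average_close[OF \<epsilon>(2) z])
            fix z assume "norm (z - g x) < 2 * \<epsilon> n"
            then have "norm (z - g x) < d" using elim by linarith
            then show "\<bar>\<zeta> z - \<zeta> (g x)\<bar> \<le> r / 2" using d(2) less_imp_le by blast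
          qed
          then show ?case using r by simp
        qed
        then show "\<exists>no. \<forall>n\<ge>no. norm ((\<integral>z. \<zeta> z * prod_kernel (\<epsilon> n) z (g x) \<partial>lborel) - \<zeta> (g x)) < r"
          by (simp add: eventually_sequentially)
      qed
    qed
    show "AE x in lborel. norm (?w x * (\<integral>z. \<zeta> z * prod_kernel (\<epsilon> n) z (g x) \<partial>lborel)) \<le> \<bar>?w x\<bar> * (3 * B)" for n
    proof (intro AE_I2)
      fix x
      have "\<bar>(\<integral>z. \<zeta> z * prod_kernel (\<epsilon> n) z (g x) \<partial>lborel) - \<zeta> (g x)\<bar> \<le> 2 * B"
      proof (rule prod_kernel_average_close[OF \<epsilon>(2) z])
        fix z show "\<bar>\<zeta> z - \<zeta> (g x)\<bar> \<le> 2 * B" using B(2)[of z] B(2)[of "g x"] by linarith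
      qed
      then have "\<bar>\<integral>z. \<zeta> z * prod_kernel (\<epsilon> n) z (g x) \<partial>lborel\<bar> \<le> 3 * B" using B(2)[of "g x"] by linarith
      from mult_left_mono[OF this abs_ge_zero[of "?w x"]]
      show "norm (?w x * (\<integral>z. \<zeta> z * prod_kernel (\<epsilon> n) z (g x) \<partial>lborel)) \<le> \<bar>?w x\<bar> * (3 * B)"
        by (simp only: real_norm_def abs_mult)
    qed
  qed
  moreover have "(\<integral>x. ?w x * \<zeta> (g x) \<partial>lborel) = jac_pair \<theta> g \<zeta>"
    unfolding jac_pair_def by (simp add: mult_ac)
  ultimately show ?thesis unfolding eq by simp
qed

section \<open>Homotopy invariance\<close>

lemma C1_of_coordinate:
  assumes "\<And>s. (r has_real_derivative r' s) (at s)" "continuous_on UNIV r'"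
  shows "C_k 1 (\<lambda>y. r (y $ i - c))" "part_deriv j (\<lambda>y. r (y $ i - c)) y = (if j = i then r' (y $ i - c) else 0)"
proof -
  have u: "C_k 1 (\<lambda>y. y $ i - c)" by (intro C_k_diff C_k_nth C_k_const)
  have "part_deriv j (\<lambda>y. y $ i - c) y = (if j = i then 1 else 0)"
  proof -
    have "((\<lambda>y. y $ i - c) has_derivative (\<lambda>h. h $ i - 0)) (at y)"
      by (intro has_derivative_diff has_derivative_const bounded_linear_imp_has_derivative bounded_linear_vec_nth)
    from part_derivI[OF this, of j] show ?thesis by (auto simp: axis_def)
  qed
  then show "C_k 1 (\<lambda>y. r (y $ i - c))" "part_deriv j (\<lambda>y. r (y $ i - c)) y = (if j = i then r' (y $ i - c) else 0)"
    using C1_compose_real[OF u assms] by auto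
qed

text \<open>The kernel is the first partial derivative of \<open>X1\<close> and the second of
  \<open>X2\<close>. After integration by parts only derivatives of \<open>\<theta>\<close> remain,
  so just the region where the cutoff varies matters. The first formula is free of derivatives of
  \<open>g x $ 1\<close>, the second of those of \<open>g x $ 2\<close>.\<close>

lemma jac_pair_prod_kernel:
  assumes e: "\<epsilon> > 0" and t: "C_k 1 \<theta>" "bounded {x. \<theta> x \<noteq> 0}" and g: "C1_map g"
    and A: "\<And>s. (A has_real_derivative kern \<epsilon> s) (at s)"
  shows "jac_pair \<theta> g (prod_kernel \<epsilon> z) = - (\<integral>x. A (g x $ 1 - z $ 1) * kern \<epsilon> (g x $ 2 - z $ 2) * wedge \<theta> (\<lambda>x. g x $ 2) x \<partial>lborel)"
    and "jac_pair \<theta> g (prod_kernel \<epsilon> z) = (\<integral>x. A (g x $ 2 - z $ 2) * kern \<epsilon> (g x $ 1 - z $ 1) * wedge \<theta> (\<lambda>x. g x $ 1) x \<partial>lborel)"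
proof -
  obtain k' where k': "\<And>s. (kern \<epsilon> has_real_derivative k' s) (at s)" "continuous_on UNIV k'"
    using kern_deriv by metis
  note CA = C1_of_coordinate[OF A kern_continuous]
  note CK = C1_of_coordinate[OF k']
  define X1 where "X1 y = A (y $ 1 - z $ 1) * kern \<epsilon> (y $ 2 - z $ 2)" for y :: "real^2"
  define X2 where "X2 y = A (y $ 2 - z $ 2) * kern \<epsilon> (y $ 1 - z $ 1)" for y :: "real^2"
  have c1: "C_k 1 X1" "C_k 1 X2"
    unfolding X1_def[abs_def] X2_def[abs_def] by (intro C_k_mult CA CK)+
  have p1: "part_deriv 1 X1 y = prod_kernel \<epsilon> z y" for y
    unfolding X1_def[abs_def]
    by (subst part_deriv_mult) (use CA(1) CK(1) in \<open>auto simp: CA(2) CK(2) prod_kernel_def\<close>)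
  have p2: "part_deriv 2 X2 y = prod_kernel \<epsilon> z y" for y
    unfolding X2_def[abs_def]
    by (subst part_deriv_mult) (use CA(1) CK(1) in \<open>auto simp: CA(2) CK(2) prod_kernel_def\<close>)
  note gi = C1_mapD[OF g]
  have "jac_pair \<theta> g (prod_kernel \<epsilon> z) = (\<integral>x. \<theta> x * wedge (\<lambda>x. X1 (g x)) (\<lambda>x. g x $ 2) x \<partial>lborel)"
    unfolding jac_pair_def wedge_compose(1)[OF c1(1) gi] p1 by (simp only: mult.assoc)
  also have "\<dots> = - (\<integral>x. X1 (g x) * wedge \<theta> (\<lambda>x. g x $ 2) x \<partial>lborel)"
    by (rule wedge_by_parts[OF t(1) C1_compose(1)[OF c1(1) gi] gi t(2)])
  finally show "jac_pair \<theta> g (prod_kernel \<epsilon> z) = - (\<integral>x. A (g x $ 1 - z $ 1) * kern \<epsilon> (g x $ 2 - z $ 2) * wedge \<theta> (\<lambda>x. g x $ 2) x \<partial>lborel)"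
    by (simp only: X1_def)
  have "jac_pair \<theta> g (prod_kernel \<epsilon> z) = (\<integral>x. \<theta> x * wedge (\<lambda>x. g x $ 1) (\<lambda>x. X2 (g x)) x \<partial>lborel)"
    unfolding jac_pair_def wedge_compose(2)[OF c1(2) gi] p2 by (simp only: mult.assoc)
  also have "\<dots> = (\<integral>x. - (\<theta> x * wedge (\<lambda>x. X2 (g x)) (\<lambda>x. g x $ 1) x) \<partial>lborel)"
    by (intro Bochner_Integration.integral_cong refl) (simp add: wedge_def algebra_simps)
  also have "\<dots> = - (\<integral>x. \<theta> x * wedge (\<lambda>x. X2 (g x)) (\<lambda>x. g x $ 1) x \<partial>lborel)" by (rule integral_minus)
  also have "\<dots> = (\<integral>x. X2 (g x) * wedge \<theta> (\<lambda>x. g x $ 1) x \<partial>lborel)"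
    by (simp only: wedge_by_parts[OF t(1) C1_compose(1)[OF c1(2) gi] gi t(2)] minus_minus)
  finally show "jac_pair \<theta> g (prod_kernel \<epsilon> z) = (\<integral>x. A (g x $ 2 - z $ 2) * kern \<epsilon> (g x $ 1 - z $ 1) * wedge \<theta> (\<lambda>x. g x $ 1) x \<partial>lborel)"
    by (simp only: X2_def)
qed

text \<open>The horizontal segment from (a, b) to (a', b) lies in the ball of radius
  \<open>R\<close> about \<open>F\<close> by convexity. If it met the square of half-width
  \<open>\<epsilon>\<close> about \<open>z\<close>, then \<open>z\<close> would be within
  \<open>R + 2 * \<epsilon>\<close> of \<open>F\<close>. So both ends lie on the same side of the
  square.\<close>

lemma segment_avoids_same_side:
  fixes a a' b c \<epsilon> :: real and F z :: "real^2"
  assumes e: "\<epsilon> > 0" and b: "\<bar>b - z $ 2\<bar> < \<epsilon>"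
    and a: "sqrt ((a - F $ 1)\<^sup>2 + (b - F $ 2)\<^sup>2) \<le> R" "sqrt ((a' - F $ 1)\<^sup>2 + (b - F $ 2)\<^sup>2) \<le> R"
    and R: "R + 2 * \<epsilon> < norm (z - F)"
  shows "(a \<ge> z $ 1 + \<epsilon> \<and> a' \<ge> z $ 1 + \<epsilon>) \<or> (a \<le> z $ 1 - \<epsilon> \<and> a' \<le> z $ 1 - \<epsilon>)"
proof (rule ccontr)
  assume n: "\<not> ?thesis"
  \<comment> \<open>A point of the segment inside the strip: the smaller end if it has already
    entered the strip, otherwise the larger end clipped at \<open>z $ 1\<close>.\<close>
  obtain s where s: "min a a' \<le> s" "s \<le> max a a'" "\<bar>s - z $ 1\<bar> < \<epsilon>"
  proof (cases "min a a' > z $ 1 - \<epsilon>")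
    case True
    then show thesis using that[of "min a a'"] n e by (auto simp: min_def max_def abs_if split: if_splits)
  next
    case False
    then show thesis using that[of "min (max a a') (z $ 1)"] n e by (auto simp: min_def max_def abs_if split: if_splits)
  qed
  have "(s - F $ 1)\<^sup>2 \<le> (a - F $ 1)\<^sup>2 \<or> (s - F $ 1)\<^sup>2 \<le> (a' - F $ 1)\<^sup>2"
    unfolding abs_le_square_iff[symmetric] using s by (auto simp: abs_if min_def max_def split: if_splits)
  then have "sqrt ((s - F $ 1)\<^sup>2 + (b - F $ 2)\<^sup>2) \<le> R"
    using a by (meson add_right_mono order_trans real_sqrt_le_mono)
  moreover define p where "p = (vector [s, b] :: real^2)"
  ultimately have "norm (p - F) \<le> R" by (simp add: norm_vec_def L2_set_def sum_2 p_def)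
  moreover have "norm (z - p) < 2 * \<epsilon>"
    using norm_le_l1_cart[of "z - p"] s(3) b by (simp add: sum_2 p_def)
  ultimately show False using R norm_triangle_ineq[of "z - p" "p - F"] by simp
qed

lemma part_deriv_nonzero_wedge:
  "(\<And>i. part_deriv i \<theta> x = 0) \<Longrightarrow> wedge \<theta> v x = 0"
  by (simp add: wedge_def)

text \<open>In the first formula for the pairing, \<open>g\<close> and \<open>g'\<close> share the
  kernel factor and the wedge. Only the values of \<open>A\<close> could differ, and where the other
  factors are nonzero both arguments lie on the same side of the kernel, where \<open>A\<close> is
  constant.\<close>

lemma jac_pair_homotopy1:
  assumes e: "\<epsilon> > 0" and t: "C_k 1 \<theta>" "bounded {x. \<theta> x \<noteq> 0}" and g: "C1_map g" "C1_map g'"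
    and eq: "\<And>x. g x $ 2 = g' x $ 2"
    and S: "\<And>x i. part_deriv i \<theta> x \<noteq> 0 \<Longrightarrow> norm (g x - F x) \<le> R x \<and> norm (g' x - F x) \<le> R x \<and> R x + 2 * \<epsilon> < norm (z - F x)"
  shows "jac_pair \<theta> g (prod_kernel \<epsilon> z) = jac_pair \<theta> g' (prod_kernel \<epsilon> z)"
proof -
  obtain A where A: "\<And>s. (A has_real_derivative kern \<epsilon> s) (at s)" "\<And>s. s \<le> - \<epsilon> \<Longrightarrow> A s = 0"
    "\<And>s. s \<ge> \<epsilon> \<Longrightarrow> A s = 1" using kern_primitive[OF e] by metis
  have "A (g x $ 1 - z $ 1) * kern \<epsilon> (g x $ 2 - z $ 2) * wedge \<theta> (\<lambda>x. g x $ 2) x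
      = A (g' x $ 1 - z $ 1) * kern \<epsilon> (g' x $ 2 - z $ 2) * wedge \<theta> (\<lambda>x. g' x $ 2) x" for x
  proof (cases "(\<exists>i. part_deriv i \<theta> x \<noteq> 0) \<and> \<bar>g x $ 2 - z $ 2\<bar> < \<epsilon>")
    case True
    then obtain i where i: "part_deriv i \<theta> x \<noteq> 0" by blast
    have n: "norm (h - F x) = sqrt ((h $ 1 - F x $ 1)\<^sup>2 + (h $ 2 - F x $ 2)\<^sup>2)" for h
      by (simp add: norm_vec_def L2_set_def sum_2)
    have "(g x $ 1 \<ge> z $ 1 + \<epsilon> \<and> g' x $ 1 \<ge> z $ 1 + \<epsilon>) \<or> (g x $ 1 \<le> z $ 1 - \<epsilon> \<and> g' x $ 1 \<le> z $ 1 - \<epsilon>)"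
      by (rule segment_avoids_same_side[OF e, of "g x $ 2" z _ "F x" "R x"])
         (use True S[OF i] n[of "g x"] n[of "g' x"] eq[of x] in auto)
    then have "A (g x $ 1 - z $ 1) = A (g' x $ 1 - z $ 1)"
      using A(2,3) by (metis add.commute add_le_imp_le_diff diff_le_eq uminus_add_conv_diff diff_conv_add_uminus)
    then show ?thesis by (simp add: eq)
  next
    case False
    then show ?thesis
      using kern_eq_0[OF e, of "g x $ 2 - z $ 2"] part_deriv_nonzero_wedge[of \<theta> x] eq[of x] by fastforce
  qed
  then show ?thesis
    unfolding jac_pair_prod_kernel(1)[OF e t g(1) A(1)] jac_pair_prod_kernel(1)[OF e t g(2) A(1)] by (simp only:)
qed

lemma jac_pair_homotopy2:
  assumes e: "\<epsilon> > 0" and t: "C_k 1 \<theta>" "bounded {x. \<theta> x \<noteq> 0}" and g: "C1_map g" "C1_map g'"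
    and eq: "\<And>x. g x $ 1 = g' x $ 1"
    and S: "\<And>x i. part_deriv i \<theta> x \<noteq> 0 \<Longrightarrow> norm (g x - F x) \<le> R x \<and> norm (g' x - F x) \<le> R x \<and> R x + 2 * \<epsilon> < norm (z - F x)"
  shows "jac_pair \<theta> g (prod_kernel \<epsilon> z) = jac_pair \<theta> g' (prod_kernel \<epsilon> z)"
proof -
  obtain A where A: "\<And>s. (A has_real_derivative kern \<epsilon> s) (at s)" "\<And>s. s \<le> - \<epsilon> \<Longrightarrow> A s = 0"
    "\<And>s. s \<ge> \<epsilon> \<Longrightarrow> A s = 1" using kern_primitive[OF e] by metis
  \<comment> \<open>Exchanging the coordinates turns the vertical segment into the horizontal one
    that has been treated.\<close>
  let ?sw = "\<lambda>h::real^2. vector [h $ 2, h $ 1] :: real^2"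
  have nsw: "norm (?sw h - ?sw k) = norm (h - k)" for h k
    by (simp add: norm_vec_def L2_set_def sum_2 add.commute)
  have "A (g x $ 2 - z $ 2) * kern \<epsilon> (g x $ 1 - z $ 1) * wedge \<theta> (\<lambda>x. g x $ 1) x
      = A (g' x $ 2 - z $ 2) * kern \<epsilon> (g' x $ 1 - z $ 1) * wedge \<theta> (\<lambda>x. g' x $ 1) x" for x
  proof (cases "(\<exists>i. part_deriv i \<theta> x \<noteq> 0) \<and> \<bar>g x $ 1 - z $ 1\<bar> < \<epsilon>")
    case True
    then obtain i where i: "part_deriv i \<theta> x \<noteq> 0" by blast
    have n: "norm (h - F x) = sqrt ((h $ 2 - F x $ 2)\<^sup>2 + (h $ 1 - F x $ 1)\<^sup>2)" for h
      by (simp add: norm_vec_def L2_set_def sum_2 add.commute)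
    have "(g x $ 2 \<ge> ?sw z $ 1 + \<epsilon> \<and> g' x $ 2 \<ge> ?sw z $ 1 + \<epsilon>) \<or> (g x $ 2 \<le> ?sw z $ 1 - \<epsilon> \<and> g' x $ 2 \<le> ?sw z $ 1 - \<epsilon>)"
      by (rule segment_avoids_same_side[OF e, of "g x $ 1" _ _ "?sw (F x)" "R x"])
         (use True S[OF i] n[of "g x"] n[of "g' x"] nsw[of z "F x"] eq[of x] in auto)
    then have "A (g x $ 2 - z $ 2) = A (g' x $ 2 - z $ 2)"
      using A(2)[of "g x $ 2 - z $ 2"] A(3)[of "g x $ 2 - z $ 2"] A(2)[of "g' x $ 2 - z $ 2"] A(3)[of "g' x $ 2 - z $ 2"]
      by auto
    then show ?thesis by (simp add: eq)
  next
    case False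
    then show ?thesis
      using kern_eq_0[OF e, of "g x $ 1 - z $ 1"] part_deriv_nonzero_wedge[of \<theta> x] eq[of x] by fastforce
  qed
  then show ?thesis
    unfolding jac_pair_prod_kernel(2)[OF e t g(1) A(1)] jac_pair_prod_kernel(2)[OF e t g(2) A(1)] by (simp only:)
qed

text \<open>The straight homotopy from \<open>g\<close> to \<open>g'\<close> is replaced by moving one coordinate at a time, since the pairing
  with a product kernel has a primitive in each single coordinate.\<close>

lemma jac_pair_homotopy:
  assumes e: "\<epsilon> > 0" and t: "C_k 1 \<theta>" "bounded {x. \<theta> x \<noteq> 0}" and g: "C1_map g" "C1_map g'"
    and S: "\<And>x i. part_deriv i \<theta> x \<noteq> 0 \<Longrightarrow> norm (g x - F x) + norm (g' x - F x) + 2 * \<epsilon> < norm (z - F x)"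
  shows "jac_pair \<theta> g (prod_kernel \<epsilon> z) = jac_pair \<theta> g' (prod_kernel \<epsilon> z)"
proof -
  define h where "h x = (vector [g' x $ 1, g x $ 2] :: real^2)" for x
  have h: "C1_map h"
    unfolding C1_map_def h_def using C1_mapD[OF g(1)] C1_mapD[OF g(2)] by (auto simp: forall_2)
  let ?R = "\<lambda>x. norm (g x - F x) + norm (g' x - F x)"
  \<comment> \<open>The intermediate map takes one coordinate from each of \<open>g\<close> and
    \<open>g'\<close>, so its distance to \<open>F\<close> is bounded by the sum of theirs. This is
    why the hypothesis contains a sum.\<close>
  have hR: "norm (h x - F x) \<le> ?R x" for x
  proof -
    have "norm (h x - F x) \<le> \<bar>(g' x - F x) $ 1\<bar> + \<bar>(g x - F x) $ 2\<bar>"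
      using norm_le_l1_cart[of "h x - F x"] by (simp add: sum_2 h_def)
    then show ?thesis
      using component_le_norm_cart[of "g' x - F x" 1] component_le_norm_cart[of "g x - F x" 2] by linarith
  qed
  have "jac_pair \<theta> g (prod_kernel \<epsilon> z) = jac_pair \<theta> h (prod_kernel \<epsilon> z)"
    by (rule jac_pair_homotopy1[OF e t g(1) h, where F=F and R="?R"]) (use hR S in \<open>auto simp: h_def\<close>)
  also have "\<dots> = jac_pair \<theta> g' (prod_kernel \<epsilon> z)"
    by (rule jac_pair_homotopy2[OF e t h g(2), where F=F and R="?R"]) (use hR S in \<open>auto simp: h_def\<close>)
  finally show ?thesis .
qed

section \<open>Local constancy of the degree\<close>

lemma part_deriv_plus_const: "u differentiable (at x) \<Longrightarrow> part_deriv i (\<lambda>x. u x + c) x = part_deriv i u x"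
  by (subst part_deriv_add) (simp_all add: part_deriv_const)

lemma C1_map_shift:
  assumes g: "C1_map g"
  shows "C1_map (\<lambda>x. g x + c)"
    "wedge (\<lambda>x. (g x + c) $ 1) (\<lambda>x. (g x + c) $ 2) x = wedge (\<lambda>x. g x $ 1) (\<lambda>x. g x $ 2) x"
proof -
  show "C1_map (\<lambda>x. g x + c)"
    unfolding C1_map_def vector_add_component by (intro allI C_k_add C_k_const C1_mapD g)
  have d: "(\<lambda>x. g x $ i) differentiable (at x)" for i using C1_differentiable[OF C1_mapD[OF g]] .
  show "wedge (\<lambda>x. (g x + c) $ 1) (\<lambda>x. (g x + c) $ 2) x = wedge (\<lambda>x. g x $ 1) (\<lambda>x. g x $ 2) x"
    unfolding vector_add_component wedge_def by (simp add: part_deriv_plus_const d)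
qed

lemma jac_pair_prod_kernel_shift:
  assumes g: "C1_map g"
  shows "jac_pair \<theta> g (prod_kernel \<epsilon> z) = jac_pair \<theta> (\<lambda>x. g x + (z0 - z)) (prod_kernel \<epsilon> z0)"
proof -
  have "prod_kernel \<epsilon> z (g x) = prod_kernel \<epsilon> z0 (g x + (z0 - z))" for x
    using prod_kernel_shift[of \<epsilon> z "g x" "z - z0"] by (simp add: algebra_simps)
  then show ?thesis unfolding jac_pair_def C1_map_shift(2)[OF g] by (simp only:)
qed

text \<open>Moving the centre of a kernel amounts to translating the map, which is a homotopy that
  keeps the region of varying \<open>\<theta>\<close> away from the kernel. The pairing with a small
  kernel is therefore independent of its centre, and superposition gives a constant times the
  integral of \<open>\<zeta>\<close>.\<close>

lemma degree_locally_constant: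
  assumes t: "C_k 1 \<theta>" "bounded {x. \<theta> x \<noteq> 0}" and g: "C1_map g" and r: "r > 0"
    and S: "\<And>x i. part_deriv i \<theta> x \<noteq> 0 \<Longrightarrow> norm (g x - z0) \<ge> 4 * r"
    and z: "continuous_on UNIV \<zeta>" "\<And>y. \<zeta> y \<noteq> 0 \<Longrightarrow> norm (y - z0) < r"
  shows "jac_pair \<theta> g \<zeta> = jac_pair \<theta> g (prod_kernel (r/2) z0) * integral\<^sup>L lborel \<zeta>"
proof -
  define \<epsilon> where "\<epsilon> n = (r/2) * step_seq n" for n
  have e1: "\<epsilon> \<longlonglongrightarrow> 0" unfolding \<epsilon>_def by (rule tendsto_mult_right_zero[OF step_seq(1)])
  have "\<epsilon> n > 0" "\<epsilon> n \<le> r / 2" for n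
    using mult_left_le[of "step_seq n" "r/2"] step_seq(3)[of n] step_seq(4)[of n] r by (auto simp: \<epsilon>_def)
  note e = e1 this
  have ct: "continuous_on UNIV \<theta>" by (rule C_k_continuous[OF t(1)])
  have loc: "jac_pair \<theta> g (prod_kernel \<delta> z) = jac_pair \<theta> g (prod_kernel \<delta> z0)"
    if d: "\<delta> > 0" "\<delta> \<le> r/2" and z: "norm (z - z0) < r" for \<delta> z
  proof -
    have "jac_pair \<theta> g (prod_kernel \<delta> z) = jac_pair \<theta> (\<lambda>x. g x + (z0 - z)) (prod_kernel \<delta> z0)"
      by (rule jac_pair_prod_kernel_shift[OF g])
    also have "\<dots> = jac_pair \<theta> g (prod_kernel \<delta> z0)"
    proof (rule jac_pair_homotopy[OF d(1) t C1_map_shift(1)[OF g] g, where F=g])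
      fix x i assume "part_deriv i \<theta> x \<noteq> 0"
      from S[OF this] show "norm (g x + (z0 - z) - g x) + norm (g x - g x) + 2 * \<delta> < norm (z0 - g x)"
        using z d r by (simp add: norm_minus_commute)
    qed
    finally show ?thesis .
  qed
  have lim: "(\<lambda>n. jac_pair \<theta> g (prod_kernel (\<epsilon> n) z0) * integral\<^sup>L lborel \<eta>) \<longlonglongrightarrow> jac_pair \<theta> g \<eta>"
    if h: "continuous_on UNIV \<eta>" "\<And>y. \<eta> y \<noteq> 0 \<Longrightarrow> norm (y - z0) < r" for \<eta>
  proof -
    have b: "bounded {y. \<eta> y \<noteq> 0}"
      by (rule bounded_subset[of "ball z0 r"]) (use h in \<open>auto simp: dist_norm norm_minus_commute\<close>)
    have "\<eta> z * jac_pair \<theta> g (prod_kernel (\<epsilon> n) z) = \<eta> z * jac_pair \<theta> g (prod_kernel (\<epsilon> n) z0)" for z n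
      using loc[OF e(2,3), of z n] h(2)[of z] by (cases "\<eta> z = 0") auto
    then have "(\<integral>z. \<eta> z * jac_pair \<theta> g (prod_kernel (\<epsilon> n) z) \<partial>lborel) = jac_pair \<theta> g (prod_kernel (\<epsilon> n) z0) * integral\<^sup>L lborel \<eta>" for n
      by (simp only: integral_mult_left_zero mult.commute)
    then show ?thesis
      using jac_pair_prod_kernel_limit[OF ct t(2) g h(1) b e(1,2)] by (simp only:)
  qed
  \<comment> \<open>The constant is identified by testing with one fixed kernel, whose integral is
    1.\<close>
  have "(\<lambda>n. jac_pair \<theta> g (prod_kernel (\<epsilon> n) z0) * integral\<^sup>L lborel (prod_kernel (r/2) z0)) \<longlonglongrightarrow> jac_pair \<theta> g (prod_kernel (r/2) z0)"
  proof (rule lim)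
    show "continuous_on UNIV (prod_kernel (r/2) z0)"
      using prod_kernel_continuous_comp[OF continuous_on_const continuous_on_id] by (simp add: id_def)
    show "norm (y - z0) < r" if "prod_kernel (r/2) z0 y \<noteq> 0" for y
      using prod_kernel_eq_0[of "r/2" y z0] that r by (cases "norm (y - z0) < r") auto
  qed
  then have "(\<lambda>n. jac_pair \<theta> g (prod_kernel (\<epsilon> n) z0)) \<longlonglongrightarrow> jac_pair \<theta> g (prod_kernel (r/2) z0)"
    using prod_kernel_integral(3)[of "r/2" z0] r by simp
  from tendsto_mult[OF this tendsto_const] lim[OF z] show ?thesis
    using LIMSEQ_unique by blast
qed

lemma prod_kernel_continuous: "continuous_on UNIV (prod_kernel \<epsilon> z)"
  using prod_kernel_continuous_comp[OF continuous_on_const continuous_on_id] by (simp add: id_def)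

text \<open>The degree is attached to \<open>F\<close>, of which no regularity is assumed: every C^1
  map close to \<open>F\<close> where \<open>\<theta>\<close> varies has the same constant. The
  fraction 1/16 keeps the perturbed maps far enough from the support of \<open>\<zeta>\<close> for
  local constancy and for a homotopy between any two of them.\<close>

lemma degree_const:
  assumes t: "C_k 1 \<theta>" "bounded {x. \<theta> x \<noteq> 0}" and r: "r > 0"
    and S: "\<And>x i. part_deriv i \<theta> x \<noteq> 0 \<Longrightarrow> norm (F x - z0) \<ge> r"
  obtains d where "\<And>g (\<zeta> :: real^2 \<Rightarrow> real). C1_map g \<Longrightarrow> (\<And>x i. part_deriv i \<theta> x \<noteq> 0 \<Longrightarrow> norm (g x - F x) < r / 16) \<Longrightarrow>
    continuous_on UNIV \<zeta> \<Longrightarrow> (\<And>y. \<zeta> y \<noteq> 0 \<Longrightarrow> norm (y - z0) < r / 16) \<Longrightarrow> jac_pair \<theta> g \<zeta> = d * integral\<^sup>L lborel \<zeta>"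
proof (cases "\<exists>g. C1_map g \<and> (\<forall>x i. part_deriv i \<theta> x \<noteq> 0 \<longrightarrow> norm (g x - F x) < r / 16)")
  case False
  \<comment> \<open>Without any C^1 map close to \<open>F\<close> the claim is vacuous and every
    \<open>d\<close> will do.\<close>
  then show thesis using that[of 0] by blast
next
  case True
  then obtain g0 where g0: "C1_map g0" "\<And>x i. part_deriv i \<theta> x \<noteq> 0 \<Longrightarrow> norm (g0 x - F x) < r / 16" by blast
  show thesis
  proof (rule that[of "jac_pair \<theta> g0 (prod_kernel (r/32) z0)"])
    fix g and \<zeta> :: "real^2 \<Rightarrow> real"
    assume g: "C1_map g" "\<And>x i. part_deriv i \<theta> x \<noteq> 0 \<Longrightarrow> norm (g x - F x) < r / 16"
      and z: "continuous_on UNIV \<zeta>" "\<And>y. \<zeta> y \<noteq> 0 \<Longrightarrow> norm (y - z0) < r / 16"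
    have "jac_pair \<theta> g \<zeta> = jac_pair \<theta> g (prod_kernel (r/16/2) z0) * integral\<^sup>L lborel \<zeta>"
    proof (rule degree_locally_constant[OF t g(1) _ _ z])
      fix x i assume x: "part_deriv i \<theta> x \<noteq> 0"
      have "norm (F x - z0) \<le> norm (F x - g x) + norm (g x - z0)"
        using norm_triangle_ineq[of "F x - g x" "g x - z0"] by simp
      then show "4 * (r/16) \<le> norm (g x - z0)" using S[OF x] g(2)[OF x] r by (simp add: norm_minus_commute)
    qed (use r in auto)
    also have "jac_pair \<theta> g (prod_kernel (r/16/2) z0) = jac_pair \<theta> g0 (prod_kernel (r/16/2) z0)"
    proof (rule jac_pair_homotopy[OF _ t g(1) g0(1), where F=F])
      fix x i assume x: "part_deriv i \<theta> x \<noteq> 0"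
      show "norm (g x - F x) + norm (g0 x - F x) + 2 * (r/16/2) < norm (z0 - F x)"
        using S[OF x] g(2)[OF x] g0(2)[OF x] r by (simp add: norm_minus_commute)
    qed (use r in simp)
    finally show "jac_pair \<theta> g \<zeta> = jac_pair \<theta> g0 (prod_kernel (r/32) z0) * integral\<^sup>L lborel \<zeta>" by simp
  qed
qed

section \<open>The degree at a regular value\<close>

lemma C1_map_derivative:
  assumes "C1_map g"
  defines "L x h \<equiv> \<chi> i. part_deriv 1 (\<lambda>x. g x $ i) x * h$1 + part_deriv 2 (\<lambda>x. g x $ i) x * (h :: real^2)$2"
  shows "(g has_derivative L x) (at x)" "det (matrix (L x)) = wedge (\<lambda>x. g x $ 1) (\<lambda>x. g x $ 2) x" "linear (L x)"
proof -
  show d: "(g has_derivative L x) (at x)"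
    unfolding L_def by (rule has_derivative_vec2) (rule C1_mapD[OF assms(1)])
  show "det (matrix (L x)) = wedge (\<lambda>x. g x $ 1) (\<lambda>x. g x $ 2) x"
    by (simp add: L_def matrix_def det_2 axis_def wedge_def)
  show "linear (L x)" using d by (rule has_derivative_linear)
qed

text \<open>Continuity of the entries of the Jacobian matrix gives smallness of the operator norm of
  the difference of derivatives, as the sum \<open>s\<close> of the entrywise differences dominates
  it.\<close>

lemma C1_map_locally_injective:
  assumes g: "C1_map g" and a: "wedge (\<lambda>x. g x $ 1) (\<lambda>x. g x $ 2) a \<noteq> 0"
  obtains r where "r > 0" "inj_on g (ball a r)"
proof -
  define L where "L x h = (\<chi> i. part_deriv 1 (\<lambda>x. g x $ i) x * h$1 + part_deriv 2 (\<lambda>x. g x $ i) x * h$2)" for x and h :: "real^2"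
  have L: "(g has_derivative L x) (at x)" "det (matrix (L x)) = wedge (\<lambda>x. g x $ 1) (\<lambda>x. g x $ 2) x" "linear (L x)" for x
    unfolding L_def[abs_def] by (rule C1_map_derivative[OF g])+
  have "inj (L a)" using det_nz_iff_inj[OF L(3)] L(2) a by metis
  then obtain g' where g': "linear g'" "g' \<circ> L a = id"
    using linear_injective_left_inverse[OF L(3)] by blast
  define s where "s x = (\<Sum>k\<in>UNIV. \<Sum>i\<in>UNIV. \<bar>part_deriv i (\<lambda>x. g x $ k) x - part_deriv i (\<lambda>x. g x $ k) a\<bar>)" for x
  have cs: "continuous_on UNIV s"
    unfolding s_def by (intro continuous_intros C1_pd_continuous C1_mapD g)
  have on: "onorm (\<lambda>v. L x v - L a v) \<le> s x" for x
  proof (rule onorm_le)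
    fix v :: "real^2"
    let ?p = "\<lambda>k i. part_deriv i (\<lambda>x. g x $ k) x - part_deriv i (\<lambda>x. g x $ k) a"
    have "norm (L x v - L a v) \<le> (\<Sum>k\<in>UNIV. \<bar>(L x v - L a v) $ k\<bar>)" by (rule norm_le_l1_cart)
    also have "\<dots> \<le> (\<Sum>k\<in>UNIV. (\<Sum>i\<in>UNIV. \<bar>?p k i\<bar>) * norm v)"
    proof (rule sum_mono)
      fix k :: 2
      have "(L x v - L a v) $ k = ?p k 1 * v $ 1 + ?p k 2 * v $ 2"
        by (simp add: L_def algebra_simps)
      also have "\<bar>\<dots>\<bar> \<le> \<bar>?p k 1\<bar> * \<bar>v $ 1\<bar> + \<bar>?p k 2\<bar> * \<bar>v $ 2\<bar>"
        unfolding abs_mult[symmetric] by (rule abs_triangle_ineq)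
      also have "\<dots> \<le> \<bar>?p k 1\<bar> * norm v + \<bar>?p k 2\<bar> * norm v"
        by (intro add_mono mult_left_mono component_le_norm_cart) auto
      finally show "\<bar>(L x v - L a v) $ k\<bar> \<le> (\<Sum>i\<in>UNIV. \<bar>?p k i\<bar>) * norm v"
        by (simp add: sum_2 distrib_right)
    qed
    also have "\<dots> = s x * norm v" by (simp add: s_def sum_distrib_right)
    finally show "norm (L x v - L a v) \<le> s x * norm v" .
  qed
  show thesis
  proof (rule has_derivative_locally_injective[of a UNIV g' L g])
    show "bounded_linear g'" using g'(1) by (simp add: linear_conv_bounded_linear)
    show "\<exists>d>0. \<forall>x. dist a x < d \<longrightarrow> onorm (\<lambda>v. L x v - L a v) < e" if e: "e > 0" for e
    proof -
      have "s a = 0" by (simp add: s_def)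
      then obtain d where d: "d > 0" "\<And>x. dist x a < d \<Longrightarrow> dist (s x) 0 < e"
        using cs e unfolding continuous_on_iff by (metis UNIV_I)
      have "onorm (\<lambda>v. L x v - L a v) < e" if "dist a x < d" for x
        using on[of x] d(2)[of x] that by (simp add: dist_commute)
      then show ?thesis using d(1) by blast
    qed
  qed (use g' L that in auto)
qed

lemma change_of_variables_wedge:
  assumes g: "C1_map g" and B: "open B" "inj_on g B" and z: "continuous_on UNIV \<zeta>" "bounded {y. \<zeta> y \<noteq> 0}"
  shows "(\<integral>x. indicator B x * (\<zeta> (g x) * \<bar>wedge (\<lambda>x. g x $ 1) (\<lambda>x. g x $ 2) x\<bar>) \<partial>lborel) = (\<integral>y. indicator (g ` B) y * \<zeta> y \<partial>lborel)"
proof -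
  define L where "L x h = (\<chi> i. part_deriv 1 (\<lambda>x. g x $ i) x * h$1 + part_deriv 2 (\<lambda>x. g x $ i) x * h$2)" for x and h :: "real^2"
  have L: "(g has_derivative L x) (at x)" "det (matrix (L x)) = wedge (\<lambda>x. g x $ 1) (\<lambda>x. g x $ 2) x" for x
    unfolding L_def[abs_def] by (rule C1_map_derivative[OF g])+
  have cg: "continuous_on UNIV g" by (rule C1_map_continuous[OF g])
  have og: "open (g ` B)"
    by (rule invariance_of_domain[OF continuous_on_subset[OF cg] B(1,2)]) auto
  let ?J = "wedge (\<lambda>x. g x $ 1) (\<lambda>x. g x $ 2)"
  \<comment> \<open>The change of variables formula concerns vector-valued integrands, so the scalar
    function is regarded as one with values in \<open>real^1\<close>.\<close>
  define f where "f y = (vec (\<zeta> y) :: real^1)" for y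
  have nth: "f y $ 1 = \<zeta> y" for y by (simp add: f_def)
  have lin: "bounded_linear (\<lambda>t. vec t :: real^1)"
    by (rule linear_conv_bounded_linear[THEN iffD1], rule linearI) (simp_all add: vec_eq_iff)
  have iz: "integrable lborel \<zeta>" by (rule integrable_continuous_bounded_support[OF z])
  have mz[measurable]: "\<zeta> \<in> borel_measurable borel" "g \<in> borel_measurable borel" "?J \<in> borel_measurable borel"
    by (intro borel_measurable_continuous_onI z cg wedge_continuous C1_mapD g)+
  have "integrable lebesgue \<zeta>" using iz by (simp add: integrable_completion)
  then have "integrable lebesgue f" unfolding f_def by (rule integrable_bounded_linear[OF lin])
  then have fi: "f absolutely_integrable_on (g ` B)"
    unfolding set_integrable_def using og
    by (intro integrable_mult_indicator) auto
  have cv: "(\<lambda>x. \<bar>det (matrix (L x))\<bar> *\<^sub>R f (g x)) absolutely_integrable_on B \<and>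
     integral B (\<lambda>x. \<bar>det (matrix (L x))\<bar> *\<^sub>R f (g x)) = integral (g ` B) f"
    by (subst has_absolute_integral_change_of_variables)
       (use B has_derivative_at_withinI[OF L(1)] fi in auto)
  have "integral (g ` B) f = (LINT y:g ` B|lebesgue. f y)"
    by (rule set_lebesgue_integral_eq_integral(2)[OF fi, symmetric])
  then have "integral (g ` B) f $ 1 = (\<integral>y. indicator (g ` B) y * \<zeta> y \<partial>lebesgue)"
    using integral_bounded_linear[OF bounded_linear_vec_nth fi[unfolded set_integrable_def], of 1]
    unfolding set_lebesgue_integral_def by (simp add: nth)
  also have "\<dots> = (\<integral>y. indicator (g ` B) y * \<zeta> y \<partial>lborel)"
    by (rule integral_completion, intro borel_measurable_times borel_measurable_indicator) (use og mz in auto)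
  finally have 1: "integral (g ` B) f $ 1 = (\<integral>y. indicator (g ` B) y * \<zeta> y \<partial>lborel)" .
  have "integral B (\<lambda>x. \<bar>det (matrix (L x))\<bar> *\<^sub>R f (g x)) = (LINT x:B|lebesgue. \<bar>det (matrix (L x))\<bar> *\<^sub>R f (g x))"
    using cv by (intro set_lebesgue_integral_eq_integral(2)[symmetric]) simp
  then have "integral B (\<lambda>x. \<bar>det (matrix (L x))\<bar> *\<^sub>R f (g x)) $ 1 = (\<integral>x. indicator B x * (\<bar>?J x\<bar> * \<zeta> (g x)) \<partial>lebesgue)"
    using integral_bounded_linear[OF bounded_linear_vec_nth, of lebesgue "\<lambda>x. indicator B x *\<^sub>R (\<bar>det (matrix (L x))\<bar> *\<^sub>R f (g x))" 1] cv
    unfolding set_lebesgue_integral_def set_integrable_def by (simp add: nth L(2) mult.assoc)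
  also have "\<dots> = (\<integral>x. indicator B x * (\<bar>?J x\<bar> * \<zeta> (g x)) \<partial>lborel)"
    by (rule integral_completion, intro borel_measurable_times borel_measurable_indicator borel_measurable_abs measurable_compose[OF mz(2) mz(1)])
       (use B mz in auto)
  finally show ?thesis using 1 cv by (simp add: mult.commute)
qed

text \<open>The preimages of \<open>y\<close> that the cutoff sees form a compact set, discrete by
  local injectivity, hence finite. Near \<open>y\<close> the integral splits over disjoint balls on
  which \<open>g\<close> is injective with Jacobian of constant sign, and each ball contributes its
  sign times the integral of \<open>\<zeta>\<close>.\<close>

lemma jac_pair_regular_value:
  assumes t: "C_k 1 \<theta>" "bounded {x. \<theta> x \<noteq> 0}" and g: "C1_map g"
    and loc: "\<And>x. g x = y \<Longrightarrow> \<exists>U c. open U \<and> x \<in> U \<and> (c = 0 \<or> c = 1) \<and> (\<forall>x'\<in>U. \<theta> x' = c)"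
    and reg: "\<And>x. g x = y \<Longrightarrow> \<theta> x \<noteq> 0 \<Longrightarrow> wedge (\<lambda>x. g x $ 1) (\<lambda>x. g x $ 2) x \<noteq> 0"
  defines "P \<equiv> {x. g x = y \<and> \<theta> x \<noteq> 0}"
  shows "finite P" and "\<exists>\<rho>>0. \<forall>\<zeta>. continuous_on UNIV \<zeta> \<and> (\<forall>z. \<zeta> z \<noteq> 0 \<longrightarrow> norm (z - y) < \<rho>) \<longrightarrow>
     jac_pair \<theta> g \<zeta> = (\<Sum>x\<in>P. sgn (wedge (\<lambda>x. g x $ 1) (\<lambda>x. g x $ 2) x)) * integral\<^sup>L lborel \<zeta>"
proof -
  let ?J = "wedge (\<lambda>x. g x $ 1) (\<lambda>x. g x $ 2)"
  have cg: "continuous_on UNIV g" by (rule C1_map_continuous[OF g])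
  have ct: "continuous_on UNIV \<theta>" by (rule C_k_continuous[OF t(1)])
  have cJ: "continuous_on UNIV ?J" by (intro wedge_continuous C1_mapD g)
  have P1: "P = {x. g x = y} \<inter> {x. \<theta> x = 1}"
    unfolding P_def using loc by fastforce
  have cP: "compact P"
  proof -
    have "closed P" unfolding P1
      by (intro closed_Int closed_Collect_eq cg ct continuous_on_const)
    moreover have "bounded P" by (rule bounded_subset[OF t(2)]) (auto simp: P_def)
    ultimately show ?thesis by (simp add: compact_eq_bounded_closed)
  qed
  have "\<exists>e>0. inj_on g (ball x e) \<and> (\<forall>x'\<in>ball x e. \<theta> x' = 1 \<and> sgn (?J x') = sgn (?J x))" if x: "x \<in> P" for x
  proof -
    have Jx: "?J x \<noteq> 0" using reg x by (auto simp: P_def)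
    obtain r1 where r1: "r1 > 0" "inj_on g (ball x r1)" using C1_map_locally_injective[OF g Jx] .
    obtain U c where U: "open U" "x \<in> U" "\<forall>x'\<in>U. \<theta> x' = c" using loc[of x] x by (auto simp: P_def)
    then have "c = 1" using x P1 by auto
    obtain r2 where r2: "r2 > 0" "ball x r2 \<subseteq> U" using U(1,2) by (rule openE)
    obtain r3 where r3: "r3 > 0" "\<And>x'. dist x' x < r3 \<Longrightarrow> dist (?J x') (?J x) < \<bar>?J x\<bar>"
      using cJ Jx unfolding continuous_on_iff by (metis UNIV_I zero_less_abs_iff)
    show ?thesis
    proof (intro exI[of _ "min r1 (min r2 r3)"] conjI ballI)
      show "inj_on g (ball x (min r1 (min r2 r3)))" by (rule inj_on_subset[OF r1(2)]) auto
      fix x' assume x': "x' \<in> ball x (min r1 (min r2 r3))"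
      show "\<theta> x' = 1" using x' r2 U(3) \<open>c = 1\<close> by auto
      show "sgn (?J x') = sgn (?J x)"
        using r3(2)[of x'] x' by (auto simp: dist_commute dist_real_def sgn_if abs_if split: if_splits)
    qed (use r1 r2 r3 in auto)
  qed
  then obtain e where e: "\<And>x. x \<in> P \<Longrightarrow> e x > 0" "\<And>x. x \<in> P \<Longrightarrow> inj_on g (ball x (e x))"
    "\<And>x x'. x \<in> P \<Longrightarrow> x' \<in> ball x (e x) \<Longrightarrow> \<theta> x' = 1 \<and> sgn (?J x') = sgn (?J x)" by metis
  have "\<not> x islimpt P" if x: "x \<in> P" for x
  proof
    assume "x islimpt P"
    then obtain x' where x': "x' \<in> P" "x' \<noteq> x" "dist x' x < e x" using e(1)[OF x] unfolding islimpt_approachable by blast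
    then show False using inj_onD[OF e(2)[OF x], of x' x] x e(1)[OF x] by (auto simp: P_def dist_commute)
  qed
  then have "finite (P \<inter> P)" by (intro finite_not_islimpt_in_compact cP) auto
  then show fP: "finite P" by simp
  have "\<exists>d>0. \<forall>x'\<in>P. x' \<noteq> x \<longrightarrow> d \<le> dist x x'" for x by (rule finite_set_avoid[OF fP])
  then obtain d where d: "\<And>x. d x > 0" "\<And>x x'. x' \<in> P \<Longrightarrow> x' \<noteq> x \<Longrightarrow> d x \<le> dist x x'" by metis
  \<comment> \<open>Half the distance to the other preimages makes the balls disjoint.\<close>
  define B where "B x = ball x (min (e x) (d x / 2))" for x
  have disj: "x1 = x2" if "x1 \<in> P" "x2 \<in> P" "w \<in> B x1" "w \<in> B x2" for x1 x2 w
  proof (rule ccontr)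
    assume "x1 \<noteq> x2"
    then have "d x1 \<le> dist x1 x2" "d x2 \<le> dist x1 x2"
      using d(2)[of x2 x1] d(2)[of x1 x2] that by (auto simp: dist_commute)
    moreover have "dist x1 x2 \<le> dist x1 w + dist x2 w" by (rule dist_triangle2)
    ultimately show False using that(3,4) by (auto simp: B_def)
  qed
  have B: "open (B x)" "x \<in> P \<Longrightarrow> x \<in> B x" "x \<in> P \<Longrightarrow> inj_on g (B x)" for x
    using e(1)[of x] d(1)[of x] e(2)[of x] by (auto simp: B_def intro: inj_on_subset)
  have Be: "x \<in> P \<Longrightarrow> x' \<in> B x \<Longrightarrow> \<theta> x' = 1 \<and> sgn (?J x') = sgn (?J x)" for x x'
    using e(3)[of x x'] by (auto simp: B_def)
  have "open (\<Inter>x\<in>P. g ` B x)"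
    by (intro open_INT fP ballI invariance_of_domain continuous_on_subset[OF cg] B) auto
  moreover have "y \<in> (\<Inter>x\<in>P. g ` B x)" using B(2) by (force simp: P_def)
  ultimately obtain \<rho>0 where \<rho>0: "\<rho>0 > 0" "ball y \<rho>0 \<subseteq> (\<Inter>x\<in>P. g ` B x)"
    by (rule openE)
  \<comment> \<open>The rest of the support of \<open>\<theta>\<close>. Its image is compact and
    misses \<open>y\<close>, so a \<open>\<zeta>\<close> supported close to \<open>y\<close> does
    not see it.\<close>
  define Q where "Q = closure {x. \<theta> x \<noteq> 0} - (\<Union>x\<in>P. B x)"
  have "compact (closure {x. \<theta> x \<noteq> 0})" using t(2) by simp
  then have cQ: "compact Q"
    unfolding Q_def by (rule compact_diff) (use B in auto)
  have "y \<notin> g ` Q"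
  proof
    assume "y \<in> g ` Q"
    then obtain x where x: "x \<in> Q" "g x = y" by auto
    obtain U c where U: "open U" "x \<in> U" "\<forall>x'\<in>U. \<theta> x' = c" using loc[OF x(2)] by auto
    have "U \<inter> {x. \<theta> x \<noteq> 0} \<noteq> {}" using x(1) U(1,2) by (auto simp: Q_def closure_iff_nhds_not_empty)
    then have "\<theta> x \<noteq> 0" using U by auto
    then have "x \<in> P" using x by (simp add: P_def)
    then show False using x(1) B(2) by (auto simp: Q_def)
  qed
  moreover have "closed (g ` Q)"
    by (intro compact_imp_closed compact_continuous_image continuous_on_subset[OF cg] cQ) auto
  ultimately have "open (- g ` Q)" "y \<in> - g ` Q" by auto
  then obtain \<rho>1 where \<rho>1: "\<rho>1 > 0" "ball y \<rho>1 \<subseteq> - g ` Q"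
    by (rule openE)
  show "\<exists>\<rho>>0. \<forall>\<zeta>. continuous_on UNIV \<zeta> \<and> (\<forall>z. \<zeta> z \<noteq> 0 \<longrightarrow> norm (z - y) < \<rho>) \<longrightarrow>
     jac_pair \<theta> g \<zeta> = (\<Sum>x\<in>P. sgn (?J x)) * integral\<^sup>L lborel \<zeta>"
  proof (intro exI[of _ "min \<rho>0 \<rho>1"] conjI allI impI)
    fix \<zeta> :: "real^2 \<Rightarrow> real" assume z: "continuous_on UNIV \<zeta> \<and> (\<forall>z. \<zeta> z \<noteq> 0 \<longrightarrow> norm (z - y) < min \<rho>0 \<rho>1)"
    then have cz: "continuous_on UNIV \<zeta>" and sz: "\<And>z. \<zeta> z \<noteq> 0 \<Longrightarrow> z \<in> ball y \<rho>0 \<and> z \<in> ball y \<rho>1"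
      by (auto simp: dist_norm norm_minus_commute)
    have bz: "bounded {z. \<zeta> z \<noteq> 0}" by (rule bounded_subset[of "ball y \<rho>0"]) (use sz in auto)
    have split: "\<theta> x * \<zeta> (g x) * ?J x = (\<Sum>p\<in>P. sgn (?J p) * (indicator (B p) x * (\<zeta> (g x) * \<bar>?J x\<bar>)))" for x
    proof (cases "\<exists>p\<in>P. x \<in> B p")
      case True
      then obtain p where p: "p \<in> P" "x \<in> B p" by blast
      have "(\<Sum>q\<in>P. sgn (?J q) * (indicator (B q) x * (\<zeta> (g x) * \<bar>?J x\<bar>))) = (\<Sum>q\<in>P. if q = p then sgn (?J p) * (\<zeta> (g x) * \<bar>?J x\<bar>) else 0)"
        by (intro sum.cong refl) (use disj p in \<open>auto simp: indicator_def\<close>)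
      also have "\<dots> = sgn (?J x) * \<bar>?J x\<bar> * \<zeta> (g x)" using fP p Be[OF p] by simp
      also have "\<dots> = ?J x * \<zeta> (g x)" by (simp only: sgn_mult_abs)
      finally show ?thesis using Be[OF p] by simp
    next
      case False
      then have "(\<Sum>p\<in>P. sgn (?J p) * (indicator (B p) x * (\<zeta> (g x) * \<bar>?J x\<bar>))) = 0"
        by (intro sum.neutral) (auto simp: indicator_def)
      moreover have "\<theta> x * \<zeta> (g x) = 0"
      proof (rule ccontr)
        assume n: "\<theta> x * \<zeta> (g x) \<noteq> 0"
        then have "x \<in> Q" using False closure_subset[of "{x. \<theta> x \<noteq> 0}"] by (auto simp: Q_def)
        then show False using sz[of "g x"] n \<rho>1(2) by auto
      qed
      ultimately show ?thesis by simp
    qed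
    have iB: "integrable lborel (\<lambda>x. indicator (B p) x * (\<zeta> (g x) * \<bar>?J x\<bar>))" for p
    proof -
      have "integrable lborel (\<lambda>x. indicator (cball p (min (e p) (d p / 2))) x *\<^sub>R (\<zeta> (g x) * \<bar>?J x\<bar>))"
        by (intro borel_integrable_compact compact_cball continuous_intros continuous_on_compose2[OF cz] continuous_on_subset[OF cg] continuous_on_subset[OF cJ]) auto
      then have "integrable lborel (\<lambda>x. indicator (B p) x *\<^sub>R (indicator (cball p (min (e p) (d p / 2))) x *\<^sub>R (\<zeta> (g x) * \<bar>?J x\<bar>)))"
        by (rule integrable_mult_indicator[rotated]) (use B in auto)
      moreover have "indicator (B p) x *\<^sub>R (indicator (cball p (min (e p) (d p / 2))) x *\<^sub>R (\<zeta> (g x) * \<bar>?J x\<bar>)) = indicator (B p) x * (\<zeta> (g x) * \<bar>?J x\<bar>)" for x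
        by (auto simp: B_def indicator_def)
      ultimately show ?thesis by (simp only:)
    qed
    have each: "(\<integral>x. indicator (B p) x * (\<zeta> (g x) * \<bar>?J x\<bar>) \<partial>lborel) = integral\<^sup>L lborel \<zeta>" if p: "p \<in> P" for p
    proof -
      have "indicator (g ` B p) z * \<zeta> z = \<zeta> z" for z
        using sz[of z] \<rho>0(2) p by (cases "\<zeta> z = 0") (auto simp: indicator_def)
      then show ?thesis
        unfolding change_of_variables_wedge[OF g B(1) B(3)[OF p] cz bz] by (simp only:)
    qed
    have "jac_pair \<theta> g \<zeta> = (\<Sum>p\<in>P. sgn (?J p) * (\<integral>x. indicator (B p) x * (\<zeta> (g x) * \<bar>?J x\<bar>) \<partial>lborel))"
      unfolding jac_pair_def split using iB by (subst Bochner_Integration.integral_sum) auto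
    also have "\<dots> = (\<Sum>p\<in>P. sgn (?J p)) * integral\<^sup>L lborel \<zeta>"
      unfolding sum_distrib_right by (intro sum.cong refl) (use each in simp)
    finally show "jac_pair \<theta> g \<zeta> = (\<Sum>x\<in>P. sgn (?J x)) * integral\<^sup>L lborel \<zeta>" .
  qed (use \<rho>0 \<rho>1 in auto)
qed

text \<open>Sard's theorem. Translating the map instead of the value keeps \<open>y\<close> fixed
  and leaves the Jacobian unchanged.\<close>

lemma regular_value_near:
  assumes g: "C1_map g" and e: "e > 0"
  obtains c where "norm c < e" "\<And>x. g x + c = y \<Longrightarrow> wedge (\<lambda>x. g x $ 1) (\<lambda>x. g x $ 2) x \<noteq> 0"
proof -
  define L where "L x h = (\<chi> i. part_deriv 1 (\<lambda>x. g x $ i) x * h$1 + part_deriv 2 (\<lambda>x. g x $ i) x * h$2)" for x and h :: "real^2"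
  have L: "(g has_derivative L x) (at x)" "det (matrix (L x)) = wedge (\<lambda>x. g x $ 1) (\<lambda>x. g x $ 2) x" for x
    unfolding L_def[abs_def] by (rule C1_map_derivative[OF g])+
  let ?S = "{x. wedge (\<lambda>x. g x $ 1) (\<lambda>x. g x $ 2) x = 0}"
  have "negligible (g ` ?S)"
  proof (rule baby_Sard)
    show "(g has_derivative L x) (at x within ?S)" for x using L(1) by (rule has_derivative_at_withinI)
    show "rank (matrix (L x)) < CARD(2)" if "x \<in> ?S" for x
      using det_eq_0_rank[of "matrix (L x)"] L(2)[of x] that by auto
  qed simp
  then have "\<not> ball y e \<subseteq> g ` ?S"
    using open_not_negligible[of "ball y e"] e negligible_subset by auto
  then obtain y' where y': "y' \<in> ball y e" "y' \<notin> g ` ?S" by blast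
  show thesis
  proof (rule that[of "y - y'"])
    show "norm (y - y') < e" using y'(1) by (simp add: dist_norm)
    fix x assume "g x + (y - y') = y"
    then have "g x = y'" by (simp add: algebra_simps)
    then show "wedge (\<lambda>x. g x $ 1) (\<lambda>x. g x $ 2) x \<noteq> 0" using y'(2) by auto
  qed
qed

text \<open>A small translate of \<open>g\<close> has \<open>y\<close> as a regular value, where the
  degree is a sum of signs; \<open>degree_const\<close> says that the translate and \<open>g\<close>
  have the same degree.\<close>

lemma jac_pair_degree_integer:
  assumes t: "C_k 1 \<theta>" "bounded {x. \<theta> x \<noteq> 0}" and g: "C1_map g" and r: "r > 0"
    and loc: "\<And>x. norm (g x - y) < r \<Longrightarrow> \<exists>U c. open U \<and> x \<in> U \<and> (c = 0 \<or> c = 1) \<and> (\<forall>x'\<in>U. \<theta> x' = c)"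
  obtains k :: int where "\<And>\<zeta> :: real^2 \<Rightarrow> real. continuous_on UNIV \<zeta> \<Longrightarrow> (\<And>z. \<zeta> z \<noteq> 0 \<Longrightarrow> norm (z - y) < r / 16) \<Longrightarrow>
     jac_pair \<theta> g \<zeta> = real_of_int k * integral\<^sup>L lborel \<zeta>"
proof -
  have S: "norm (g x - y) \<ge> r" if "part_deriv i \<theta> x \<noteq> 0" for x i
  proof (rule ccontr)
    assume "\<not> ?thesis"
    then obtain U c where "open U" "x \<in> U" "\<forall>x'\<in>U. \<theta> x' = c" using loc[of x] by auto
    then show False using part_deriv_eq_0[of U x \<theta> c i] that by auto
  qed
  obtain d where d: "\<And>h \<zeta>. C1_map h \<Longrightarrow> (\<And>x i. part_deriv i \<theta> x \<noteq> 0 \<Longrightarrow> norm (h x - g x) < r / 16) \<Longrightarrow>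
    continuous_on UNIV \<zeta> \<Longrightarrow> (\<And>z. \<zeta> z \<noteq> 0 \<Longrightarrow> norm (z - y) < r / 16) \<Longrightarrow> jac_pair \<theta> h \<zeta> = d * integral\<^sup>L lborel \<zeta>"
    using degree_const[OF t r, of g y] S by blast
  obtain c where c: "norm c < r / 16" "\<And>x. g x + c = y \<Longrightarrow> wedge (\<lambda>x. g x $ 1) (\<lambda>x. g x $ 2) x \<noteq> 0"
    using regular_value_near[OF g, of "r/16" y] r by auto
  let ?h = "\<lambda>x. g x + c"
  let ?P = "{x. ?h x = y \<and> \<theta> x \<noteq> 0}"
  let ?J = "wedge (\<lambda>x. ?h x $ 1) (\<lambda>x. ?h x $ 2)"
  have h: "C1_map ?h" by (rule C1_map_shift[OF g])
  have loch: "\<exists>U c. open U \<and> x \<in> U \<and> (c = 0 \<or> c = 1) \<and> (\<forall>x'\<in>U. \<theta> x' = c)" if "?h x = y" for x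
  proof (rule loc)
    have "g x - y = - c" using that by (simp add: algebra_simps eq_neg_iff_add_eq_0)
    then show "norm (g x - y) < r" using c(1) r by simp
  qed
  have reg: "?J x \<noteq> 0" if "?h x = y" for x unfolding C1_map_shift(2)[OF g] by (rule c(2)[OF that])
  obtain \<rho> where \<rho>: "\<rho> > 0" "\<And>\<zeta>. continuous_on UNIV \<zeta> \<Longrightarrow> (\<And>z. \<zeta> z \<noteq> 0 \<Longrightarrow> norm (z - y) < \<rho>) \<Longrightarrow>
     jac_pair \<theta> ?h \<zeta> = (\<Sum>x\<in>?P. sgn (?J x)) * integral\<^sup>L lborel \<zeta>"
    using jac_pair_regular_value(2)[OF t h loch reg] by blast
  define k :: int where "k = (\<Sum>x\<in>?P. (if ?J x > 0 then 1 else if ?J x < 0 then -1 else 0))"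
  have k: "(\<Sum>x\<in>?P. sgn (?J x)) = real_of_int k"
    unfolding k_def of_int_sum by (intro sum.cong refl) (simp add: sgn_if)
  \<comment> \<open>The kernel of width \<open>s\<close> is narrow enough for both descriptions of
    the degree of the translate, so that evaluating both on it equates the two constants.\<close>
  define s where "s = min \<rho> (r/16) / 2"
  have s: "s > 0" using \<rho>(1) r by (simp add: s_def)
  have supp: "norm (z - y) < min \<rho> (r/16)" if "prod_kernel s y z \<noteq> 0" for z
    using prod_kernel_eq_0[OF s, of z y] that by (cases "norm (z - y) < min \<rho> (r/16)") (auto simp: s_def)
  have "jac_pair \<theta> ?h (prod_kernel s y) = real_of_int k * 1"
    using \<rho>(2)[OF prod_kernel_continuous, of s y] supp prod_kernel_integral(3)[OF s, of y] k by fastforce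
  moreover have "jac_pair \<theta> ?h (prod_kernel s y) = d * 1"
    using d[OF h _ prod_kernel_continuous, of s y] supp prod_kernel_integral(3)[OF s, of y] c(1) by fastforce
  ultimately have dk: "d = real_of_int k" by simp
  show thesis
  proof (rule that[of k])
    fix \<zeta> :: "real^2 \<Rightarrow> real" assume "continuous_on UNIV \<zeta>" "\<And>z. \<zeta> z \<noteq> 0 \<Longrightarrow> norm (z - y) < r / 16"
    then show "jac_pair \<theta> g \<zeta> = real_of_int k * integral\<^sup>L lborel \<zeta>"
      using d[OF g] r dk by simp
  qed
qed

section \<open>Homeomorphisms of planar domains\<close>

text \<open>Symmetric under exchange of (\<Omega>, f) and (\<Omega>', h), so that every result about
  \<open>f\<close> is available for the inverse through \<open>flip\<close>.\<close>

locale planar_homeo =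
  fixes \<Omega> \<Omega>' :: "(real^2) set" and f h :: "real^2 \<Rightarrow> real^2"
  assumes opn: "open \<Omega>" "open \<Omega>'" and bdd: "bounded \<Omega>" "bounded \<Omega>'"
    and img: "f ` \<Omega> = \<Omega>'" "h ` \<Omega>' = \<Omega>"
    and cont: "continuous_on \<Omega> f" "continuous_on \<Omega>' h"
    and inv: "\<And>x. x \<in> \<Omega> \<Longrightarrow> h (f x) = x" "\<And>y. y \<in> \<Omega>' \<Longrightarrow> f (h y) = y"
begin

abbreviation F :: "nat \<Rightarrow> real^2 \<Rightarrow> real^2" where "F \<equiv> conv_approx \<Omega> f"

lemma f_in: "x \<in> \<Omega> \<Longrightarrow> f x \<in> \<Omega>'" and h_in: "y \<in> \<Omega>' \<Longrightarrow> h y \<in> \<Omega>"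
  using img by auto

lemma f_eq_iff: "x \<in> \<Omega> \<Longrightarrow> x' \<in> \<Omega> \<Longrightarrow> f x = f x' \<longleftrightarrow> x = x'"
  using inv by metis

lemma bdd_cont_f: "bdd_cont \<Omega> (\<lambda>x. f x $ i)"
  by (rule conv_approx_nth(1)[OF opn(1) bdd(1) cont(1)]) (use img bdd in simp)

lemma F_nth: "F n x $ i = moll \<Omega> (\<lambda>x. f x $ i) n x"
  by (rule conv_approx_nth(2)[OF opn(1) bdd(1) cont(1)]) (use img bdd in simp)

lemma F_C1: "C1_map (F n)"
  unfolding C1_map_def F_nth by (intro allI moll_C_k bdd_cont_f)

lemma F_uniform:
  assumes K: "compact K" "K \<subseteq> \<Omega>" and e: "e > 0"
  shows "\<forall>\<^sub>F n in sequentially. \<forall>x\<in>K. norm (F n x - f x) < e"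
proof -
  have *: "\<forall>\<^sub>F n in sequentially. \<forall>x\<in>K. \<bar>moll \<Omega> (\<lambda>x. f x $ i) n x - f x $ i\<bar> < e/2" for i
    by (rule moll_uniform[OF bdd_cont_f K]) (use e in simp)
  from *[of 1] *[of 2] show ?thesis
  proof eventually_elim
    case (elim n)
    show ?case
    proof
      fix x assume x: "x \<in> K"
      have "norm (F n x - f x) \<le> \<bar>F n x $ 1 - f x $ 1\<bar> + \<bar>F n x $ 2 - f x $ 2\<bar>"
        using norm_le_l1_cart[of "F n x - f x"] by (simp add: sum_2)
      then show "norm (F n x - f x) < e" using elim x unfolding F_nth by fastforce
    qed
  qed
qed

lemma flip: "planar_homeo \<Omega>' \<Omega> h f"
  by unfold_locales (use opn bdd img cont inv in auto)

lemma separation: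
  assumes C: "compact C" "C \<subseteq> \<Omega>'" and K: "compact K" "K \<subseteq> \<Omega>" and W: "open W" "h ` C \<subseteq> W"
  obtains r where "r > 0" "\<And>x z. x \<in> K - W \<Longrightarrow> z \<in> C \<Longrightarrow> norm (f x - z) \<ge> r"
proof -
  have "compact (f ` (K - W))"
    by (intro compact_continuous_image continuous_on_subset[OF cont(1)] compact_diff K W) (use K in auto)
  moreover have "f ` (K - W) \<inter> C = {}"
  proof (rule ccontr)
    assume "f ` (K - W) \<inter> C \<noteq> {}"
    then obtain x where x: "x \<in> K" "x \<notin> W" "f x \<in> C" by auto
    then show False using inv(1)[of x] K W by force
  qed
  ultimately obtain r where "r > 0" "\<forall>y\<in>f ` (K - W). \<forall>z\<in>C. r \<le> dist y z"
    using separate_compact_closed[of "f ` (K - W)" C] C compact_imp_closed by blast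
  then show thesis using that by (auto simp: dist_norm)
qed

lemma separation_point:
  assumes x0: "x0 \<in> \<Omega>" and K: "compact K" "K \<subseteq> \<Omega>" and W: "open W" "x0 \<in> W"
  obtains r where "r > 0" "\<And>x. x \<in> K - W \<Longrightarrow> norm (f x - f x0) \<ge> r"
proof (rule separation[of "{f x0}" K W])
  show "h ` {f x0} \<subseteq> W" "{f x0} \<subseteq> \<Omega>'" using W inv(1)[OF x0] f_in[OF x0] by auto
qed (use that K W in auto)

text \<open>The degree of \<open>f\<close> at \<open>f x0\<close>, read off from the mollifications
  with large index. It is real by definition; that an integer value exists is a separate fact, and
  decisive for showing that it equals 1.\<close>

definition local_deg :: "(real^2 \<Rightarrow> real) \<Rightarrow> real^2 \<Rightarrow> real \<Rightarrow> bool" where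
  "local_deg \<theta> x0 d \<longleftrightarrow> (\<exists>r>0. \<forall>\<^sub>F n in sequentially. \<forall>\<zeta>. continuous_on UNIV \<zeta> \<and> (\<forall>y. \<zeta> y \<noteq> 0 \<longrightarrow> norm (y - f x0) < r) \<longrightarrow>
     jac_pair \<theta> (F n) \<zeta> = d * integral\<^sup>L lborel \<zeta>)"

lemma part_deriv_cutoff:
  assumes "open W" "\<And>x. x \<in> W \<Longrightarrow> \<theta> x = 1" "part_deriv i \<theta> x \<noteq> 0"
  shows "x \<in> closure {x. \<theta> x \<noteq> 0} - W"
  using part_deriv_support[of i \<theta>] part_deriv_eq_0[of W x \<theta> 1 i] assms by blast

text \<open>If a mollification is close to \<open>f\<close>, the points of the support of
  \<open>\<theta>\<close> that it sends near \<open>f x0\<close> lie in \<open>W\<close>, where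
  \<open>\<theta>\<close> is 1. The cutoff is thus locally constant around preimages, and the degree
  of one such mollification is an integer.\<close>

lemma local_deg_integer:
  assumes t: "\<theta> \<in> test_functions \<Omega>" and W: "open W" "x0 \<in> W" "x0 \<in> \<Omega>" "\<And>x. x \<in> W \<Longrightarrow> \<theta> x = 1"
  obtains k :: int where "local_deg \<theta> x0 (real_of_int k)"
proof -
  define K where "K = closure {x. \<theta> x \<noteq> 0}"
  note tD = test_functionD[OF t]
  have K: "compact K" "K \<subseteq> \<Omega>" using tD by (auto simp: K_def)
  obtain r where r: "r > 0" "\<And>x. x \<in> K - W \<Longrightarrow> norm (f x - f x0) \<ge> r"
    by (rule separation_point[OF W(3) K W(1,2)]) blast
  have S: "norm (f x - f x0) \<ge> r" if "part_deriv i \<theta> x \<noteq> 0" for x i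
    using part_deriv_cutoff[OF W(1,4) that] r(2) by (auto simp: K_def)
  have pK: "x \<in> K" if "part_deriv i \<theta> x \<noteq> 0" for x i
    using part_deriv_cutoff[OF W(1,4) that] by (auto simp: K_def)
  obtain d where d: "\<And>g (\<zeta> :: real^2 \<Rightarrow> real). C1_map g \<Longrightarrow> (\<And>x i. part_deriv i \<theta> x \<noteq> 0 \<Longrightarrow> norm (g x - f x) < r / 16) \<Longrightarrow>
    continuous_on UNIV \<zeta> \<Longrightarrow> (\<And>y. \<zeta> y \<noteq> 0 \<Longrightarrow> norm (y - f x0) < r / 16) \<Longrightarrow> jac_pair \<theta> g \<zeta> = d * integral\<^sup>L lborel \<zeta>"
    using degree_const[OF tD(5,4) r(1), of f "f x0"] S by blast
  have ev: "\<forall>\<^sub>F n in sequentially. \<forall>x\<in>K. norm (F n x - f x) < r / 32" by (rule F_uniform[OF K]) (use r in simp)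
  then obtain n where n: "\<And>x. x \<in> K \<Longrightarrow> norm (F n x - f x) < r / 32"
    using eventually_happens'[OF sequentially_bot] by blast
  obtain k :: int where k: "\<And>\<zeta> :: real^2 \<Rightarrow> real. continuous_on UNIV \<zeta> \<Longrightarrow> (\<And>z. \<zeta> z \<noteq> 0 \<Longrightarrow> norm (z - f x0) < (r/2) / 16) \<Longrightarrow>
     jac_pair \<theta> (F n) \<zeta> = real_of_int k * integral\<^sup>L lborel \<zeta>"
  proof (rule jac_pair_degree_integer[OF tD(5,4) F_C1[of n], of "r/2" "f x0"])
    fix x assume x: "norm (F n x - f x0) < r / 2"
    consider "x \<notin> K" | "x \<in> W" | "x \<in> K - W" by blast
    then show "\<exists>U c. open U \<and> x \<in> U \<and> (c = 0 \<or> c = 1) \<and> (\<forall>x'\<in>U. \<theta> x' = c)"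
    proof cases
      case 1
      then show ?thesis
        using closure_subset[of "{x. \<theta> x \<noteq> 0}"] by (intro exI[of _ "- K"] exI[of _ 0]) (auto simp: K_def)
    next
      case 2
      then show ?thesis using W by (intro exI[of _ W] exI[of _ 1]) auto
    next
      case 3
      have "norm (f x - f x0) \<le> norm (F n x - f x) + norm (F n x - f x0)"
        using norm_triangle_ineq[of "f x - F n x" "F n x - f x0"] by (simp add: norm_minus_commute)
      then show ?thesis using r(2)[OF 3] n[of x] 3 x r(1) by simp
    qed
  qed (use r that in auto)
  \<comment> \<open>The kernel of this width is supported within \<open>r / 64\<close> of
    \<open>f x0\<close>, in the range of both formulas. Comparing them there shows that the constant
    valid for all large indices is the integer found at a single one.\<close>
  have s: "r / 128 > 0" using r by simp
  have supp: "norm (z - f x0) < r / 32" if "prod_kernel (r/128) (f x0) z \<noteq> 0" for z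
    using prod_kernel_eq_0[OF s, of z "f x0"] that r(1) by (cases "norm (z - f x0) < r / 32") auto
  have "jac_pair \<theta> (F n) (prod_kernel (r/128) (f x0)) = real_of_int k * 1"
    using k[OF prod_kernel_continuous, of "r/128" "f x0"] supp prod_kernel_integral(3)[OF s, of "f x0"] by simp
  moreover have "jac_pair \<theta> (F n) (prod_kernel (r/128) (f x0)) = d * 1"
  proof -
    have "jac_pair \<theta> (F n) (prod_kernel (r/128) (f x0)) = d * integral\<^sup>L lborel (prod_kernel (r/128) (f x0))"
    proof (rule d[OF F_C1 _ prod_kernel_continuous])
      show "norm (F n x - f x) < r / 16" if "part_deriv i \<theta> x \<noteq> 0" for x i using n[OF pK[OF that]] r(1) by simp
      show "norm (y - f x0) < r / 16" if "prod_kernel (r / 128) (f x0) y \<noteq> 0" for y using supp[OF that] r(1) by simp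
    qed
    then show ?thesis by (simp only: prod_kernel_integral(3)[OF s])
  qed
  ultimately have dk: "d = real_of_int k" by simp
  have "local_deg \<theta> x0 (real_of_int k)"
    unfolding local_deg_def
  proof (intro exI[of _ "r/16"] conjI)
    from ev show "\<forall>\<^sub>F n in sequentially. \<forall>\<zeta>. continuous_on UNIV \<zeta> \<and> (\<forall>y. \<zeta> y \<noteq> 0 \<longrightarrow> norm (y - f x0) < r/16) \<longrightarrow>
       jac_pair \<theta> (F n) \<zeta> = real_of_int k * integral\<^sup>L lborel \<zeta>"
    proof eventually_elim
      case (elim n)
      show ?case
      proof (intro allI impI)
        fix \<zeta> :: "real^2 \<Rightarrow> real" assume z: "continuous_on UNIV \<zeta> \<and> (\<forall>y. \<zeta> y \<noteq> 0 \<longrightarrow> norm (y - f x0) < r/16)"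
        show "jac_pair \<theta> (F n) \<zeta> = real_of_int k * integral\<^sup>L lborel \<zeta>"
          unfolding dk[symmetric]
        proof (rule d[OF F_C1])
          show "norm (F n x - f x) < r / 16" if "part_deriv i \<theta> x \<noteq> 0" for x i
            using elim pK[OF that] r(1) by fastforce
        qed (use z in auto)
      qed
    qed
  qed (use r in simp)
  then show thesis by (rule that)
qed

text \<open>Only the germ of the cutoff at \<open>x0\<close> counts: outside \<open>W\<close> the
  mollifications stay away from \<open>f x0\<close>, so a \<open>\<zeta>\<close> of small support
  vanishes along them.\<close>

lemma local_deg_unique_cutoff:
  assumes t: "\<theta> \<in> test_functions \<Omega>" "\<theta>' \<in> test_functions \<Omega>" and W: "open W" "x0 \<in> W" "x0 \<in> \<Omega>" "\<And>x. x \<in> W \<Longrightarrow> \<theta> x = \<theta>' x"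
    and d: "local_deg \<theta> x0 d"
  shows "local_deg \<theta>' x0 d"
proof -
  define K where "K = closure {x. \<theta> x \<noteq> 0} \<union> closure {x. \<theta>' x \<noteq> 0}"
  have K: "compact K" "K \<subseteq> \<Omega>" using test_functionD[OF t(1)] test_functionD[OF t(2)] by (auto simp: K_def)
  obtain r where r: "r > 0" "\<And>x. x \<in> K - W \<Longrightarrow> norm (f x - f x0) \<ge> r"
    by (rule separation_point[OF W(3) K W(1,2)]) blast
  obtain s where s: "s > 0" "\<forall>\<^sub>F n in sequentially. \<forall>\<zeta>. continuous_on UNIV \<zeta> \<and> (\<forall>y. \<zeta> y \<noteq> 0 \<longrightarrow> norm (y - f x0) < s) \<longrightarrow>
     jac_pair \<theta> (F n) \<zeta> = d * integral\<^sup>L lborel \<zeta>" using d by (auto simp: local_deg_def)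
  have ev: "\<forall>\<^sub>F n in sequentially. \<forall>x\<in>K. norm (F n x - f x) < r / 2" by (rule F_uniform[OF K]) (use r in simp)
  show ?thesis
    unfolding local_deg_def
  proof (intro exI[of _ "min s (r/2)"] conjI)
    from ev s(2) show "\<forall>\<^sub>F n in sequentially. \<forall>\<zeta>. continuous_on UNIV \<zeta> \<and> (\<forall>y. \<zeta> y \<noteq> 0 \<longrightarrow> norm (y - f x0) < min s (r/2)) \<longrightarrow>
       jac_pair \<theta>' (F n) \<zeta> = d * integral\<^sup>L lborel \<zeta>"
    proof eventually_elim
      case (elim n)
      show ?case
      proof (intro allI impI)
        fix \<zeta> :: "real^2 \<Rightarrow> real" assume z: "continuous_on UNIV \<zeta> \<and> (\<forall>y. \<zeta> y \<noteq> 0 \<longrightarrow> norm (y - f x0) < min s (r/2))"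
        have "\<theta>' x * \<zeta> (F n x) = \<theta> x * \<zeta> (F n x)" for x
        proof (cases "x \<in> K - W")
          case True
          have "norm (f x - f x0) \<le> norm (F n x - f x) + norm (F n x - f x0)"
            using norm_triangle_ineq[of "f x - F n x" "F n x - f x0"] by (simp add: norm_minus_commute)
          moreover have "norm (F n x - f x) < r/2" using elim(1) True by simp
          ultimately have "\<not> norm (F n x - f x0) < r/2" using r(2)[OF True] by linarith
          then show ?thesis using z by fastforce
        next
          case False
          then have "\<theta> x = \<theta>' x"
            using W(4) closure_subset[of "{x. \<theta> x \<noteq> 0}"] closure_subset[of "{x. \<theta>' x \<noteq> 0}"] by (force simp: K_def)
          then show ?thesis by simp
        qed
        then have "jac_pair \<theta>' (F n) \<zeta> = jac_pair \<theta> (F n) \<zeta>" unfolding jac_pair_def by (simp only:)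
        also have "\<dots> = d * integral\<^sup>L lborel \<zeta>" using elim(2) z by simp
        finally show "jac_pair \<theta>' (F n) \<zeta> = d * integral\<^sup>L lborel \<zeta>" .
      qed
    qed
  qed (use r s in simp)
qed

lemma local_deg_unique:
  assumes "local_deg \<theta> x0 d" "local_deg \<theta> x0 d'"
  shows "d = d'"
proof -
  obtain s where s: "s > 0" "\<forall>\<^sub>F n in sequentially. \<forall>\<zeta>. continuous_on UNIV \<zeta> \<and> (\<forall>y. \<zeta> y \<noteq> 0 \<longrightarrow> norm (y - f x0) < s) \<longrightarrow>
     jac_pair \<theta> (F n) \<zeta> = d * integral\<^sup>L lborel \<zeta>" using assms(1) by (auto simp: local_deg_def)
  obtain s' where s': "s' > 0" "\<forall>\<^sub>F n in sequentially. \<forall>\<zeta>. continuous_on UNIV \<zeta> \<and> (\<forall>y. \<zeta> y \<noteq> 0 \<longrightarrow> norm (y - f x0) < s') \<longrightarrow>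
     jac_pair \<theta> (F n) \<zeta> = d' * integral\<^sup>L lborel \<zeta>" using assms(2) by (auto simp: local_deg_def)
  define \<epsilon> where "\<epsilon> = min s s' / 2"
  have e: "\<epsilon> > 0" using s s' by (simp add: \<epsilon>_def)
  have supp: "norm (z - f x0) < s \<and> norm (z - f x0) < s'" if "prod_kernel \<epsilon> (f x0) z \<noteq> 0" for z
  proof -
    have "\<not> 2 * \<epsilon> \<le> norm (z - f x0)" using prod_kernel_eq_0[OF e] that by blast
    then have "norm (z - f x0) < min s s'" by (simp add: \<epsilon>_def not_le)
    then show ?thesis by simp
  qed
  have "\<forall>\<^sub>F n in sequentially. d = d'"
    using s(2) s'(2)
  proof eventually_elim
    case (elim n)
    have "jac_pair \<theta> (F n) (prod_kernel \<epsilon> (f x0)) = d * 1" "jac_pair \<theta> (F n) (prod_kernel \<epsilon> (f x0)) = d' * 1"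
      using elim supp prod_kernel_continuous prod_kernel_integral(3)[OF e, of "f x0"] by metis+
    then show ?case by simp
  qed
  then show ?thesis by simp
qed

end

section \<open>Multiplicativity of the degree\<close>

lemma wedge_composition:
  assumes g: "C1_map g" and k: "C1_map k"
  shows "C1_map (\<lambda>x. k (g x))"
    "wedge (\<lambda>x. k (g x) $ 1) (\<lambda>x. k (g x) $ 2) x = wedge (\<lambda>y. k y $ 1) (\<lambda>y. k y $ 2) (g x) * wedge (\<lambda>x. g x $ 1) (\<lambda>x. g x $ 2) x"
proof -
  show "C1_map (\<lambda>x. k (g x))"
    unfolding C1_map_def using C1_compose(1)[OF C1_mapD[OF k] C1_mapD[OF g]] by blast
  show "wedge (\<lambda>x. k (g x) $ 1) (\<lambda>x. k (g x) $ 2) x = wedge (\<lambda>y. k y $ 1) (\<lambda>y. k y $ 2) (g x) * wedge (\<lambda>x. g x $ 1) (\<lambda>x. g x $ 2) x"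
    unfolding wedge_def C1_compose(2)[OF C1_mapD[OF k] C1_mapD[OF g]] by (simp add: algebra_simps)
qed

context planar_homeo
begin

interpretation H: planar_homeo \<Omega>' \<Omega> h f by (rule flip)

text \<open>Multiplicativity of the degree, applied to \<open>h \<circ> f = id\<close>.\<close>

lemma local_deg_inverse:
  assumes x0: "x0 \<in> \<Omega>" and t: "\<theta>1 \<in> test_functions \<Omega>" and W1: "open W1" "x0 \<in> W1" "\<And>x. x \<in> W1 \<Longrightarrow> \<theta>1 x = 1"
    and \<tau>: "\<tau> \<in> test_functions \<Omega>'" and W': "open W'" "f x0 \<in> W'" "\<And>y. y \<in> W' \<Longrightarrow> \<tau> y = 1"
    and d: "local_deg \<theta>1 x0 d" and e: "H.local_deg \<tau> (f x0) e"
  shows "d * e = 1"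
proof -
  let ?z = "f x0"
  have z0: "?z \<in> \<Omega>'" and hz: "h ?z = x0" using x0 f_in inv by auto
  \<comment> \<open>The cutoff \<open>\<theta>\<close> is chosen inside the preimage of
    \<open>W'\<close>, so that \<open>\<tau>\<close> equals 1 on a neighbourhood of the image of its
    support.\<close>
  define U0 where "U0 = \<Omega> \<inter> f -` W'"
  have U0: "open U0" "x0 \<in> U0" "U0 \<subseteq> \<Omega>"
    using continuous_open_preimage[OF cont(1) opn(1) W'(1)] x0 W'(2) by (auto simp: U0_def)
  obtain \<theta> W where \<theta>: "\<theta> \<in> test_functions U0" and W: "open W" "{x0} \<subseteq> W" "W \<subseteq> U0" "\<And>x. x \<in> W \<Longrightarrow> \<theta> x = 1"
    using cutoff_exists[of "{x0}" U0] U0 by (metis compact_sing empty_subsetI insert_subset)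
  have \<theta>\<Omega>: "\<theta> \<in> test_functions \<Omega>" using \<theta> U0(3) unfolding test_functions_def by blast
  note tD = test_functionD[OF \<theta>]
  have "local_deg \<theta> x0 d"
    by (rule local_deg_unique_cutoff[OF t \<theta>\<Omega> _ _ x0 _ d, of "W \<inter> W1"]) (use W W1 in auto)
  then obtain r where r: "r > 0" "\<forall>\<^sub>F n in sequentially. \<forall>\<zeta>. continuous_on UNIV \<zeta> \<and> (\<forall>y. \<zeta> y \<noteq> 0 \<longrightarrow> norm (y - ?z) < r) \<longrightarrow>
     jac_pair \<theta> (F n) \<zeta> = d * integral\<^sup>L lborel \<zeta>" by (auto simp: local_deg_def)
  obtain s where s: "s > 0" "\<forall>\<^sub>F n in sequentially. \<forall>\<zeta>. continuous_on UNIV \<zeta> \<and> (\<forall>y. \<zeta> y \<noteq> 0 \<longrightarrow> norm (y - x0) < s) \<longrightarrow>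
     jac_pair \<tau> (H.F n) \<zeta> = e * integral\<^sup>L lborel \<zeta>" using e by (auto simp: H.local_deg_def hz)
  define K where "K = closure {x. \<theta> x \<noteq> 0}"
  have K: "compact K" "K \<subseteq> U0" "K \<subseteq> \<Omega>" using tD U0 by (auto simp: K_def)
  have \<theta>0: "\<theta> x = 0" if "x \<notin> K" for x using that closure_subset[of "{x. \<theta> x \<noteq> 0}"] by (auto simp: K_def)
  define K' where "K' = closure {y. \<tau> y \<noteq> 0}"
  have K': "compact K'" "K' \<subseteq> \<Omega>'" using test_functionD[OF \<tau>] by (auto simp: K'_def)
  have \<tau>0: "\<tau> y = 0" if "y \<notin> K'" for y using that closure_subset[of "{x. \<tau> x \<noteq> 0}"] by (auto simp: K'_def)
  have cfK: "compact (f ` K)" by (intro compact_continuous_image continuous_on_subset[OF cont(1)] K)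
  have fKW: "f ` K \<subseteq> W' \<inter> \<Omega>'" using K f_in by (auto simp: U0_def)
  have x0K: "x0 \<in> K" using W(2,4) closure_subset[of "{x. \<theta> x \<noteq> 0}"] by (auto simp: K_def)
  obtain \<delta> where d\<delta>: "\<delta> > 0" and cC: "compact {y. infdist y (f ` K) \<le> \<delta>}" and C: "{y. infdist y (f ` K) \<le> \<delta>} \<subseteq> W' \<inter> \<Omega>'"
    using compact_neighborhood[OF cfK open_Int[OF W'(1) opn(2)] fKW] x0K by blast
  let ?C = "{y. infdist y (f ` K) \<le> \<delta>}"
  obtain m0 where m0: "m0 > 0" "\<And>y. y \<in> K' - ball ?z r \<Longrightarrow> norm (h y - x0) \<ge> m0"
    by (rule H.separation_point[OF z0 K' open_ball centre_in_ball[THEN iffD2, OF r(1)]]) (simp add: hz)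
  have "\<exists>m1>0. \<forall>x\<in>K - W. m1 \<le> norm (x - x0)"
  proof -
    obtain m where "m > 0" "\<forall>a\<in>K - W. \<forall>b\<in>{x0}. m \<le> dist a b"
      using separate_compact_closed[of "K - W" "{x0}"] compact_diff[OF K(1) W(1)] W(2) by auto
    then show ?thesis by (auto simp: dist_norm)
  qed
  then obtain m1 where m1: "m1 > 0" "\<And>x. x \<in> K - W \<Longrightarrow> m1 \<le> norm (x - x0)" by blast
  obtain w where w: "w > 0" "ball x0 w \<subseteq> W" using W(1,2) by (auto elim: openE)
  \<comment> \<open>The kernel about \<open>x0\<close> has radius \<open>2 * \<sigma>\<close>. Being
    below \<open>s\<close> it is where the degree of \<open>h\<close> is known, below
    \<open>w\<close> it is where \<open>\<theta>\<close> is 1, below \<open>m0 / 2\<close> it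
    confines the support of \<open>\<zeta>\<close> to the ball where the degree of \<open>f\<close>
    is known, and below \<open>m1 / 2\<close> it stays clear of the region of varying
    \<open>\<theta>\<close> during the homotopy.\<close>
  define \<sigma> where "\<sigma> = min (min s w) (min m0 m1) / 8"
  have sg: "\<sigma> > 0" "2 * \<sigma> < s" "2 * \<sigma> < w" "2 * \<sigma> < m0 / 2" "2 * \<sigma> < m1 / 2" "2 * \<sigma> \<le> m1 / 4"
    using s(1) w(1) m0(1) m1(1) by (auto simp: \<sigma>_def min_def)
  let ?\<chi> = "prod_kernel \<sigma> x0"
  have \<chi>s: "norm (x - x0) < 2 * \<sigma>" if "?\<chi> x \<noteq> 0" for x
    using prod_kernel_eq_0[OF sg(1), of x x0] that by (cases "norm (x - x0) < 2 * \<sigma>") auto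
  have "\<forall>\<^sub>F m in sequentially. \<forall>y\<in>K'. norm (H.F m y - h y) < m0 / 2"
    by (rule H.F_uniform[OF K']) (use m0 in simp)
  moreover have "\<forall>\<^sub>F m in sequentially. \<forall>y\<in>?C. norm (H.F m y - h y) < m1 / 4"
    by (rule H.F_uniform[OF cC]) (use C m1 in auto)
  ultimately have "\<forall>\<^sub>F m in sequentially. (\<forall>y\<in>K'. norm (H.F m y - h y) < m0 / 2) \<and> (\<forall>y\<in>?C. norm (H.F m y - h y) < m1 / 4) \<and>
     (\<forall>\<zeta>. continuous_on UNIV \<zeta> \<and> (\<forall>y. \<zeta> y \<noteq> 0 \<longrightarrow> norm (y - x0) < s) \<longrightarrow> jac_pair \<tau> (H.F m) \<zeta> = e * integral\<^sup>L lborel \<zeta>)"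
    using s(2) by eventually_elim blast
  then obtain m where m: "\<And>y. y \<in> K' \<Longrightarrow> norm (H.F m y - h y) < m0 / 2" "\<And>y. y \<in> ?C \<Longrightarrow> norm (H.F m y - h y) < m1 / 4"
     "\<And>\<zeta>. continuous_on UNIV \<zeta> \<and> (\<forall>y. \<zeta> y \<noteq> 0 \<longrightarrow> norm (y - x0) < s) \<Longrightarrow> jac_pair \<tau> (H.F m) \<zeta> = e * integral\<^sup>L lborel \<zeta>"
    using eventually_happens'[OF sequentially_bot] by blast
  have "uniformly_continuous_on ?C h"
    by (intro compact_uniformly_continuous continuous_on_subset[OF cont(2)] cC) (use C in auto)
  then obtain q where q: "q > 0" "\<And>y y'. y \<in> ?C \<Longrightarrow> y' \<in> ?C \<Longrightarrow> dist y' y < q \<Longrightarrow> dist (h y') (h y) < m1 / 4"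
    unfolding uniformly_continuous_on_def using m1(1) by (metis zero_less_divide_iff zero_less_numeral)
  have "\<forall>\<^sub>F n in sequentially. \<forall>x\<in>K. norm (F n x - f x) < min q \<delta>"
    by (rule F_uniform[OF K(1,3)]) (use q d\<delta> in simp)
  then have "\<forall>\<^sub>F n in sequentially. (\<forall>x\<in>K. norm (F n x - f x) < min q \<delta>) \<and>
      (\<forall>\<zeta>. continuous_on UNIV \<zeta> \<and> (\<forall>y. \<zeta> y \<noteq> 0 \<longrightarrow> norm (y - ?z) < r) \<longrightarrow> jac_pair \<theta> (F n) \<zeta> = d * integral\<^sup>L lborel \<zeta>)"
    using r(2) by eventually_elim blast
  then obtain n where n: "\<And>x. x \<in> K \<Longrightarrow> norm (F n x - f x) < min q \<delta>"
     "\<And>\<zeta>. continuous_on UNIV \<zeta> \<and> (\<forall>y. \<zeta> y \<noteq> 0 \<longrightarrow> norm (y - ?z) < r) \<Longrightarrow> jac_pair \<theta> (F n) \<zeta> = d * integral\<^sup>L lborel \<zeta>"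
    using eventually_happens'[OF sequentially_bot] by blast
  have FC: "F n x \<in> ?C" if "x \<in> K" for x
    using infdist_le[of "f x" "f ` K" "F n x"] n(1)[OF that] that by (auto simp: dist_norm)
  have fC: "f x \<in> ?C" if "x \<in> K" for x using that d\<delta> by simp
  have near: "norm (H.F m (F n x) - x) < m1 / 2" if x: "x \<in> K" for x
  proof -
    have "norm (H.F m (F n x) - h (F n x)) < m1 / 4" by (rule m(2)[OF FC[OF x]])
    moreover have "norm (h (F n x) - h (f x)) < m1 / 4"
      using q(2)[OF fC[OF x] FC[OF x]] n(1)[OF x] by (simp add: dist_norm)
    moreover have "h (f x) = x" using x K by (intro inv) auto
    ultimately show ?thesis
      using norm_triangle_ineq[of "H.F m (F n x) - h (F n x)" "h (F n x) - x"] by simp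
  qed
  let ?JH = "wedge (\<lambda>y. H.F m y $ 1) (\<lambda>y. H.F m y $ 2)"
  \<comment> \<open>The density obtained by pulling back the kernel with the mollified inverse. Its
    integral is the degree \<open>e\<close> of the inverse; its pairing with \<open>F n\<close> is
    \<open>d\<close> times that integral, and by the chain rule it is also the pairing of the
    composed map with the kernel.\<close>
  define \<zeta> where "\<zeta> y = \<tau> y * ?\<chi> (H.F m y) * ?JH y" for y
  have cz: "continuous_on UNIV \<zeta>"
    unfolding \<zeta>_def
    by (intro continuous_on_mult test_functionD(6)[OF \<tau>] continuous_on_compose2[OF prod_kernel_continuous C1_map_continuous[OF H.F_C1]]
        wedge_continuous C1_mapD[OF H.F_C1]) auto
  have sz: "norm (y - ?z) < r" if y: "\<zeta> y \<noteq> 0" for y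
  proof (rule ccontr)
    assume n: "\<not> norm (y - ?z) < r"
    have yK: "y \<in> K'" using y \<tau>0 by (auto simp: \<zeta>_def)
    then have "norm (h y - x0) \<ge> m0" using m0(2)[of y] n by (auto simp: dist_norm norm_minus_commute)
    moreover have "norm (H.F m y - x0) < 2 * \<sigma>" using \<chi>s[of "H.F m y"] y by (auto simp: \<zeta>_def)
    moreover have "norm (h y - x0) \<le> norm (H.F m y - h y) + norm (H.F m y - x0)"
      using norm_triangle_ineq[of "h y - H.F m y" "H.F m y - x0"] by (simp add: norm_minus_commute)
    ultimately show False using m(1)[OF yK] sg(4) by linarith
  qed
  have "jac_pair \<theta> (F n) \<zeta> = d * integral\<^sup>L lborel \<zeta>" using n(2) cz sz by blast
  also have "integral\<^sup>L lborel \<zeta> = jac_pair \<tau> (H.F m) ?\<chi>" by (simp add: jac_pair_def \<zeta>_def[abs_def])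
  also have "\<dots> = e * 1"
    using m(3)[of ?\<chi>] prod_kernel_continuous \<chi>s sg(2) prod_kernel_integral(3)[OF sg(1), of x0] by fastforce
  finally have "jac_pair \<theta> (F n) \<zeta> = d * e" by simp
  moreover have "jac_pair \<theta> (F n) \<zeta> = jac_pair \<theta> (\<lambda>x. H.F m (F n x)) ?\<chi>"
  proof -
    have "\<theta> x * \<zeta> (F n x) * wedge (\<lambda>x. F n x $ 1) (\<lambda>x. F n x $ 2) x =
      \<theta> x * ?\<chi> (H.F m (F n x)) * wedge (\<lambda>x. H.F m (F n x) $ 1) (\<lambda>x. H.F m (F n x) $ 2) x" for x
    proof (cases "x \<in> K")
      case True
      then have "\<tau> (F n x) = 1" using FC C W'(3) by blast
      then show ?thesis unfolding wedge_composition(2)[OF F_C1 H.F_C1] by (simp add: \<zeta>_def)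
    qed (simp add: \<theta>0)
    then show ?thesis unfolding jac_pair_def by (simp only:)
  qed
  \<comment> \<open>Where the cutoff varies, the composed mollifications are within
    \<open>m1 / 2\<close> of the identity, so the pairing can be computed for the identity.\<close>
  moreover have "jac_pair \<theta> (\<lambda>x. H.F m (F n x)) ?\<chi> = jac_pair \<theta> (\<lambda>x. x) ?\<chi>"
  proof (rule jac_pair_homotopy[OF sg(1) tD(5,4) wedge_composition(1)[OF F_C1 H.F_C1], where F="\<lambda>x. x"])
    show "C1_map (\<lambda>x. x)" unfolding C1_map_def by (intro allI C_k_nth)
    fix x i assume "part_deriv i \<theta> x \<noteq> 0"
    then have "x \<in> K - W" using part_deriv_cutoff[OF W(1,4)] by (auto simp: K_def)
    then show "norm (H.F m (F n x) - x) + norm (x - x) + 2 * \<sigma> < norm (x0 - x)"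
      using near[of x] m1(2)[of x] sg(5) by (simp add: norm_minus_commute)
  qed
  moreover have "jac_pair \<theta> (\<lambda>x. x) ?\<chi> = 1"
  proof -
    have "\<theta> x * ?\<chi> x * wedge (\<lambda>x. x $ 1) (\<lambda>x. x $ 2) x = ?\<chi> x" for x
    proof (cases "?\<chi> x = 0")
      case False
      then have "x \<in> W" using \<chi>s[of x] sg(3) w(2) by (auto simp: dist_norm norm_minus_commute)
      then show ?thesis using W(4) by (simp add: wedge_nth part_deriv_nth)
    qed simp
    then show ?thesis unfolding jac_pair_def by (simp only: prod_kernel_integral(3)[OF sg(1)])
  qed
  ultimately show ?thesis by simp
qed

end

lemma compact_positive_gap:
  fixes u :: "'a::metric_space \<Rightarrow> real"
  assumes "compact S" "continuous_on S u" "\<And>x. x \<in> S \<Longrightarrow> u x > 0"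
  obtains m where "m > 0" "\<And>x. x \<in> S \<Longrightarrow> m \<le> u x"
proof (cases "S = {}")
  case True
  then show thesis using that[of 1] by simp
next
  case False
  then obtain x where x: "x \<in> S" "\<forall>y\<in>S. u x \<le> u y" using continuous_attains_inf[OF assms(1) _ assms(2)] by blast
  then show thesis using that[of "u x"] assms(3) by blast
qed

context planar_homeo
begin

section \<open>The Brouwer degree of a homeomorphism\<close>

text \<open>The admissible maps \<open>g\<close> need not be uniformly close to \<open>f\<close>
  compared with the scale of the local degree: the straight homotopy from \<open>g\<close> to
  \<open>f\<close> may cross \<open>f x0\<close> inside the ball. The cutoff is therefore taken to
  be 1 around all points where this can happen.\<close>

lemma regular_approx_count:
  assumes x0: "x0 \<in> \<Omega>" and \<rho>: "\<rho> > 0" "cball x0 \<rho> \<subseteq> \<Omega>"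
    and t: "\<theta> \<in> test_functions \<Omega>" and W: "open W" "x0 \<in> W" "\<And>x. x \<in> W \<Longrightarrow> \<theta> x = 1"
    and d: "local_deg \<theta> x0 d" and ra: "regular_approx f (ball x0 \<rho>) (f x0) g"
  shows "(\<Sum>x\<in>{x \<in> ball x0 \<rho>. g x = f x0}. sgn (det (jacobian g (at x)))) = d"
proof -
  let ?y = "f x0"
  have g: "C1_map g" using ra by (simp add: regular_approx_def C1_map_def)
  have cg: "continuous_on UNIV g" by (rule C1_map_continuous[OF g])
  have near: "norm (g x - f x) < infdist ?y (f ` sphere x0 \<rho>)" if "x \<in> cball x0 \<rho>" for x
    using ra that \<rho>(1) by (auto simp: regular_approx_def dist_norm)
  have reg: "wedge (\<lambda>x. g x $ 1) (\<lambda>x. g x $ 2) x \<noteq> 0" if "x \<in> ball x0 \<rho>" "g x = ?y" for x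
    using ra that det_jacobian[OF C1_mapD[OF g], of x] by (auto simp: regular_approx_def)
  \<comment> \<open>The points where the segment from \<open>f x\<close> to \<open>g x\<close> could
    reach \<open>f x0\<close>. The closeness condition on the sphere makes this a compact subset of
    the open ball.\<close>
  define Kg where "Kg = {x \<in> cball x0 \<rho>. norm (?y - f x) \<le> norm (g x - f x)}"
  have cf: "continuous_on (cball x0 \<rho>) f" by (rule continuous_on_subset[OF cont(1) \<rho>(2)])
  have "closed Kg"
    unfolding Kg_def
    by (intro continuous_on_closed_Collect_le continuous_intros cf continuous_on_subset[OF cg]) auto
  then have cK: "compact Kg" unfolding Kg_def
    by (metis (no_types, lifting) bounded_cball bounded_subset compact_eq_bounded_closed mem_Collect_eq subsetI)
  have Kb: "Kg \<subseteq> ball x0 \<rho>"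
  proof
    fix x assume x: "x \<in> Kg"
    show "x \<in> ball x0 \<rho>"
    proof (rule ccontr)
      assume "x \<notin> ball x0 \<rho>"
      then have "x \<in> sphere x0 \<rho>" using x by (auto simp: Kg_def)
      then have "infdist ?y (f ` sphere x0 \<rho>) \<le> norm (?y - f x)" using infdist_le[of "f x" "f ` sphere x0 \<rho>" ?y] by (simp add: dist_norm)
      then show False using near[of x] x by (auto simp: Kg_def)
    qed
  qed
  have x0K: "x0 \<in> Kg" using \<rho> by (simp add: Kg_def)
  obtain \<theta>g Wg where \<theta>g: "\<theta>g \<in> test_functions (ball x0 \<rho>)" and Wg: "open Wg" "Kg \<subseteq> Wg" "\<And>x. x \<in> Wg \<Longrightarrow> \<theta>g x = 1"
    using cutoff_exists[OF cK open_ball Kb] by metis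
  have \<theta>\<Omega>: "\<theta>g \<in> test_functions \<Omega>"
    using \<theta>g order_trans[OF ball_subset_cball \<rho>(2)] unfolding test_functions_def by auto
  note tD = test_functionD[OF \<theta>g]
  define K where "K = closure {x. \<theta>g x \<noteq> 0}"
  have K1: "compact K" "K \<subseteq> ball x0 \<rho>" using tD by (auto simp: K_def)
  have bO: "ball x0 \<rho> \<subseteq> \<Omega>" using \<rho>(2) ball_subset_cball by (rule order_trans[rotated])
  note K = K1 order_trans[OF K1(2) bO]
  have \<theta>0: "\<theta>g x = 0" if "x \<notin> K" for x using that closure_subset[of "{x. \<theta>g x \<noteq> 0}"] by (auto simp: K_def)
  have "local_deg \<theta>g x0 d"
    by (rule local_deg_unique_cutoff[OF t \<theta>\<Omega> _ _ x0 _ d, of "W \<inter> Wg"]) (use W Wg x0K in auto)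
  then obtain s where s: "s > 0" "\<forall>\<^sub>F n in sequentially. \<forall>\<zeta>. continuous_on UNIV \<zeta> \<and> (\<forall>y. \<zeta> y \<noteq> 0 \<longrightarrow> norm (y - ?y) < s) \<longrightarrow>
     jac_pair \<theta>g (F n) \<zeta> = d * integral\<^sup>L lborel \<zeta>" by (auto simp: local_deg_def)
  let ?J = "wedge (\<lambda>x. g x $ 1) (\<lambda>x. g x $ 2)"
  let ?P = "{x. g x = ?y \<and> \<theta>g x \<noteq> 0}"
  have inKg: "x \<in> Kg" if "x \<in> cball x0 \<rho>" "g x = ?y" for x using that by (simp add: Kg_def)
  have loc: "\<exists>U c. open U \<and> x \<in> U \<and> (c = 0 \<or> c = 1) \<and> (\<forall>x'\<in>U. \<theta>g x' = c)" if gx: "g x = ?y" for x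
  proof (cases "x \<in> K")
    case True
    then have "x \<in> Wg" using inKg[of x] gx K(2) Wg(2) ball_subset_cball by blast
    then show ?thesis using Wg by (intro exI[of _ Wg] exI[of _ 1]) auto
  next
    case False
    moreover have "open (- K)" using compact_imp_closed[OF K(1)] by (rule open_Compl)
    ultimately show ?thesis using \<theta>0 by (intro exI[of _ "- K"] exI[of _ 0] conjI ballI) simp_all
  qed
  have P_in: "x \<in> ball x0 \<rho>" if "\<theta>g x \<noteq> 0" for x using \<theta>0 that K(2) by blast
  obtain \<rho>' where \<rho>': "\<rho>' > 0" "\<And>\<zeta>. continuous_on UNIV \<zeta> \<Longrightarrow> (\<And>z. \<zeta> z \<noteq> 0 \<Longrightarrow> norm (z - ?y) < \<rho>') \<Longrightarrow>
     jac_pair \<theta>g g \<zeta> = (\<Sum>x\<in>?P. sgn (?J x)) * integral\<^sup>L lborel \<zeta>"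
    using jac_pair_regular_value(2)[OF tD(5,4) g loc reg] P_in by blast
  have Peq: "?P = {x \<in> ball x0 \<rho>. g x = ?y}"
    using P_in inKg Wg ball_subset_cball by fastforce
  have cKW: "compact (K - Wg)" by (rule compact_diff[OF K(1) Wg(1)])
  \<comment> \<open>Off \<open>Wg\<close> the value \<open>f x0\<close> is farther from
    \<open>f x\<close> than \<open>g x\<close> is, by a uniform margin on the support of the cutoff.
    This margin is what the homotopy to a mollification consumes.\<close>
  obtain \<mu> where \<mu>: "\<mu> > 0" "\<And>x. x \<in> K - Wg \<Longrightarrow> \<mu> \<le> norm (?y - f x) - norm (g x - f x)"
  proof (rule compact_positive_gap[OF cKW, of "\<lambda>x. norm (?y - f x) - norm (g x - f x)"])
    show "continuous_on (K - Wg) (\<lambda>x. norm (?y - f x) - norm (g x - f x))"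
      by (intro continuous_intros continuous_on_subset[OF cg] continuous_on_subset[OF cont(1)]) (use K in auto)
    show "norm (?y - f x) - norm (g x - f x) > 0" if "x \<in> K - Wg" for x
    proof -
      have "x \<in> cball x0 \<rho>" "x \<notin> Kg" using that K(2) Wg(2) ball_subset_cball by auto
      then show ?thesis by (simp add: Kg_def)
    qed
  qed blast
  have "\<forall>\<^sub>F n in sequentially. \<forall>x\<in>K. norm (F n x - f x) < \<mu> / 4"
    by (rule F_uniform[OF K(1,3)]) (use \<mu> in simp)
  then have "\<forall>\<^sub>F n in sequentially. (\<forall>x\<in>K. norm (F n x - f x) < \<mu> / 4) \<and> (\<forall>\<zeta>. continuous_on UNIV \<zeta> \<and> (\<forall>y. \<zeta> y \<noteq> 0 \<longrightarrow> norm (y - ?y) < s) \<longrightarrow>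
     jac_pair \<theta>g (F n) \<zeta> = d * integral\<^sup>L lborel \<zeta>)" using s(2) by eventually_elim blast
  then obtain n where n: "\<And>x. x \<in> K \<Longrightarrow> norm (F n x - f x) < \<mu> / 4"
     "\<And>\<zeta>. continuous_on UNIV \<zeta> \<Longrightarrow> (\<And>y. \<zeta> y \<noteq> 0 \<Longrightarrow> norm (y - ?y) < s) \<Longrightarrow> jac_pair \<theta>g (F n) \<zeta> = d * integral\<^sup>L lborel \<zeta>"
    using eventually_happens'[OF sequentially_bot] by blast
  define \<epsilon> where "\<epsilon> = min (min s \<rho>') \<mu> / 16"
  have e: "\<epsilon> > 0" "2 * \<epsilon> < s" "2 * \<epsilon> < \<rho>'" "2 * \<epsilon> < \<mu> / 4" using s(1) \<rho>'(1) \<mu>(1) by (auto simp: \<epsilon>_def min_def)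
  have supp: "norm (z - ?y) < 2 * \<epsilon>" if "prod_kernel \<epsilon> ?y z \<noteq> 0" for z
    using prod_kernel_eq_0[OF e(1), of z ?y] that by (cases "norm (z - ?y) < 2 * \<epsilon>") auto
  have "jac_pair \<theta>g g (prod_kernel \<epsilon> ?y) = jac_pair \<theta>g (F n) (prod_kernel \<epsilon> ?y)"
  proof (rule jac_pair_homotopy[OF e(1) tD(5,4) g F_C1, where F=f])
    fix x i assume "part_deriv i \<theta>g x \<noteq> 0"
    then have "x \<in> K - Wg" using part_deriv_cutoff[OF Wg(1,3)] by (auto simp: K_def)
    then show "norm (g x - f x) + norm (F n x - f x) + 2 * \<epsilon> < norm (?y - f x)"
      using \<mu>(2)[of x] n(1)[of x] e(4) \<mu>(1) by simp
  qed
  moreover have "jac_pair \<theta>g (F n) (prod_kernel \<epsilon> ?y) = d * integral\<^sup>L lborel (prod_kernel \<epsilon> ?y)"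
    by (rule n(2)[OF prod_kernel_continuous]) (use supp e(2) in fastforce)
  moreover have "jac_pair \<theta>g g (prod_kernel \<epsilon> ?y) = (\<Sum>x\<in>?P. sgn (?J x)) * integral\<^sup>L lborel (prod_kernel \<epsilon> ?y)"
    by (rule \<rho>'(2)[OF prod_kernel_continuous]) (use supp e(3) in fastforce)
  ultimately have "(\<Sum>x\<in>?P. sgn (?J x)) = d" by (simp add: prod_kernel_integral(3)[OF e(1)])
  then show ?thesis unfolding Peq det_jacobian[OF C1_mapD[OF g]] .
qed

text \<open>A mollification, translated slightly by Sard's theorem. The permitted distance is
  positive because injectivity keeps \<open>f x0\<close> off the image of the sphere.\<close>

lemma regular_approx_exists:
  assumes x0: "x0 \<in> \<Omega>" and \<rho>: "\<rho> > 0" "cball x0 \<rho> \<subseteq> \<Omega>"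
  shows "\<exists>g. regular_approx f (ball x0 \<rho>) (f x0) g"
proof -
  let ?R = "infdist (f x0) (f ` sphere x0 \<rho>)"
  have sp: "sphere x0 \<rho> \<noteq> {}" using \<rho>(1) by simp
  have sub: "sphere x0 \<rho> \<subseteq> \<Omega>" using \<rho> by auto
  have "closed (f ` sphere x0 \<rho>)"
    by (intro compact_imp_closed compact_continuous_image continuous_on_subset[OF cont(1) sub]) simp
  moreover have "f x0 \<notin> f ` sphere x0 \<rho>"
  proof
    assume "f x0 \<in> f ` sphere x0 \<rho>"
    then obtain x where "x \<in> sphere x0 \<rho>" "f x0 = f x" by blast
    then show False using f_eq_iff[OF x0, of x] sub \<rho>(1) by auto
  qed
  ultimately have "?R \<noteq> 0" using in_closed_iff_infdist_zero[of "f ` sphere x0 \<rho>"] sp by auto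
  then have R: "?R > 0" using infdist_nonneg[of "f x0" "f ` sphere x0 \<rho>"] by simp
  have "\<forall>\<^sub>F n in sequentially. \<forall>x\<in>cball x0 \<rho>. norm (F n x - f x) < ?R / 2"
    by (rule F_uniform[OF _ \<rho>(2)]) (use R in auto)
  then obtain n where n: "\<And>x. x \<in> cball x0 \<rho> \<Longrightarrow> norm (F n x - f x) < ?R / 2"
    using eventually_happens'[OF sequentially_bot] by blast
  obtain c where c: "norm c < ?R / 2" "\<And>x. F n x + c = f x0 \<Longrightarrow> wedge (\<lambda>x. F n x $ 1) (\<lambda>x. F n x $ 2) x \<noteq> 0"
    using regular_value_near[OF F_C1[of n], of "?R/2" "f x0"] R by auto
  let ?g = "\<lambda>x. F n x + c"
  have g: "C1_map ?g" by (rule C1_map_shift[OF F_C1])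
  have "regular_approx f (ball x0 \<rho>) (f x0) ?g"
    unfolding regular_approx_def
  proof (intro conjI allI ballI impI)
    show "C_k 1 (\<lambda>x. ?g x $ i)" for i by (rule C1_mapD[OF g])
    show "dist (?g x) (f x) < infdist (f x0) (f ` frontier (ball x0 \<rho>))" if "x \<in> closure (ball x0 \<rho>)" for x
    proof -
      have "norm (?g x - f x) \<le> norm (F n x - f x) + norm c"
        using norm_triangle_ineq[of "F n x - f x" c] by (simp add: algebra_simps)
      then show ?thesis using n[of x] c(1) that \<rho>(1) by (simp add: dist_norm)
    qed
    show "det (jacobian ?g (at x)) \<noteq> 0" if "?g x = f x0" for x
      unfolding det_jacobian[OF C1_mapD[OF g]] C1_map_shift(2)[OF F_C1] by (rule c(2)[OF that])
  qed
  then show ?thesis by blast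
qed

text \<open>Evaluates the definite description: an admissible map exists, and all of them give the
  same signed count.\<close>

lemma brouwer_degree_eq_local_deg:
  assumes x0: "x0 \<in> \<Omega>" and \<rho>: "\<rho> > 0" "cball x0 \<rho> \<subseteq> \<Omega>"
    and t: "\<theta> \<in> test_functions \<Omega>" and W: "open W" "x0 \<in> W" "\<And>x. x \<in> W \<Longrightarrow> \<theta> x = 1"
    and k: "local_deg \<theta> x0 (real_of_int k)"
  shows "brouwer_degree f (ball x0 \<rho>) (f x0) = k"
  unfolding brouwer_degree_def
proof (rule the_equality)
  show "\<exists>g. regular_approx f (ball x0 \<rho>) (f x0) g \<and> real_of_int k = (\<Sum>x\<in>{x \<in> ball x0 \<rho>. g x = f x0}. sgn (det (jacobian g (at x))))"
  proof -
    obtain g where g: "regular_approx f (ball x0 \<rho>) (f x0) g" using regular_approx_exists[OF x0 \<rho>] by blast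
    show ?thesis by (intro exI[of _ g] conjI g) (rule regular_approx_count[OF x0 \<rho> t W k g, symmetric])
  qed
  fix d :: int
  assume "\<exists>g. regular_approx f (ball x0 \<rho>) (f x0) g \<and> real_of_int d = (\<Sum>x\<in>{x \<in> ball x0 \<rho>. g x = f x0}. sgn (det (jacobian g (at x))))"
  then obtain g where g: "regular_approx f (ball x0 \<rho>) (f x0) g"
    "real_of_int d = (\<Sum>x\<in>{x \<in> ball x0 \<rho>. g x = f x0}. sgn (det (jacobian g (at x))))" by blast
  have "real_of_int d = real_of_int k" unfolding g(2) by (rule regular_approx_count[OF x0 \<rho> t W k g(1)])
  then show "d = k" by simp
qed

lemma point_cutoff:
  assumes "x0 \<in> \<Omega>"
  obtains \<theta> W where "\<theta> \<in> test_functions \<Omega>" "open W" "x0 \<in> W" "\<And>x. x \<in> W \<Longrightarrow> \<theta> x = 1"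
  using cutoff_exists[of "{x0}" \<Omega>] assms opn(1) by (metis compact_sing empty_subsetI insert_subset)

end

context planar_homeo
begin

interpretation H: planar_homeo \<Omega>' \<Omega> h f by (rule flip)

text \<open>The local degrees of \<open>f\<close> and of its inverse are integers with product 1,
  hence both 1 or both -1; positivity of the Brouwer degree on one small ball decides the
  sign.\<close>

lemma sense_preserving_local_deg:
  assumes sp: "sense_preserving \<Omega> f" and x0: "x0 \<in> \<Omega>"
    and t: "\<theta> \<in> test_functions \<Omega>" and W: "open W" "x0 \<in> W" "\<And>x. x \<in> W \<Longrightarrow> \<theta> x = 1"
  shows "local_deg \<theta> x0 1"
proof -
  obtain k :: int where k: "local_deg \<theta> x0 (real_of_int k)"
    using local_deg_integer[OF t W(1,2) x0 W(3)] .
  have z: "f x0 \<in> \<Omega>'" using f_in x0 by blast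
  obtain \<tau> W' where \<tau>: "\<tau> \<in> test_functions \<Omega>'" "open W'" "f x0 \<in> W'" "\<And>y. y \<in> W' \<Longrightarrow> \<tau> y = 1"
    using H.point_cutoff[OF z] by metis
  obtain e :: int where e: "H.local_deg \<tau> (f x0) (real_of_int e)"
    using H.local_deg_integer[OF \<tau>(1,2,3) z \<tau>(4)] .
  have "real_of_int k * real_of_int e = 1" by (rule local_deg_inverse[OF x0 t W \<tau> k e])
  then have ke: "k * e = 1" by (metis of_int_eq_1_iff of_int_mult)
  obtain \<rho> where \<rho>: "\<rho> > 0" "cball x0 \<rho> \<subseteq> \<Omega>" using opn(1) x0 open_contains_cball by blast
  have "f x0 \<in> f ` ball x0 \<rho> - f ` frontier (ball x0 \<rho>)"
  proof -
    have "f x0 \<notin> f ` sphere x0 \<rho>"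
    proof
      assume "f x0 \<in> f ` sphere x0 \<rho>"
      then obtain x where "x \<in> sphere x0 \<rho>" "f x0 = f x" by blast
      then show False using f_eq_iff[OF x0, of x] \<rho> by auto
    qed
    then show ?thesis using \<rho>(1) by auto
  qed
  then have "brouwer_degree f (ball x0 \<rho>) (f x0) > 0"
    using sp \<rho> unfolding sense_preserving_def by (auto dest!: spec[of _ "ball x0 \<rho>"])
  then have "k > 0" using brouwer_degree_eq_local_deg[OF x0 \<rho> t W k] by simp
  then have "k = 1" using ke by (simp add: zmult_eq_1_iff)
  then show ?thesis using k by simp
qed

text \<open>The threshold on \<open>n\<close> depends only on the gap \<open>r\<close> between
  \<open>C\<close> and the region of varying cutoff, so it is uniform in \<open>\<zeta>\<close>.
  Superposing kernels centred in \<open>C\<close> extends the formula from small supports to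
  supports in \<open>C\<close> without a partition of unity.\<close>

lemma jac_pair_eventually:
  assumes sp: "sense_preserving \<Omega> f" and C: "compact C" "C \<subseteq> \<Omega>'"
    and t: "\<theta> \<in> test_functions \<Omega>" and W: "open W" "h ` C \<subseteq> W" "\<And>x. x \<in> W \<Longrightarrow> \<theta> x = 1"
  shows "\<forall>\<^sub>F n in sequentially. \<forall>\<zeta>. continuous_on UNIV \<zeta> \<and> (\<forall>y. \<zeta> y \<noteq> 0 \<longrightarrow> y \<in> C) \<longrightarrow> jac_pair \<theta> (F n) \<zeta> = integral\<^sup>L lborel \<zeta>"
proof -
  note tD = test_functionD[OF t]
  define K where "K = closure {x. \<theta> x \<noteq> 0}"
  have K: "compact K" "K \<subseteq> \<Omega>" using tD by (auto simp: K_def)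
  obtain r where r: "r > 0" "\<And>x z. x \<in> K - W \<Longrightarrow> z \<in> C \<Longrightarrow> norm (f x - z) \<ge> r"
    using separation[OF C K W(1,2)] by blast
  have ev: "\<forall>\<^sub>F n in sequentially. \<forall>x\<in>K. norm (F n x - f x) < r / 16"
    by (rule F_uniform[OF K]) (use r in simp)
  have pK: "x \<in> K - W" if "part_deriv i \<theta> x \<noteq> 0" for x i
    using part_deriv_cutoff[OF W(1,3) that] by (auto simp: K_def)
  \<comment> \<open>Near \<open>z\<close> the degree of all close mollifications is one constant
    \<open>d\<close>. It is a local degree at \<open>h z\<close>, and uniqueness of the local degree
    gives \<open>d = 1\<close>.\<close>
  have one: "jac_pair \<theta> (F n) \<zeta> = integral\<^sup>L lborel \<zeta>"
    if n: "\<forall>x\<in>K. norm (F n x - f x) < r / 16" and z: "z \<in> C"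
      and \<zeta>: "continuous_on UNIV \<zeta>" "\<And>y. \<zeta> y \<noteq> 0 \<Longrightarrow> norm (y - z) < r / 16" for n z \<zeta>
  proof -
    obtain d where d: "\<And>g (\<zeta> :: real^2 \<Rightarrow> real). C1_map g \<Longrightarrow> (\<And>x i. part_deriv i \<theta> x \<noteq> 0 \<Longrightarrow> norm (g x - f x) < r / 16) \<Longrightarrow>
      continuous_on UNIV \<zeta> \<Longrightarrow> (\<And>y. \<zeta> y \<noteq> 0 \<Longrightarrow> norm (y - z) < r / 16) \<Longrightarrow> jac_pair \<theta> g \<zeta> = d * integral\<^sup>L lborel \<zeta>"
    proof (rule degree_const[OF tD(5,4) r(1), of f z])
      show "r \<le> norm (f x - z)" if "part_deriv i \<theta> x \<noteq> 0" for x i using r(2)[OF pK[OF that] z] .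
    qed blast
    have dF: "jac_pair \<theta> (F n) \<zeta> = d * integral\<^sup>L lborel \<zeta>"
      if "\<forall>x\<in>K. norm (F n x - f x) < r / 16" "continuous_on UNIV \<zeta>" "\<And>y. \<zeta> y \<noteq> 0 \<Longrightarrow> norm (y - z) < r / 16" for n \<zeta>
      by (rule d[OF F_C1]) (use that pK in blast)+
    have zz: "f (h z) = z" "h z \<in> \<Omega>" "h z \<in> W" using z C W(2) inv h_in by auto
    have "local_deg \<theta> (h z) d"
      unfolding local_deg_def zz(1)
    proof (intro exI[of _ "r/16"] conjI)
      from ev show "\<forall>\<^sub>F n in sequentially. \<forall>\<zeta>. continuous_on UNIV \<zeta> \<and> (\<forall>y. \<zeta> y \<noteq> 0 \<longrightarrow> norm (y - z) < r/16) \<longrightarrow>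
         jac_pair \<theta> (F n) \<zeta> = d * integral\<^sup>L lborel \<zeta>"
        by eventually_elim (use dF in blast)
    qed (use r in simp)
    moreover have "local_deg \<theta> (h z) 1"
      by (rule sense_preserving_local_deg[OF sp zz(2) t W(1) zz(3) W(3)])
    ultimately have "d = 1" by (rule local_deg_unique)
    then show ?thesis using dF[OF n \<zeta>] by simp
  qed
  from ev show ?thesis
  proof eventually_elim
    case (elim n)
    show ?case
    proof (intro allI impI)
      fix \<zeta> :: "real^2 \<Rightarrow> real" assume z: "continuous_on UNIV \<zeta> \<and> (\<forall>y. \<zeta> y \<noteq> 0 \<longrightarrow> y \<in> C)"
      have bz: "bounded {y. \<zeta> y \<noteq> 0}" by (rule bounded_subset[OF compact_imp_bounded[OF C(1)]]) (use z in auto)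
      define \<epsilon> where "\<epsilon> k = (r/64) * step_seq k" for k
      have e1: "\<epsilon> \<longlonglongrightarrow> 0" unfolding \<epsilon>_def by (rule tendsto_mult_right_zero[OF step_seq(1)])
      have e2: "\<epsilon> k > 0" "\<epsilon> k \<le> r / 64" for k
        using mult_left_le[of "step_seq k" "r/64"] step_seq(3)[of k] step_seq(4)[of k] r(1) by (auto simp: \<epsilon>_def)
      have "\<zeta> z * jac_pair \<theta> (F n) (prod_kernel (\<epsilon> k) z) = \<zeta> z" for z k
      proof (cases "\<zeta> z = 0")
        case False
        then have zC: "z \<in> C" using z by blast
        have "jac_pair \<theta> (F n) (prod_kernel (\<epsilon> k) z) = integral\<^sup>L lborel (prod_kernel (\<epsilon> k) z)"
        proof (rule one[OF elim zC prod_kernel_continuous])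
          fix y assume "prod_kernel (\<epsilon> k) z y \<noteq> 0"
          then have "\<not> 2 * \<epsilon> k \<le> norm (y - z)" using prod_kernel_eq_0[OF e2(1)] by blast
          then show "norm (y - z) < r / 16" using e2(2)[of k] r(1) by linarith
        qed
        then show ?thesis by (simp add: prod_kernel_integral(3)[OF e2(1)])
      qed simp
      then have "(\<lambda>k::nat. integral\<^sup>L lborel \<zeta>) \<longlonglongrightarrow> jac_pair \<theta> (F n) \<zeta>"
        using jac_pair_prod_kernel_limit[OF tD(6,4) F_C1 conjunct1[OF z] bz e1 e2(1), of n] by (simp only:)
      then show "jac_pair \<theta> (F n) \<zeta> = integral\<^sup>L lborel \<zeta>" by (simp add: LIMSEQ_const_iff)
    qed
  qed
qed

end

section \<open>An isoperimetric inequality for the Jacobian pairing\<close>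

text \<open>A smoothed coarea formula: the kernel concentrates \<open>w\<close> near a level set of
  \<open>p\<close>, and integrating over the levels recovers the integral of
  \<open>w\<close>.\<close>

lemma kern_fubini:
  fixes p w :: "real^2 \<Rightarrow> real"
  assumes e: "\<epsilon> > 0" and p: "continuous_on UNIV p" and w: "continuous_on UNIV w" "bounded {x. w x \<noteq> 0}"
  shows "integrable lborel (\<lambda>t. \<integral>x. kern \<epsilon> (p x - t) * w x \<partial>lborel)"
    "(\<integral>t. (\<integral>x. kern \<epsilon> (p x - t) * w x \<partial>lborel) \<partial>lborel) = integral\<^sup>L lborel w"
proof -
  let ?f = "\<lambda>(t :: real, x :: real^2). kern \<epsilon> (p x - t) * w x"
  have "continuous_on UNIV (\<lambda>q::real\<times>(real^2). kern \<epsilon> (p (snd q) - fst q) * w (snd q))"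
    by (intro continuous_on_mult continuous_on_compose2[OF kern_continuous] continuous_on_diff continuous_on_compose2[OF p]
        continuous_on_compose2[OF w(1)] continuous_on_fst continuous_on_snd continuous_on_id) auto
  then have c: "continuous_on UNIV ?f" by (simp add: case_prod_beta)
  have "compact (p ` closure {x. w x \<noteq> 0})"
    by (intro compact_continuous_image continuous_on_subset[OF p]) (use w(2) in auto)
  then have "bounded (p ` closure {x. w x \<noteq> 0})" by (rule compact_imp_bounded)
  then obtain P where P: "\<forall>y\<in>p ` closure {x. w x \<noteq> 0}. norm y \<le> P" unfolding bounded_iff by blast
  have "bounded ({-(P+\<epsilon>)..P+\<epsilon>} \<times> {x. w x \<noteq> 0})" by (intro bounded_Times w(2)) simp
  moreover have "{q. ?f q \<noteq> 0} \<subseteq> {-(P+\<epsilon>)..P+\<epsilon>} \<times> {x. w x \<noteq> 0}"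
  proof
    fix q assume "q \<in> {q. ?f q \<noteq> 0}"
    then obtain t x where q: "q = (t, x)" "kern \<epsilon> (p x - t) \<noteq> 0" "w x \<noteq> 0" by (cases q) auto
    have "\<not> \<bar>p x - t\<bar> \<ge> \<epsilon>" using kern_eq_0[OF e] q(2) by blast
    moreover have "\<bar>p x\<bar> \<le> P" using P q(3) closure_subset[of "{x. w x \<noteq> 0}"] by force
    ultimately show "q \<in> {-(P+\<epsilon>)..P+\<epsilon>} \<times> {x. w x \<noteq> 0}" using q by auto
  qed
  ultimately have "bounded {q. ?f q \<noteq> 0}" by (rule bounded_subset)
  then have i: "integrable (lborel \<Otimes>\<^sub>M lborel) ?f"
    unfolding lborel_prod by (rule integrable_continuous_bounded_support[OF c])
  from lborel_pair.integrable_fst'[OF i]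
  show "integrable lborel (\<lambda>t. \<integral>x. kern \<epsilon> (p x - t) * w x \<partial>lborel)" by simp
  from lborel_pair.Fubini_integral[OF i]
  have "(\<integral>t. (\<integral>x. kern \<epsilon> (p x - t) * w x \<partial>lborel) \<partial>lborel) = (\<integral>x. (\<integral>t. kern \<epsilon> (p x - t) * w x \<partial>lborel) \<partial>lborel)"
    by simp
  also have "\<dots> = integral\<^sup>L lborel w" by (simp add: kern_shift_integral(1)[OF e])
  finally show "(\<integral>t. (\<integral>x. kern \<epsilon> (p x - t) * w x \<partial>lborel) \<partial>lborel) = integral\<^sup>L lborel w" .
qed

text \<open>Dropping the factor \<open>A\<close>, which lies between 0 and 1, leaves a bound that
  depends on a single coordinate of \<open>z\<close>. Either coordinate can be chosen.\<close>

lemma jac_pair_prod_kernel_bound: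
  assumes e: "\<epsilon> > 0" and t: "C_k 1 \<phi>" "bounded {x. \<phi> x \<noteq> 0}" and g: "C1_map g"
  shows "\<bar>jac_pair \<phi> g (prod_kernel \<epsilon> z)\<bar> \<le> (\<integral>x. kern \<epsilon> (g x $ 2 - z $ 2) * \<bar>wedge \<phi> (\<lambda>x. g x $ 2) x\<bar> \<partial>lborel)"
    "\<bar>jac_pair \<phi> g (prod_kernel \<epsilon> z)\<bar> \<le> (\<integral>x. kern \<epsilon> (g x $ 1 - z $ 1) * \<bar>wedge \<phi> (\<lambda>x. g x $ 1) x\<bar> \<partial>lborel)"
proof -
  obtain A where A: "\<And>s. (A has_real_derivative kern \<epsilon> s) (at s)" "\<And>s. 0 \<le> A s" "\<And>s. A s \<le> 1"
    using kern_primitive[OF e] by metis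
  have cA: "continuous_on UNIV A" using A(1) DERIV_isCont continuous_at_imp_continuous_on by blast
  have cg: "continuous_on UNIV (\<lambda>x. g x $ i)" for i by (rule C_k_continuous[OF C1_mapD[OF g]])
  have cA': "continuous_on UNIV (\<lambda>x. A (g x $ i - c))" for i c
    by (rule continuous_on_compose2[OF cA continuous_on_diff[OF cg continuous_on_const]]) auto
  have ck: "continuous_on UNIV (\<lambda>x. kern \<epsilon> (g x $ i - c))" for i c
    by (rule continuous_on_compose2[OF kern_continuous continuous_on_diff[OF cg continuous_on_const]]) auto
  have cw: "continuous_on UNIV (wedge \<phi> (\<lambda>x. g x $ i))" for i by (intro wedge_continuous t C1_mapD g)
  have bw: "bounded {x. wedge \<phi> (\<lambda>x. g x $ i) x \<noteq> 0}" for i by (rule bounded_support_wedge[OF t(2)])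
  have *: "\<bar>\<integral>x. A (g x $ i - a) * kern \<epsilon> (g x $ j - b) * wedge \<phi> (\<lambda>x. g x $ j) x \<partial>lborel\<bar>
     \<le> (\<integral>x. kern \<epsilon> (g x $ j - b) * \<bar>wedge \<phi> (\<lambda>x. g x $ j) x\<bar> \<partial>lborel)" for i j a b
  proof -
    have "\<bar>\<integral>x. A (g x $ i - a) * kern \<epsilon> (g x $ j - b) * wedge \<phi> (\<lambda>x. g x $ j) x \<partial>lborel\<bar>
      \<le> (\<integral>x. \<bar>A (g x $ i - a) * kern \<epsilon> (g x $ j - b) * wedge \<phi> (\<lambda>x. g x $ j) x\<bar> \<partial>lborel)"
      by (rule integral_abs_bound)
    also have "\<dots> \<le> (\<integral>x. kern \<epsilon> (g x $ j - b) * \<bar>wedge \<phi> (\<lambda>x. g x $ j) x\<bar> \<partial>lborel)"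
    proof (rule integral_mono)
      show "integrable lborel (\<lambda>x. \<bar>A (g x $ i - a) * kern \<epsilon> (g x $ j - b) * wedge \<phi> (\<lambda>x. g x $ j) x\<bar>)"
        by (intro integrable_abs integrable_continuous_bounded_support continuous_on_mult cA' ck cw bounded_support_mult2 bw)
      show "integrable lborel (\<lambda>x. kern \<epsilon> (g x $ j - b) * \<bar>wedge \<phi> (\<lambda>x. g x $ j) x\<bar>)"
        by (intro integrable_continuous_bounded_support continuous_on_mult continuous_on_rabs ck cw bounded_support_mult2) (use bw in simp)
      fix x
      have k: "kern \<epsilon> (g x $ j - b) \<ge> 0" by (rule kern_nonneg[OF e])
      have "A (g x $ i - a) * (kern \<epsilon> (g x $ j - b) * \<bar>wedge \<phi> (\<lambda>x. g x $ j) x\<bar>) \<le> 1 * (kern \<epsilon> (g x $ j - b) * \<bar>wedge \<phi> (\<lambda>x. g x $ j) x\<bar>)"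
        using k by (intro mult_right_mono A(3)) simp
      then show "\<bar>A (g x $ i - a) * kern \<epsilon> (g x $ j - b) * wedge \<phi> (\<lambda>x. g x $ j) x\<bar> \<le> kern \<epsilon> (g x $ j - b) * \<bar>wedge \<phi> (\<lambda>x. g x $ j) x\<bar>"
        using k A(2)[of "g x $ i - a"] by (simp add: abs_mult mult.assoc)
    qed
    finally show ?thesis .
  qed
  show "\<bar>jac_pair \<phi> g (prod_kernel \<epsilon> z)\<bar> \<le> (\<integral>x. kern \<epsilon> (g x $ 2 - z $ 2) * \<bar>wedge \<phi> (\<lambda>x. g x $ 2) x\<bar> \<partial>lborel)"
    using *[of 1 "z $ 1" 2 "z $ 2"] unfolding jac_pair_prod_kernel(1)[OF e t g A(1)] by simp
  show "\<bar>jac_pair \<phi> g (prod_kernel \<epsilon> z)\<bar> \<le> (\<integral>x. kern \<epsilon> (g x $ 1 - z $ 1) * \<bar>wedge \<phi> (\<lambda>x. g x $ 1) x\<bar> \<partial>lborel)"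
    using *[of 2 "z $ 2" 1 "z $ 1"] unfolding jac_pair_prod_kernel(2)[OF e t g A(1)] by simp
qed

text \<open>The function \<open>u z = jac_pair \<phi> g (prod_kernel \<epsilon> z)\<close> is bounded by a function of \<open>z\<^sub>1\<close> and by a function of
  \<open>z\<^sub>2\<close>, so that \<open>u\<^sup>2\<close> is bounded by their product, as in the Gagliardo-Nirenberg inequality.\<close>

lemma jac_pair_isoperimetric:
  assumes t: "C_k 1 \<phi>" "bounded {x. \<phi> x \<noteq> 0}" and g: "C1_map g"
    and z: "continuous_on UNIV \<zeta>" "bounded {y. \<zeta> y \<noteq> 0}" and Z: "(\<integral>y. (\<zeta> y)\<^sup>2 \<partial>lborel) \<le> Z" "Z > 0"
  shows "\<bar>jac_pair \<phi> g \<zeta>\<bar> \<le> sqrt Z * (((\<integral>x. \<bar>wedge \<phi> (\<lambda>x. g x $ 1) x\<bar> \<partial>lborel) + (\<integral>x. \<bar>wedge \<phi> (\<lambda>x. g x $ 2) x\<bar> \<partial>lborel)) / 2)"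
proof -
  define W where "W i = (\<integral>x. \<bar>wedge \<phi> (\<lambda>x. g x $ i) x\<bar> \<partial>lborel)" for i
  have W0: "W i \<ge> 0" for i by (simp add: W_def)
  define V where "V = (W 1 + W 2) / 2"
  have cg: "continuous_on UNIV (\<lambda>x. g x $ i)" for i by (rule C_k_continuous[OF C1_mapD[OF g]])
  have cw: "continuous_on UNIV (\<lambda>x. \<bar>wedge \<phi> (\<lambda>x. g x $ i) x\<bar>)" for i by (intro continuous_on_rabs wedge_continuous t C1_mapD g)
  have bw: "bounded {x. \<bar>wedge \<phi> (\<lambda>x. g x $ i) x\<bar> \<noteq> 0}" for i using bounded_support_wedge[OF t(2)] by simp
  have ct: "continuous_on UNIV \<phi>" by (rule C_k_continuous[OF t(1)])
  have iz: "integrable lborel (\<lambda>y. (\<zeta> y)\<^sup>2)"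
    unfolding power2_eq_square by (intro integrable_continuous_bounded_support continuous_on_mult z bounded_support_mult1)
  \<comment> \<open>A strict upper bound \<open>T\<close> of \<open>V\<close> keeps the weight
    \<open>c\<close> positive even when both variations vanish; it is sent to \<open>V\<close> at
    the end.\<close>
  have main: "\<bar>\<integral>y. \<zeta> y * jac_pair \<phi> g (prod_kernel \<epsilon> y) \<partial>lborel\<bar> \<le> sqrt Z * T" if e: "\<epsilon> > 0" and T: "T > V" for \<epsilon> T
  proof -
    have T0: "T > 0" using T W0[of 1] W0[of 2] by (simp add: V_def)
    define U where "U i s = (\<integral>x. kern \<epsilon> (g x $ i - s) * \<bar>wedge \<phi> (\<lambda>x. g x $ i) x\<bar> \<partial>lborel)" for i s
    have Ui: "integrable lborel (U i)" and UW: "integral\<^sup>L lborel (U i) = W i" for i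
      using kern_fubini[OF e cg cw bw, of i i] by (auto simp: U_def[abs_def] W_def)
    have U0: "U i s \<ge> 0" for i s unfolding U_def
      by (intro integral_nonneg_AE AE_I2 mult_nonneg_nonneg kern_nonneg[OF e]) simp
    let ?u = "\<lambda>y. jac_pair \<phi> g (prod_kernel \<epsilon> y)"
    have u2: "(?u y)\<^sup>2 \<le> U 1 (y $ 1) * U 2 (y $ 2)" for y
    proof -
      have "\<bar>?u y\<bar> \<le> U 2 (y $ 2)" "\<bar>?u y\<bar> \<le> U 1 (y $ 1)"
        unfolding U_def by (rule jac_pair_prod_kernel_bound[OF e t g])+
      then have "\<bar>?u y\<bar> * \<bar>?u y\<bar> \<le> U 1 (y $ 1) * U 2 (y $ 2)" by (intro mult_mono U0) auto
      then show ?thesis by (simp add: power2_eq_square)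
    qed
    have iU: "integrable lborel (\<lambda>y::real^2. U 1 (y $ 1) * U 2 (y $ 2))"
      and UU: "(\<integral>y. U 1 (y $ 1) * U 2 (y $ 2) \<partial>(lborel :: (real^2) measure)) = W 1 * W 2"
      using integral_product_vec2[OF Ui Ui, of 1 2] by (simp_all add: UW)
    \<comment> \<open>The weight that minimises (c Z + T^2 / c) / 2 in Young's inequality; the
      minimum is \<open>sqrt Z * T\<close>.\<close>
    define c where "c = T / sqrt Z"
    have c0: "c > 0" using T0 Z(2) by (simp add: c_def)
    let ?b = "\<lambda>y. (c * (\<zeta> y)\<^sup>2 + U 1 (y $ 1) * U 2 (y $ 2) / c) / 2"
    have ib: "integrable lborel ?b" using iz iU by auto
    have pt: "\<bar>\<zeta> y * ?u y\<bar> \<le> ?b y" for y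
    proof -
      have "0 \<le> (c * \<bar>\<zeta> y\<bar> - \<bar>?u y\<bar>)\<^sup>2" by simp
      then have "2 * c * (\<bar>\<zeta> y\<bar> * \<bar>?u y\<bar>) \<le> c\<^sup>2 * (\<zeta> y)\<^sup>2 + (?u y)\<^sup>2"
        by (simp add: power2_diff power_mult_distrib algebra_simps)
      also have "\<dots> \<le> c\<^sup>2 * (\<zeta> y)\<^sup>2 + U 1 (y $ 1) * U 2 (y $ 2)" using u2 by simp
      finally have "\<bar>\<zeta> y\<bar> * \<bar>?u y\<bar> \<le> (c\<^sup>2 * (\<zeta> y)\<^sup>2 + U 1 (y $ 1) * U 2 (y $ 2)) / (2 * c)"
        using c0 by (simp add: pos_le_divide_eq mult_ac)
      also have "\<dots> = ?b y" using c0 by (simp add: field_simps power2_eq_square)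
      finally show ?thesis by (simp add: abs_mult)
    qed
    have Zc: "sqrt Z * sqrt Z = Z" using Z(2) by simp
    show ?thesis
    proof (cases "integrable lborel (\<lambda>y. \<zeta> y * ?u y)")
      \<comment> \<open>The integral of a nonintegrable function is 0 by convention, so the bound
        holds trivially.\<close>
      case False
      then show ?thesis using T0 Z(2) by (simp add: not_integrable_integral_eq)
    next
      case True
      have "\<bar>\<integral>y. \<zeta> y * ?u y \<partial>lborel\<bar> \<le> (\<integral>y. \<bar>\<zeta> y * ?u y\<bar> \<partial>lborel)" by (rule integral_abs_bound)
      also have "\<dots> \<le> (\<integral>y. ?b y \<partial>lborel)" by (intro integral_mono integrable_abs True ib pt)
      also have "\<dots> = (c * (\<integral>y. (\<zeta> y)\<^sup>2 \<partial>lborel) + W 1 * W 2 / c) / 2"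
        using iz iU by (simp add: UU)
      also have "\<dots> \<le> (c * Z + T * T / c) / 2"
      proof -
        have "W 1 * W 2 \<le> V * V"
          using zero_le_square[of "W 1 - W 2"] by (simp add: V_def algebra_simps)
        also have "\<dots> \<le> T * T" using T W0[of 1] W0[of 2] by (intro mult_mono) (auto simp: V_def)
        finally have "W 1 * W 2 / c \<le> T * T / c" using c0 by (intro divide_right_mono) auto
        moreover have "c * (\<integral>y. (\<zeta> y)\<^sup>2 \<partial>lborel) \<le> c * Z" using Z(1) c0 by (intro mult_left_mono) auto
        ultimately show ?thesis by (intro divide_right_mono[OF add_mono]) auto
      qed
      also have "\<dots> = sqrt Z * T"
      proof -
        have "c * Z = sqrt Z * T" using Z(2) Zc by (simp add: c_def field_simps)
        moreover have "T * T / c = sqrt Z * T" using T0 Z(2) by (simp add: c_def)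
        ultimately show ?thesis by simp
      qed
      finally show ?thesis .
    qed
  qed
  have "(\<lambda>n. \<integral>y. \<zeta> y * jac_pair \<phi> g (prod_kernel (step_seq n) y) \<partial>lborel) \<longlonglongrightarrow> jac_pair \<phi> g \<zeta>"
    by (rule jac_pair_prod_kernel_limit[OF ct t(2) g z step_seq(1,4)])
  then have lim: "(\<lambda>n. \<bar>\<integral>y. \<zeta> y * jac_pair \<phi> g (prod_kernel (step_seq n) y) \<partial>lborel\<bar>) \<longlonglongrightarrow> \<bar>jac_pair \<phi> g \<zeta>\<bar>"
    by (rule tendsto_rabs)
  have T: "\<bar>jac_pair \<phi> g \<zeta>\<bar> \<le> sqrt Z * T" if "T > V" for T
    by (rule LIMSEQ_le_const2[OF lim]) (use main[OF step_seq(4) that] in blast)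
  have "\<bar>jac_pair \<phi> g \<zeta>\<bar> / sqrt Z \<le> V"
    by (rule dense_ge) (use T Z(2) in \<open>simp add: divide_le_eq mult.commute\<close>)
  then show ?thesis using Z(2) by (simp add: V_def W_def divide_le_eq mult.commute)
qed

section \<open>Decomposition of a linear function into layers\<close>

text \<open>A C^1 version of the positive part: 0 up to 0, quadratic on [0, 1], then t - 1/2. Its
  unit difference \<open>layer\<close> rises from 0 to 1 over [0, 2], and the derivative
  \<open>dlayer\<close> is a hat function, so that sums of integer shifts telescope.\<close>

definition ramp :: "real \<Rightarrow> real" where "ramp t = ((max 0 t)\<^sup>2 - (max 0 (t - 1))\<^sup>2) / 2"
definition clamp01 :: "real \<Rightarrow> real" where "clamp01 t = max 0 t - max 0 (t - 1)"
definition layer :: "real \<Rightarrow> real" where "layer t = ramp t - ramp (t - 1)"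
definition dlayer :: "real \<Rightarrow> real" where "dlayer t = clamp01 t - clamp01 (t - 1)"

lemma ramp_deriv: "(ramp has_real_derivative clamp01 t) (at t)"
proof -
  have "((\<lambda>t. (max 0 (t - 1))\<^sup>2) has_real_derivative 2 * max 0 (t - 1) * 1) (at t)" for t :: real
    by (rule DERIV_chain2[OF DERIV_pos_part_sq]) (auto intro!: derivative_eq_intros)
  from DERIV_cdivide[OF DERIV_diff[OF DERIV_pos_part_sq this], of 2 t] show ?thesis
    by (simp add: ramp_def[abs_def] clamp01_def diff_divide_distrib)
qed

lemma layer_deriv: "(layer has_real_derivative dlayer t) (at t)"
proof -
  have "((\<lambda>t. ramp (t - 1)) has_real_derivative clamp01 (t - 1) * 1) (at t)"
    by (rule DERIV_chain2[OF ramp_deriv]) (auto intro!: derivative_eq_intros)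
  from DERIV_diff[OF ramp_deriv this] show ?thesis by (simp add: layer_def[abs_def] dlayer_def)
qed

lemma dlayer_continuous: "continuous_on UNIV dlayer"
  unfolding dlayer_def clamp01_def by (intro continuous_intros)

lemma layer_eq_0: "t \<le> 0 \<Longrightarrow> layer t = 0"
  by (simp add: layer_def ramp_def)

lemma layer_eq_1: "t \<ge> 2 \<Longrightarrow> layer t = 1"
  by (simp add: layer_def ramp_def power2_eq_square field_simps)

lemma clamp01_le: "clamp01 t \<le> 1" and clamp01_mono: "s \<le> t \<Longrightarrow> clamp01 s \<le> clamp01 t"
  and clamp01_nonneg: "clamp01 t \<ge> 0"
  by (auto simp: clamp01_def max_def)

lemma dlayer_nonneg: "dlayer t \<ge> 0"
  using clamp01_mono[of "t - 1" t] by (simp add: dlayer_def)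

lemma layer_mono: "s \<le> t \<Longrightarrow> layer s \<le> layer t"
  by (rule DERIV_nonneg_imp_nondecreasing) (use layer_deriv dlayer_nonneg in blast)+

lemma layer_bounds: "0 \<le> layer t" "layer t \<le> 1"
  using layer_mono[of "min t 0" t] layer_mono[of t "max t 2"] layer_eq_0[of "min t 0"] layer_eq_1[of "max t 2"] by auto

lemma sum_layer: "(\<Sum>k<m. layer (t - real k)) = ramp t - ramp (t - real m)"
proof -
  have "(\<Sum>k<m. layer (t - real k)) = (\<Sum>k<m. ramp (t - real k) - ramp (t - real (Suc k)))"
    by (intro sum.cong refl) (simp add: layer_def algebra_simps)
  also have "\<dots> = ramp t - ramp (t - real m)"
    using sum_lessThan_telescope'[of "\<lambda>k. ramp (t - real k)" m] by simp
  finally show ?thesis .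
qed

text \<open>The telescoped sum reduces to \<open>ramp t\<close> in this range, since the subtracted
  ramp has not started; beyond 1 the ramp is linear with offset 1/2.\<close>

lemma sum_layer_linear: "1 \<le> t \<Longrightarrow> t \<le> real m \<Longrightarrow> (\<Sum>k<m. layer (t - real k)) = t - 1/2"
  unfolding sum_layer by (simp add: ramp_def power2_eq_square field_simps)

text \<open>The gradients of the layers form a subpartition of unity. This is why the total
  variation does not grow with the number of layers.\<close>

lemma sum_dlayer_le: "(\<Sum>k<m. dlayer (t - real k)) \<le> 1"
proof -
  have "(\<Sum>k<m. dlayer (t - real k)) = (\<Sum>k<m. clamp01 (t - real k) - clamp01 (t - real (Suc k)))"
    by (intro sum.cong refl) (simp add: dlayer_def algebra_simps)
  also have "\<dots> = clamp01 t - clamp01 (t - real m)"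
    using sum_lessThan_telescope'[of "\<lambda>k. clamp01 (t - real k)" m] by simp
  also have "\<dots> \<le> 1" using clamp01_le[of t] clamp01_nonneg[of "t - real m"] by linarith
  finally show ?thesis .
qed

lemma layer_fun:
  fixes l :: "real^2 \<Rightarrow> real"
  assumes l: "C_k 1 l" and d: "\<delta> > 0"
  shows "C_k 1 (\<lambda>x. \<delta> * layer ((l x - c) / \<delta>))"
    "part_deriv j (\<lambda>x. \<delta> * layer ((l x - c) / \<delta>)) x = dlayer ((l x - c) / \<delta>) * part_deriv j l x"
proof -
  have D: "((\<lambda>s. \<delta> * layer ((s - c) / \<delta>)) has_real_derivative dlayer ((s - c) / \<delta>)) (at s)" for s
  proof -
    have "((\<lambda>s. layer ((s - c) / \<delta>)) has_real_derivative dlayer ((s - c) / \<delta>) * (1 / \<delta>)) (at s)"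
      by (rule DERIV_chain2[OF layer_deriv]) (use d in \<open>auto intro!: derivative_eq_intros\<close>)
    from DERIV_cmult[OF this, of \<delta>] show ?thesis using d by simp
  qed
  have c: "continuous_on UNIV (\<lambda>s. dlayer ((s - c) / \<delta>))"
    by (intro continuous_on_compose2[OF dlayer_continuous] continuous_intros) (use d in auto)
  from C1_compose_real[OF l D c] show "C_k 1 (\<lambda>x. \<delta> * layer ((l x - c) / \<delta>))"
    "part_deriv j (\<lambda>x. \<delta> * layer ((l x - c) / \<delta>)) x = dlayer ((l x - c) / \<delta>) * part_deriv j l x" by auto
qed

text \<open>Glues on the open cover by \<open>U\<close> and \<open>- C\<close>, on the latter of
  which the product vanishes. It allows functions of \<open>f\<close> or \<open>h\<close>,
  controlled only on their domains, to be used as global integrands.\<close>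

lemma continuous_on_UNIV_mult_supported:
  fixes u v :: "'a::metric_space \<Rightarrow> real"
  assumes u: "continuous_on UNIV u" and C: "closed C" "\<And>x. u x \<noteq> 0 \<Longrightarrow> x \<in> C" "C \<subseteq> U" "open U" and v: "continuous_on U v"
  shows "continuous_on UNIV (\<lambda>x. u x * v x)"
proof -
  have 1: "continuous_on U (\<lambda>x. u x * v x)" by (intro continuous_on_mult continuous_on_subset[OF u] v) auto
  have "continuous_on (- C) (\<lambda>x. 0 :: real)" by simp
  then have 2: "continuous_on (- C) (\<lambda>x. u x * v x)"
    by (rule continuous_on_eq) (use C(2) in force)
  have "continuous_on (U \<union> - C) (\<lambda>x. u x * v x)"
    by (rule continuous_on_open_Un[OF C(4) open_Compl[OF C(1)] 1 2])
  moreover have "U \<union> - C = UNIV" using C(3) by auto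
  ultimately show ?thesis by simp
qed

text \<open>The distribution of \<open>l\<close> on \<open>C\<close> has no atoms, hence gives
  uniformly small mass to short intervals. Otherwise short intervals of mass at least
  \<open>s\<close> would accumulate at some \<open>a\<close>, and by continuity from above the level
  set of \<open>a\<close> would have mass at least \<open>s\<close>.\<close>

lemma no_atoms_uniform:
  fixes l :: "'a::euclidean_space \<Rightarrow> real"
  assumes C: "compact C" and l: "continuous_on C l"
    and na: "\<And>t. measure lborel {y \<in> C. l y = t} = 0" and s: "s > 0"
  obtains \<delta> where "\<delta> > 0" "\<delta> \<le> 1" "\<And>t. measure lborel {y \<in> C. t \<le> l y \<and> l y \<le> t + \<delta>} < s"
proof (rule ccontr)
  assume "\<not> thesis"
  then have n: "\<exists>t. measure lborel {y \<in> C. t \<le> l y \<and> l y \<le> t + step_seq n} \<ge> s" for n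
    using that[of "step_seq n"] step_seq(3,4)[of n] by (meson abs_le_D1 not_le)
  then obtain t where t: "\<And>n. measure lborel {y \<in> C. t n \<le> l y \<and> l y \<le> t n + step_seq n} \<ge> s" by metis
  have cl: "closed {y \<in> C. a \<le> l y \<and> l y \<le> b}" for a b
  proof -
    have "{y \<in> C. a \<le> l y \<and> l y \<le> b} = C \<inter> l -` {a..b}" by auto
    then show ?thesis using continuous_closed_preimage[OF l compact_imp_closed[OF C], of "{a..b}"] by simp
  qed
  have meas: "{y \<in> C. a \<le> l y \<and> l y \<le> b} \<in> fmeasurable lborel" for a b
  proof -
    have "bounded {y \<in> C. a \<le> l y \<and> l y \<le> b}" by (rule bounded_subset[OF compact_imp_bounded[OF C]]) auto
    then show ?thesis using cl[of a b] emeasure_bounded_finite by (auto simp: fmeasurable_def)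
  qed
  have "bounded (l ` C)" using compact_continuous_image[OF l C] by (rule compact_imp_bounded)
  then obtain M where M: "\<And>y. y \<in> C \<Longrightarrow> \<bar>l y\<bar> \<le> M" unfolding bounded_iff by auto
  have tb: "t n \<in> cball 0 (M + 1)" for n
  proof -
    have "{y \<in> C. t n \<le> l y \<and> l y \<le> t n + step_seq n} \<noteq> {}"
      using t[of n] s by (metis measure_empty not_le)
    then obtain y where "y \<in> C" "t n \<le> l y" "l y \<le> t n + step_seq n" by auto
    then show ?thesis using M[of y] step_seq(3)[of n] by (auto simp: abs_le_iff)
  qed
  obtain a r where r: "strict_mono (r :: nat \<Rightarrow> nat)" "(t \<circ> r) \<longlonglongrightarrow> a"
    using compact_cball[of "0::real" "M + 1"] tb unfolding compact_def by meson
  let ?Z = "\<lambda>j. {y \<in> C. a - step_seq j \<le> l y \<and> l y \<le> a + step_seq j}"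
  have Zs: "s \<le> measure lborel (?Z j)" for j
  proof -
    have 1: "\<forall>\<^sub>F n in sequentially. dist ((t \<circ> r) n) a < step_seq j / 2"
      using tendstoD[OF r(2), of "step_seq j / 2"] step_seq(4)[of j] by simp
    have "(\<lambda>n. step_seq (r n)) \<longlonglongrightarrow> 0"
      using LIMSEQ_subseq_LIMSEQ[OF step_seq(1) r(1)] by (simp add: o_def)
    then have 2: "\<forall>\<^sub>F n in sequentially. step_seq (r n) < step_seq j / 2"
      by (rule order_tendstoD(2)) (use step_seq(4)[of j] in simp)
    from eventually_happens'[OF sequentially_bot eventually_conj[OF 1 2]]
    obtain n where n: "\<bar>t (r n) - a\<bar> < step_seq j / 2" "step_seq (r n) < step_seq j / 2" by (auto simp: dist_real_def)
    have "s \<le> measure lborel {y \<in> C. t (r n) \<le> l y \<and> l y \<le> t (r n) + step_seq (r n)}" by (rule t)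
    also have "\<dots> \<le> measure lborel (?Z j)"
    proof (rule measure_mono_fmeasurable)
      show "{y \<in> C. t (r n) \<le> l y \<and> l y \<le> t (r n) + step_seq (r n)} \<subseteq> ?Z j"
      proof safe
        fix y assume "t (r n) \<le> l y" "l y \<le> t (r n) + step_seq (r n)"
        then show "a - step_seq j \<le> l y" "l y \<le> a + step_seq j" using n by linarith+
      qed
      show "{y \<in> C. t (r n) \<le> l y \<and> l y \<le> t (r n) + step_seq (r n)} \<in> sets lborel" using meas by (auto simp: fmeasurable_def)
    qed (rule meas)
    finally show ?thesis .
  qed
  have "(\<lambda>j. measure lborel (?Z j)) \<longlonglongrightarrow> measure lborel (\<Inter>j. ?Z j)"
  proof (rule Lim_measure_decseq)
    show "range ?Z \<subseteq> sets lborel" using meas by (auto simp: fmeasurable_def)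
    have "step_seq j \<le> step_seq i" if "i \<le> j" for i j using that by (simp add: step_seq_def frac_le)
    then show "decseq ?Z" unfolding decseq_def by (auto; smt (verit))
    show "emeasure lborel (?Z i) \<noteq> \<infinity>" for i
      using meas[of "a - step_seq i" "a + step_seq i"] unfolding fmeasurable_def by auto
  qed
  moreover have "(\<Inter>j. ?Z j) = {y \<in> C. l y = a}"
  proof (intro equalityI subsetI)
    fix y assume y: "y \<in> (\<Inter>j. ?Z j)"
    have "\<bar>l y - a\<bar> \<le> step_seq j" for j
    proof -
      have "a - step_seq j \<le> l y" "l y \<le> a + step_seq j" using y by auto
      then show ?thesis by linarith
    qed
    then have "\<bar>l y - a\<bar> \<le> 0" by (intro LIMSEQ_le_const[OF step_seq(1)]) auto
    then show "y \<in> {y \<in> C. l y = a}" using y by auto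
  next
    fix y assume "y \<in> {y \<in> C. l y = a}"
    then show "y \<in> (\<Inter>j. ?Z j)" using step_seq(4) less_imp_le by auto
  qed
  ultimately have "(\<lambda>j. measure lborel (?Z j)) \<longlonglongrightarrow> 0" using na by simp
  then have "s \<le> 0" by (rule LIMSEQ_le_const) (use Zs in auto)
  then show False using s by simp
qed

lemma radon_lborel: "radon_measure_on UNIV lborel"
  unfolding radon_measure_on_def
  using emeasure_bounded_finite[OF compact_imp_bounded] by (auto simp: sets_restrict_space)

text \<open>A continuous majorant of the indicator of \<open>K\<close> with almost the same
  integral; indicators themselves cannot be paired, since \<open>\<zeta>\<close> has to be
  continuous.\<close>

lemma compact_outer_bump:
  assumes K: "compact (K :: (real^2) set)" and s: "s > 0"
  obtains \<alpha> where "continuous_on UNIV \<alpha>" "bounded {x. \<alpha> x \<noteq> 0}" "\<And>x. 0 \<le> \<alpha> x" "\<And>x. \<alpha> x \<le> 1" "\<And>x. x \<in> K \<Longrightarrow> \<alpha> x = 1"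
    "integral\<^sup>L lborel \<alpha> \<le> measure lborel K + s"
proof -
  obtain \<theta> where \<theta>: "\<And>n. \<theta> n \<in> test_functions UNIV" "\<And>n x. 0 \<le> \<theta> n x \<and> \<theta> n x \<le> 1" "\<And>n x. x \<in> K \<Longrightarrow> \<theta> n x = 1"
    "\<And>M. radon_measure_on UNIV M \<Longrightarrow> (\<lambda>n. integral\<^sup>L M (\<theta> n)) \<longlonglongrightarrow> measure M K"
    by (rule compact_measure_limit[OF K subset_UNIV open_UNIV]) blast
  have "\<forall>\<^sub>F n in sequentially. integral\<^sup>L lborel (\<theta> n) < measure lborel K + s"
    by (rule order_tendstoD(2)[OF \<theta>(4)[OF radon_lborel]]) (use s in simp)
  then obtain n where n: "integral\<^sup>L lborel (\<theta> n) < measure lborel K + s"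
    using eventually_happens'[OF sequentially_bot] by blast
  show thesis
    by (rule that[of "\<theta> n"]) (use \<theta> n test_functionD[OF \<theta>(1)[of n]] in auto)
qed

section \<open>Linear functions and the layered limit\<close>

definition lin :: "real^2 \<Rightarrow> real^2 \<Rightarrow> real" where "lin e x = e $ 1 * x $ 1 + e $ 2 * x $ 2"

lemma lin_C_k: "C_k k (lin e)"
  unfolding lin_def[abs_def] by (intro C_k_add C_k_cmult C_k_nth)

lemma lin_part_deriv: "part_deriv j (lin e) x = e $ j"
proof -
  have "((\<lambda>x. e $ 1 * x $ 1 + e $ 2 * x $ 2) has_derivative (\<lambda>h. e $ 1 * h $ 1 + e $ 2 * h $ 2)) (at x)"
    by (intro has_derivative_add has_derivative_mult_right bounded_linear_imp_has_derivative bounded_linear_vec_nth)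
  from part_derivI[OF this, of j] show ?thesis
    using exhaust_2[of j] unfolding lin_def[abs_def] by (auto simp: axis_def)
qed

lemma lin_lipschitz: "\<bar>lin e x - lin e y\<bar> \<le> (\<bar>e $ 1\<bar> + \<bar>e $ 2\<bar>) * norm (x - y)"
proof -
  have "\<bar>lin e x - lin e y\<bar> = \<bar>e $ 1 * (x - y) $ 1 + e $ 2 * (x - y) $ 2\<bar>" by (simp add: lin_def algebra_simps)
  also have "\<dots> \<le> \<bar>e $ 1\<bar> * \<bar>(x - y) $ 1\<bar> + \<bar>e $ 2\<bar> * \<bar>(x - y) $ 2\<bar>"
    unfolding abs_mult[symmetric] by (rule abs_triangle_ineq)
  also have "\<dots> \<le> \<bar>e $ 1\<bar> * norm (x - y) + \<bar>e $ 2\<bar> * norm (x - y)"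
    by (intro add_mono mult_left_mono component_le_norm_cart) auto
  finally show ?thesis by (simp add: distrib_right)
qed

context planar_homeo
begin

text \<open>Outside a strip the layer \<open>L k\<close> is constant, and there \<open>L k x\<close>
  may be replaced by \<open>L k (h (F n x))\<close>, a function of the image point to which the
  degree formula applies exactly. The part over the image \<open>A k\<close> of the strip is
  estimated isoperimetrically; the bound contains the small area \<open>s\<close> and, after
  summation over \<open>k\<close>, the total variation bound \<open>B\<close>.\<close>

lemma layered_estimate:
  assumes sp: "sense_preserving \<Omega> f" and C: "compact C" "C \<subseteq> \<Omega>'"
    and t: "\<theta> \<in> test_functions \<Omega>" and W: "open W" "h ` C \<subseteq> W" "\<And>x. x \<in> W \<Longrightarrow> \<theta> x = 1"
    and K_def: "K = closure {x. \<theta> x \<noteq> 0}"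
    and B: "\<forall>\<^sub>F n in sequentially. \<forall>i j. (\<integral>x. indicator K x * \<bar>part_deriv j (\<lambda>x. F n x $ i) x\<bar> \<partial>lborel) \<le> B"
    and na: "\<And>t. measure lborel {y \<in> C. lin e (h y) = t} = 0"
    and \<psi>: "continuous_on UNIV \<psi>" "\<And>y. \<psi> y \<noteq> 0 \<Longrightarrow> y \<in> C" "\<And>y. \<bar>\<psi> y\<bar> \<le> X" "X > 0"
    and M: "\<And>x. x \<in> K \<Longrightarrow> \<bar>lin e x\<bar> \<le> M" "M \<ge> 0"
    and P: "\<And>x j. \<bar>\<theta> x\<bar> * \<bar>e $ j\<bar> + \<bar>part_deriv j \<theta> x\<bar> * (2 * M + 1) \<le> P" "P \<ge> 0"
    and s: "s > 0"
  shows "\<forall>\<^sub>F n in sequentially. \<bar>jac_pair (\<lambda>x. \<theta> x * lin e x) (F n) \<psi> - (\<integral>y. \<psi> y * lin e (h y) \<partial>lborel)\<bar>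
     \<le> sqrt (2 * X\<^sup>2 * s) * (2 * P * B) + (2 * M + 3) * (2 * X * s)"
proof -
  note tD = test_functionD[OF t]
  have K: "compact K" "K \<subseteq> \<Omega>" using tD by (auto simp: K_def)
  have \<theta>K: "\<theta> x = 0" if "x \<notin> K" for x using that closure_subset[of "{x. \<theta> x \<noteq> 0}"] by (auto simp: K_def)
  have d\<theta>K: "part_deriv j \<theta> x = 0" if "x \<notin> K" for x j
    using that part_deriv_support[of j \<theta>] by (auto simp: K_def)
  have WK: "x \<in> K" if "x \<in> W" for x using \<theta>K[of x] W(3)[OF that] by force
  have hC: "h y \<in> K" "f (h y) = y" if "y \<in> C" for y using that W(2) WK C(2) inv(2) by auto
  have CfK: "C \<subseteq> f ` K" using hC by force
  have clh: "continuous_on \<Omega>' (\<lambda>y. lin e (h y))"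
    by (intro continuous_on_compose2[OF C_k_continuous[OF lin_C_k] cont(2)]) auto
  obtain \<delta>' where d': "\<delta>' > 0" "\<delta>' \<le> 1" "\<And>t. measure lborel {y \<in> C. t \<le> lin e (h y) \<and> lin e (h y) \<le> t + \<delta>'} < s"
    by (rule no_atoms_uniform[OF C(1) continuous_on_subset[OF clh C(2)] na s]) blast
  \<comment> \<open>\<open>L k\<close> varies while \<open>lin e\<close> runs through an interval of
    length \<open>2 * \<delta>\<close>. Widening it by \<open>\<delta>\<close> on both sides gives
    the strip of width \<open>4 * \<delta>\<close>; the margin absorbs the distance between
    \<open>x\<close> and \<open>h (F n x)\<close>.\<close>
  define \<delta> where "\<delta> = \<delta>' / 4"
  have d: "\<delta> > 0" "\<delta> \<le> 1/4" "\<delta>' = 4 * \<delta>" using d' by (auto simp: \<delta>_def)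
  \<comment> \<open>Starting one step below \<open>- M\<close> puts all values of
    \<open>lin e\<close> on \<open>K\<close> into the range where the layers add up to a linear
    function. The offset \<open>c0\<close> comes from the summand 1/2 in
    \<open>sum_layer_linear\<close>.\<close>
  define t0 where "t0 = - M - \<delta>"
  define c0 where "c0 = t0 + \<delta> / 2"
  define c where "c k = t0 + real k * \<delta>" for k :: nat
  define m where "m = nat \<lceil>(2 * M + 2 * \<delta>) / \<delta>\<rceil>"
  have m: "(2 * M + 2 * \<delta>) / \<delta> \<le> real m" "real m * \<delta> \<le> 2 * M + 3"
  proof -
    have pos: "(2 * M + 2 * \<delta>) / \<delta> \<ge> 0" using M(2) d(1) by simp
    then show "(2 * M + 2 * \<delta>) / \<delta> \<le> real m" unfolding m_def by (simp add: of_nat_ceiling)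
    have "real m \<le> (2 * M + 2 * \<delta>) / \<delta> + 1" unfolding m_def using pos of_int_ceiling_le_add_one by simp
    then have "real m * \<delta> \<le> ((2 * M + 2 * \<delta>) / \<delta> + 1) * \<delta>" using d(1) by (intro mult_right_mono) auto
    also have "\<dots> = 2 * M + 3 * \<delta>" using d(1) by (simp add: field_simps)
    finally show "real m * \<delta> \<le> 2 * M + 3" using d(2) by simp
  qed
  define L where "L k x = \<delta> * layer ((lin e x - c k) / \<delta>)" for k x
  have L1: "C_k 1 (L k)" "part_deriv j (L k) x = dlayer ((lin e x - c k) / \<delta>) * e $ j" for k j x
    using layer_fun[OF lin_C_k[of 1 e] d(1), where c="c k"] unfolding L_def[abs_def] lin_part_deriv by blast+
  have Lb: "0 \<le> L k x" "L k x \<le> \<delta>" for k x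
    using layer_bounds d(1) by (auto simp: L_def intro!: mult_left_le)
  have arg: "(lin e x - c k) / \<delta> = (lin e x - t0) / \<delta> - real k" for x k
    using d(1) by (simp add: c_def field_simps)
  have sumL: "(\<Sum>k<m. L k x) = lin e x - c0" if x: "x \<in> K" for x
  proof -
    have "1 \<le> (lin e x - t0) / \<delta>" "(lin e x - t0) / \<delta> \<le> real m"
    proof -
      show "1 \<le> (lin e x - t0) / \<delta>" using M(1)[OF x] d(1) by (simp add: t0_def abs_le_iff)
      have "(lin e x - t0) / \<delta> \<le> (2 * M + 2 * \<delta>) / \<delta>"
        using M(1)[OF x] d(1) by (intro divide_right_mono) (auto simp: t0_def abs_le_iff)
      then show "(lin e x - t0) / \<delta> \<le> real m" using m(1) by linarith
    qed
    then have "(\<Sum>k<m. layer ((lin e x - t0) / \<delta> - real k)) = (lin e x - t0) / \<delta> - 1/2"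
      by (rule sum_layer_linear)
    then have "(\<Sum>k<m. L k x) = \<delta> * ((lin e x - t0) / \<delta> - 1/2)"
      by (simp only: L_def arg sum_distrib_left[symmetric])
    also have "\<dots> = lin e x - c0" using d(1) by (simp add: c0_def field_simps)
    finally show ?thesis .
  qed
  have sumL_le: "(\<Sum>k<m. L k x) \<le> 2 * M + 1" if x: "x \<in> K" for x
    using sumL[OF x] M(1)[OF x] d by (auto simp: c0_def t0_def abs_le_iff)
  have sumdl: "(\<Sum>k<m. dlayer ((lin e x - c k) / \<delta>)) \<le> 1" for x
    unfolding arg by (rule sum_dlayer_le)
  define A where "A k = {y \<in> C. c k - \<delta> \<le> lin e (h y) \<and> lin e (h y) \<le> c k - \<delta> + \<delta>'}" for k
  have cA: "compact (A k)" for k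
  proof -
    have "A k = C \<inter> (\<lambda>y. lin e (h y)) -` {c k - \<delta>..c k - \<delta> + \<delta>'}" by (auto simp: A_def)
    moreover have "closed (C \<inter> (\<lambda>y. lin e (h y)) -` {c k - \<delta>..c k - \<delta> + \<delta>'})"
      by (intro continuous_closed_preimage continuous_on_subset[OF clh C(2)] compact_imp_closed C(1)) simp
    ultimately have "closed (A k)" by simp
    moreover have "C \<inter> A k = A k" by (auto simp: A_def)
    ultimately show ?thesis using compact_Int_closed[OF C(1), of "A k"] by simp
  qed
  have mA: "measure lborel (A k) < s" for k unfolding A_def by (rule d'(3))
  have "\<exists>\<alpha>. continuous_on UNIV \<alpha> \<and> bounded {x. \<alpha> x \<noteq> 0} \<and> (\<forall>x. 0 \<le> \<alpha> x \<and> \<alpha> x \<le> 1) \<and> (\<forall>x\<in>A k. \<alpha> x = 1) \<and>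
     integral\<^sup>L lborel \<alpha> \<le> measure lborel (A k) + s" for k
    by (rule compact_outer_bump[OF cA[of k] s]) blast
  then obtain \<alpha> where \<alpha>: "\<And>k. continuous_on UNIV (\<alpha> k)" "\<And>k. bounded {x. \<alpha> k x \<noteq> 0}" "\<And>k x. 0 \<le> \<alpha> k x" "\<And>k x. \<alpha> k x \<le> 1"
     "\<And>k x. x \<in> A k \<Longrightarrow> \<alpha> k x = 1" "\<And>k. integral\<^sup>L lborel (\<alpha> k) \<le> measure lborel (A k) + s" by metis
  have \<alpha>s: "integral\<^sup>L lborel (\<alpha> k) \<le> 2 * s" for k using \<alpha>(6)[of k] mA[of k] by linarith
  have i\<alpha>: "integrable lborel (\<alpha> k)" for k by (intro integrable_continuous_bounded_support \<alpha>)
  have b\<psi>: "bounded {y. \<psi> y \<noteq> 0}" by (rule bounded_subset[OF compact_imp_bounded[OF C(1)]]) (use \<psi>(2) in auto)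
  have c\<psi>: "continuous_on UNIV (\<lambda>y. \<psi> y * v y)" if "continuous_on \<Omega>' v" for v
    by (rule continuous_on_UNIV_mult_supported[OF \<psi>(1) compact_imp_closed[OF C(1)] \<psi>(2) C(2) opn(2) that])
  have cLh: "continuous_on \<Omega>' (\<lambda>y. L k (h y))" for k
    by (intro continuous_on_compose2[OF C_k_continuous[OF L1(1)] cont(2)]) auto
  \<comment> \<open>The layer seen from the image side. The factor \<open>1 - \<alpha> k y\<close>
    removes the strip, the only place where \<open>L k x\<close> and \<open>L k (h (F n x))\<close>
    can differ.\<close>
  define \<zeta> where "\<zeta> k y = \<psi> y * ((1 - \<alpha> k y) * L k (h y))" for k y
  have c\<zeta>: "continuous_on UNIV (\<zeta> k)" for k
    unfolding \<zeta>_def[abs_def] by (intro c\<psi> continuous_on_mult continuous_on_diff continuous_on_const cLh continuous_on_subset[OF \<alpha>(1)]) auto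
  have s\<zeta>: "y \<in> C" if "\<zeta> k y \<noteq> 0" for k y using that \<psi>(2) by (auto simp: \<zeta>_def)
  have i1: "integrable lborel (\<lambda>y. \<psi> y * L k (h y))" for k
    by (intro integrable_continuous_bounded_support c\<psi> cLh bounded_support_mult1 b\<psi>)
  have i2: "integrable lborel (\<zeta> k)" for k
    by (rule integrable_continuous_bounded_support[OF c\<zeta>], rule bounded_subset[OF compact_imp_bounded[OF C(1)]]) (use s\<zeta> in blast)
  have i3: "integrable lborel \<psi>" by (intro integrable_continuous_bounded_support \<psi> b\<psi>)
  have split_lim: "(\<integral>y. \<psi> y * lin e (h y) \<partial>lborel) = c0 * integral\<^sup>L lborel \<psi> + (\<Sum>k<m. \<integral>y. \<psi> y * L k (h y) \<partial>lborel)"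
  proof -
    have "\<psi> y * lin e (h y) = c0 * \<psi> y + (\<Sum>k<m. \<psi> y * L k (h y))" for y
    proof (cases "\<psi> y = 0")
      case False
      have "(\<Sum>k<m. L k (h y)) = lin e (h y) - c0" by (rule sumL[OF hC(1)[OF \<psi>(2)[OF False]]])
      then have eq: "lin e (h y) = c0 + (\<Sum>k<m. L k (h y))" by simp
      show ?thesis unfolding eq sum_distrib_left[symmetric] by (simp add: algebra_simps)
    qed simp
    then show ?thesis using i1 i3 by (simp add: Bochner_Integration.integral_sum)
  qed
  have lim_err: "\<bar>(\<integral>y. \<psi> y * L k (h y) \<partial>lborel) - integral\<^sup>L lborel (\<zeta> k)\<bar> \<le> \<delta> * (X * (2 * s))" for k
  proof -
    have "\<bar>(\<integral>y. \<psi> y * L k (h y) \<partial>lborel) - integral\<^sup>L lborel (\<zeta> k)\<bar> = \<bar>\<integral>y. \<psi> y * L k (h y) - \<zeta> k y \<partial>lborel\<bar>"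
      by (simp only: Bochner_Integration.integral_diff[OF i1 i2])
    also have "\<dots> \<le> (\<integral>y. \<bar>\<psi> y * L k (h y) - \<zeta> k y\<bar> \<partial>lborel)" by (rule integral_abs_bound)
    also have "\<dots> \<le> (\<integral>y. \<delta> * X * \<alpha> k y \<partial>lborel)"
    proof (rule integral_mono)
      show "integrable lborel (\<lambda>y. \<bar>\<psi> y * L k (h y) - \<zeta> k y\<bar>)"
        by (intro integrable_abs Bochner_Integration.integrable_diff i1 i2)
      show "integrable lborel (\<lambda>y. \<delta> * X * \<alpha> k y)" by (intro integrable_mult_right i\<alpha>)
      fix y
      have "\<psi> y * L k (h y) - \<zeta> k y = \<psi> y * L k (h y) * \<alpha> k y" by (simp add: \<zeta>_def algebra_simps)
      moreover have "\<bar>\<psi> y\<bar> * L k (h y) \<le> X * \<delta>" using \<psi>(3,4) Lb by (intro mult_mono) auto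
      ultimately show "\<bar>\<psi> y * L k (h y) - \<zeta> k y\<bar> \<le> \<delta> * X * \<alpha> k y"
        using \<alpha>(3)[of k y] Lb(1)[of k "h y"] mult_right_mono[of "\<bar>\<psi> y\<bar> * L k (h y)" "X * \<delta>" "\<alpha> k y"]
        by (simp add: abs_mult mult.commute)
    qed
    also have "\<dots> \<le> \<delta> * X * (2 * s)" using \<alpha>s[of k] d(1) \<psi>(4) by simp
    finally show ?thesis by (simp add: mult.assoc)
  qed
  \<comment> \<open>A Lipschitz constant of \<open>lin e\<close>; thresholds are divided by
    \<open>E + 1\<close> to include \<open>e = 0\<close>.\<close>
  define E where "E = \<bar>e $ 1\<bar> + \<bar>e $ 2\<bar>"
  have E: "E \<ge> 0" by (simp add: E_def)
  have "uniformly_continuous_on (f ` K) h"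
    by (intro compact_uniformly_continuous continuous_on_subset[OF cont(2)] compact_continuous_image continuous_on_subset[OF cont(1)] K)
       (use K f_in in auto)
  moreover have "\<delta> / (E + 1) > 0" using d(1) E by simp
  ultimately obtain q where q: "q > 0" "\<And>y y'. y \<in> f ` K \<Longrightarrow> y' \<in> f ` K \<Longrightarrow> dist y' y < q \<Longrightarrow> dist (h y') (h y) < \<delta> / (E + 1)"
    unfolding uniformly_continuous_on_def by metis
  have ev1: "\<forall>\<^sub>F n in sequentially. \<forall>x\<in>K. norm (F n x - f x) < q" by (rule F_uniform[OF K q(1)])
  have ev2: "\<forall>\<^sub>F n in sequentially. \<forall>\<zeta>. continuous_on UNIV \<zeta> \<and> (\<forall>y. \<zeta> y \<noteq> 0 \<longrightarrow> y \<in> C) \<longrightarrow> jac_pair \<theta> (F n) \<zeta> = integral\<^sup>L lborel \<zeta>"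
    by (rule jac_pair_eventually[OF sp C t W])
  from ev1 ev2 B show ?thesis
  proof eventually_elim
    case (elim n)
    let ?J = "wedge (\<lambda>x. F n x $ 1) (\<lambda>x. F n x $ 2)"
    let ?\<phi> = "\<lambda>k x. \<theta> x * L k x"
    have \<phi>1: "C_k 1 (?\<phi> k)" "bounded {x. ?\<phi> k x \<noteq> 0}" for k
      by (intro C_k_mult tD L1 bounded_support_mult1)+
    \<comment> \<open>For large \<open>n\<close> the values of \<open>lin e\<close> at
      \<open>x\<close> and at \<open>h (F n x)\<close> differ by less than \<open>\<delta>\<close>.
      If the second is outside the strip, both lie on the same side of the interval where the layer
      varies.\<close>
    have same: "L k x = L k (h (F n x))" if x: "x \<in> K" and y: "F n x \<in> C" "F n x \<notin> A k" for x k
    proof -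
      have fx: "h (f x) = x" using inv(1) x K by auto
      have "dist (h (F n x)) (h (f x)) < \<delta> / (E + 1)"
        by (rule q(2)) (use x y CfK elim(1) in \<open>auto simp: dist_norm\<close>)
      then have "norm (h (F n x) - x) * (E + 1) < \<delta>" using E by (simp add: fx dist_norm less_divide_eq)
      then have "E * norm (h (F n x) - x) + norm (h (F n x) - x) < \<delta>" by (simp add: algebra_simps)
      then have cl: "\<bar>lin e (h (F n x)) - lin e x\<bar> < \<delta>"
        using lin_lipschitz[of e "h (F n x)" x] norm_ge_zero[of "h (F n x) - x"] unfolding E_def[symmetric]
        by linarith
      have "lin e (h (F n x)) < c k - \<delta> \<or> lin e (h (F n x)) > c k + 3 * \<delta>"
        using y d(3) by (auto simp: A_def)
      then show ?thesis
      proof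
        assume a: "lin e (h (F n x)) < c k - \<delta>"
        then have "(lin e (h (F n x)) - c k) / \<delta> \<le> 0" "(lin e x - c k) / \<delta> \<le> 0"
          using cl d(1) by (auto simp: divide_le_0_iff)
        then show ?thesis by (simp add: L_def layer_eq_0)
      next
        assume a: "lin e (h (F n x)) > c k + 3 * \<delta>"
        then have "(lin e (h (F n x)) - c k) / \<delta> \<ge> 2" "(lin e x - c k) / \<delta> \<ge> 2"
          using cl d(1) by (auto simp: le_divide_eq)
        then show ?thesis by (simp add: L_def layer_eq_1)
      qed
    qed
    have int: "integrable lborel (\<lambda>x. a x * v (F n x) * ?J x)"
      if "continuous_on UNIV a" "bounded {x. a x \<noteq> 0}" "continuous_on UNIV v" for a v
      by (rule jac_pair_integrable[OF that(1,2) F_C1 that(3)])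
    have c\<phi>: "continuous_on UNIV (?\<phi> k)" for k by (rule C_k_continuous[OF \<phi>1(1)])
    have c\<psi>\<alpha>: "continuous_on UNIV (\<lambda>y. \<psi> y * \<alpha> k y)" for k by (intro continuous_on_mult \<psi> \<alpha>)
    have split_n: "jac_pair (\<lambda>x. \<theta> x * lin e x) (F n) \<psi> = c0 * jac_pair \<theta> (F n) \<psi> + (\<Sum>k<m. jac_pair (?\<phi> k) (F n) \<psi>)"
    proof -
      have "\<theta> x * lin e x * \<psi> (F n x) * ?J x = c0 * (\<theta> x * \<psi> (F n x) * ?J x) + (\<Sum>k<m. ?\<phi> k x * \<psi> (F n x) * ?J x)" for x
      proof (cases "x \<in> K")
        case True
        have "(\<Sum>k<m. ?\<phi> k x * \<psi> (F n x) * ?J x) = \<theta> x * (\<Sum>k<m. L k x) * \<psi> (F n x) * ?J x"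
          by (simp add: sum_distrib_left sum_distrib_right)
        then show ?thesis unfolding sumL[OF True] by (simp add: algebra_simps)
      qed (simp add: \<theta>K)
      then show ?thesis
        unfolding jac_pair_def using int[OF tD(6,4) \<psi>(1)] int[OF c\<phi> \<phi>1(2) \<psi>(1)]
        by (simp add: Bochner_Integration.integral_sum)
    qed
    have layer_n: "jac_pair (?\<phi> k) (F n) \<psi> = integral\<^sup>L lborel (\<zeta> k) + jac_pair (?\<phi> k) (F n) (\<lambda>y. \<psi> y * \<alpha> k y)" for k
    proof -
      have "?\<phi> k x * \<psi> (F n x) * ?J x = \<theta> x * \<zeta> k (F n x) * ?J x + ?\<phi> k x * (\<psi> (F n x) * \<alpha> k (F n x)) * ?J x" for x
      proof (cases "x \<in> K \<and> F n x \<in> C \<and> F n x \<notin> A k")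
        case True
        then have "L k (h (F n x)) = L k x" using same by simp
        then show ?thesis by (simp add: \<zeta>_def algebra_simps)
      next
        case False
        then consider "x \<notin> K" | "F n x \<notin> C" | "F n x \<in> A k" by blast
        then show ?thesis
        proof cases
          case 1 then show ?thesis by (simp add: \<theta>K)
        next
          case 2
          then have "\<psi> (F n x) = 0" using \<psi>(2) by blast
          then show ?thesis by (simp add: \<zeta>_def)
        next
          case 3 then show ?thesis by (simp add: \<zeta>_def \<alpha>(5))
        qed
      qed
      then have "jac_pair (?\<phi> k) (F n) \<psi> = jac_pair \<theta> (F n) (\<zeta> k) + jac_pair (?\<phi> k) (F n) (\<lambda>y. \<psi> y * \<alpha> k y)"
        unfolding jac_pair_def using int[OF tD(6,4) c\<zeta>, of k] int[OF c\<phi> \<phi>1(2) c\<psi>\<alpha>, of k k] by simp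
      moreover have "jac_pair \<theta> (F n) (\<zeta> k) = integral\<^sup>L lborel (\<zeta> k)" using elim(2) c\<zeta> s\<zeta> by blast
      ultimately show ?thesis by simp
    qed
    define w where "w i k = (\<integral>x. \<bar>wedge (?\<phi> k) (\<lambda>x. F n x $ i) x\<bar> \<partial>lborel)" for i k
    \<comment> \<open>Since the square of \<open>\<alpha> k\<close> is at most
      \<open>\<alpha> k\<close>, whose integral is at most \<open>2 * s\<close>, the squared weight
      has integral at most \<open>2 * X\<^sup>2 * s\<close>.\<close>
    have R: "\<bar>jac_pair (?\<phi> k) (F n) (\<lambda>y. \<psi> y * \<alpha> k y)\<bar> \<le> sqrt (2 * X\<^sup>2 * s) * ((w 1 k + w 2 k) / 2)" for k
      unfolding w_def
    proof (rule jac_pair_isoperimetric[OF \<phi>1 F_C1 c\<psi>\<alpha> bounded_support_mult1[OF b\<psi>]])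
      have "(\<integral>y. (\<psi> y * \<alpha> k y)\<^sup>2 \<partial>lborel) \<le> (\<integral>y. X\<^sup>2 * \<alpha> k y \<partial>lborel)"
      proof (rule integral_mono)
        show "integrable lborel (\<lambda>y. (\<psi> y * \<alpha> k y)\<^sup>2)"
          unfolding power2_eq_square
          by (intro integrable_continuous_bounded_support continuous_on_mult[OF c\<psi>\<alpha> c\<psi>\<alpha>] bounded_support_mult1 b\<psi>)
        show "integrable lborel (\<lambda>y. X\<^sup>2 * \<alpha> k y)" by (intro integrable_mult_right i\<alpha>)
        fix y
        have "(\<psi> y)\<^sup>2 \<le> X\<^sup>2" using \<psi>(3)[of y] \<psi>(4) abs_le_square_iff[of "\<psi> y" X] by simp
        moreover have "(\<alpha> k y)\<^sup>2 \<le> \<alpha> k y" using \<alpha>(3,4)[of k y] by (simp add: power2_eq_square mult_left_le)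
        ultimately show "(\<psi> y * \<alpha> k y)\<^sup>2 \<le> X\<^sup>2 * \<alpha> k y" unfolding power_mult_distrib by (intro mult_mono) auto
      qed
      also have "\<dots> \<le> X\<^sup>2 * (2 * s)" using \<alpha>s[of k] by (simp add: mult_left_mono)
      finally show "(\<integral>y. (\<psi> y * \<alpha> k y)\<^sup>2 \<partial>lborel) \<le> 2 * X\<^sup>2 * s" by simp
    qed (use s \<psi>(4) in simp)
    \<comment> \<open>Pointwise, the derivatives of the functions \<open>\<theta> x * L k x\<close>
      sum to at most \<open>P\<close> in absolute value, because the \<open>dlayer\<close> factors
      sum to at most 1 and the layers to at most \<open>2 * M + 1\<close>. The bound does not
      involve \<open>m\<close>.\<close>
    have sw: "(\<Sum>k<m. w i k) \<le> 2 * P * B" for i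
    proof -
      let ?p = "\<lambda>j x. indicator K x * \<bar>part_deriv j (\<lambda>x. F n x $ i) x\<bar>"
      have iw: "integrable lborel (\<lambda>x. \<bar>wedge (?\<phi> k) (\<lambda>x. F n x $ i) x\<bar>)" for k
        by (intro integrable_abs integrable_continuous_bounded_support wedge_continuous \<phi>1 C1_mapD[OF F_C1] bounded_support_wedge)
      have ip: "integrable lborel (?p j)" for j
        using borel_integrable_compact[OF K(1), of "\<lambda>x. \<bar>part_deriv j (\<lambda>x. F n x $ i) x\<bar>"]
          continuous_on_subset[OF continuous_on_rabs[OF C1_pd_continuous[OF C1_mapD[OF F_C1]]]] by simp
      have pw: "(\<Sum>k<m. \<bar>wedge (?\<phi> k) (\<lambda>x. F n x $ i) x\<bar>) \<le> P * ?p 1 x + P * ?p 2 x" for x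
      proof -
        let ?v = "\<lambda>j. \<bar>part_deriv j (\<lambda>x. F n x $ i) x\<bar>"
        have dp: "part_deriv j (?\<phi> k) x = \<theta> x * (dlayer ((lin e x - c k) / \<delta>) * e $ j) + part_deriv j \<theta> x * L k x" for j k
          using part_deriv_mult[of \<theta> x "L k" j] C1_differentiable[OF tD(5)] C1_differentiable[OF L1(1)] L1(2) by simp
        have le: "\<bar>wedge (?\<phi> k) (\<lambda>x. F n x $ i) x\<bar> \<le> \<bar>part_deriv 1 (?\<phi> k) x\<bar> * ?v 2 + \<bar>part_deriv 2 (?\<phi> k) x\<bar> * ?v 1" for k
          unfolding wedge_def abs_mult[symmetric] by (rule abs_triangle_ineq4)
        show ?thesis
        proof (cases "x \<in> K")
          case False
          then have "part_deriv j (?\<phi> k) x = 0" for j k unfolding dp using \<theta>K d\<theta>K by simp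
          then have "wedge (?\<phi> k) (\<lambda>x. F n x $ i) x = 0" for k by (simp add: wedge_def)
          then show ?thesis using False by simp
        next
          case True
          have sj: "(\<Sum>k<m. \<bar>part_deriv j (?\<phi> k) x\<bar>) \<le> P" for j
          proof -
            have "(\<Sum>k<m. \<bar>part_deriv j (?\<phi> k) x\<bar>) \<le> (\<Sum>k<m. \<bar>\<theta> x\<bar> * \<bar>e $ j\<bar> * dlayer ((lin e x - c k) / \<delta>) + \<bar>part_deriv j \<theta> x\<bar> * L k x)"
            proof (rule sum_mono)
              fix k
              have "\<bar>part_deriv j (?\<phi> k) x\<bar> \<le> \<bar>\<theta> x * (dlayer ((lin e x - c k) / \<delta>) * e $ j)\<bar> + \<bar>part_deriv j \<theta> x * L k x\<bar>"
                unfolding dp by (rule abs_triangle_ineq)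
              then show "\<bar>part_deriv j (?\<phi> k) x\<bar> \<le> \<bar>\<theta> x\<bar> * \<bar>e $ j\<bar> * dlayer ((lin e x - c k) / \<delta>) + \<bar>part_deriv j \<theta> x\<bar> * L k x"
                using dlayer_nonneg[of "(lin e x - c k) / \<delta>"] Lb(1)[of k x] by (simp add: abs_mult mult_ac)
            qed
            also have "\<dots> = \<bar>\<theta> x\<bar> * \<bar>e $ j\<bar> * (\<Sum>k<m. dlayer ((lin e x - c k) / \<delta>)) + \<bar>part_deriv j \<theta> x\<bar> * (\<Sum>k<m. L k x)"
              by (simp add: sum.distrib sum_distrib_left)
            also have "\<dots> \<le> \<bar>\<theta> x\<bar> * \<bar>e $ j\<bar> * 1 + \<bar>part_deriv j \<theta> x\<bar> * (2 * M + 1)"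
              by (intro add_mono mult_left_mono sumdl sumL_le True) auto
            also have "\<dots> \<le> P" using P(1)[of x j] by simp
            finally show ?thesis .
          qed
          have "(\<Sum>k<m. \<bar>wedge (?\<phi> k) (\<lambda>x. F n x $ i) x\<bar>) \<le> (\<Sum>k<m. \<bar>part_deriv 1 (?\<phi> k) x\<bar> * ?v 2 + \<bar>part_deriv 2 (?\<phi> k) x\<bar> * ?v 1)"
            by (intro sum_mono le)
          also have "\<dots> = (\<Sum>k<m. \<bar>part_deriv 1 (?\<phi> k) x\<bar>) * ?v 2 + (\<Sum>k<m. \<bar>part_deriv 2 (?\<phi> k) x\<bar>) * ?v 1"
            by (simp only: sum.distrib sum_distrib_right)
          also have "\<dots> \<le> P * ?v 2 + P * ?v 1" by (intro add_mono mult_right_mono sj) auto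
          finally show ?thesis using True by simp
        qed
      qed
      have "(\<Sum>k<m. w i k) = (\<integral>x. (\<Sum>k<m. \<bar>wedge (?\<phi> k) (\<lambda>x. F n x $ i) x\<bar>) \<partial>lborel)"
        unfolding w_def by (rule Bochner_Integration.integral_sum[symmetric]) (rule iw)
      also have "\<dots> \<le> (\<integral>x. P * ?p 1 x + P * ?p 2 x \<partial>lborel)"
        by (intro integral_mono Bochner_Integration.integrable_sum Bochner_Integration.integrable_add integrable_mult_right iw ip pw)
      also have "\<dots> = P * (\<integral>x. ?p 1 x \<partial>lborel) + P * (\<integral>x. ?p 2 x \<partial>lborel)"
        by (subst Bochner_Integration.integral_add) (simp_all add: ip)
      also have "\<dots> \<le> P * B + P * B" using elim(3) P(2) by (intro add_mono mult_left_mono) auto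
      finally show ?thesis by (simp add: mult_ac)
    qed
    have \<psi>int: "jac_pair \<theta> (F n) \<psi> = integral\<^sup>L lborel \<psi>" using elim(2) \<psi> by blast
    have "jac_pair (\<lambda>x. \<theta> x * lin e x) (F n) \<psi> - (\<integral>y. \<psi> y * lin e (h y) \<partial>lborel)
      = (\<Sum>k<m. jac_pair (?\<phi> k) (F n) (\<lambda>y. \<psi> y * \<alpha> k y) - ((\<integral>y. \<psi> y * L k (h y) \<partial>lborel) - integral\<^sup>L lborel (\<zeta> k)))"
      unfolding split_n split_lim layer_n \<psi>int by (simp add: sum.distrib sum_subtractf)
    also have "\<bar>\<dots>\<bar> \<le> (\<Sum>k<m. \<bar>jac_pair (?\<phi> k) (F n) (\<lambda>y. \<psi> y * \<alpha> k y) - ((\<integral>y. \<psi> y * L k (h y) \<partial>lborel) - integral\<^sup>L lborel (\<zeta> k))\<bar>)"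
      by (rule sum_abs)
    also have "\<dots> \<le> (\<Sum>k<m. sqrt (2 * X\<^sup>2 * s) * ((w 1 k + w 2 k) / 2) + \<delta> * (X * (2 * s)))"
      by (intro sum_mono order_trans[OF abs_triangle_ineq4] add_mono R lim_err)
    also have "\<dots> = sqrt (2 * X\<^sup>2 * s) * (((\<Sum>k<m. w 1 k) + (\<Sum>k<m. w 2 k)) / 2) + real m * \<delta> * (X * (2 * s))"
      by (simp add: sum.distrib sum_distrib_left[symmetric] sum_divide_distrib[symmetric])
    also have "\<dots> \<le> sqrt (2 * X\<^sup>2 * s) * (2 * P * B) + (2 * M + 3) * (X * (2 * s))"
    proof (intro add_mono mult_left_mono mult_right_mono m(2))
      show "((\<Sum>k<m. w 1 k) + (\<Sum>k<m. w 2 k)) / 2 \<le> 2 * P * B" 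
        using sw[of 1] sw[of 2] by argo
    qed (use s \<psi>(4) in auto)
    finally show ?case by (simp add: mult_ac)
  qed
qed

text \<open>All constants of the layered estimate other than \<open>s\<close> are fixed by
  \<open>\<theta>\<close>, \<open>\<psi>\<close>, \<open>e\<close> and \<open>B\<close>, so the
  absence of atoms allows \<open>s\<close> to be taken as small as desired.\<close>

lemma layered_limit:
  assumes sp: "sense_preserving \<Omega> f" and C: "compact C" "C \<subseteq> \<Omega>'"
    and t: "\<theta> \<in> test_functions \<Omega>" and W: "open W" "h ` C \<subseteq> W" "\<And>x. x \<in> W \<Longrightarrow> \<theta> x = 1"
    and B: "\<forall>\<^sub>F n in sequentially. \<forall>i j. (\<integral>x. indicator (closure {x. \<theta> x \<noteq> 0}) x * \<bar>part_deriv j (\<lambda>x. F n x $ i) x\<bar> \<partial>lborel) \<le> B"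
    and na: "\<And>t. measure lborel {y \<in> C. lin e (h y) = t} = 0"
    and \<psi>: "continuous_on UNIV \<psi>" "\<And>y. \<psi> y \<noteq> 0 \<Longrightarrow> y \<in> C"
  shows "(\<lambda>n. jac_pair (\<lambda>x. \<theta> x * lin e x) (F n) \<psi>) \<longlonglongrightarrow> (\<integral>y. \<psi> y * lin e (h y) \<partial>lborel)"
proof (rule LIMSEQ_I)
  fix r :: real assume r: "r > 0"
  note tD = test_functionD[OF t]
  have b\<psi>: "bounded {y. \<psi> y \<noteq> 0}" by (rule bounded_subset[OF compact_imp_bounded[OF C(1)]]) (use \<psi>(2) in auto)
  obtain X where X: "X > 0" "\<And>y. \<bar>\<psi> y\<bar> \<le> X" using bounded_supportE[OF \<psi>(1) b\<psi>] by metis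
  have "compact (lin e ` closure {x. \<theta> x \<noteq> 0})"
    by (intro compact_continuous_image continuous_on_subset[OF C_k_continuous[OF lin_C_k]] tD) auto
  then have "bounded (lin e ` closure {x. \<theta> x \<noteq> 0})" by (rule compact_imp_bounded)
  then obtain M where M: "M > 0" "\<forall>y\<in>lin e ` closure {x. \<theta> x \<noteq> 0}. norm y \<le> M" unfolding bounded_pos by blast
  obtain T where T: "T > 0" "\<And>x. \<bar>\<theta> x\<bar> \<le> T" using bounded_supportE[OF tD(6,4)] by metis
  have "\<exists>D>0. \<forall>x. \<bar>part_deriv j \<theta> x\<bar> \<le> D" for j
    using bounded_supportE[OF C1_pd_continuous[OF tD(5), of j] bounded_support_part_deriv[OF tD(4), of j]] by metis
  then obtain D where D: "\<And>j. D j > 0" "\<And>j x. \<bar>part_deriv j \<theta> x\<bar> \<le> D j" by metis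
  define P where "P = (\<Sum>j\<in>UNIV. T * \<bar>e $ j\<bar> + D j * (2 * M + 1))"
  have Pj: "0 \<le> T * \<bar>e $ j\<bar> + D j * (2 * M + 1)" for j using T D(1)[of j] M(1) by simp
  have P: "\<bar>\<theta> x\<bar> * \<bar>e $ j\<bar> + \<bar>part_deriv j \<theta> x\<bar> * (2 * M + 1) \<le> P" for x j
  proof -
    have "\<bar>\<theta> x\<bar> * \<bar>e $ j\<bar> + \<bar>part_deriv j \<theta> x\<bar> * (2 * M + 1) \<le> T * \<bar>e $ j\<bar> + D j * (2 * M + 1)"
      using T(2) D(2) M(1) by (intro add_mono mult_right_mono) auto
    also have "\<dots> \<le> P" unfolding P_def by (rule member_le_sum) (use Pj in auto)
    finally show ?thesis .
  qed
  have P0: "P \<ge> 0" unfolding P_def by (intro sum_nonneg Pj)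
  \<comment> \<open>Both error terms are at most \<open>sqrt s\<close> times their part of
    \<open>G\<close>, since \<open>s \<le> 1\<close> gives \<open>s \<le> sqrt s\<close>. The
    absolute value of \<open>B\<close> appears because its sign is not known.\<close>
  define G where "G = sqrt 2 * X * (2 * P * \<bar>B\<bar>) + (2 * M + 3) * (2 * X)"
  have G: "G > 0" unfolding G_def using X(1) P0 M(1) by (intro add_nonneg_pos mult_nonneg_nonneg mult_pos_pos) auto
  define s where "s = min 1 ((r / (2 * G))\<^sup>2)"
  have s: "s > 0" "s \<le> 1" using r G by (auto simp: s_def)
  have ss: "sqrt s \<le> r / (2 * G)" using r G by (simp add: s_def real_le_lsqrt)
  have bound: "sqrt (2 * X\<^sup>2 * s) * (2 * P * B) + (2 * M + 3) * (2 * X * s) < r"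
  proof -
    have "sqrt (2 * X\<^sup>2 * s) * (2 * P * B) \<le> sqrt (2 * X\<^sup>2 * s) * (2 * P * \<bar>B\<bar>)"
      using P0 s by (intro mult_left_mono) auto
    also have "\<dots> = sqrt s * (sqrt 2 * X * (2 * P * \<bar>B\<bar>))" using X(1) by (simp add: real_sqrt_mult)
    finally have 1: "sqrt (2 * X\<^sup>2 * s) * (2 * P * B) \<le> sqrt s * (sqrt 2 * X * (2 * P * \<bar>B\<bar>))" .
    have "s = sqrt s * sqrt s" using s by simp
    also have "\<dots> \<le> sqrt s * 1" using s by (intro mult_left_mono) auto
    finally have "s \<le> sqrt s" by simp
    then have 2: "(2 * M + 3) * (2 * X * s) \<le> sqrt s * ((2 * M + 3) * (2 * X))"
      using M(1) X(1) by (simp add: mult_ac)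
    have "sqrt s * (sqrt 2 * X * (2 * P * \<bar>B\<bar>)) + sqrt s * ((2 * M + 3) * (2 * X)) = sqrt s * G" by (simp add: G_def distrib_left)
    also have "\<dots> \<le> r / (2 * G) * G" using ss G by (intro mult_right_mono) auto
    also have "\<dots> < r" using r G by simp
    finally show ?thesis using 1 2 by linarith
  qed
  have "\<forall>\<^sub>F n in sequentially. \<bar>jac_pair (\<lambda>x. \<theta> x * lin e x) (F n) \<psi> - (\<integral>y. \<psi> y * lin e (h y) \<partial>lborel)\<bar>
     \<le> sqrt (2 * X\<^sup>2 * s) * (2 * P * B) + (2 * M + 3) * (2 * X * s)"
    by (rule layered_estimate[OF sp C t W refl B na \<psi> X(2,1) _ _ P P0 s(1)]) (use M in auto)
  then have "\<forall>\<^sub>F n in sequentially. norm (jac_pair (\<lambda>x. \<theta> x * lin e x) (F n) \<psi> - (\<integral>y. \<psi> y * lin e (h y) \<partial>lborel)) < r"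
    by eventually_elim (use bound in simp)
  then show "\<exists>no. \<forall>n\<ge>no. norm (jac_pair (\<lambda>x. \<theta> x * lin e x) (F n) \<psi> - (\<integral>y. \<psi> y * lin e (h y) \<partial>lborel)) < r"
    by (simp add: eventually_sequentially)
qed

end

section \<open>Directions without atoms\<close>

context planar_homeo
begin

text \<open>The image under \<open>f\<close> of the part in \<open>\<Omega>\<close> of the line x_1
  + a x_2 = t. A one-parameter family of directions suffices, as it is uncountable.\<close>

definition fibre :: "real \<Rightarrow> real \<Rightarrow> (real^2) set" where
  "fibre a t = {y \<in> \<Omega>'. lin (vector [1, a]) (h y) = t}"

lemma fibre_fmeasurable: "fibre a t \<in> fmeasurable lborel"
proof -
  have c: "continuous_on \<Omega>' (\<lambda>y. lin (vector [1, a]) (h y))"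
    by (intro continuous_on_compose2[OF C_k_continuous[OF lin_C_k] cont(2)]) auto
  have "(\<lambda>y. lin (vector [1, a]) (h y)) -` {t} \<inter> \<Omega>' \<in> sets (restrict_space borel \<Omega>')"
    using measurable_sets[OF borel_measurable_continuous_on_restrict[OF c], of "{t}"] by (simp add: space_restrict_space)
  then have "(\<lambda>y. lin (vector [1, a]) (h y)) -` {t} \<inter> \<Omega>' \<in> sets borel"
    using opn(2) by (subst (asm) sets_restrict_space_iff) auto
  moreover have "(\<lambda>y. lin (vector [1, a]) (h y)) -` {t} \<inter> \<Omega>' = fibre a t" by (auto simp: fibre_def)
  moreover have "bounded (fibre a t)" by (rule bounded_subset[OF bdd(2)]) (auto simp: fibre_def)
  ultimately show ?thesis using emeasure_bounded_finite by (auto simp: fmeasurable_def)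
qed

lemma fibre_inter:
  assumes "a \<noteq> a'" "y \<in> fibre a t" "y \<in> fibre a' t'" "z \<in> fibre a t" "z \<in> fibre a' t'"
  shows "y = z"
proof -
  have e: "h y $ 1 + a * h y $ 2 = t" "h y $ 1 + a' * h y $ 2 = t'" "h z $ 1 + a * h z $ 2 = t" "h z $ 1 + a' * h z $ 2 = t'"
    and \<Omega>': "y \<in> \<Omega>'" "z \<in> \<Omega>'"
    using assms by (auto simp: fibre_def lin_def)
  have "(a - a') * (h y $ 2 - h z $ 2) = (h y $ 1 + a * h y $ 2) - (h y $ 1 + a' * h y $ 2) - (h z $ 1 + a * h z $ 2) + (h z $ 1 + a' * h z $ 2)"
    by (simp add: algebra_simps)
  also have "\<dots> = 0" unfolding e by simp
  finally have 2: "h y $ 2 = h z $ 2" using assms(1) by simp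
  then have "h y $ 1 = h z $ 1" using e by auto
  with 2 have "h y = h z" by (simp add: vec_eq_iff forall_2)
  then show ?thesis using inv(2) \<Omega>' by metis
qed

text \<open>Lines of different directions meet in at most one point, so fibres of different
  directions are disjoint up to a null set. With one fibre of measure above \<open>c\<close> for
  each, there can be no more than the area of \<open>\<Omega>'\<close> divided by \<open>c\<close>
  of them.\<close>

lemma finite_heavy_directions:
  assumes c: "c > 0"
  shows "finite {a. \<exists>t. c < measure lborel (fibre a t)}"
proof (rule ccontr)
  assume "infinite {a. \<exists>t. c < measure lborel (fibre a t)}"
  moreover define N where "N = nat \<lceil>measure lborel \<Omega>' / c\<rceil> + 1"
  ultimately obtain S where S: "finite S" "card S = N" "S \<subseteq> {a. \<exists>t. c < measure lborel (fibre a t)}"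
    using infinite_arbitrarily_large by blast
  then have "\<forall>a\<in>S. \<exists>t. c < measure lborel (fibre a t)" by blast
  then obtain t where "\<forall>a\<in>S. c < measure lborel (fibre a (t a))" by (rule bchoice[THEN exE])
  then have t: "\<And>a. a \<in> S \<Longrightarrow> c < measure lborel (fibre a (t a))" by blast
  have "measure lborel (\<Union>a\<in>S. fibre a (t a)) = (\<Sum>a\<in>S. measure lborel (fibre a (t a)))"
  proof (rule measure_UNION_AE[OF S(1) fibre_fmeasurable])
    show "pairwise (\<lambda>a b. AE x in lborel. x \<notin> fibre a (t a) \<or> x \<notin> fibre b (t b)) S"
    proof (rule pairwiseI)
      fix a b :: real assume ab: "a \<noteq> b"
      show "AE x in lborel. x \<notin> fibre a (t a) \<or> x \<notin> fibre b (t b)"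
      proof (cases "fibre a (t a) \<inter> fibre b (t b) = {}")
        case False
        then obtain p where p: "p \<in> fibre a (t a)" "p \<in> fibre b (t b)" by blast
        have "x \<notin> fibre a (t a) \<or> x \<notin> fibre b (t b)" if "x \<noteq> p" for x
          using fibre_inter[OF ab _ _ p, of x] that by blast
        then show ?thesis using AE_lborel_singleton[of p] by (rule_tac eventually_mono) auto
      qed (auto intro!: AE_I2)
    qed
  qed
  moreover have "real N * c \<le> (\<Sum>a\<in>S. measure lborel (fibre a (t a)))"
    using sum_mono[of S "\<lambda>_. c" "\<lambda>a. measure lborel (fibre a (t a))"] less_imp_le[OF t] S(2) by simp
  moreover have "measure lborel (\<Union>a\<in>S. fibre a (t a)) \<le> measure lborel \<Omega>'"
  proof (rule measure_mono_fmeasurable)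
    show "(\<Union>a\<in>S. fibre a (t a)) \<subseteq> \<Omega>'" by (auto simp: fibre_def)
    show "(\<Union>a\<in>S. fibre a (t a)) \<in> sets lborel"
      using fibre_fmeasurable S(1) by (intro sets.finite_UN) (auto simp: fmeasurable_def)
    show "\<Omega>' \<in> fmeasurable lborel" using opn(2) emeasure_bounded_finite[OF bdd(2)] by (simp add: fmeasurable_def)
  qed
  moreover have "measure lborel \<Omega>' < real N * c"
  proof -
    have "measure lborel \<Omega>' / c < real N" unfolding N_def by linarith
    then show ?thesis using c by (simp add: pos_divide_less_eq)
  qed
  ultimately show False by linarith
qed

text \<open>A bad direction has a fibre of measure above some \<open>step_seq n\<close>, so the bad
  directions form a countable union of finite sets.\<close>

lemma good_directions:
  obtains a b where "a \<noteq> b" "\<And>t. measure lborel (fibre a t) = 0" "\<And>t. measure lborel (fibre b t) = 0"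
proof -
  let ?bad = "{a. \<exists>t. 0 < measure lborel (fibre a t)}"
  have "?bad \<subseteq> (\<Union>n. {a. \<exists>t. step_seq n < measure lborel (fibre a t)})"
  proof
    fix a assume "a \<in> ?bad"
    then obtain t where t: "0 < measure lborel (fibre a t)" by blast
    have "\<forall>\<^sub>F n in sequentially. step_seq n < measure lborel (fibre a t)" by (rule order_tendstoD(2)[OF step_seq(1) t])
    then obtain n where "step_seq n < measure lborel (fibre a t)" using eventually_happens'[OF sequentially_bot] by blast
    then show "a \<in> (\<Union>n. {a. \<exists>t. step_seq n < measure lborel (fibre a t)})" by blast
  qed
  moreover have "countable (\<Union>n. {a. \<exists>t. step_seq n < measure lborel (fibre a t)})"
    by (rule countable_UN[OF _ countable_finite[OF finite_heavy_directions[OF step_seq(4)]]]) simp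
  ultimately have "countable ?bad" by (rule countable_subset)
  then have unc: "uncountable (UNIV - ?bad)" using uncountable_UNIV_real uncountable_minus_countable by blast
  then have "UNIV - ?bad \<noteq> {}" using countable_empty by metis
  then obtain a where a: "a \<notin> ?bad" by blast
  have "uncountable (UNIV - ?bad - {a})" by (rule uncountable_minus_countable[OF unc]) simp
  then have "UNIV - ?bad - {a} \<noteq> {}" using countable_empty by metis
  then obtain b where b: "b \<notin> ?bad" "b \<noteq> a" by blast
  have "measure lborel (fibre c t) = 0" if "c \<notin> ?bad" for c t
  proof -
    have "\<not> 0 < measure lborel (fibre c t)" using that by blast
    then show ?thesis using measure_nonneg[of lborel "fibre c t"] by linarith
  qed
  then show thesis using that[of a b] a b by metis
qed

lemma linear_limit:
  assumes sp: "sense_preserving \<Omega> f" and C: "compact C" "C \<subseteq> \<Omega>'"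
    and t: "\<theta> \<in> test_functions \<Omega>" and W: "open W" "h ` C \<subseteq> W" "\<And>x. x \<in> W \<Longrightarrow> \<theta> x = 1"
    and B: "\<forall>\<^sub>F n in sequentially. \<forall>i j. (\<integral>x. indicator (closure {x. \<theta> x \<noteq> 0}) x * \<bar>part_deriv j (\<lambda>x. F n x $ i) x\<bar> \<partial>lborel) \<le> B"
    and \<psi>: "continuous_on UNIV \<psi>" "\<And>y. \<psi> y \<noteq> 0 \<Longrightarrow> y \<in> C"
  shows "(\<lambda>n. jac_pair (\<lambda>x. \<theta> x * x $ i) (F n) \<psi>) \<longlonglongrightarrow> (\<integral>y. \<psi> y * h y $ i \<partial>lborel)"
proof -
  note tD = test_functionD[OF t]
  obtain a b where ab: "a \<noteq> b" "\<And>t. measure lborel (fibre a t) = 0" "\<And>t. measure lborel (fibre b t) = 0"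
    by (rule good_directions) blast
  let ?v = "\<lambda>a. vector [1, a] :: real^2"
  have na: "measure lborel {y \<in> C. lin (?v c) (h y) = t} = 0" if c: "\<And>t. measure lborel (fibre c t) = 0" for c t
  proof -
    have sub: "{y \<in> C. lin (?v c) (h y) = t} \<subseteq> fibre c t" using C(2) by (auto simp: fibre_def)
    have "{y \<in> C. lin (?v c) (h y) = t} = C \<inter> fibre c t" using sub by (auto simp: fibre_def)
    then have "{y \<in> C. lin (?v c) (h y) = t} \<in> sets lborel"
      using fibre_fmeasurable[of c t] borel_closed[OF compact_imp_closed[OF C(1)]] by (auto simp: fmeasurable_def)
    then have "measure lborel {y \<in> C. lin (?v c) (h y) = t} \<le> measure lborel (fibre c t)"
      by (intro measure_mono_fmeasurable sub fibre_fmeasurable)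
    then show ?thesis using c[of t] measure_nonneg[of lborel "{y \<in> C. lin (?v c) (h y) = t}"] by linarith
  qed
  \<comment> \<open>Cramer's rule for recovering x_1 and x_2 from x_1 + a x_2 and x_1 + b
    x_2.\<close>
  define q where "q = (if i = 1 then (- b / (a - b), a / (a - b)) else (1 / (a - b), - 1 / (a - b)))"
  have comb: "x $ i = fst q * lin (?v a) x + snd q * lin (?v b) x" for x :: "real^2"
  proof -
    define d where "d = a - b"
    have d: "d \<noteq> 0" "a = b + d" using ab(1) by (auto simp: d_def)
    have "x $ 1 = - b / d * (x $ 1 + (b + d) * x $ 2) + (b + d) / d * (x $ 1 + b * x $ 2)"
      "x $ 2 = 1 / d * (x $ 1 + (b + d) * x $ 2) + - 1 / d * (x $ 1 + b * x $ 2)"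
      using d(1) by (simp_all add: divide_simps) (simp_all add: algebra_simps)
    then show ?thesis using exhaust_2[of i] by (auto simp: q_def lin_def d_def[symmetric] d(2)[symmetric])
  qed
  have ct: "continuous_on UNIV (\<lambda>x. \<theta> x * lin e x)" "bounded {x. \<theta> x * lin e x \<noteq> 0}" for e
    by (intro continuous_on_mult tD C_k_continuous[OF lin_C_k] bounded_support_mult1)+
  have ji: "integrable lborel (\<lambda>x. \<theta> x * lin e x * \<psi> (F n x) * wedge (\<lambda>x. F n x $ 1) (\<lambda>x. F n x $ 2) x)" for e n
    by (rule jac_pair_integrable[OF ct F_C1 \<psi>(1)])
  have "jac_pair (\<lambda>x. \<theta> x * x $ i) (F n) \<psi> = fst q * jac_pair (\<lambda>x. \<theta> x * lin (?v a) x) (F n) \<psi> + snd q * jac_pair (\<lambda>x. \<theta> x * lin (?v b) x) (F n) \<psi>" for n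
  proof -
    have "\<theta> x * x $ i * \<psi> (F n x) * wedge (\<lambda>x. F n x $ 1) (\<lambda>x. F n x $ 2) x
      = fst q * (\<theta> x * lin (?v a) x * \<psi> (F n x) * wedge (\<lambda>x. F n x $ 1) (\<lambda>x. F n x $ 2) x)
       + snd q * (\<theta> x * lin (?v b) x * \<psi> (F n x) * wedge (\<lambda>x. F n x $ 1) (\<lambda>x. F n x $ 2) x)" for x
      unfolding comb[of x] by (simp add: algebra_simps)
    then show ?thesis unfolding jac_pair_def by (simp add: ji)
  qed
  moreover have "(\<lambda>n. fst q * jac_pair (\<lambda>x. \<theta> x * lin (?v a) x) (F n) \<psi> + snd q * jac_pair (\<lambda>x. \<theta> x * lin (?v b) x) (F n) \<psi>)
     \<longlonglongrightarrow> fst q * (\<integral>y. \<psi> y * lin (?v a) (h y) \<partial>lborel) + snd q * (\<integral>y. \<psi> y * lin (?v b) (h y) \<partial>lborel)"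
    by (intro tendsto_add tendsto_mult tendsto_const layered_limit[OF sp C t W B na \<psi>] ab)
  moreover have "fst q * (\<integral>y. \<psi> y * lin (?v a) (h y) \<partial>lborel) + snd q * (\<integral>y. \<psi> y * lin (?v b) (h y) \<partial>lborel) = (\<integral>y. \<psi> y * h y $ i \<partial>lborel)"
  proof -
    have ii: "integrable lborel (\<lambda>y. \<psi> y * lin e (h y))" for e
    proof (rule integrable_continuous_bounded_support)
      show "continuous_on UNIV (\<lambda>y. \<psi> y * lin e (h y))"
        by (rule continuous_on_UNIV_mult_supported[OF \<psi>(1) compact_imp_closed[OF C(1)] \<psi>(2) C(2) opn(2)])
           (auto intro!: continuous_on_compose2[OF C_k_continuous[OF lin_C_k] cont(2)])
      show "bounded {y. \<psi> y * lin e (h y) \<noteq> 0}"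
        by (rule bounded_subset[OF compact_imp_bounded[OF C(1)]]) (use \<psi>(2) in auto)
    qed
    have "\<psi> y * h y $ i = fst q * (\<psi> y * lin (?v a) (h y)) + snd q * (\<psi> y * lin (?v b) (h y))" for y
      unfolding comb[of "h y"] by (simp add: algebra_simps)
    then show ?thesis by (simp add: ii)
  qed
  ultimately show ?thesis by simp
qed

lemma uniform_compose:
  fixes a u :: "real^2 \<Rightarrow> real"
  assumes a: "continuous_on UNIV a" "\<And>x. x \<notin> K \<Longrightarrow> a x = 0" and K: "compact K" "K \<subseteq> \<Omega>"
    and u: "continuous_on UNIV u" "bounded {y. u y \<noteq> 0}" and e: "e > 0"
  shows "\<forall>\<^sub>F n in sequentially. \<forall>x. \<bar>a x * u (F n x) - a x * u (f x)\<bar> \<le> e"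
proof -
  have "bounded {x. a x \<noteq> 0}" by (rule bounded_subset[OF compact_imp_bounded[OF K(1)]]) (use a in auto)
  then obtain M where M: "M > 0" "\<And>x. \<bar>a x\<bar> \<le> M" using bounded_supportE[OF a(1)] by metis
  have "e / M > 0" using e M by simp
  then obtain d where d: "d > 0" "\<And>x y. norm (y - x) < d \<Longrightarrow> \<bar>u y - u x\<bar> < e / M"
    using uniformly_continuous_bounded_supportE[OF u] by metis
  from F_uniform[OF K d(1)] show ?thesis
  proof eventually_elim
    case (elim n)
    show ?case
    proof
      fix x
      show "\<bar>a x * u (F n x) - a x * u (f x)\<bar> \<le> e"
      proof (cases "x \<in> K")
        case True
        have "\<bar>a x * u (F n x) - a x * u (f x)\<bar> = \<bar>a x\<bar> * \<bar>u (F n x) - u (f x)\<bar>"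
          by (simp only: abs_mult[symmetric] right_diff_distrib)
        also have "\<dots> \<le> M * (e / M)" using M d(2)[of "F n x" "f x"] elim True by (intro mult_mono) (auto simp: less_imp_le)
        finally show ?thesis using M by simp
      qed (use a e in simp)
    qed
  qed
qed

end

section \<open>The weak derivative of the inverse\<close>

definition pair_integral :: "(real^2) measure \<times> (real^2) measure \<Rightarrow> (real^2 \<Rightarrow> real) \<Rightarrow> real" where
  "pair_integral m v = integral\<^sup>L (fst m) v - integral\<^sup>L (snd m) v"

text \<open>Swapping the two parts of a signed measure negates it.\<close>

definition adj_entry :: "(2 \<Rightarrow> 2 \<Rightarrow> 'a \<times> 'a) \<Rightarrow> 2 \<Rightarrow> 2 \<Rightarrow> 'a \<times> 'a" where
  "adj_entry m i j = (if i = j then m (if i = 1 then 2 else 1) (if i = 1 then 2 else 1) else prod.swap (m i j))"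

lemma adj_entry_simps:
  "adj_entry m 1 1 = m 2 2" "adj_entry m 1 2 = prod.swap (m 1 2)" "adj_entry m 2 1 = prod.swap (m 2 1)" "adj_entry m 2 2 = m 1 1"
  by (simp_all add: adj_entry_def)

lemma pair_integral_swap: "pair_integral (prod.swap m) v = - pair_integral m v"
  by (simp add: pair_integral_def)

text \<open>\<open>D i j\<close> represents the derivative of the i-th component in direction j by
  finite measures on the plane that do not charge the complement of \<open>\<Omega>\<close>. The
  analysis is done in this form and transferred to signed Radon measures on \<open>\<Omega>\<close>
  afterwards.\<close>

locale bv_homeo = planar_homeo +
  fixes D :: "2 \<Rightarrow> 2 \<Rightarrow> (real^2) measure \<times> (real^2) measure"
  assumes D: "weak_deriv \<Omega> j (\<lambda>x. f x $ i) (fst (D i j)) (snd (D i j))"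
    and null: "emeasure (fst (D i j)) (- \<Omega>) = 0" "emeasure (snd (D i j)) (- \<Omega>) = 0"
    and sp: "sense_preserving \<Omega> f"
begin

lemma D_finite: "finite_measure (fst (D i j))" "finite_measure (snd (D i j))"
  and D_sets: "sets (fst (D i j)) = sets borel" "sets (snd (D i j)) = sets borel"
  using D[of j i] by (auto simp: weak_deriv_def)

lemma AE_D: "AE x in fst (D i j). x \<in> \<Omega>" "AE x in snd (D i j). x \<in> \<Omega>"
proof -
  have "- \<Omega> \<in> null_sets (fst (D i j))" "- \<Omega> \<in> null_sets (snd (D i j))"
    using null[of i j] D_sets[of i j] opn(1) by (auto simp: null_sets_def)
  then show "AE x in fst (D i j). x \<in> \<Omega>" "AE x in snd (D i j). x \<in> \<Omega>"
    by (auto dest: AE_not_in elim: eventually_mono)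
qed

lemma F_weak_convergence:
  assumes "compact K" "K \<subseteq> \<Omega>" "\<And>n. continuous_on UNIV (w n)" "\<And>n x. x \<notin> K \<Longrightarrow> w n x = 0"
    "continuous_on UNIV v" "\<And>x. x \<notin> K \<Longrightarrow> v x = 0"
    "\<And>e. e > 0 \<Longrightarrow> \<forall>\<^sub>F n in sequentially. \<forall>x. \<bar>w n x - v x\<bar> \<le> e"
  shows "(\<lambda>n. \<integral>x. w n x * part_deriv j (\<lambda>x. F n x $ i) x \<partial>lborel) \<longlonglongrightarrow> pair_integral (D i j) v"
  unfolding F_nth pair_integral_def by (rule moll_weak_convergence[OF bdd_cont_f D assms])

lemma F_L1_bound:
  assumes K: "compact K" "K \<subseteq> \<Omega>"
  obtains B where "\<forall>\<^sub>F n in sequentially. \<forall>i j. (\<integral>x. indicator K x * \<bar>part_deriv j (\<lambda>x. F n x $ i) x\<bar> \<partial>lborel) \<le> B"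
proof -
  let ?b = "\<lambda>i j. measure (fst (D i j)) UNIV + measure (snd (D i j)) UNIV"
  have le: "?b i j \<le> (\<Sum>i\<in>UNIV. \<Sum>j\<in>UNIV. ?b i j)" for i j
  proof -
    have "?b i j \<le> (\<Sum>j\<in>UNIV. ?b i j)" by (rule member_le_sum) auto
    also have "\<dots> \<le> (\<Sum>i\<in>UNIV. \<Sum>j\<in>UNIV. ?b i j)" by (rule member_le_sum[of i]) (auto intro!: sum_nonneg)
    finally show ?thesis .
  qed
  have ev: "\<forall>\<^sub>F n in sequentially. (\<integral>x. indicator K x * \<bar>part_deriv j (\<lambda>x. F n x $ i) x\<bar> \<partial>lborel) \<le> ?b i j" for i j
    unfolding F_nth by (rule moll_part_deriv_L1_bound[OF bdd_cont_f D K])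
  have "\<forall>\<^sub>F n in sequentially. \<forall>i j. (\<integral>x. indicator K x * \<bar>part_deriv j (\<lambda>x. F n x $ i) x\<bar> \<partial>lborel) \<le> ?b i j"
    unfolding forall_2 using ev by (intro eventually_conj) auto
  then have "\<forall>\<^sub>F n in sequentially. \<forall>i j. (\<integral>x. indicator K x * \<bar>part_deriv j (\<lambda>x. F n x $ i) x\<bar> \<partial>lborel) \<le> (\<Sum>i\<in>UNIV. \<Sum>j\<in>UNIV. ?b i j)"
    by (rule eventually_mono) (intro allI, rule order_trans[OF _ le], blast)
  then show thesis by (rule that)
qed

text \<open>The derivative of \<psi> in direction j at \<open>F n x\<close>, times the Jacobian, is
  the wedge in which \<psi> \<circ> F_n replaces the j-th component of F_n. Integration by parts
  moves the derivative onto \<theta> x_i, leaving the derivative of the other component in the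
  direction other than i: this is the adjugate, with its signs coming from antisymmetry.\<close>

lemma inverse_weak_limit:
  assumes \<psi>: "\<psi> \<in> test_functions \<Omega>'" and t: "\<theta> \<in> test_functions \<Omega>"
    and W: "open W" "h ` closure {y. \<psi> y \<noteq> 0} \<subseteq> W" "\<And>x. x \<in> W \<Longrightarrow> \<theta> x = 1"
  shows "- (\<integral>y. part_deriv j \<psi> y * h y $ i \<partial>lborel) = pair_integral (adj_entry D i j) (\<lambda>x. \<theta> x * \<psi> (f x))"
proof -
  note tD = test_functionD[OF t] and pD = test_functionD[OF \<psi>]
  define C where "C = closure {y. \<psi> y \<noteq> 0}"
  have C: "compact C" "C \<subseteq> \<Omega>'" "h ` C \<subseteq> W" using pD W(2) by (auto simp: C_def)
  have \<psi>C: "y \<in> C" if "\<psi> y \<noteq> 0" for y using that closure_subset[of "{y. \<psi> y \<noteq> 0}"] by (auto simp: C_def)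
  have d\<psi>C: "y \<in> C" if "part_deriv j \<psi> y \<noteq> 0" for y using that part_deriv_support[of j \<psi>] by (auto simp: C_def)
  define K where "K = closure {x. \<theta> x \<noteq> 0}"
  have K: "compact K" "K \<subseteq> \<Omega>" using tD by (auto simp: K_def)
  have \<theta>K: "\<theta> x = 0" if "x \<notin> K" for x using that closure_subset[of "{x. \<theta> x \<noteq> 0}"] by (auto simp: K_def)
  have d\<theta>K: "part_deriv j \<theta> x = 0" if "x \<notin> K" for x j using that part_deriv_support[of j \<theta>] by (auto simp: K_def)
  obtain B where B: "\<forall>\<^sub>F n in sequentially. \<forall>i j. (\<integral>x. indicator K x * \<bar>part_deriv j (\<lambda>x. F n x $ i) x\<bar> \<partial>lborel) \<le> B"
    using F_L1_bound[OF K] .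
  have lim1: "(\<lambda>n. jac_pair (\<lambda>x. \<theta> x * x $ i) (F n) (part_deriv j \<psi>)) \<longlonglongrightarrow> (\<integral>y. part_deriv j \<psi> y * h y $ i \<partial>lborel)"
    by (rule linear_limit[OF sp C(1,2) t W(1) C(3) W(3) B[unfolded K_def] C1_pd_continuous[OF pD(5)] d\<psi>C])
  obtain r where r: "r > 0" "\<And>x z. x \<in> K - W \<Longrightarrow> z \<in> C \<Longrightarrow> norm (f x - z) \<ge> r"
    using separation[OF C(1,2) K W(1) C(3)] by blast
  have ev: "\<forall>\<^sub>F n in sequentially. \<forall>x\<in>K. norm (F n x - f x) < r" by (rule F_uniform[OF K r(1)])
  have t1: "C_k 1 (\<lambda>x. \<theta> x * x $ i)" by (intro C_k_mult tD C_k_nth)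
  have ts: "bounded {x. \<theta> x * x $ i \<noteq> 0}" by (intro bounded_support_mult1 tD)
  note Fi = C1_mapD[OF F_C1]
  let ?w = "\<lambda>n x. \<theta> x * \<psi> (F n x)"
  \<comment> \<open>on the support of \<open>\<psi> \<circ> F n\<close> the cutoff is constant\<close>
  have key: "\<forall>\<^sub>F n in sequentially. \<forall>v x. \<psi> (F n x) * wedge (\<lambda>x. \<theta> x * x $ i) v x = ?w n x * wedge (\<lambda>x. x $ i) v x"
    using ev
  proof eventually_elim
    case (elim n)
    show ?case
    proof (intro allI)
      fix v x
      have eq: "wedge (\<lambda>x. \<theta> x * x $ i) v x = \<theta> x * wedge (\<lambda>x. x $ i) v x + x $ i * wedge \<theta> v x"
        by (rule wedge_mult_left) (use C1_differentiable[OF tD(5)] C1_differentiable[OF C_k_nth] in auto)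
      consider "x \<in> W" | "x \<notin> K" | "x \<in> K - W" by blast
      then show "\<psi> (F n x) * wedge (\<lambda>x. \<theta> x * x $ i) v x = ?w n x * wedge (\<lambda>x. x $ i) v x"
      proof cases
        case 1
        then have "part_deriv k \<theta> x = 0" for k using part_deriv_eq_0[OF W(1) 1, of \<theta> 1] W(3) by auto
        then show ?thesis unfolding eq by (simp add: wedge_def W(3)[OF 1])
      next
        case 2
        then show ?thesis unfolding eq using \<theta>K[OF 2] d\<theta>K[OF 2] by (simp add: wedge_def)
      next
        case 3
        have "\<psi> (F n x) = 0"
        proof (rule ccontr)
          assume "\<psi> (F n x) \<noteq> 0"
          from r(2)[OF 3 \<psi>C[OF this]] show False using elim 3 by (auto simp: norm_minus_commute not_le[symmetric])
        qed
        then show ?thesis by simp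
      qed
    qed
  qed
  have cw: "continuous_on UNIV (?w n)" for n
    by (intro continuous_on_mult tD continuous_on_compose2[OF pD(6) C1_map_continuous[OF F_C1]]) auto
  have cv: "continuous_on UNIV (\<lambda>x. \<theta> x * \<psi> (f x))"
  proof (rule continuous_on_UNIV_mult_supported[OF tD(6) compact_imp_closed[OF K(1)] _ K(2) opn(1)])
    show "\<theta> x \<noteq> 0 \<Longrightarrow> x \<in> K" for x using \<theta>K by blast
    show "continuous_on \<Omega> (\<lambda>x. \<psi> (f x))" by (intro continuous_on_compose2[OF pD(6) cont(1)]) auto
  qed
  have wc: "(\<lambda>n. \<integral>x. ?w n x * part_deriv k (\<lambda>x. F n x $ l) x \<partial>lborel) \<longlonglongrightarrow> pair_integral (D l k) (\<lambda>x. \<theta> x * \<psi> (f x))" for k l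
  proof (rule F_weak_convergence[OF K cw _ cv])
    show "\<forall>\<^sub>F n in sequentially. \<forall>x. \<bar>\<theta> x * \<psi> (F n x) - \<theta> x * \<psi> (f x)\<bar> \<le> e" if "e > 0" for e
      by (rule uniform_compose[OF tD(6) \<theta>K K pD(6,4) that])
  qed (use \<theta>K in auto)
  \<comment> \<open>Common conclusion of the four index cases: for large \<open>n\<close> the cutoff
    may be taken out of the wedge, and the limit is compared with the one from
    \<open>linear_limit\<close>. The cases supply only the sign \<open>c\<close> and the component
    \<open>l\<close>.\<close>
  have conv_eq: "(\<lambda>n. c * (\<integral>x. ?w n x * wedge (\<lambda>x. x $ i) (\<lambda>x. F n x $ l) x \<partial>lborel)) \<longlonglongrightarrow> L
      \<Longrightarrow> (\<And>n. jac_pair (\<lambda>x. \<theta> x * x $ i) (F n) (part_deriv j \<psi>) = c * (\<integral>x. \<psi> (F n x) * wedge (\<lambda>x. \<theta> x * x $ i) (\<lambda>x. F n x $ l) x \<partial>lborel))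
      \<Longrightarrow> (\<integral>y. part_deriv j \<psi> y * h y $ i \<partial>lborel) = L" for c L l
  proof -
    assume 1: "(\<lambda>n. c * (\<integral>x. ?w n x * wedge (\<lambda>x. x $ i) (\<lambda>x. F n x $ l) x \<partial>lborel)) \<longlonglongrightarrow> L"
      and 2: "\<And>n. jac_pair (\<lambda>x. \<theta> x * x $ i) (F n) (part_deriv j \<psi>) = c * (\<integral>x. \<psi> (F n x) * wedge (\<lambda>x. \<theta> x * x $ i) (\<lambda>x. F n x $ l) x \<partial>lborel)"
    have "\<forall>\<^sub>F n in sequentially. c * (\<integral>x. ?w n x * wedge (\<lambda>x. x $ i) (\<lambda>x. F n x $ l) x \<partial>lborel) = jac_pair (\<lambda>x. \<theta> x * x $ i) (F n) (part_deriv j \<psi>)"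
      using key unfolding 2
    proof eventually_elim
      case (elim n)
      show ?case by (simp only: elim)
    qed
    then have "(\<lambda>n. jac_pair (\<lambda>x. \<theta> x * x $ i) (F n) (part_deriv j \<psi>)) \<longlonglongrightarrow> L" by (rule Lim_transform_eventually[OF 1])
    then show ?thesis using lim1 LIMSEQ_unique by blast
  qed
  have j1: "jac_pair (\<lambda>x. \<theta> x * x $ i) (F n) (part_deriv 1 \<psi>) = (-1) * (\<integral>x. \<psi> (F n x) * wedge (\<lambda>x. \<theta> x * x $ i) (\<lambda>x. F n x $ 2) x \<partial>lborel)" for n
  proof -
    have "jac_pair (\<lambda>x. \<theta> x * x $ i) (F n) (part_deriv 1 \<psi>) = (\<integral>x. \<theta> x * x $ i * wedge (\<lambda>x. \<psi> (F n x)) (\<lambda>x. F n x $ 2) x \<partial>lborel)"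
      unfolding jac_pair_def wedge_compose(1)[OF pD(5) Fi] by (simp only: mult.assoc)
    then show ?thesis
      using wedge_by_parts[OF t1 C1_compose(1)[OF pD(5) Fi] Fi ts, of n n 2] by simp
  qed
  have j2: "jac_pair (\<lambda>x. \<theta> x * x $ i) (F n) (part_deriv 2 \<psi>) = 1 * (\<integral>x. \<psi> (F n x) * wedge (\<lambda>x. \<theta> x * x $ i) (\<lambda>x. F n x $ 1) x \<partial>lborel)" for n
  proof -
    have "jac_pair (\<lambda>x. \<theta> x * x $ i) (F n) (part_deriv 2 \<psi>) = (\<integral>x. \<theta> x * x $ i * wedge (\<lambda>x. F n x $ 1) (\<lambda>x. \<psi> (F n x)) x \<partial>lborel)"
      unfolding jac_pair_def wedge_compose(2)[OF pD(5) Fi] by (simp only: mult.assoc)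
    also have "\<dots> = (\<integral>x. - (\<theta> x * x $ i * wedge (\<lambda>x. \<psi> (F n x)) (\<lambda>x. F n x $ 1) x) \<partial>lborel)"
      by (intro Bochner_Integration.integral_cong refl) (simp add: wedge_swap[of "\<lambda>x. F n x $ 1"])
    also have "\<dots> = - (\<integral>x. \<theta> x * x $ i * wedge (\<lambda>x. \<psi> (F n x)) (\<lambda>x. F n x $ 1) x \<partial>lborel)" by (rule integral_minus)
    finally show ?thesis
      using wedge_by_parts[OF t1 C1_compose(1)[OF pD(5) Fi] Fi ts, of n n 1] by simp
  qed
  let ?I = "\<lambda>n k l. \<integral>x. ?w n x * part_deriv k (\<lambda>x. F n x $ l) x \<partial>lborel"
  have w1: "(\<integral>x. ?w n x * wedge (\<lambda>x. x $ 1) (\<lambda>x. F n x $ l) x \<partial>lborel) = ?I n 2 l" for n l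
    by (simp only: wedge_nth)
  have w2: "(\<integral>x. ?w n x * wedge (\<lambda>x. x $ 2) (\<lambda>x. F n x $ l) x \<partial>lborel) = - ?I n 1 l" for n l
    by (simp add: wedge_nth)
  consider "i = 1" "j = 1" | "i = 1" "j = 2" | "i = 2" "j = 1" | "i = 2" "j = 2"
    using exhaust_2[of i] exhaust_2[of j] by blast
  then show ?thesis
  proof cases
    case 1
    have "(\<integral>y. part_deriv j \<psi> y * h y $ i \<partial>lborel) = (-1) * pair_integral (D 2 2) (\<lambda>x. \<theta> x * \<psi> (f x))"
    proof (rule conv_eq[of "-1" 2])
      show "(\<lambda>n. - 1 * (\<integral>x. ?w n x * wedge (\<lambda>x. x $ i) (\<lambda>x. F n x $ 2) x \<partial>lborel)) \<longlonglongrightarrow> (-1) * pair_integral (D 2 2) (\<lambda>x. \<theta> x * \<psi> (f x))"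
        unfolding 1 w1 by (intro tendsto_mult tendsto_const wc)
      show "jac_pair (\<lambda>x. \<theta> x * x $ i) (F n) (part_deriv j \<psi>) = - 1 * (\<integral>x. \<psi> (F n x) * wedge (\<lambda>x. \<theta> x * x $ i) (\<lambda>x. F n x $ 2) x \<partial>lborel)" for n
        using j1[of n] 1 by simp
    qed
    then show ?thesis using 1 by (simp add: adj_entry_simps)
  next
    case 2
    have "(\<integral>y. part_deriv j \<psi> y * h y $ i \<partial>lborel) = 1 * pair_integral (D 1 2) (\<lambda>x. \<theta> x * \<psi> (f x))"
    proof (rule conv_eq[of 1 1])
      show "(\<lambda>n. 1 * (\<integral>x. ?w n x * wedge (\<lambda>x. x $ i) (\<lambda>x. F n x $ 1) x \<partial>lborel)) \<longlonglongrightarrow> 1 * pair_integral (D 1 2) (\<lambda>x. \<theta> x * \<psi> (f x))"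
        unfolding 2 w1 by (intro tendsto_mult tendsto_const wc)
      show "jac_pair (\<lambda>x. \<theta> x * x $ i) (F n) (part_deriv j \<psi>) = 1 * (\<integral>x. \<psi> (F n x) * wedge (\<lambda>x. \<theta> x * x $ i) (\<lambda>x. F n x $ 1) x \<partial>lborel)" for n
        using j2[of n] 2 by simp
    qed
    then show ?thesis using 2 by (simp add: adj_entry_simps pair_integral_swap)
  next
    case 3
    have "(\<integral>y. part_deriv j \<psi> y * h y $ i \<partial>lborel) = (-1) * (- pair_integral (D 2 1) (\<lambda>x. \<theta> x * \<psi> (f x)))"
    proof (rule conv_eq[of "-1" 2])
      show "(\<lambda>n. - 1 * (\<integral>x. ?w n x * wedge (\<lambda>x. x $ i) (\<lambda>x. F n x $ 2) x \<partial>lborel)) \<longlonglongrightarrow> (-1) * (- pair_integral (D 2 1) (\<lambda>x. \<theta> x * \<psi> (f x)))"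
        unfolding 3 w2 by (intro tendsto_mult tendsto_const tendsto_minus wc)
      show "jac_pair (\<lambda>x. \<theta> x * x $ i) (F n) (part_deriv j \<psi>) = - 1 * (\<integral>x. \<psi> (F n x) * wedge (\<lambda>x. \<theta> x * x $ i) (\<lambda>x. F n x $ 2) x \<partial>lborel)" for n
        using j1[of n] 3 by simp
    qed
    then show ?thesis using 3 by (simp add: adj_entry_simps pair_integral_swap)
  next
    case 4
    have "(\<integral>y. part_deriv j \<psi> y * h y $ i \<partial>lborel) = 1 * (- pair_integral (D 1 1) (\<lambda>x. \<theta> x * \<psi> (f x)))"
    proof (rule conv_eq[of 1 1])
      show "(\<lambda>n. 1 * (\<integral>x. ?w n x * wedge (\<lambda>x. x $ i) (\<lambda>x. F n x $ 1) x \<partial>lborel)) \<longlonglongrightarrow> 1 * (- pair_integral (D 1 1) (\<lambda>x. \<theta> x * \<psi> (f x)))"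
        unfolding 4 w2 by (intro tendsto_mult tendsto_const tendsto_minus wc)
      show "jac_pair (\<lambda>x. \<theta> x * x $ i) (F n) (part_deriv j \<psi>) = 1 * (\<integral>x. \<psi> (F n x) * wedge (\<lambda>x. \<theta> x * x $ i) (\<lambda>x. F n x $ 1) x \<partial>lborel)" for n
        using j2[of n] 4 by simp
    qed
    then show ?thesis using 4 by (simp add: adj_entry_simps)
  qed
qed

text \<open>The map is set to 0 off \<open>\<Omega>\<close>, where \<open>f\<close> is uncontrolled,
  in order to be Borel on the plane; the measures to which it is applied are concentrated on
  \<open>\<Omega>\<close>.\<close>

definition push :: "(real^2) measure \<Rightarrow> (real^2) measure" where
  "push M = distr M borel (\<lambda>x. indicator \<Omega> x *\<^sub>R f x)"

lemma push_meas: "(\<lambda>x. indicator \<Omega> x *\<^sub>R f x) \<in> borel_measurable borel"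
  using borel_measurable_continuous_on_indicator[OF _ cont(1)] opn(1) by simp

lemma push_integral:
  assumes M: "sets M = sets borel" "AE x in M. x \<in> \<Omega>" and v: "v \<in> borel_measurable borel" and w: "w \<in> borel_measurable borel"
    and eq: "\<And>x. x \<in> \<Omega> \<Longrightarrow> v (f x) = (w x :: real)"
  shows "integral\<^sup>L (push M) v = integral\<^sup>L M w"
proof -
  have pm: "(\<lambda>x. indicator \<Omega> x *\<^sub>R f x) \<in> measurable M borel" using push_meas M(1) measurable_cong_sets by blast
  have "integral\<^sup>L (push M) v = (\<integral>x. v (indicator \<Omega> x *\<^sub>R f x) \<partial>M)"
    unfolding push_def by (rule integral_distr[OF pm v])
  also have "\<dots> = integral\<^sup>L M w"
  proof (rule integral_cong_AE)
    show "(\<lambda>x. v (indicator \<Omega> x *\<^sub>R f x)) \<in> borel_measurable M" by (rule measurable_compose[OF pm v])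
    show "w \<in> borel_measurable M" using w M(1) measurable_cong_sets by blast
    show "AE x in M. v (indicator \<Omega> x *\<^sub>R f x) = w x" using M(2) by eventually_elim (simp add: eq)
  qed
  finally show ?thesis .
qed

lemma adj_entry_props:
  "finite_measure (fst (adj_entry D i j)) \<and> finite_measure (snd (adj_entry D i j)) \<and>
   sets (fst (adj_entry D i j)) = sets borel \<and> sets (snd (adj_entry D i j)) = sets borel \<and>
   (AE x in fst (adj_entry D i j). x \<in> \<Omega>) \<and> (AE x in snd (adj_entry D i j). x \<in> \<Omega>)"
proof (cases "i = j")
  case True
  then obtain k where "adj_entry D i j = D k k" by (simp add: adj_entry_def)
  then show ?thesis using D_finite[of k k] D_sets[of k k] AE_D[of k k] by argo
next
  case False
  then have "fst (adj_entry D i j) = snd (D i j)" "snd (adj_entry D i j) = fst (D i j)" by (simp_all add: adj_entry_def)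
  then show ?thesis using D_finite[of i j] D_sets[of i j] AE_D[of i j] by argo
qed

lemma inverse_weak_deriv:
  "weak_deriv \<Omega>' j (\<lambda>y. h y $ i) (push (fst (adj_entry D i j))) (push (snd (adj_entry D i j)))"
proof -
  let ?m = "adj_entry D i j"
  note P = adj_entry_props[of i j]
  have fin: "finite_measure (push M)" if "finite_measure M" "sets M = sets borel" for M
    unfolding push_def using push_meas that(2) measurable_cong_sets
    by (intro finite_measure.finite_measure_distr that(1)) blast
  show ?thesis
    unfolding weak_deriv_def
  proof (intro conjI ballI)
    show "finite_measure (push (fst ?m))" "finite_measure (push (snd ?m))" using fin P by auto
    show "sets (push (fst ?m)) = sets borel" "sets (push (snd ?m)) = sets borel" by (simp_all add: push_def)
    fix \<psi> assume \<psi>: "\<psi> \<in> test_functions \<Omega>'"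
    note pD = test_functionD[OF \<psi>]
    let ?C = "closure {y. \<psi> y \<noteq> 0}"
    have "compact (h ` ?C)" by (intro compact_continuous_image continuous_on_subset[OF cont(2)] pD)
    moreover have "h ` ?C \<subseteq> \<Omega>" using pD(3) h_in by auto
    ultimately obtain \<theta> W where t: "\<theta> \<in> test_functions \<Omega>" and W: "open W" "h ` ?C \<subseteq> W" "\<And>x. x \<in> W \<Longrightarrow> \<theta> x = 1"
      by (rule cutoff_exists[OF _ opn(1)]) blast
    note tD = test_functionD[OF t]
    have eqx: "\<psi> (f x) = \<theta> x * \<psi> (f x)" if "x \<in> \<Omega>" for x
    proof (cases "\<psi> (f x) = 0")
      case False
      then have "f x \<in> ?C" using closure_subset by fastforce
      then have "x \<in> W" using W(2) inv(1)[OF that] by force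
      then show ?thesis using W(3) by simp
    qed simp
    have mp: "\<psi> \<in> borel_measurable borel" by (rule borel_measurable_continuous_onI[OF pD(6)])
    let ?w = "\<lambda>x. \<theta> x * \<psi> (indicator \<Omega> x *\<^sub>R f x)"
    have mw: "?w \<in> borel_measurable borel"
      by (intro borel_measurable_times borel_measurable_continuous_onI[OF tD(6)] measurable_compose[OF push_meas mp])
    have ww: "?w = (\<lambda>x. \<theta> x * \<psi> (f x))"
    proof
      fix x
      show "?w x = \<theta> x * \<psi> (f x)"
      proof (cases "x \<in> \<Omega>")
        case False
        then have "\<theta> x = 0" using tD(3) closure_subset[of "{x. \<theta> x \<noteq> 0}"] by auto
        then show ?thesis by simp
      qed simp
    qed
    have pi: "integral\<^sup>L (push M) \<psi> = integral\<^sup>L M (\<lambda>x. \<theta> x * \<psi> (f x))" if "sets M = sets borel" "AE x in M. x \<in> \<Omega>" for M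
      by (rule push_integral[OF that mp mw[unfolded ww] eqx])
    have "- (\<integral>x. (indicator \<Omega>' x * h x $ i) * part_deriv j \<psi> x \<partial>lborel) = - (\<integral>y. part_deriv j \<psi> y * h y $ i \<partial>lborel)"
    proof -
      have "(indicator \<Omega>' x * h x $ i) * part_deriv j \<psi> x = part_deriv j \<psi> x * h x $ i" for x
        using part_deriv_support[of j \<psi>] pD(3) by (cases "x \<in> \<Omega>'") auto
      then show ?thesis by (simp only:)
    qed
    also have "\<dots> = pair_integral ?m (\<lambda>x. \<theta> x * \<psi> (f x))" by (rule inverse_weak_limit[OF \<psi> t W])
    also have "\<dots> = integral\<^sup>L (push (fst ?m)) \<psi> - integral\<^sup>L (push (snd ?m)) \<psi>"
      unfolding pair_integral_def using pi[of "fst ?m"] pi[of "snd ?m"] P by argo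
    finally show "- (\<integral>x. (indicator \<Omega>' x * h x $ i) * part_deriv j \<psi> x \<partial>lborel) = integral\<^sup>L (push (fst ?m)) \<psi> - integral\<^sup>L (push (snd ?m)) \<psi>" .
  qed
qed

section \<open>The distributional Jacobian\<close>

text \<open>Integration by parts onto the first component, followed by weak convergence of the
  derivatives of the second with weights that contain the uniformly convergent first. The limit is
  the explicit formula for the distributional Jacobian.\<close>

lemma jacobian_limit_explicit:
  assumes \<phi>: "\<phi> \<in> test_functions \<Omega>"
  shows "(\<lambda>n. \<integral>x. \<phi> x * wedge (\<lambda>x. F n x $ 1) (\<lambda>x. F n x $ 2) x \<partial>lborel) \<longlonglongrightarrow>
     - (pair_integral (D 2 2) (\<lambda>x. part_deriv 1 \<phi> x * f x $ 1) - pair_integral (D 2 1) (\<lambda>x. part_deriv 2 \<phi> x * f x $ 1))"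
proof -
  note pD = test_functionD[OF \<phi>]
  define K where "K = closure {x. \<phi> x \<noteq> 0}"
  have K: "compact K" "K \<subseteq> \<Omega>" using pD by (auto simp: K_def)
  have dK: "part_deriv j \<phi> x = 0" if "x \<notin> K" for x j using that part_deriv_support[of j \<phi>] by (auto simp: K_def)
  have dB: "bounded {x. part_deriv j \<phi> x \<noteq> 0}" for j by (rule bounded_support_part_deriv[OF pD(4)])
  have cd: "continuous_on UNIV (part_deriv j \<phi>)" for j by (rule C1_pd_continuous[OF pD(5)])
  note Fi = C1_mapD[OF F_C1]
  have wc: "(\<lambda>n. \<integral>x. (part_deriv j \<phi> x * F n x $ 1) * part_deriv k (\<lambda>x. F n x $ 2) x \<partial>lborel) \<longlonglongrightarrow> pair_integral (D 2 k) (\<lambda>x. part_deriv j \<phi> x * f x $ 1)" for j k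
  proof (rule F_weak_convergence[OF K])
    show "continuous_on UNIV (\<lambda>x. part_deriv j \<phi> x * F n x $ 1)" for n
      by (intro continuous_on_mult cd C_k_continuous[OF Fi])
    show "continuous_on UNIV (\<lambda>x. part_deriv j \<phi> x * f x $ 1)"
    proof (rule continuous_on_UNIV_mult_supported[OF cd compact_imp_closed[OF K(1)] _ K(2) opn(1)])
      show "part_deriv j \<phi> x \<noteq> 0 \<Longrightarrow> x \<in> K" for x using dK by blast
    qed (intro continuous_on_component cont)
    fix e :: real assume e: "e > 0"
    obtain M where M: "M > 0" "\<And>x. \<bar>part_deriv j \<phi> x\<bar> \<le> M" using bounded_supportE[OF cd[of j] dB[of j]] by blast
    have "\<forall>\<^sub>F n in sequentially. \<forall>x\<in>K. norm (F n x - f x) < e / M" by (rule F_uniform[OF K]) (use e M in simp)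
    then show "\<forall>\<^sub>F n in sequentially. \<forall>x. \<bar>part_deriv j \<phi> x * F n x $ 1 - part_deriv j \<phi> x * f x $ 1\<bar> \<le> e"
    proof eventually_elim
      case (elim n)
      show ?case
      proof
        fix x
        show "\<bar>part_deriv j \<phi> x * F n x $ 1 - part_deriv j \<phi> x * f x $ 1\<bar> \<le> e"
        proof (cases "x \<in> K")
          case True
          have "\<bar>part_deriv j \<phi> x * F n x $ 1 - part_deriv j \<phi> x * f x $ 1\<bar> = \<bar>part_deriv j \<phi> x\<bar> * \<bar>(F n x - f x) $ 1\<bar>"
            by (simp add: abs_mult[symmetric] right_diff_distrib)
          also have "\<dots> \<le> M * (e / M)"
            using M elim True component_le_norm_cart[of "F n x - f x" 1] by (intro mult_mono) (auto intro: order_trans less_imp_le)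
          finally show ?thesis using M by simp
        qed (use dK e in simp)
      qed
    qed
  qed (use dK in auto)
  have int: "integrable lborel (\<lambda>x. (part_deriv j \<phi> x * F n x $ 1) * part_deriv k (\<lambda>x. F n x $ 2) x)" for n j k
    by (intro integrable_continuous_bounded_support continuous_on_mult cd C_k_continuous[OF Fi] C1_pd_continuous[OF Fi] bounded_support_mult1 dB)
  have "(\<integral>x. \<phi> x * wedge (\<lambda>x. F n x $ 1) (\<lambda>x. F n x $ 2) x \<partial>lborel)
    = - ((\<integral>x. (part_deriv 1 \<phi> x * F n x $ 1) * part_deriv 2 (\<lambda>x. F n x $ 2) x \<partial>lborel) - (\<integral>x. (part_deriv 2 \<phi> x * F n x $ 1) * part_deriv 1 (\<lambda>x. F n x $ 2) x \<partial>lborel))" for n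
  proof -
    have "(\<integral>x. \<phi> x * wedge (\<lambda>x. F n x $ 1) (\<lambda>x. F n x $ 2) x \<partial>lborel) = - (\<integral>x. F n x $ 1 * wedge \<phi> (\<lambda>x. F n x $ 2) x \<partial>lborel)"
      by (rule wedge_by_parts[OF pD(5) Fi Fi pD(4)])
    also have "(\<integral>x. F n x $ 1 * wedge \<phi> (\<lambda>x. F n x $ 2) x \<partial>lborel)
      = (\<integral>x. (part_deriv 1 \<phi> x * F n x $ 1) * part_deriv 2 (\<lambda>x. F n x $ 2) x - (part_deriv 2 \<phi> x * F n x $ 1) * part_deriv 1 (\<lambda>x. F n x $ 2) x \<partial>lborel)"
      by (intro Bochner_Integration.integral_cong refl) (simp add: wedge_def algebra_simps)
    finally show ?thesis by (simp only: Bochner_Integration.integral_diff[OF int int])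
  qed
  then show ?thesis by (simp only:) (intro tendsto_minus tendsto_diff wc)
qed

text \<open>It remains to recognise the explicit limit as the integral of \<phi> \<circ> h. The
  chain rule is applied to mollifications of \<open>h\<close>, whose derivative measures are images
  of entries of the adjugate; transported back to \<open>\<Omega>\<close>, they are tested with
  derivatives of \<phi> times f_1.\<close>

lemma jacobian_limit:
  assumes \<phi>: "\<phi> \<in> test_functions \<Omega>"
  shows "(\<lambda>n. \<integral>x. \<phi> x * wedge (\<lambda>x. F n x $ 1) (\<lambda>x. F n x $ 2) x \<partial>lborel) \<longlonglongrightarrow> (\<integral>y. indicator \<Omega>' y * \<phi> (h y) \<partial>lborel)"
proof -
  interpret H: planar_homeo \<Omega>' \<Omega> h f by (rule flip)
  note pD = test_functionD[OF \<phi>]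
  define K where "K = closure {x. \<phi> x \<noteq> 0}"
  have K: "compact K" "K \<subseteq> \<Omega>" using pD by (auto simp: K_def)
  have \<phi>K: "\<phi> x = 0" if "x \<notin> K" for x using that closure_subset[of "{x. \<phi> x \<noteq> 0}"] by (auto simp: K_def)
  have dK: "part_deriv j \<phi> x = 0" if "x \<notin> K" for x j using that part_deriv_support[of j \<phi>] by (auto simp: K_def)
  have dB: "bounded {x. part_deriv j \<phi> x \<noteq> 0}" for j by (rule bounded_support_part_deriv[OF pD(4)])
  have cd: "continuous_on UNIV (part_deriv j \<phi>)" for j by (rule C1_pd_continuous[OF pD(5)])
  have cfK: "compact (f ` K)" by (intro compact_continuous_image continuous_on_subset[OF cont(1)] K)
  have fK: "f ` K \<subseteq> \<Omega>'" using K f_in by auto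
  obtain \<tau> W where \<tau>: "\<tau> \<in> test_functions \<Omega>'" and W: "open W" "f ` K \<subseteq> W" "\<And>y. y \<in> W \<Longrightarrow> \<tau> y = 1"
    by (rule cutoff_exists[OF cfK opn(2) fK]) blast
  note tD = test_functionD[OF \<tau>]
  define K' where "K' = closure {y. \<tau> y \<noteq> 0}"
  have K': "compact K'" "K' \<subseteq> \<Omega>'" using tD by (auto simp: K'_def)
  have \<tau>K: "\<tau> y = 0" if "y \<notin> K'" for y using that closure_subset[of "{y. \<tau> y \<noteq> 0}"] by (auto simp: K'_def)
  \<comment> \<open>The first coordinate, cut off to have compact support in
    \<open>\<Omega>'\<close>. Its first partial derivative is 1 near the image of the support of
    \<open>\<phi>\<close>, so the cutoff leaves no trace in the limit.\<close>
  define p where "p y = \<tau> y * y $ 1" for y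
  have p1: "C_k 1 p" unfolding p_def[abs_def] by (intro C_k_mult tD C_k_nth)
  have pb: "bounded {y. p y \<noteq> 0}" unfolding p_def by (intro bounded_support_mult1 tD)
  have pK: "p y = 0" if "y \<notin> K'" for y using \<tau>K[OF that] by (simp add: p_def)
  have cp: "continuous_on UNIV p" by (rule C_k_continuous[OF p1])
  have sup: "{y. p y \<noteq> 0} \<subseteq> {y. \<tau> y \<noteq> 0}" by (auto simp: p_def)
  have dpK: "part_deriv 1 p y = 0" if "y \<notin> K'" for y
    using that part_deriv_support[of 1 p] closure_mono[OF sup] by (auto simp: K'_def)
  have dpW: "part_deriv 1 p y = 1" if "y \<in> W" for y
  proof -
    have "part_deriv 1 \<tau> y = 0" by (rule part_deriv_eq_0[OF W(1) that]) (use W(3) in auto)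
    moreover have "part_deriv 1 p y = \<tau> y * part_deriv 1 (\<lambda>y. y $ 1) y + part_deriv 1 \<tau> y * y $ 1"
      unfolding p_def[abs_def] by (rule part_deriv_mult) (use C1_differentiable[OF tD(5)] C1_differentiable[OF C_k_nth] in auto)
    ultimately show ?thesis using W(3)[OF that] by (simp add: part_deriv_nth)
  qed
  have inW: "y \<in> W" if "y \<in> \<Omega>'" "h y \<in> K" for y using W(2) that inv(2) by force
  note Hi = C1_mapD[OF H.F_C1]
  have c\<phi>H: "C_k 1 (\<lambda>y. \<phi> (H.F n y))" for n by (rule C1_compose(1)[OF pD(5) Hi])
  \<comment> \<open>The claim results from computing the limit of \<open>?A\<close> twice, by parts and by the chain rule.\<close>
  let ?A = "\<lambda>n. \<integral>y. p y * part_deriv 1 (\<lambda>y. \<phi> (H.F n y)) y \<partial>lborel"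
  have limA1: "?A \<longlonglongrightarrow> - (\<integral>y. indicator \<Omega>' y * \<phi> (h y) \<partial>lborel)"
  proof -
    have A: "?A n = - (\<integral>y. part_deriv 1 p y * \<phi> (H.F n y) \<partial>lborel)" for n
      by (rule integration_by_parts[OF p1 c\<phi>H pb])
    have cdp: "continuous_on UNIV (part_deriv 1 p)" by (rule C1_pd_continuous[OF p1])
    have ch: "continuous_on UNIV (\<lambda>y. part_deriv 1 p y * \<phi> (h y))"
    proof (rule continuous_on_UNIV_mult_supported[OF cdp compact_imp_closed[OF K'(1)] _ K'(2) opn(2)])
      show "part_deriv 1 p y \<noteq> 0 \<Longrightarrow> y \<in> K'" for y using dpK by blast
    qed (intro continuous_on_compose2[OF pD(6) cont(2)], auto)
    have "(\<lambda>n. \<integral>y. part_deriv 1 p y * \<phi> (H.F n y) \<partial>lborel) \<longlonglongrightarrow> (\<integral>y. part_deriv 1 p y * \<phi> (h y) \<partial>lborel)"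
    proof -
      obtain M where M: "M > 0" "\<And>x. \<bar>\<phi> x\<bar> \<le> M" using bounded_supportE[OF pD(6,4)] by blast
      show ?thesis
      proof (rule integral_dominated_convergence[where w="\<lambda>y. \<bar>part_deriv 1 p y\<bar> * M"])
        show "(\<lambda>y. part_deriv 1 p y * \<phi> (h y)) \<in> borel_measurable lborel"
          using borel_measurable_continuous_onI[OF ch] by simp
        show "(\<lambda>y. part_deriv 1 p y * \<phi> (H.F n y)) \<in> borel_measurable lborel" for n
          using borel_measurable_continuous_onI[OF continuous_on_mult[OF cdp C_k_continuous[OF c\<phi>H]]] by simp
        show "integrable lborel (\<lambda>y. \<bar>part_deriv 1 p y\<bar> * M)"
          by (intro integrable_mult_left integrable_abs integrable_continuous_bounded_support cdp bounded_support_part_deriv pb)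
        show "AE y in lborel. norm (part_deriv 1 p y * \<phi> (H.F n y)) \<le> \<bar>part_deriv 1 p y\<bar> * M" for n
          by (intro AE_I2) (simp add: abs_mult mult_left_mono M(2))
        show "AE y in lborel. (\<lambda>n. part_deriv 1 p y * \<phi> (H.F n y)) \<longlonglongrightarrow> part_deriv 1 p y * \<phi> (h y)"
        proof (intro AE_I2)
          fix y
          show "(\<lambda>n. part_deriv 1 p y * \<phi> (H.F n y)) \<longlonglongrightarrow> part_deriv 1 p y * \<phi> (h y)"
          proof (rule tendstoI)
            fix e :: real assume e: "e > 0"
            have "\<forall>\<^sub>F n in sequentially. \<forall>x. \<bar>part_deriv 1 p x * \<phi> (H.F n x) - part_deriv 1 p x * \<phi> (h x)\<bar> \<le> e / 2"
              by (rule H.uniform_compose[OF cdp dpK K' pD(6,4)]) (use e in auto)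
            then show "\<forall>\<^sub>F n in sequentially. dist (part_deriv 1 p y * \<phi> (H.F n y)) (part_deriv 1 p y * \<phi> (h y)) < e"
            proof eventually_elim
              case (elim n)
              then have "\<bar>part_deriv 1 p y * \<phi> (H.F n y) - part_deriv 1 p y * \<phi> (h y)\<bar> \<le> e / 2" by blast
              then show ?case unfolding dist_real_def using e by linarith
            qed
          qed
        qed
      qed
    qed
    moreover have "part_deriv 1 p y * \<phi> (h y) = indicator \<Omega>' y * \<phi> (h y)" for y
    proof (cases "y \<in> \<Omega>'")
      case True
      then show ?thesis using \<phi>K[of "h y"] inW[OF True] dpW[of y] by (cases "h y \<in> K") auto
    next
      case False
      then show ?thesis using dpK[of y] K'(2) by auto
    qed
    ultimately have "(\<lambda>n. \<integral>y. part_deriv 1 p y * \<phi> (H.F n y) \<partial>lborel) \<longlonglongrightarrow> (\<integral>y. indicator \<Omega>' y * \<phi> (h y) \<partial>lborel)" by (simp only:)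
    then show ?thesis unfolding A by (rule tendsto_minus)
  qed
  have wc: "(\<lambda>n. \<integral>y. (p y * part_deriv k \<phi> (H.F n y)) * part_deriv 1 (\<lambda>y. H.F n y $ k) y \<partial>lborel)
      \<longlonglongrightarrow> pair_integral (adj_entry D k 1) (\<lambda>x. part_deriv k \<phi> x * f x $ 1)" for k
  proof -
    let ?m = "adj_entry D k 1"
    note P = adj_entry_props[of k 1]
    let ?v = "\<lambda>y. p y * part_deriv k \<phi> (h y)"
    have cv: "continuous_on UNIV ?v"
    proof (rule continuous_on_UNIV_mult_supported[OF cp compact_imp_closed[OF K'(1)] _ K'(2) opn(2)])
      show "p y \<noteq> 0 \<Longrightarrow> y \<in> K'" for y using pK by blast
    qed (intro continuous_on_compose2[OF cd cont(2)], auto)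
    have "(\<lambda>n. \<integral>y. (p y * part_deriv k \<phi> (H.F n y)) * part_deriv 1 (moll \<Omega>' (\<lambda>y. h y $ k) n) y \<partial>lborel)
      \<longlonglongrightarrow> integral\<^sup>L (push (fst ?m)) ?v - integral\<^sup>L (push (snd ?m)) ?v"
    proof (rule moll_weak_convergence[OF H.bdd_cont_f inverse_weak_deriv K' _ _ cv])
      show "continuous_on UNIV (\<lambda>y. p y * part_deriv k \<phi> (H.F n y))" for n
        by (intro continuous_on_mult cp continuous_on_compose2[OF cd C1_map_continuous[OF H.F_C1]]) auto
      show "\<forall>\<^sub>F n in sequentially. \<forall>y. \<bar>p y * part_deriv k \<phi> (H.F n y) - ?v y\<bar> \<le> e" if "e > 0" for e
        by (rule H.uniform_compose[OF cp pK K' cd dB that])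
    qed (use pK in auto)
    moreover have "integral\<^sup>L (push M) ?v = integral\<^sup>L M (\<lambda>x. part_deriv k \<phi> x * f x $ 1)" if M: "sets M = sets borel" "AE x in M. x \<in> \<Omega>" for M
    proof (rule push_integral[OF M])
      show "?v \<in> borel_measurable borel" by (rule borel_measurable_continuous_onI[OF cv])
      show "(\<lambda>x. part_deriv k \<phi> x * f x $ 1) \<in> borel_measurable borel"
      proof (rule borel_measurable_continuous_onI, rule continuous_on_UNIV_mult_supported[OF cd compact_imp_closed[OF K(1)] _ K(2) opn(1)])
        show "part_deriv k \<phi> x \<noteq> 0 \<Longrightarrow> x \<in> K" for x using dK by blast
      qed (intro continuous_on_component cont)
      fix x assume x: "x \<in> \<Omega>"
      show "?v (f x) = part_deriv k \<phi> x * f x $ 1"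
      proof (cases "x \<in> K")
        case True
        then have "\<tau> (f x) = 1" using W by auto
        then show ?thesis using inv(1)[OF x] by (simp add: p_def)
      qed (simp add: inv(1)[OF x] dK)
    qed
    ultimately show ?thesis using P unfolding pair_integral_def H.F_nth by simp
  qed
  have limA2: "?A \<longlonglongrightarrow> pair_integral (adj_entry D 1 1) (\<lambda>x. part_deriv 1 \<phi> x * f x $ 1) + pair_integral (adj_entry D 2 1) (\<lambda>x. part_deriv 2 \<phi> x * f x $ 1)"
  proof -
    have int: "integrable lborel (\<lambda>y. (p y * part_deriv k \<phi> (H.F n y)) * part_deriv 1 (\<lambda>y. H.F n y $ k) y)" for n k
      by (intro integrable_continuous_bounded_support continuous_on_mult cp continuous_on_compose2[OF cd C1_map_continuous[OF H.F_C1]]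
          C1_pd_continuous[OF Hi] bounded_support_mult1 pb) auto
    have "?A n = (\<integral>y. (p y * part_deriv 1 \<phi> (H.F n y)) * part_deriv 1 (\<lambda>y. H.F n y $ 1) y \<partial>lborel)
       + (\<integral>y. (p y * part_deriv 2 \<phi> (H.F n y)) * part_deriv 1 (\<lambda>y. H.F n y $ 2) y \<partial>lborel)" for n
    proof -
      have "p y * part_deriv 1 (\<lambda>y. \<phi> (H.F n y)) y = (p y * part_deriv 1 \<phi> (H.F n y)) * part_deriv 1 (\<lambda>y. H.F n y $ 1) y
        + (p y * part_deriv 2 \<phi> (H.F n y)) * part_deriv 1 (\<lambda>y. H.F n y $ 2) y" for y
        unfolding C1_compose(2)[OF pD(5) Hi] by (simp add: algebra_simps)
      then show ?thesis by (simp only: Bochner_Integration.integral_add[OF int int])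
    qed
    then show ?thesis by (simp only:) (intro tendsto_add wc)
  qed
  \<comment> \<open>The first column of the adjugate consists of D_2 f_2 and - D_1 f_2, exactly the
    combination in \<open>jacobian_limit_explicit\<close>.\<close>
  have "pair_integral (D 2 2) (\<lambda>x. part_deriv 1 \<phi> x * f x $ 1) - pair_integral (D 2 1) (\<lambda>x. part_deriv 2 \<phi> x * f x $ 1)
     = - (\<integral>y. indicator \<Omega>' y * \<phi> (h y) \<partial>lborel)"
    using LIMSEQ_unique[OF limA2 limA1] by (simp add: adj_entry_simps pair_integral_swap)
  then show ?thesis using jacobian_limit_explicit[OF \<phi>] by simp
qed

end

section \<open>Transport of measures by the homeomorphism\<close>

lemma set_integral_lebesgue_mult:
  fixes u v :: "real^2 \<Rightarrow> real"
  assumes "open \<Omega>" "continuous_on \<Omega> u" "continuous_on UNIV v"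
  shows "(LINT x:\<Omega>|lebesgue. u x * v x) = (\<integral>x. (indicator \<Omega> x * u x) * v x \<partial>lborel)"
proof -
  have m: "(\<lambda>x. (indicator \<Omega> x * u x) * v x) \<in> borel_measurable lborel"
    using borel_measurable_times[OF indicator_mult_measurable[OF assms(1,2)] borel_measurable_continuous_onI[OF assms(3)]] by simp
  have "(LINT x:\<Omega>|lebesgue. u x * v x) = (\<integral>x. (indicator \<Omega> x * u x) * v x \<partial>lebesgue)"
    unfolding set_lebesgue_integral_def by (simp add: mult.assoc)
  then show ?thesis using integral_completion[OF m] by simp
qed

lemma distr_deriv_lborel:
  assumes "open \<Omega>" "continuous_on \<Omega> u" "\<phi> \<in> test_functions \<Omega>"
  shows "distr_deriv \<Omega> j u \<phi> = - (\<integral>x. (indicator \<Omega> x * u x) * part_deriv j \<phi> x \<partial>lborel)"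
  unfolding distr_deriv_def
  by (simp only: set_integral_lebesgue_mult[OF assms(1,2) C1_pd_continuous[OF test_functionD(5)[OF assms(3)]]])

text \<open>Turns a measure on the trace Borel sets of \<open>\<Omega>\<close> into one on the Borel
  sets of the plane without mass outside \<open>\<Omega>\<close>, the form that
  \<open>weak_deriv\<close> expects.\<close>

definition extend :: "(real^2) measure \<Rightarrow> (real^2) measure" where
  "extend M = distr M borel (\<lambda>x. x)"

lemma extend_measure:
  assumes M: "radon_measure_on \<Omega> M"
  shows "(\<lambda>x. x) \<in> measurable M borel" "sets (extend M) = sets borel"
    "v \<in> borel_measurable borel \<Longrightarrow> integral\<^sup>L (extend M) v = integral\<^sup>L M (v :: real^2 \<Rightarrow> real)"
    "open \<Omega> \<Longrightarrow> emeasure (extend M) (- \<Omega>) = 0"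
    "emeasure M \<Omega> < \<infinity> \<Longrightarrow> finite_measure (extend M)"
proof -
  have s: "sets M = sets (restrict_space borel \<Omega>)" using M by (simp add: radon_measure_on_def)
  have "(\<lambda>x. x) \<in> measurable (restrict_space borel \<Omega>) borel" by (rule measurable_restrict_space1) simp
  then show id: "(\<lambda>x. x) \<in> measurable M borel" using measurable_cong_sets[OF s refl] by blast
  show "sets (extend M) = sets borel" by (simp add: extend_def)
  show "integral\<^sup>L (extend M) v = integral\<^sup>L M v" if "v \<in> borel_measurable borel"
    unfolding extend_def by (rule integral_distr[OF id that])
  show "emeasure (extend M) (- \<Omega>) = 0" if "open \<Omega>"
    unfolding extend_def using that radon_space[OF M] by (simp add: emeasure_distr[OF id])
  show "finite_measure (extend M)" if "emeasure M \<Omega> < \<infinity>"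
    unfolding extend_def using that radon_space[OF M] by (intro finite_measure.finite_measure_distr[OF _ id] finite_measureI) auto
qed

context planar_homeo
begin

text \<open>The image on the trace Borel sets of \<open>\<Omega>'\<close>, as the encoding of signed
  Radon measures demands; \<open>push\<close> is its counterpart for measures on the whole
  plane.\<close>

definition image_measure :: "(real^2) measure \<Rightarrow> (real^2) measure" where
  "image_measure M = distr M (restrict_space borel \<Omega>') f"

lemma image_measurable: "radon_measure_on \<Omega> M \<Longrightarrow> f \<in> measurable M (restrict_space borel \<Omega>')"
proof (rule measurable_restrict_space2)
  assume M: "radon_measure_on \<Omega> M"
  show "f \<in> space M \<rightarrow> \<Omega>'" using f_in radon_space[OF M] by auto
  have "f \<in> measurable (restrict_space borel \<Omega>) borel" by (rule borel_measurable_continuous_on_restrict[OF cont(1)])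
  then show "f \<in> measurable M borel" using M measurable_cong_sets unfolding radon_measure_on_def by blast
qed

lemma image_integral:
  assumes "radon_measure_on \<Omega> M" "v \<in> borel_measurable borel"
  shows "integral\<^sup>L (image_measure M) v = (\<integral>x. (v (f x) :: real) \<partial>M)"
  unfolding image_measure_def by (rule integral_distr[OF image_measurable[OF assms(1)] measurable_restrict_space1[OF assms(2)]])

text \<open>The image of \<open>A\<close> under \<open>f\<close> is the preimage of \<open>A\<close>
  under the continuous inverse \<open>h\<close>.\<close>

lemma image_sets:
  assumes "A \<in> sets (restrict_space borel \<Omega>)"
  shows "f ` A \<in> sets (restrict_space borel \<Omega>')"
proof -
  have A: "A \<subseteq> \<Omega>" "A \<in> sets borel" using assms opn(1) by (auto simp: sets_restrict_space_iff)
  have "f ` A = h -` A \<inter> space (restrict_space borel \<Omega>')"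
    using A(1) img inv by (force simp: space_restrict_space)
  also have "\<dots> \<in> sets (restrict_space borel \<Omega>')"
    by (rule measurable_sets[OF borel_measurable_continuous_on_restrict[OF cont(2)] A(2)])
  finally show ?thesis .
qed

lemma emeasure_image:
  assumes M: "radon_measure_on \<Omega> M" and A: "A \<in> sets (restrict_space borel \<Omega>)"
  shows "emeasure (image_measure M) (f ` A) = emeasure M A"
proof -
  have "A \<subseteq> \<Omega>" using A opn(1) by (auto simp: sets_restrict_space_iff)
  then have "f -` f ` A \<inter> space M = A" unfolding radon_space[OF M] using f_eq_iff by blast
  then show ?thesis unfolding image_measure_def using emeasure_distr[OF image_measurable[OF M] image_sets[OF A]] by simp
qed

lemma radon_image:
  assumes M: "radon_measure_on \<Omega> M"
  shows "radon_measure_on \<Omega>' (image_measure M)"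
  unfolding radon_measure_on_def
proof (intro conjI allI impI)
  show "sets (image_measure M) = sets (restrict_space borel \<Omega>')" by (simp add: image_measure_def)
  fix K assume K: "compact K \<and> K \<subseteq> \<Omega>'"
  have hK: "compact (h ` K)" "h ` K \<subseteq> \<Omega>"
    using K h_in by (auto intro!: compact_continuous_image continuous_on_subset[OF cont(2)])
  have "h ` K \<in> sets (restrict_space borel \<Omega>)"
    using radon_compact_sets(1)[OF M hK] M by (simp add: radon_measure_on_def)
  moreover have "f ` h ` K = K" using K inv(2) by (force simp: image_image)
  ultimately show "emeasure (image_measure M) K < \<infinity>" using emeasure_image[OF M] radon_compact_sets(2)[OF M hK] by metis
qed

text \<open>Injectivity of \<open>f\<close> carries a Hahn set to a Hahn set, so the images of the
  two parts are again mutually singular and form a Jordan decomposition.\<close>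

lemma signed_radon_image:
  assumes m: "signed_radon_on \<Omega> m"
  shows "signed_radon_on \<Omega>' (map_prod image_measure image_measure m)"
proof -
  obtain A where A: "A \<in> sets (restrict_space borel \<Omega>)" "emeasure (fst m) (\<Omega> - A) = 0" "emeasure (snd m) A = 0"
    using m by (auto simp: signed_radon_on_def)
  have R: "radon_measure_on \<Omega> (fst m)" "radon_measure_on \<Omega> (snd m)" using m by (auto simp: signed_radon_on_def)
  have "space (restrict_space borel \<Omega>) - A \<in> sets (restrict_space borel \<Omega>)" by (rule sets.compl_sets[OF A(1)])
  then have c: "\<Omega> - A \<in> sets (restrict_space borel \<Omega>)" by (simp add: space_restrict_space)
  have "A \<subseteq> \<Omega>" using A(1) opn(1) by (auto simp: sets_restrict_space_iff)
  then have "\<Omega>' - f ` A = f ` (\<Omega> - A)" using img f_eq_iff by blast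
  then show ?thesis unfolding signed_radon_on_def
    using A R c image_sets[OF A(1)] emeasure_image[OF R(1) c] emeasure_image[OF R(2) A(1)] radon_image[OF R(1)] radon_image[OF R(2)]
    by (auto intro!: bexI[of _ "f ` A"])
qed

lemma sm_image:
  assumes m: "signed_radon_on \<Omega> m" and U: "U \<in> sets borel" "U \<subseteq> \<Omega>"
  shows "sm_val (map_prod image_measure image_measure m) (f ` U) = sm_val m U"
    "sm_finite (map_prod image_measure image_measure m) (f ` U) \<longleftrightarrow> sm_finite m U"
proof -
  have "U \<in> sets (restrict_space borel \<Omega>)" using U opn(1) by (simp add: sets_restrict_space_iff)
  then have "emeasure (image_measure (fst m)) (f ` U) = emeasure (fst m) U" "emeasure (image_measure (snd m)) (f ` U) = emeasure (snd m) U"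
    using emeasure_image m by (auto simp: signed_radon_on_def)
  then show "sm_val (map_prod image_measure image_measure m) (f ` U) = sm_val m U"
    "sm_finite (map_prod image_measure image_measure m) (f ` U) \<longleftrightarrow> sm_finite m U"
    by (simp_all add: sm_val_def sm_finite_def measure_def)
qed

end

section \<open>From signed Radon measures to the values on Borel sets\<close>

locale bv_homeo_measure = planar_homeo +
  fixes m :: "2 \<Rightarrow> 2 \<Rightarrow> signed_measure"
  assumes m: "represents_distr \<Omega> (m i j) (distr_deriv \<Omega> j (\<lambda>x. f x $ i))"
    and m_finite: "sm_finite (m i j) \<Omega>"
    and sp: "sense_preserving \<Omega> f"
begin

lemma m_signed: "signed_radon_on \<Omega> (m i j)"
  using m by (simp add: represents_distr_def)

lemma m_radon: "radon_measure_on \<Omega> (fst (m i j))" "radon_measure_on \<Omega> (snd (m i j))"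
  using m_signed[of i j] by (simp_all add: signed_radon_on_def)

lemma m_weak_deriv: "weak_deriv \<Omega> j (\<lambda>x. f x $ i) (extend (fst (m i j))) (extend (snd (m i j)))"
  unfolding weak_deriv_def
proof (intro conjI ballI)
  note R = m_radon[of i j]
  have fin: "emeasure (fst (m i j)) \<Omega> < \<infinity>" "emeasure (snd (m i j)) \<Omega> < \<infinity>"
    using m_finite[of i j] by (simp_all add: sm_finite_def)
  show "finite_measure (extend (fst (m i j)))" by (rule extend_measure(5)[OF R(1) fin(1)])
  show "finite_measure (extend (snd (m i j)))" by (rule extend_measure(5)[OF R(2) fin(2)])
  show "sets (extend (fst (m i j))) = sets borel" "sets (extend (snd (m i j))) = sets borel"
    using extend_measure(2) R by blast+
  fix \<phi> assume \<phi>: "\<phi> \<in> test_functions \<Omega>"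
  have mb: "\<phi> \<in> borel_measurable borel" by (rule borel_measurable_continuous_onI[OF test_functionD(6)[OF \<phi>]])
  have "- (\<integral>x. (indicator \<Omega> x * f x $ i) * part_deriv j \<phi> x \<partial>lborel) = distr_deriv \<Omega> j (\<lambda>x. f x $ i) \<phi>"
    by (rule distr_deriv_lborel[symmetric, OF opn(1) _ \<phi>]) (intro continuous_on_component cont)
  also have "\<dots> = sm_integral (m i j) \<phi>" using m[of i j] \<phi> by (simp add: represents_distr_def)
  also have "\<dots> = integral\<^sup>L (extend (fst (m i j))) \<phi> - integral\<^sup>L (extend (snd (m i j))) \<phi>"
    unfolding sm_integral_def by (simp only: extend_measure(3)[OF R(1) mb] extend_measure(3)[OF R(2) mb])
  finally show "- (\<integral>x. (indicator \<Omega> x * f x $ i) * part_deriv j \<phi> x \<partial>lborel)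
    = integral\<^sup>L (extend (fst (m i j))) \<phi> - integral\<^sup>L (extend (snd (m i j))) \<phi>" .
qed

sublocale bv_homeo \<Omega> \<Omega>' f h "\<lambda>i j. map_prod extend extend (m i j)"
proof unfold_locales
  fix i j
  show "weak_deriv \<Omega> j (\<lambda>x. f x $ i) (fst (map_prod extend extend (m i j))) (snd (map_prod extend extend (m i j)))"
    using m_weak_deriv by simp
  show "emeasure (fst (map_prod extend extend (m i j))) (- \<Omega>) = 0" "emeasure (snd (map_prod extend extend (m i j))) (- \<Omega>) = 0"
    using extend_measure(4) m_radon opn(1) by simp_all
qed (rule sp)

text \<open>For a negated entry the parts are exchanged, and the complement of a Hahn set takes its
  place.\<close>

lemma adj_entry_signed: "signed_radon_on \<Omega> (adj_entry m i j)"
proof (cases "i = j")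
  case True
  then show ?thesis using m_signed by (simp add: adj_entry_def)
next
  case False
  obtain A where A: "A \<in> sets (restrict_space borel \<Omega>)" "emeasure (fst (m i j)) (\<Omega> - A) = 0" "emeasure (snd (m i j)) A = 0"
    using m_signed[of i j] by (auto simp: signed_radon_on_def)
  have "space (restrict_space borel \<Omega>) - A \<in> sets (restrict_space borel \<Omega>)" by (rule sets.compl_sets[OF A(1)])
  then have c: "\<Omega> - A \<in> sets (restrict_space borel \<Omega>)" by (simp add: space_restrict_space)
  have "A \<subseteq> \<Omega>" using A(1) opn(1) by (auto simp: sets_restrict_space_iff)
  then have "\<Omega> - (\<Omega> - A) = A" by blast
  then show ?thesis using A c m_radon[of i j] False by (auto simp: signed_radon_on_def adj_entry_def intro!: bexI[of _ "\<Omega> - A"])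
qed

lemma push_extend:
  assumes M: "radon_measure_on \<Omega> M" and v: "v \<in> borel_measurable borel"
  shows "integral\<^sup>L (push (extend M)) v = integral\<^sup>L (image_measure M) (v :: real^2 \<Rightarrow> real)"
proof -
  note vg = measurable_compose[OF push_meas v]
  have g: "(\<lambda>x. indicator \<Omega> x *\<^sub>R f x) \<in> measurable (extend M) borel"
    using push_meas measurable_cong_sets[OF extend_measure(2)[OF M] refl] by blast
  have "integral\<^sup>L (push (extend M)) v = (\<integral>x. v (indicator \<Omega> x *\<^sub>R f x) \<partial>extend M)"
    unfolding push_def by (rule integral_distr[OF g v])
  also have "\<dots> = (\<integral>x. v (indicator \<Omega> x *\<^sub>R f x) \<partial>M)" by (rule extend_measure(3)[OF M vg])
  also have "\<dots> = (\<integral>x. v (f x) \<partial>M)"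
    by (intro Bochner_Integration.integral_cong refl) (simp add: radon_space[OF M])
  finally show ?thesis using image_integral[OF M v] by simp
qed

lemma inverse_represents:
  "represents_distr \<Omega>' (map_prod image_measure image_measure (adj_entry m i j)) (distr_deriv \<Omega>' j (\<lambda>y. h y $ i))"
  unfolding represents_distr_def
proof (intro conjI ballI)
  show "signed_radon_on \<Omega>' (map_prod image_measure image_measure (adj_entry m i j))" by (rule signed_radon_image[OF adj_entry_signed])
  have R: "radon_measure_on \<Omega> (fst (adj_entry m i j))" "radon_measure_on \<Omega> (snd (adj_entry m i j))"
    using adj_entry_signed[of i j] by (simp_all add: signed_radon_on_def)
  have e: "fst (adj_entry (\<lambda>i j. map_prod extend extend (m i j)) i j) = extend (fst (adj_entry m i j))"
    "snd (adj_entry (\<lambda>i j. map_prod extend extend (m i j)) i j) = extend (snd (adj_entry m i j))"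
    by (simp_all add: adj_entry_def)
  fix \<psi> assume \<psi>: "\<psi> \<in> test_functions \<Omega>'"
  have mb: "\<psi> \<in> borel_measurable borel" by (rule borel_measurable_continuous_onI[OF test_functionD(6)[OF \<psi>]])
  have "distr_deriv \<Omega>' j (\<lambda>y. h y $ i) \<psi> = - (\<integral>x. (indicator \<Omega>' x * h x $ i) * part_deriv j \<psi> x \<partial>lborel)"
    by (rule distr_deriv_lborel[OF opn(2) _ \<psi>]) (intro continuous_on_component cont)
  also have "\<dots> = integral\<^sup>L (push (extend (fst (adj_entry m i j)))) \<psi> - integral\<^sup>L (push (extend (snd (adj_entry m i j)))) \<psi>"
    using inverse_weak_deriv[of j i] \<psi> unfolding weak_deriv_def e by blast
  also have "\<dots> = sm_integral (map_prod image_measure image_measure (adj_entry m i j)) \<psi>"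
    unfolding sm_integral_def by (simp only: push_extend[OF R(1) mb] push_extend[OF R(2) mb] fst_map_prod snd_map_prod)
  finally show "distr_deriv \<Omega>' j (\<lambda>y. h y $ i) \<psi> = sm_integral (map_prod image_measure image_measure (adj_entry m i j)) \<psi>" .
qed

lemma D_measure_f: "D_measure \<Omega> j (\<lambda>x. f x $ i) = m i j"
  unfolding D_measure_def by (rule distr_measure_eq[OF opn(1) m])

lemma D_measure_h: "D_measure \<Omega>' j (\<lambda>y. h y $ i) = map_prod image_measure image_measure (adj_entry m i j)"
  unfolding D_measure_def by (rule distr_measure_eq[OF opn(2) inverse_represents])

lemma BV_loc_h: "BV_loc_on \<Omega>' (\<lambda>y. h y $ i)"
  unfolding BV_loc_on_def
proof (intro conjI allI impI)
  fix K assume K: "compact K \<and> K \<subseteq> \<Omega>'"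
  have "continuous_on K (\<lambda>y. h y $ i)" using K by (intro continuous_on_component continuous_on_subset[OF cont(2)]) auto
  then have "integrable lborel (\<lambda>y. indicator K y *\<^sub>R h y $ i)" using K borel_integrable_compact by blast
  then show "set_integrable lebesgue K (\<lambda>y. h y $ i)" unfolding set_integrable_def
    using integrable_completion borel_measurable_integrable by blast
next
  show "is_measure_distr \<Omega>' (distr_deriv \<Omega>' j (\<lambda>y. h y $ i))" for j
    using inverse_represents unfolding is_measure_distr_def by blast
qed

lemma sm_finite_h:
  assumes U: "U \<in> sets borel" "U \<subseteq> \<Omega>"
  shows "sm_finite (D_measure \<Omega>' j (\<lambda>y. h y $ i)) (f ` U)"
proof -
  have "sm_finite (m i j) U" for i j
  proof -
    have "\<Omega> \<in> sets (fst (m i j))" "\<Omega> \<in> sets (snd (m i j))"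
      using m_radon[of i j] sets.top radon_space by metis+
    then have "emeasure (fst (m i j)) U \<le> emeasure (fst (m i j)) \<Omega>" "emeasure (snd (m i j)) U \<le> emeasure (snd (m i j)) \<Omega>"
      using U by (auto intro: emeasure_mono)
    then show ?thesis using m_finite[of i j] le_less_trans unfolding sm_finite_def by blast
  qed
  then have "sm_finite (adj_entry m i j) U" by (auto simp: adj_entry_def sm_finite_def)
  then show ?thesis unfolding D_measure_h by (simp add: sm_image(2)[OF adj_entry_signed U])
qed

lemma D_matrix_h:
  assumes U: "U \<in> sets borel" "U \<subseteq> \<Omega>"
  shows "D_matrix \<Omega>' h (f ` U) = adj_D \<Omega> f U"
proof -
  have sw: "sm_val (prod.swap p) U = - sm_val p U" for p by (simp add: sm_val_def)
  have "D_matrix \<Omega>' h (f ` U) $ i $ j = sm_val (adj_entry m i j) U" for i j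
    by (simp add: D_matrix_def D_val_def D_measure_h sm_image(1)[OF adj_entry_signed U])
  then show ?thesis
    unfolding vec_eq_iff forall_2 by (simp add: adj_D_def D_val_def D_measure_f adj_entry_simps sw)
qed

lemma approx_Jacobian_limit:
  assumes \<phi>: "\<phi> \<in> test_functions \<Omega>"
  shows "approx_Jacobian \<Omega> f \<phi> \<longlonglongrightarrow> (\<integral>y. indicator \<Omega>' y * \<phi> (h y) \<partial>lborel)"
proof -
  note pD = test_functionD[OF \<phi>]
  have out: "\<phi> x = 0" if "x \<notin> \<Omega>" for x using that pD(3) closure_subset[of "{x. \<phi> x \<noteq> 0}"] by auto
  have "approx_Jacobian \<Omega> f \<phi> n = (\<integral>x. \<phi> x * wedge (\<lambda>x. F n x $ 1) (\<lambda>x. F n x $ 2) x \<partial>lborel)" for n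
  proof -
    note Fi = C1_mapD[OF F_C1]
    have "approx_Jacobian \<Omega> f \<phi> n = (LINT x:\<Omega>|lebesgue. \<phi> x * wedge (\<lambda>x. F n x $ 1) (\<lambda>x. F n x $ 2) x)"
      unfolding approx_Jacobian_def det_jacobian[OF Fi] ..
    also have "\<dots> = (\<integral>x. (indicator \<Omega> x * \<phi> x) * wedge (\<lambda>x. F n x $ 1) (\<lambda>x. F n x $ 2) x \<partial>lborel)"
      by (rule set_integral_lebesgue_mult[OF opn(1) continuous_on_subset[OF pD(6)] wedge_continuous[OF Fi Fi]]) simp
    also have "(\<lambda>x. indicator \<Omega> x * \<phi> x) = \<phi>" by (rule ext) (use out in \<open>auto simp: indicator_def\<close>)
    finally show ?thesis .
  qed
  from ext[of "approx_Jacobian \<Omega> f \<phi>", OF this] show ?thesis using jacobian_limit[OF \<phi>] by (simp only:)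
qed

text \<open>The image of Lebesgue measure on \<open>\<Omega>'\<close> under \<open>h\<close>, that
  is E \<mapsto> |f(E)|. With a zero negative part it is a Jordan decomposition.\<close>

definition volume_image :: signed_measure where
  "volume_image = (planar_homeo.image_measure \<Omega> h (restrict_space lborel \<Omega>'), null_measure (restrict_space borel \<Omega>))"

lemma volume_image_props:
  "represents_distr \<Omega> volume_image (Det_D \<Omega> f)"
  "U \<in> sets borel \<Longrightarrow> U \<subseteq> \<Omega> \<Longrightarrow> emeasure (fst volume_image) U = emeasure lborel (f ` U)"
proof -
  interpret H: planar_homeo \<Omega>' \<Omega> h f by (rule flip)
  let ?L = "restrict_space lborel \<Omega>' :: (real^2) measure"
  have emL: "emeasure ?L A = emeasure lborel A" if "A \<subseteq> \<Omega>'" for A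
    using that opn(2) by (intro emeasure_restrict_space) auto
  have L: "radon_measure_on \<Omega>' ?L"
    unfolding radon_measure_on_def
  proof (intro conjI allI impI)
    show "sets ?L = sets (restrict_space borel \<Omega>')" by (rule sets_restrict_space_cong) simp
    show "emeasure ?L K < \<infinity>" if "compact K \<and> K \<subseteq> \<Omega>'" for K
      using that emL[of K] emeasure_compact_finite[of K] by simp
  qed
  have fi: "f ` U \<in> sets (restrict_space borel \<Omega>')" if "U \<in> sets borel" "U \<subseteq> \<Omega>" for U
    using that opn(1) by (intro image_sets) (simp add: sets_restrict_space_iff)
  show "emeasure (fst volume_image) U = emeasure lborel (f ` U)" if U: "U \<in> sets borel" "U \<subseteq> \<Omega>"
  proof -
    have "h ` f ` U = U" using U(2) inv(1) by (force simp: image_image)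
    then have "emeasure (H.image_measure ?L) U = emeasure ?L (f ` U)" using H.emeasure_image[OF L fi[OF U]] by simp
    also have "\<dots> = emeasure lborel (f ` U)" by (rule emL) (use U(2) f_in in auto)
    finally show ?thesis by (simp add: volume_image_def)
  qed
  show "represents_distr \<Omega> volume_image (Det_D \<Omega> f)"
    unfolding represents_distr_def
  proof (intro conjI ballI)
    have "\<Omega> \<in> sets (restrict_space borel \<Omega>)" using opn(1) by (simp add: sets_restrict_space_iff)
    then show "signed_radon_on \<Omega> volume_image"
      unfolding signed_radon_on_def volume_image_def using H.radon_image[OF L]
      by (auto simp: radon_measure_on_def intro!: bexI[of _ \<Omega>])
    fix \<phi> assume \<phi>: "\<phi> \<in> test_functions \<Omega>"
    have mb: "\<phi> \<in> borel_measurable borel" by (rule borel_measurable_continuous_onI[OF test_functionD(6)[OF \<phi>]])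
    have "Det_D \<Omega> f \<phi> = (\<integral>y. indicator \<Omega>' y * \<phi> (h y) \<partial>lborel)"
      unfolding Det_D_def by (rule limI[OF approx_Jacobian_limit[OF \<phi>]])
    also have "\<dots> = (\<integral>y. \<phi> (h y) \<partial>?L)"
      using opn(2) by (subst integral_restrict_space) simp_all
    also have "\<dots> = integral\<^sup>L (H.image_measure ?L) \<phi>" by (rule H.image_integral[OF L mb, symmetric])
    also have "\<dots> = sm_integral volume_image \<phi>" by (simp add: sm_integral_def volume_image_def)
    finally show "Det_D \<Omega> f \<phi> = sm_integral volume_image \<phi>" .
  qed
qed

lemma distr_measure_Det: "distr_measure \<Omega> (Det_D \<Omega> f) = volume_image"
  by (rule distr_measure_eq[OF opn(1) volume_image_props(1)])

lemma Det_D_value: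
  assumes U: "U \<in> sets borel" "U \<subseteq> \<Omega>"
  shows "sm_finite (distr_measure \<Omega> (Det_D \<Omega> f)) U"
    "sm_val (distr_measure \<Omega> (Det_D \<Omega> f)) U = measure lebesgue (f ` U)"
proof -
  note em = volume_image_props(2)[OF U]
  have sn: "emeasure (snd volume_image) U = 0" by (simp add: volume_image_def)
  have fU: "f ` U \<subseteq> \<Omega>'" "f ` U \<in> sets borel"
    using U image_sets[of U] opn by (auto simp: sets_restrict_space_iff)
  have "emeasure lborel (f ` U) < \<infinity>"
    by (rule emeasure_bounded_finite[OF bounded_subset[OF bdd(2) fU(1)]])
  then show "sm_finite (distr_measure \<Omega> (Det_D \<Omega> f)) U"
    unfolding distr_measure_Det sm_finite_def using em sn by simp
  show "sm_val (distr_measure \<Omega> (Det_D \<Omega> f)) U = measure lebesgue (f ` U)"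
    unfolding distr_measure_Det sm_val_def using em sn fU(2) by (simp add: measure_def)
qed

end

text \<open>The clauses on local bounded variation, finiteness, convergence and representability
  ensure that the matrix entries, the limit and the measure in the two equalities are genuine values
  and not defaults of \<open>THE\<close>, \<open>lim\<close> or \<open>measure\<close>.\<close>

theorem theorem1:
  fixes \<Omega> U :: "(real^2) set" and f :: "real^2 \<Rightarrow> real^2"
  assumes "open \<Omega>" and "bounded \<Omega>"
    and "BV_homeomorphism \<Omega> f" and "bounded (f ` \<Omega>)" and "sense_preserving \<Omega> f"
    and "U \<in> sets borel" and "U \<subseteq> \<Omega>"
  shows "(\<forall>i. BV_loc_on (f ` \<Omega>) (\<lambda>y. inv_into \<Omega> f y $ i)) \<and>
     (\<forall>i j. sm_finite (D_measure (f ` \<Omega>) j (\<lambda>y. inv_into \<Omega> f y $ i)) (f ` U)) \<and>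
     D_matrix (f ` \<Omega>) (inv_into \<Omega> f) (f ` U) = adj_D \<Omega> f U \<and>
     (\<forall>\<phi> \<in> test_functions \<Omega>. convergent (approx_Jacobian \<Omega> f \<phi>)) \<and>
     is_measure_distr \<Omega> (Det_D \<Omega> f) \<and>
     sm_finite (distr_measure \<Omega> (Det_D \<Omega> f)) U \<and>
     sm_val (distr_measure \<Omega> (Det_D \<Omega> f)) U = measure lebesgue (f ` U)"
proof -
  obtain g where g: "homeomorphism \<Omega> (f ` \<Omega>) f g" and "open (f ` \<Omega>)" and bv: "BV_on \<Omega> (\<lambda>x. f x $ i)" for i
    using assms(3) unfolding BV_homeomorphism_def by blast
  have inj: "inj_on f \<Omega>" using homeomorphism_apply1[OF g] by (rule inj_on_inverseI)
  have "inv_into \<Omega> f y = g y" if "y \<in> f ` \<Omega>" for y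
    using that homeomorphism_apply1[OF g] inv_into_f_f[OF inj] by auto
  then have "continuous_on (f ` \<Omega>) (inv_into \<Omega> f)"
    using homeomorphism_cont2[OF g] continuous_on_cong by metis
  then have planar: "planar_homeo \<Omega> (f ` \<Omega>) f (inv_into \<Omega> f)"
    using assms homeomorphism_cont1[OF g] inj \<open>open (f ` \<Omega>)\<close>
    by unfold_locales (auto simp: f_inv_into_f inv_into_image_cancel)
  \<comment> \<open>\<open>D_measure\<close> is a definite description. By uniqueness it is itself a
    representing pair, so it can instantiate the locale parameter directly.\<close>
  interpret bv_homeo_measure \<Omega> "f ` \<Omega>" f "inv_into \<Omega> f" "\<lambda>i j. D_measure \<Omega> j (\<lambda>x. f x $ i)"
  proof (rule bv_homeo_measure.intro[OF planar], unfold_locales)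
    fix i j
    obtain m where m: "represents_distr \<Omega> m (distr_deriv \<Omega> j (\<lambda>x. f x $ i))"
      using bv[of i] unfolding BV_on_def is_measure_distr_def by blast
    then show "represents_distr \<Omega> (D_measure \<Omega> j (\<lambda>x. f x $ i)) (distr_deriv \<Omega> j (\<lambda>x. f x $ i))"
      unfolding D_measure_def distr_measure_eq[OF assms(1) m] .
    show "sm_finite (D_measure \<Omega> j (\<lambda>x. f x $ i)) \<Omega>" using bv[of i] by (simp add: BV_on_def)
  qed (rule assms(5))
  show ?thesis
  proof (intro conjI allI ballI)
    show "convergent (approx_Jacobian \<Omega> f \<phi>)" if "\<phi> \<in> test_functions \<Omega>" for \<phi>
      using approx_Jacobian_limit[OF that] by (rule convergentI)
    show "is_measure_distr \<Omega> (Det_D \<Omega> f)" using volume_image_props(1) unfolding is_measure_distr_def by blast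
  qed (intro BV_loc_h sm_finite_h D_matrix_h Det_D_value assms)+
qed

end
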